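(* Let $n\ge2$, $k\ge0$ and $n\ge a\ge b\ge0$. (i) If $k>0$ or $a>b$, then the representation $\mathrm{Sym}^kH\otimes\Lambda^{a,b}_{\mathrm{top}}E$ has a unique maximal twist, namely $\mathcal{R}^{k+n-b,\,a}=\mathrm{Sym}^{k+n-b}H\otimes\Lambda^a_\circ E$, and $\mathrm{index}(k,a,b;\,k+n-b,a)=(-1)^b$. (ii) If $k=0$ and $a=b$, then the admissible twists of $\Lambda^{a,a}_{\mathrm{top}}E$ are exactly $\mathcal{R}^{n-d,d}=\mathrm{Sym}^{n-d}H\otimes\Lambda^d_\circ E$ for $d=a,\dots,n$; all of them satisfy $\phi(n-d,d)=0$, hence are simultaneously maximal and minimal, and $\mathrm{index}(0,a,a;\,n-d,d)=(-1)^d$.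
   Context: $H\cong\mathbb{C}^2$, $E\cong\mathbb{C}^{2n}$ are the standard representations of $\mathbf{Sp}(1)$, $\mathbf{Sp}(n)$ with symplectic forms $\sigma$. $\Lambda^d_\circ E$ ($0\le d\le n$) is the kernel of contraction with $\sigma$ on $\Lambda^dE$; for $n\ge a\ge b\ge0$, $\Lambda^{a,b}_{\mathrm{top}}E$ is the irreducible representation of highest weight in $\Lambda^a_\circ E\otimes\Lambda^b_\circ E$. $\mathcal{R}^{l,d}:=\mathrm{Sym}^lH\otimes\Lambda^d_\circ E$ ($l\ge0$, $0\le d\le n$). The spinor representation is $\mathbf{S}=\bigoplus_{r=0}^n\mathbf{S}_r$, $\mathbf{S}_r=\mathrm{Sym}^rH\otimes\Lambda^{n-r}_\circ E$, with half-spin parts $\mathbf{S}^+=\bigoplus_{r\equiv n\,(2)}\mathbf{S}_r$, $\mathbf{S}^-=\bigoplus_{r\not\equiv n\,(2)}\mathbf{S}_r$. A twist $\mathcal{R}^{l,d}$ is admissible for an irreducible $\pi=\mathrm{Sym}^kH\otimes\Lambda^{a,b}_{\mathrm{top}}E$ if $\mathrm{Hom}_{\mathbf{Sp}(1)\times\mathbf{Sp}(n)}(\pi,\mathbf{S}\otimes\mathcal{R}^{l,d})\ne\{0\}$. Let $\phi(l,d):=(l+d-n)(l-d+n+2)$. An admissible twist is maximal (resp. minimal) for $\pi$ if $\phi$ attains at it its maximum (resp. minimum) over all admissible twists of $\pi$. The index is $\mathrm{index}(k,a,b;l,d):=\dim\mathrm{Hom}(\pi,\mathbf{S}^+\otimes\mathcal{R}^{l,d})-\dim\mathrm{Hom}(\pi,\mathbf{S}^-\otimes\mathcal{R}^{l,d})$,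 Hom being $\mathbf{Sp}(1)\times\mathbf{Sp}(n)$-equivariant. *)

theory Defs
  imports Complex_Main "HOL-Combinatorics.Permutations"
begin

type_synonym cvec = "nat \<Rightarrow> complex"
type_synonym cmat = "nat \<Rightarrow> nat \<Rightarrow> complex"

definition vecs :: "nat \<Rightarrow> cvec set" where
  "vecs N = {v. \<forall>i. N \<le> i \<longrightarrow> v i = 0}"

definition mat_supp :: "nat \<Rightarrow> nat \<Rightarrow> cmat \<Rightarrow> bool" where
  "mat_supp R C A \<longleftrightarrow> (\<forall>i j. R \<le> i \<or> C \<le> j \<longrightarrow> A i j = 0)"

definition mv :: "nat \<Rightarrow> cmat \<Rightarrow> cvec \<Rightarrow> cvec" where
  "mv N A v = (\<lambda>i. \<Sum>j<N. A i j * v j)"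

definition cspan :: "cvec set \<Rightarrow> cvec set" where
  "cspan S = {v. \<exists>A c. finite A \<and> A \<subseteq> S \<and> v = (\<lambda>i. \<Sum>a\<in>A. c a * a i)}"

definition sform :: "nat \<Rightarrow> nat \<Rightarrow> nat \<Rightarrow> complex" where
  "sform m k l = (if k < m \<and> l = k + m then 1 else if l < m \<and> k = l + m then -1 else 0)"

definition in_Sp :: "nat \<Rightarrow> cmat \<Rightarrow> bool" where
  "in_Sp m g \<longleftrightarrow> mat_supp (2*m) (2*m) g
     \<and> (\<forall>i<2*m. \<forall>j<2*m. (\<Sum>k<2*m. \<Sum>l<2*m. g k i * sform m k l * g l j) = sform m i j)
     \<and> (\<forall>i<2*m. \<forall>j<2*m. (\<Sum>k<2*m. cnj (g k i) * g k j) = (if i = j then 1 else 0))"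

definition Grp :: "nat \<Rightarrow> (cmat \<times> cmat) set" where
  "Grp n = {(g1, g2). in_Sp 1 g1 \<and> in_Sp n g2}"

text \<open>A representation of Sp(1) x Sp(n): ambient dimension, action matrices
  (of the pair (g1,g2)), and the invariant subspace actually carrying the representation.\<close>
record rep =
  rdim :: nat
  ract :: "cmat \<Rightarrow> cmat \<Rightarrow> cmat"
  rsp :: "cvec set"

text \<open>Sym^l H, basis x^i y^(l-i), i = 0..l, where x = e_0, y = e_1.\<close>
definition sym_act :: "nat \<Rightarrow> cmat \<Rightarrow> cmat" where
  "sym_act l g = (\<lambda>j i. if i \<le> l \<and> j \<le> l then
      (\<Sum>p\<le>j. if p \<le> i \<and> j - p \<le> l - i then
          of_nat (i choose p) * g 0 0 ^ p * g 1 0 ^ (i - p)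
          * of_nat ((l - i) choose (j - p)) * g 0 1 ^ (j - p) * g 1 1 ^ (l - i - (j - p))
        else 0)
    else 0)"

definition Symrep :: "nat \<Rightarrow> rep" where
  "Symrep l = \<lparr>rdim = l + 1, ract = (\<lambda>g1 g2. sym_act l g1), rsp = vecs (l + 1)\<rparr>"

text \<open>Lambda^d of C^m: basis e_I indexed by increasing lists I of length d.\<close>
definition subsets :: "nat \<Rightarrow> nat \<Rightarrow> nat list list" where
  "subsets d m = filter (\<lambda>xs. length xs = d) (subseqs [0..<m])"

definition detsub :: "nat \<Rightarrow> cmat \<Rightarrow> nat list \<Rightarrow> nat list \<Rightarrow> complex" where
  "detsub d g I J = (\<Sum>p | p permutes {..<d}. of_int (sign p) * (\<Prod>i<d. g (I ! i) (J ! (p i))))"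

definition ext_act :: "nat \<Rightarrow> nat \<Rightarrow> cmat \<Rightarrow> cmat" where
  "ext_act n d g = (\<lambda>i j. if i < length (subsets d (2*n)) \<and> j < length (subsets d (2*n))
       then detsub d g (subsets d (2*n) ! i) (subsets d (2*n) ! j) else 0)"

definition remove2 :: "nat list \<Rightarrow> nat \<Rightarrow> nat \<Rightarrow> nat list" where
  "remove2 J p q = map (nth J) (filter (\<lambda>i. i \<noteq> p \<and> i \<noteq> q) [0..<length J])"

text \<open>Coefficient of e_I' in the contraction with sigma of e_J:
  v_1 ^ ... ^ v_d |-> sum_(p<q) (-1)^(p+q+1) sigma(v_p, v_q) v_1 ^..(omit p,q)..^ v_d.\<close>
definition ctr_coef :: "nat \<Rightarrow> nat list \<Rightarrow> nat list \<Rightarrow> complex" where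
  "ctr_coef n J I' = (\<Sum>p<length J. \<Sum>q<length J.
     if p < q \<and> remove2 J p q = I' then (-1) ^ (p + q + 1) * sform n (J ! p) (J ! q) else 0)"

definition prim_ext :: "nat \<Rightarrow> nat \<Rightarrow> cvec set" where
  "prim_ext n d = {v \<in> vecs (length (subsets d (2*n))).
     \<forall>I' \<in> set (subsets (d - 2) (2*n)).
       (\<Sum>j<length (subsets d (2*n)). v j * ctr_coef n (subsets d (2*n) ! j) I') = 0}"

definition Extrep :: "nat \<Rightarrow> nat \<Rightarrow> rep" where
  "Extrep n d = \<lparr>rdim = length (subsets d (2*n)), ract = (\<lambda>g1 g2. ext_act n d g2),
                 rsp = prim_ext n d\<rparr>"

definition tens :: "nat \<Rightarrow> nat \<Rightarrow> cvec \<Rightarrow> cvec \<Rightarrow> cvec" where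
  "tens N1 N2 v w = (\<lambda>k. if k < N1 * N2 then v (k div N2) * w (k mod N2) else 0)"

definition kron :: "nat \<Rightarrow> nat \<Rightarrow> cmat \<Rightarrow> cmat \<Rightarrow> cmat" where
  "kron N1 N2 A B = (\<lambda>r c. if r < N1 * N2 \<and> c < N1 * N2
      then A (r div N2) (c div N2) * B (r mod N2) (c mod N2) else 0)"

definition tensor_rep :: "rep \<Rightarrow> rep \<Rightarrow> rep" where
  "tensor_rep R1 R2 = \<lparr>rdim = rdim R1 * rdim R2,
     ract = (\<lambda>g1 g2. kron (rdim R1) (rdim R2) (ract R1 g1 g2) (ract R2 g1 g2)),
     rsp = cspan {tens (rdim R1) (rdim R2) v w | v w. v \<in> rsp R1 \<and> w \<in> rsp R2}\<rparr>"

definition dsum :: "rep \<Rightarrow> rep \<Rightarrow> rep" where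
  "dsum R1 R2 = \<lparr>rdim = rdim R1 + rdim R2,
     ract = (\<lambda>g1 g2 i j.
        if i < rdim R1 \<and> j < rdim R1 then ract R1 g1 g2 i j
        else if rdim R1 \<le> i \<and> rdim R1 \<le> j \<and> i < rdim R1 + rdim R2 \<and> j < rdim R1 + rdim R2
          then ract R2 g1 g2 (i - rdim R1) (j - rdim R1)
        else 0),
     rsp = {v. (\<lambda>i. if i < rdim R1 then v i else 0) \<in> rsp R1
               \<and> (\<lambda>i. v (i + rdim R1)) \<in> rsp R2}\<rparr>"

definition zero_rep :: rep where
  "zero_rep = \<lparr>rdim = 0, ract = (\<lambda>g1 g2 i j. 0), rsp = {\<lambda>i. 0}\<rparr>"

definition dsum_list :: "rep list \<Rightarrow> rep" where
  "dsum_list Rs = foldr dsum Rs zero_rep"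

definition Spiece :: "nat \<Rightarrow> nat \<Rightarrow> rep" where
  "Spiece n r = tensor_rep (Symrep r) (Extrep n (n - r))"

definition Spin :: "nat \<Rightarrow> rep" where
  "Spin n = dsum_list (map (Spiece n) [0..<n+1])"

definition Spin_plus :: "nat \<Rightarrow> rep" where
  "Spin_plus n = dsum_list (map (Spiece n) (filter (\<lambda>r. even (r + n)) [0..<n+1]))"

definition Spin_minus :: "nat \<Rightarrow> rep" where
  "Spin_minus n = dsum_list (map (Spiece n) (filter (\<lambda>r. odd (r + n)) [0..<n+1]))"

definition Rrep :: "nat \<Rightarrow> nat \<Rightarrow> nat \<Rightarrow> rep" where
  "Rrep n l d = tensor_rep (Symrep l) (Extrep n d)"

definition ext_basis :: "nat \<Rightarrow> nat \<Rightarrow> nat list \<Rightarrow> cvec" where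
  "ext_basis n d I = (\<lambda>i. if i < length (subsets d (2*n)) \<and> subsets d (2*n) ! i = I then 1 else 0)"

text \<open>Lambda^(a,b)_top E: the irreducible subrepresentation of Lambda^a_o E (x) Lambda^b_o E
  generated by the highest weight vector (e_0^...^e_(a-1)) (x) (e_0^...^e_(b-1)),
  highest weight eps_1+..+eps_a + eps_1+..+eps_b for the torus diag(t,t^-1).\<close>
definition toprep :: "nat \<Rightarrow> nat \<Rightarrow> nat \<Rightarrow> rep" where
  "toprep n a b = (let T = tensor_rep (Extrep n a) (Extrep n b);
       hw = tens (rdim (Extrep n a)) (rdim (Extrep n b))
              (ext_basis n a [0..<a]) (ext_basis n b [0..<b])
     in T\<lparr>rsp := cspan {mv (rdim T) (ract T g1 g2) hw | g1 g2. (g1, g2) \<in> Grp n}\<rparr>)"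

definition pirep :: "nat \<Rightarrow> nat \<Rightarrow> nat \<Rightarrow> nat \<Rightarrow> rep" where
  "pirep n k a b = tensor_rep (Symrep k) (toprep n a b)"

text \<open>Equivariant linear maps P -> V (as matrices, vanishing on the orthogonal
  complement of the carrier of P).\<close>
definition homs :: "nat \<Rightarrow> rep \<Rightarrow> rep \<Rightarrow> cmat set" where
  "homs n P V = {T. mat_supp (rdim V) (rdim P) T
     \<and> (\<forall>v\<in>rsp P. mv (rdim P) T v \<in> rsp V)
     \<and> (\<forall>(g1, g2)\<in>Grp n. \<forall>v\<in>rsp P.
          mv (rdim P) T (mv (rdim P) (ract P g1 g2) v) = mv (rdim V) (ract V g1 g2) (mv (rdim P) T v))
     \<and> (\<forall>v\<in>vecs (rdim P). (\<forall>w\<in>rsp P. (\<Sum>i<rdim P. v i * cnj (w i)) = 0)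
          \<longrightarrow> mv (rdim P) T v = (\<lambda>i. 0))}"

definition mat_lin_indep :: "cmat set \<Rightarrow> bool" where
  "mat_lin_indep A \<longleftrightarrow> (\<forall>c. (\<forall>i j. (\<Sum>T\<in>A. c T * T i j) = 0) \<longrightarrow> (\<forall>T\<in>A. c T = 0))"

definition hom_dim :: "nat \<Rightarrow> rep \<Rightarrow> rep \<Rightarrow> nat" where
  "hom_dim n P V = Sup {card A | A. finite A \<and> A \<subseteq> homs n P V \<and> mat_lin_indep A}"

definition admissible :: "nat \<Rightarrow> nat \<Rightarrow> nat \<Rightarrow> nat \<Rightarrow> nat \<Rightarrow> nat \<Rightarrow> bool" where
  "admissible n k a b l d \<longleftrightarrow> d \<le> n \<and>
     hom_dim n (pirep n k a b) (tensor_rep (Spin n) (Rrep n l d)) \<noteq> 0"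

definition phi :: "nat \<Rightarrow> nat \<Rightarrow> nat \<Rightarrow> int" where
  "phi n l d = (int l + int d - int n) * (int l - int d + int n + 2)"

definition maximal_twist :: "nat \<Rightarrow> nat \<Rightarrow> nat \<Rightarrow> nat \<Rightarrow> nat \<Rightarrow> nat \<Rightarrow> bool" where
  "maximal_twist n k a b l d \<longleftrightarrow> admissible n k a b l d \<and>
     (\<forall>l' d'. admissible n k a b l' d' \<longrightarrow> phi n l' d' \<le> phi n l d)"

definition minimal_twist :: "nat \<Rightarrow> nat \<Rightarrow> nat \<Rightarrow> nat \<Rightarrow> nat \<Rightarrow> nat \<Rightarrow> bool" where
  "minimal_twist n k a b l d \<longleftrightarrow> admissible n k a b l d \<and>
     (\<forall>l' d'. admissible n k a b l' d' \<longrightarrow> phi n l d \<le> phi n l' d')"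

definition index :: "nat \<Rightarrow> nat \<Rightarrow> nat \<Rightarrow> nat \<Rightarrow> nat \<Rightarrow> nat \<Rightarrow> int" where
  "index n k a b l d =
     int (hom_dim n (pirep n k a b) (tensor_rep (Spin_plus n) (Rrep n l d)))
     - int (hom_dim n (pirep n k a b) (tensor_rep (Spin_minus n) (Rrep n l d)))"

end

theory Submission
  imports Defs "Jordan_Normal_Form.Determinant"
begin

text \<open>Both parts reduce to two facts about homomorphisms from \<open>Sym\<^sup>k H \<otimes> \<Lambda>\<^sup>a\<^sup>,\<^sup>b E\<close> into
  \<open>Sym\<^sup>r H \<otimes> \<Lambda>\<^sup>p E \<otimes> Sym\<^sup>l H \<otimes> \<Lambda>\<^sup>d E\<close> (primitive exterior powers).

  Upper bounds: such a homomorphism is determined by the image \<open>w\<close> of the highest weight vector.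
  Differentiating equivariance along one-parameter subgroups and passing to complex combinations shows
  that \<open>w\<close> is annihilated by the positive root vectors and has the expected weight. Looking at the lowest
  weight occurring in the first tensor factor, \<open>w\<close> is determined by its component along the highest
  weight vector of the second factor. Hence a non-zero homomorphism forces \<open>l \<le> k + r\<close> and
  \<open>b + \<bar>d - a\<bar> \<le> p\<close>, and in the extremal case \<open>l = k + r\<close>, \<open>p = b + d - a\<close> (which covers the
  twists of both parts) the homomorphisms form a space of dimension at most one.

  Existence in the extremal case: \<open>Sym\<^sup>k\<close> embeds into \<open>Sym\<^sup>r \<otimes> Sym\<^sup>k\<^sup>+\<^sup>r\<close> by multiplication with a power
  of the invariant \<open>x\<^sub>1 y\<^sub>2 - y\<^sub>1 x\<^sub>2\<close>, and \<open>\<Lambda>\<^sup>a\<^sup>,\<^sup>b E\<close> maps to \<open>\<Lambda>\<^sup>p E \<otimes> \<Lambda>\<^sup>d E\<close> by the adjoint of the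
  \<open>(d - a)\<close>-fold contraction with the symplectic form between the two factors, followed by the orthogonal
  projection onto the primitive part.\<close>

section \<open>Alternating functions and minors\<close>

text \<open>No character theory or complete reducibility is used: \<open>toprep\<close> is by
  definition spanned by the translates of one vector, so a homomorphism is fixed by the image of
  that vector, and every upper bound is a statement about one coordinate array. The groups are
  compact, hence the root vectors are not in their Lie algebras; they are reached only as complex
  combinations of skew-Hermitian generators, which is legitimate because infinitesimal equivariance
  is complex-linear in the generator. Compactness in turn gives adjoints and orthogonal projections
  that commute with the group. The existence half rests on them; its real difficulty is
  non-vanishing, settled by a pairing that is a sum of nonnegative terms. Since \<open>S_r\<close>
  carries \<open>p = n - r\<close>, the bounds read \<open>l \<le> k + r\<close> and
  \<open>r \<le> n - b - |d - a|\<close>. Together with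
  \<open>phi = (l + 1)^2 - (n - d + 1)^2\<close> they single out the maximal twist. For each twist
  whose index is computed exactly one \<open>r\<close> contributes, with multiplicity one, so the
  index is the sign \<open>(-1)^(n - r)\<close>.\<close>

definition idm :: cmat where
  "idm = (\<lambda>i j. if i = j then 1 else 0)"

definition swp :: "nat \<Rightarrow> nat \<Rightarrow> 'a list \<Rightarrow> 'a list" where
  "swp p q xs = xs[p := xs ! q, q := xs ! p]"

definition Lst :: "nat \<Rightarrow> nat \<Rightarrow> nat list set" where
  "Lst N d = {xs. length xs = d \<and> set xs \<subseteq> {..<N}}"

definition alternating :: "nat \<Rightarrow> (nat list \<Rightarrow> complex) \<Rightarrow> bool" where
  "alternating d c \<longleftrightarrow> (\<forall>xs p q. length xs = d \<and> p < d \<and> q < d \<and> p \<noteq> q \<longrightarrow> c (swp p q xs) = - c xs)"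

lemma length_swp [simp]: "length (swp p q xs) = length xs"
  by (simp add: swp_def)

lemma nth_swp:
  "p < length xs \<Longrightarrow> q < length xs \<Longrightarrow> i < length xs \<Longrightarrow> swp p q xs ! i = xs ! (transpose p q i)"
  by (auto simp: swp_def nth_list_update transpose_def)

lemma swp_adjacent: "swp (length us) (Suc (length us)) (us @ x # y # vs) = us @ y # x # vs"
  by (simp add: swp_def list_update_append nth_append)

lemma alternating_adjacent:
  assumes "alternating d c" "length us + length vs + 2 = d"
  shows "c (us @ y # x # vs) = - c (us @ x # y # vs)"
  using assms(1)[unfolded alternating_def, rule_format, of "us @ x # y # vs" "length us" "Suc (length us)"]
    assms(2) by (simp add: swp_adjacent)

lemma alternating_not_distinct:
  assumes "alternating d c" "length xs = d" "\<not> distinct xs"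
  shows "c xs = 0"
proof -
  obtain p q where pq: "p < d" "q < d" "p \<noteq> q" "xs ! p = xs ! q"
    using assms(2,3) by (auto simp: distinct_conv_nth)
  have "swp p q xs = xs" using pq by (simp add: swp_def) (metis list_update_id)
  then have "c xs = - c xs" using assms(1,2) pq unfolding alternating_def by metis
  then show ?thesis by simp
qed

text \<open>Here the sign is tracked, because the coefficients \<open>ctr_coef\<close> carry
  explicit powers of \<open>-1\<close> that must be matched.\<close>

lemma alternating_move_front:
  assumes "alternating d c"
  shows "length us + length vs + 1 = d \<Longrightarrow> c (us @ x # vs) = (-1) ^ length us * c (x # us @ vs)"
proof (induction us arbitrary: vs rule: rev_induct)
  case (snoc y us)
  have "c (us @ y # x # vs) = - c (us @ x # y # vs)"
    by (rule alternating_adjacent[OF assms]) (use snoc.prems in simp)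
  also have "\<dots> = - ((-1) ^ length us * c (x # us @ y # vs))"
    by (subst snoc.IH) (use snoc.prems in simp_all)
  finally show ?case by simp
qed simp

text \<open>The sign is left open on purpose: the results built on this only ask whether a
  coefficient vanishes, so signs of permutations need no bookkeeping.\<close>

lemma alternating_insort:
  assumes "alternating d c"
  shows "length us + length ys + 1 = d \<Longrightarrow>
    c (us @ x # ys) = c (us @ insort x ys) \<or> c (us @ x # ys) = - c (us @ insort x ys)"
proof (induction ys arbitrary: us)
  case (Cons y ys)
  show ?case
  proof (cases "x \<le> y")
    case False
    have "c (us @ x # y # ys) = - c (us @ y # x # ys)"
      by (rule alternating_adjacent[OF assms]) (use Cons.prems in simp)
    moreover have "c ((us @ [y]) @ x # ys) = c ((us @ [y]) @ insort x ys)
       \<or> c ((us @ [y]) @ x # ys) = - c ((us @ [y]) @ insort x ys)"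
      by (rule Cons.IH) (use Cons.prems in simp)
    ultimately show ?thesis using False by auto
  qed simp
qed simp

lemma alternating_sort_aux:
  assumes "alternating d c"
  shows "length us + length ys = d \<Longrightarrow>
    c (us @ ys) = c (us @ sort ys) \<or> c (us @ ys) = - c (us @ sort ys)"
proof (induction ys arbitrary: us)
  case (Cons y ys)
  have "c ((us @ [y]) @ ys) = c ((us @ [y]) @ sort ys) \<or> c ((us @ [y]) @ ys) = - c ((us @ [y]) @ sort ys)"
    by (rule Cons.IH) (use Cons.prems in simp)
  moreover have "c (us @ y # sort ys) = c (us @ insort y (sort ys))
      \<or> c (us @ y # sort ys) = - c (us @ insort y (sort ys))"
    by (rule alternating_insort[OF assms]) (use Cons.prems in simp)
  ultimately show ?case by auto
qed simp

lemma alternating_sort: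
  assumes "alternating d c" "length xs = d"
  shows "c xs = c (sort xs) \<or> c xs = - c (sort xs)"
  using alternating_sort_aux[OF assms(1), of "[]" xs] assms(2) by simp

lemma alternating_same_set:
  assumes "alternating d c" "length xs = d" "length ys = d" "distinct xs" "distinct ys" "set xs = set ys"
  shows "c xs = c ys \<or> c xs = - c ys"
proof -
  have "sort xs = sort ys"
    using assms by (intro sorted_distinct_set_unique) auto
  then show ?thesis
    using alternating_sort[OF assms(1,2)] alternating_sort[OF assms(1,3)] by auto
qed

section \<open>Increasing lists and minors of the identity matrix\<close>

lemma mem_subsets: "xs \<in> set (subsets d N) \<longleftrightarrow> length xs = d \<and> sorted xs \<and> distinct xs \<and> set xs \<subseteq> {..<N}"
proof -
  have sorted_subseqs: "sorted ys" if "ys \<in> set (subseqs zs)" "sorted zs" for ys zs :: "nat list"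
    using that
  proof (induction zs arbitrary: ys)
    case (Cons z zs)
    have "set ys' \<subseteq> set zs" if "ys' \<in> set (subseqs zs)" for ys'
      using subseqs_powset[of zs] that by blast
    then show ?case using Cons by (force simp: Let_def)
  qed simp
  have "sorted xs \<and> distinct xs \<and> set xs \<subseteq> {..<N}" if "xs \<in> set (subseqs [0..<N])"
    using that sorted_subseqs[OF that] subseqs_distinctD[OF that] subseqs_powset[of "[0..<N]"]
    by (auto simp: atLeast0LessThan)
  moreover have "xs \<in> set (subseqs [0..<N])" if xs: "sorted xs" "distinct xs" "set xs \<subseteq> {..<N}"
  proof -
    obtain zs where zs: "zs \<in> set (subseqs [0..<N])" "set zs = set xs"
      using subset_subseqs[of "set xs" "[0..<N]"] xs(3) by (auto simp: atLeast0LessThan)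
    have "zs = xs"
      by (rule sorted_distinct_set_unique)
        (use xs zs sorted_subseqs[OF zs(1)] subseqs_distinctD[OF zs(1)] in auto)
    with zs show ?thesis by simp
  qed
  ultimately show ?thesis by (auto simp: subsets_def)
qed

lemma distinct_subsets: "distinct (subsets d N)"
  using distinct_set_subseqs[of "[0..<N]"] by (simp add: subsets_def distinct_map)

lemma nth_subsets:
  assumes "i < length (subsets d N)"
  shows "length (subsets d N ! i) = d" "sorted (subsets d N ! i)" "distinct (subsets d N ! i)"
    "set (subsets d N ! i) \<subseteq> {..<N}"
  using nth_mem[OF assms] by (simp_all add: mem_subsets)

lemma nth_subsets_less: "i < length (subsets d N) \<Longrightarrow> m < d \<Longrightarrow> subsets d N ! i ! m < N"
  using nth_subsets(1)[of i d N] subsetD[OF nth_subsets(4)[of i d N] nth_mem, of m] by simp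

lemma sort_mem_subsets: "xs \<in> Lst N d \<Longrightarrow> distinct xs \<Longrightarrow> sort xs \<in> set (subsets d N)"
  by (auto simp: mem_subsets Lst_def)

lemma subsets_index:
  assumes "xs \<in> set (subsets d N)"
  obtains i where "i < length (subsets d N)" "subsets d N ! i = xs"
  using assms by (metis in_set_conv_nth)

lemma nth_subsets_eq_iff:
  "i < length (subsets d N) \<Longrightarrow> j < length (subsets d N) \<Longrightarrow> subsets d N ! i = subsets d N ! j \<longleftrightarrow> i = j"
  using distinct_subsets nth_eq_iff_index_eq by blast

text \<open>Exchange of two rows: composing the summation permutation with the transposition
  permutes the factors of the product and flips the sign. The row list may repeat entries, so minors
  become alternating functions on all lists.\<close>

lemma alternating_detsub: "alternating d (\<lambda>xs. detsub d h xs J)"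
  unfolding alternating_def
proof (intro allI impI, elim conjE)
  fix xs :: "nat list" and p q assume h: "length xs = d" "p < d" "q < d" "p \<noteq> q"
  let ?t = "transpose p q"
  have t: "?t permutes {..<d}" using h by (simp add: permutes_swap_id)
  have "detsub d h (swp p q xs) J
      = (\<Sum>s | s permutes {..<d}. of_int (sign s) * (\<Prod>i<d. h (xs ! ?t i) (J ! s i)))"
    unfolding detsub_def using h by (intro sum.cong refl arg_cong2[where f="(*)"] prod.cong) (auto simp: nth_swp)
  also have "\<dots> = (\<Sum>s | s permutes {..<d}. of_int (sign s) * (\<Prod>i<d. h (xs ! i) (J ! (s \<circ> ?t) i)))"
  proof (intro sum.cong refl arg_cong2[where f="(*)"])
    fix s
    have "(\<Prod>i<d. h (xs ! ?t i) (J ! s i)) = (\<Prod>i<d. h (xs ! ?t (?t i)) (J ! s (?t i)))"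
      using prod.permute[OF t, of "\<lambda>i. h (xs ! ?t i) (J ! s i)"] by (simp add: o_def)
    then show "(\<Prod>i<d. h (xs ! ?t i) (J ! s i)) = (\<Prod>i<d. h (xs ! i) (J ! (s \<circ> ?t) i))"
      by simp
  qed
  also have "\<dots> = (\<Sum>s | s permutes {..<d}. - of_int (sign (s \<circ> ?t)) * (\<Prod>i<d. h (xs ! i) (J ! (s \<circ> ?t) i)))"
  proof (intro sum.cong refl arg_cong2[where f="(*)"])
    fix s assume "s \<in> {s. s permutes {..<d}}"
    then have "permutation s" by (auto intro: permutation_permutes[THEN iffD2] exI[of _ "{..<d}"])
    then show "of_int (sign s) = (- of_int (sign (s \<circ> ?t)) :: complex)"
      using h by (simp add: sign_compose permutation_swap_id sign_swap_id)
  qed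
  also have "\<dots> = (\<Sum>s | s permutes {..<d}. - of_int (sign s) * (\<Prod>i<d. h (xs ! i) (J ! s i)))"
    by (rule sum.reindex_bij_betw[of "\<lambda>s. s \<circ> ?t" _ _ "\<lambda>s. - of_int (sign s) * (\<Prod>i<d. h (xs ! i) (J ! s i))"])
      (use t in \<open>auto intro!: bij_betw_byWitness[where f'="\<lambda>s. s \<circ> ?t"] permutes_compose simp: o_assoc[symmetric]\<close>)
  finally show "detsub d h (swp p q xs) J = - detsub d h xs J"
    by (simp add: detsub_def sum_negf)
qed

lemma detsub_cong:
  "(\<And>i j. i < d \<Longrightarrow> j < d \<Longrightarrow> g (I ! i) (J ! j) = h (I ! i) (J ! j)) \<Longrightarrow> detsub d g I J = detsub d h I J"
  unfolding detsub_def by (intro sum.cong refl arg_cong2[where f="(*)"] prod.cong)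
    (auto dest: permutes_in_image)

lemma detsub_idm_eq_0:
  assumes "length I = d" "length J = d" "distinct I" "distinct J" "set I \<noteq> set J"
  shows "detsub d idm I J = 0"
proof -
  have "(\<Prod>i<d. idm (I ! i) (J ! p i)) = 0" if p: "p permutes {..<d}" for p
  proof (rule ccontr)
    assume "(\<Prod>i<d. idm (I ! i) (J ! p i)) \<noteq> 0"
    then have "\<And>i. i < d \<Longrightarrow> I ! i = J ! p i" by (auto simp: idm_def split: if_splits)
    then have "set I \<subseteq> set J" using p assms(1,2)
      by (auto simp: in_set_conv_nth) (metis lessThan_iff permutes_in_image)
    moreover have "card (set I) = card (set J)" using assms by (simp add: distinct_card)
    ultimately show False using assms(5) card_subset_eq[of "set J" "set I"] by simp
  qed
  then show ?thesis unfolding detsub_def by (intro sum.neutral) auto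
qed

lemma detsub_idm_self:
  assumes "length I = d" "distinct I"
  shows "detsub d idm I I = 1"
proof -
  have "(\<Prod>i<d. idm (I ! i) (I ! p i)) = 0" if p: "p permutes {..<d}" "p \<noteq> id" for p
  proof (rule ccontr)
    assume "(\<Prod>i<d. idm (I ! i) (I ! p i)) \<noteq> 0"
    then have "\<And>i. i < d \<Longrightarrow> I ! i = I ! p i" by (auto simp: idm_def split: if_splits)
    then have "\<And>i. i < d \<Longrightarrow> p i = i" using assms p
      by (metis distinct_conv_nth lessThan_iff permutes_in_image)
    then have "p i = i" for i using p(1) by (cases "i < d") (auto simp: permutes_not_in)
    then show False using p(2) by (auto simp: fun_eq_iff)
  qed
  then have "detsub d idm I I = (\<Sum>p\<in>{id}. of_int (sign p) * (\<Prod>i<d. idm (I ! i) (I ! p i)))"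
    unfolding detsub_def
    by (intro sum.mono_neutral_right) (auto simp: finite_permutations permutes_id)
  then show ?thesis by (simp add: idm_def)
qed

text \<open>The minors of the identity are the standard basis of the exterior power, seen as
  functions of their row list: they alternate, and on increasing lists they form a Kronecker
  delta.\<close>

lemma detsub_idm_subsets:
  assumes "i < length (subsets d N)" "j < length (subsets d N)"
  shows "detsub d idm (subsets d N ! i) (subsets d N ! j) = (if i = j then 1 else 0)"
proof (cases "i = j")
  case True then show ?thesis using nth_subsets[OF assms(1)] by (simp add: detsub_idm_self)
next
  case False
  then have "set (subsets d N ! i) \<noteq> set (subsets d N ! j)"
    using nth_subsets[OF assms(1)] nth_subsets[OF assms(2)] nth_subsets_eq_iff[OF assms]
      sorted_distinct_set_unique by metis
  with False show ?thesis using nth_subsets[OF assms(1)] nth_subsets[OF assms(2)] by (simp add: detsub_idm_eq_0)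
qed

text \<open>The workhorse for identities between alternating functions: take the difference and test
  it on increasing lists.\<close>

lemma alternating_eq_0:
  assumes "alternating d c" "\<And>i. i < length (subsets d N) \<Longrightarrow> c (subsets d N ! i) = 0" "xs \<in> Lst N d"
  shows "c xs = 0"
proof (cases "distinct xs")
  case True
  then obtain i where "i < length (subsets d N)" "subsets d N ! i = sort xs"
    using subsets_index sort_mem_subsets[OF assms(3)] by metis
  then have "c (sort xs) = 0" using assms(2) by metis
  then show ?thesis using assms alternating_sort[OF assms(1), of xs] by (auto simp: Lst_def)
qed (use assms alternating_not_distinct in \<open>auto simp: Lst_def\<close>)

lemma alternating_diff: "alternating d f \<Longrightarrow> alternating d g \<Longrightarrow> alternating d (\<lambda>x. f x - g x)"
  by (simp add: alternating_def)

lemma alternating_sum: "(\<And>a. a \<in> A \<Longrightarrow> alternating d (f a)) \<Longrightarrow> alternating d (\<lambda>x. \<Sum>a\<in>A. f a x)"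
  by (simp add: alternating_def flip: sum_negf)

lemma alternating_mult_right: "alternating d f \<Longrightarrow> alternating d (\<lambda>x. f x * k)"
  by (simp add: alternating_def)

lemma alternating_mult_left: "alternating d f \<Longrightarrow> alternating d (\<lambda>x. k * f x)"
  by (simp add: alternating_def)

lemma alternating_expand:
  assumes "alternating d c" "xs \<in> Lst N d"
  shows "c xs = (\<Sum>i<length (subsets d N). detsub d idm xs (subsets d N ! i) * c (subsets d N ! i))"
proof -
  let ?G = "\<lambda>xs. c xs - (\<Sum>i<length (subsets d N). detsub d idm xs (subsets d N ! i) * c (subsets d N ! i))"
  have "?G xs = 0"
    by (rule alternating_eq_0[OF _ _ assms(2)])
      (auto intro!: alternating_diff assms(1) alternating_sum alternating_mult_right alternating_detsub
        simp: detsub_idm_subsets if_distrib[of "\<lambda>x. x * _"] sum.delta cong: if_cong)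
  then show ?thesis by simp
qed

section \<open>Cauchy-Binet formula\<close>

lemma sum_Lst_prod:
  fixes f :: "nat \<Rightarrow> nat \<Rightarrow> complex"
  shows "(\<Prod>i<d. \<Sum>k<N. f i k) = (\<Sum>ks\<in>Lst N d. \<Prod>i<d. f i (ks ! i))"
proof (induction d arbitrary: f)
  case 0
  have "Lst N 0 = {[]}" by (auto simp: Lst_def)
  then show ?case by simp
next
  case (Suc d)
  have L: "Lst N (Suc d) = (\<lambda>(k, ks). k # ks) ` ({..<N} \<times> Lst N d)"
    by (auto simp: Lst_def image_iff length_Suc_conv)
  have "(\<Prod>i<Suc d. \<Sum>k<N. f i k) = (\<Sum>k<N. f 0 k) * (\<Sum>ks\<in>Lst N d. \<Prod>i<d. f (Suc i) (ks ! i))"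
    by (simp add: prod.lessThan_Suc_shift Suc.IH del: prod.lessThan_Suc)
  also have "\<dots> = (\<Sum>(k, ks)\<in>{..<N} \<times> Lst N d. f 0 k * (\<Prod>i<d. f (Suc i) (ks ! i)))"
    by (simp add: sum_product sum.cartesian_product)
  also have "\<dots> = (\<Sum>ks\<in>Lst N (Suc d). \<Prod>i<Suc d. f i (ks ! i))"
    unfolding L by (subst sum.reindex)
      (auto simp: inj_on_def prod.lessThan_Suc_shift case_prod_beta simp del: prod.lessThan_Suc intro!: sum.cong)
  finally show ?case .
qed

lemma detsub_mult_aux:
  "detsub d (\<lambda>i j. \<Sum>k<N. g i k * h k j) I J = (\<Sum>ks\<in>Lst N d. (\<Prod>i<d. g (I ! i) (ks ! i)) * detsub d h ks J)"
proof -
  have "detsub d (\<lambda>i j. \<Sum>k<N. g i k * h k j) I J =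
     (\<Sum>p | p permutes {..<d}. of_int (sign p) * (\<Sum>ks\<in>Lst N d. \<Prod>i<d. g (I ! i) (ks ! i) * h (ks ! i) (J ! p i)))"
    unfolding detsub_def by (simp add: sum_Lst_prod)
  also have "\<dots> = (\<Sum>ks\<in>Lst N d. \<Sum>p | p permutes {..<d}.
        (\<Prod>i<d. g (I ! i) (ks ! i)) * (of_int (sign p) * (\<Prod>i<d. h (ks ! i) (J ! p i))))"
    by (subst sum.swap) (simp add: sum_distrib_left prod.distrib mult_ac)
  finally show ?thesis by (simp add: detsub_def sum_distrib_left)
qed

text \<open>The Leibniz sum first runs over all intermediate lists \<open>ks\<close>. As
  \<open>detsub d h ks J\<close> alternates in \<open>ks\<close>, it expands over increasing lists,
  and the coefficients collected in front of each are again minors of \<open>g\<close>.\<close>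

lemma cauchy_binet:
  assumes "set J \<subseteq> {..<N}" "set I \<subseteq> {..<N}" "length I = d"
  shows "detsub d (\<lambda>i j. \<Sum>k<N. g i k * h k j) I J =
    (\<Sum>K<length (subsets d N). detsub d g I (subsets d N ! K) * detsub d h (subsets d N ! K) J)"
proof -
  have "detsub d (\<lambda>i j. \<Sum>k<N. g i k * h k j) I J = (\<Sum>ks\<in>Lst N d. (\<Prod>i<d. g (I ! i) (ks ! i)) *
     (\<Sum>K<length (subsets d N). detsub d idm ks (subsets d N ! K) * detsub d h (subsets d N ! K) J))"
    unfolding detsub_mult_aux
    by (intro sum.cong refl arg_cong2[where f="(*)"] alternating_expand[OF alternating_detsub]) auto
  also have "\<dots> = (\<Sum>K<length (subsets d N). (\<Sum>ks\<in>Lst N d. (\<Prod>i<d. g (I ! i) (ks ! i)) *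
      detsub d idm ks (subsets d N ! K)) * detsub d h (subsets d N ! K) J)"
    by (simp add: sum_distrib_left sum_distrib_right mult_ac) (rule sum.swap)
  also have "\<dots> = (\<Sum>K<length (subsets d N). detsub d g I (subsets d N ! K) * detsub d h (subsets d N ! K) J)"
  proof (intro sum.cong refl arg_cong2[where f="(*)"])
    fix K assume K: "K \<in> {..<length (subsets d N)}"
    have "detsub d (\<lambda>i j. \<Sum>k<N. g i k * idm k j) I (subsets d N ! K) = detsub d g I (subsets d N ! K)"
      by (rule detsub_cong) (use nth_subsets_less[of K d N] K in \<open>auto simp: idm_def if_distrib cong: if_cong\<close>)
    then show "(\<Sum>ks\<in>Lst N d. (\<Prod>i<d. g (I ! i) (ks ! i)) * detsub d idm ks (subsets d N ! K)) = detsub d g I (subsets d N ! K)"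
      by (simp add: detsub_mult_aux)
  qed
  finally show ?thesis .
qed

section \<open>Highest weight vectors in the primitive exterior powers\<close>

text \<open>The derivation by which a matrix acts on a tensor power, written on coefficient
  functions: one slot at a time. It is the derivative of the entrywise group action.\<close>

definition lie_op :: "nat \<Rightarrow> cmat \<Rightarrow> (nat list \<Rightarrow> complex) \<Rightarrow> nat list \<Rightarrow> complex" where
  "lie_op N A c xs = (\<Sum>m<length xs. \<Sum>k<N. A (xs ! m) k * c (xs[m := k]))"

definition unitm :: "nat \<Rightarrow> nat \<Rightarrow> cmat" where
  "unitm u v = (\<lambda>a b. if a = u \<and> b = v then 1 else 0)"

text \<open>Indices \<open>i < n\<close> stand for \<open>e\<^sub>i\<close> and \<open>n + i\<close> for the dual vector \<open>f\<^sub>i\<close>. The short root vector maps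
  \<open>e\<^sub>j \<mapsto> e\<^sub>i\<close>, \<open>f\<^sub>i \<mapsto> - f\<^sub>j\<close>, the long one \<open>f\<^sub>i \<mapsto> e\<^sub>i\<close>.\<close>
definition short_root :: "nat \<Rightarrow> nat \<Rightarrow> nat \<Rightarrow> cmat" where
  "short_root n i j = (\<lambda>a b. unitm i j a b - unitm (n + j) (n + i) a b)"

definition long_root :: "nat \<Rightarrow> nat \<Rightarrow> cmat" where
  "long_root n i = unitm i (n + i)"

definition cartan :: "nat \<Rightarrow> nat \<Rightarrow> cmat" where
  "cartan n i = (\<lambda>a b. unitm i i a b - unitm (n + i) (n + i) a b)"

abbreviation rpl :: "nat \<Rightarrow> nat \<Rightarrow> nat list \<Rightarrow> nat list" where
  "rpl u v xs \<equiv> map (\<lambda>x. if x = u then v else x) xs"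

lemma finite_Lst [simp]: "finite (Lst N d)"
  unfolding Lst_def using finite_lists_length_eq[of "{..<N}" d] by (simp add: conj_commute)

lemma Lst_update: "xs \<in> Lst N d \<Longrightarrow> k < N \<Longrightarrow> xs[m := k] \<in> Lst N d"
  using set_update_subset_insert[of xs m k] by (auto simp: Lst_def)

lemma length_Lst: "xs \<in> Lst N d \<Longrightarrow> length xs = d"
  by (simp add: Lst_def)

lemma nth_Lst: "xs \<in> Lst N d \<Longrightarrow> m < d \<Longrightarrow> xs ! m < N"
  using subsetD[OF _ nth_mem, of xs "{..<N}" m] by (simp add: Lst_def)

lemma lie_op_diff: "lie_op N (\<lambda>a b. A a b - B a b) c xs = lie_op N A c xs - lie_op N B c xs"
  by (simp add: lie_op_def left_diff_distrib sum_subtractf)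

lemma lie_op_unitm:
  assumes "distinct xs" "v < N"
  shows "lie_op N (unitm u v) c xs = (if u \<in> set xs then c (rpl u v xs) else 0)"
proof -
  have "lie_op N (unitm u v) c xs = (\<Sum>m<length xs. if xs ! m = u then c (xs[m := v]) else 0)"
    unfolding lie_op_def unitm_def
  proof (intro sum.cong refl)
    fix m
    show "(\<Sum>k<N. (if xs ! m = u \<and> k = v then 1 else 0) * c (xs[m := k]))
        = (if xs ! m = u then c (xs[m := v]) else 0)"
      using assms(2) by (cases "xs ! m = u") (simp_all add: if_distrib[of "\<lambda>x. x * _"] cong: if_cong)
  qed
  also have "\<dots> = (if u \<in> set xs then c (rpl u v xs) else 0)"
  proof (cases "u \<in> set xs")
    case True
    then obtain m where m: "m < length xs" "xs ! m = u" by (auto simp: in_set_conv_nth)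
    have "rpl u v xs = xs[m := v]"
      by (rule nth_equalityI) (use m assms(1) in \<open>auto simp: nth_list_update nth_eq_iff_index_eq\<close>)
    moreover have "(if xs ! m' = u then c (xs[m' := v]) else 0) = (if m' = m then c (xs[m := v]) else 0)"
      if "m' < length xs" for m' using m assms(1) that by (auto simp: nth_eq_iff_index_eq)
    ultimately show ?thesis using True m by simp
  qed (auto simp: in_set_conv_nth intro!: sum.neutral)
  finally show ?thesis .
qed

lemma lie_op_short_root:
  assumes "distinct xs" "i < n" "j < n"
  shows "lie_op (2*n) (short_root n i j) c xs =
    (if i \<in> set xs then c (rpl i j xs) else 0) - (if n + j \<in> set xs then c (rpl (n + j) (n + i) xs) else 0)"
  unfolding short_root_def lie_op_diff using assms by (simp add: lie_op_unitm)

lemma lie_op_long_root: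
  assumes "distinct xs" "i < n"
  shows "lie_op (2*n) (long_root n i) c xs = (if i \<in> set xs then c (rpl i (n + i) xs) else 0)"
  unfolding long_root_def using assms by (simp add: lie_op_unitm)

lemma lie_op_cartan:
  assumes "distinct xs" "i < n"
  shows "lie_op (2*n) (cartan n i) c xs =
    ((if i \<in> set xs then 1 else 0) - (if n + i \<in> set xs then 1 else 0)) * c xs"
proof -
  have "rpl u u xs = xs" for u by (simp add: map_idI)
  then show ?thesis unfolding cartan_def lie_op_diff using assms by (simp add: lie_op_unitm)
qed

text \<open>Swapping two slots merely permutes the outer sum over slots by the same
  transposition.\<close>

lemma alternating_lie_op:
  assumes "alternating d c"
  shows "alternating d (lie_op N A c)"
  unfolding alternating_def
proof (intro allI impI, elim conjE)
  fix xs :: "nat list" and p q assume h: "length xs = d" "p < d" "q < d" "p \<noteq> q"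
  let ?t = "transpose p q"
  have t: "?t permutes {..<d}" using h by (simp add: permutes_swap_id)
  have sw: "(swp p q xs)[m := k] = swp p q (xs[?t m := k])" if "m < d" for m k
    by (rule nth_equalityI) (use h that in \<open>auto simp: nth_list_update nth_swp transpose_def swp_def\<close>)
  have "lie_op N A c (swp p q xs) = (\<Sum>m<d. \<Sum>k<N. A (xs ! ?t m) k * - c (xs[?t m := k]))"
    unfolding lie_op_def using h assms
    by (intro sum.cong) (auto simp: sw nth_swp alternating_def)
  also have "\<dots> = (\<Sum>m<d. \<Sum>k<N. A (xs ! m) k * - c (xs[m := k]))"
    using sum.permute[OF t, of "\<lambda>m. \<Sum>k<N. A (xs ! m) k * - c (xs[m := k])"] by (simp add: o_def)
  finally show "lie_op N A c (swp p q xs) = - lie_op N A c xs"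
    using h by (simp add: lie_op_def sum_negf)
qed

lemma down_closed_card:
  fixes S :: "nat set"
  assumes "finite S" "\<And>i j. j \<in> S \<Longrightarrow> i < j \<Longrightarrow> i \<in> S"
  shows "S = {..<card S}"
proof -
  have "x < card S" if "x \<in> S" for x
  proof -
    have "{..x} \<subseteq> S" using assms(2) that by (metis atMost_iff le_neq_implies_less subsetI)
    then have "card {..x} \<le> card S" using assms(1) card_mono by blast
    then show ?thesis by simp
  qed
  then have "S \<subseteq> {..<card S}" by auto
  then show ?thesis by (intro card_subset_eq) auto
qed

text \<open>The annihilator of the positive root vectors inside the primitive part of the exterior power
  is the line of the highest weight vector: a coefficient containing both \<open>e\<^sub>i\<close> and \<open>f\<^sub>i\<close> does not
  depend on \<open>i\<close>, so the contraction returns a positive multiple of it.\<close>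
lemma primitive_highest_weight:
  assumes alt: "alternating d c"
    and short: "\<And>i j xs. i < j \<Longrightarrow> j < n \<Longrightarrow> xs \<in> Lst (2*n) d \<Longrightarrow> lie_op (2*n) (short_root n i j) c xs = 0"
    and long: "\<And>i xs. i < n \<Longrightarrow> xs \<in> Lst (2*n) d \<Longrightarrow> lie_op (2*n) (long_root n i) c xs = 0"
    and prim: "\<And>ys. 2 \<le> d \<Longrightarrow> ys \<in> Lst (2*n) (d - 2) \<Longrightarrow> (\<Sum>k<n. c (k # (n + k) # ys)) = 0"
    and zs: "zs \<in> Lst (2*n) d" "c zs \<noteq> 0"
  shows "set zs = {..<d}"
proof -
  have dz: "distinct zs" using alternating_not_distinct[OF alt] zs by (auto simp: Lst_def)
  have lz: "length zs = d" "set zs \<subseteq> {..<2*n}" using zs by (auto simp: Lst_def)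
  have rpl_rpl: "rpl v u (rpl u v xs) = xs" if "v \<notin> set xs" for u v xs
    using that by (auto intro!: map_idI)
  have rpl_distinct: "distinct (rpl u v xs)" if "v \<notin> set xs" "distinct xs" for u v xs
    using that by (auto simp: distinct_map inj_on_def)
  have rpl_Lst: "rpl u v zs \<in> Lst (2*n) d" if "v < 2*n" for u v
    using lz that by (auto simp: Lst_def)
  \<comment> \<open>Otherwise the long root relation at the list with \<open>n + i\<close> replaced
    by \<open>i\<close> consists of the single term \<open>c zs\<close>.\<close>
  have 1: "i \<in> set zs" if i: "i < n" "n + i \<in> set zs" for i
  proof (rule ccontr)
    assume ni: "i \<notin> set zs"
    have "lie_op (2*n) (long_root n i) c (rpl (n + i) i zs) = 0"
      using i by (intro long rpl_Lst) auto
    moreover have "i \<in> set (rpl (n + i) i zs)" using i by auto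
    moreover have "rpl i (n + i) (rpl (n + i) i zs) = zs" by (rule rpl_rpl[OF ni])
    ultimately show False
      using zs(2) lie_op_long_root[OF rpl_distinct[OF ni dz] i(1), of c "n + i"] by simp
  qed
  have 2: "n + i \<notin> set zs" if i: "i < n" for i
  proof
    assume ni: "n + i \<in> set zs"
    with 1 i have mi: "i \<in> set zs" by blast
    define ys where "ys = filter (\<lambda>x. x \<noteq> i \<and> x \<noteq> n + i) zs"
    have dy: "distinct ys" "i \<notin> set ys" "n + i \<notin> set ys" "set ys \<subseteq> {..<2*n}"
      using dz lz by (auto simp: ys_def)
    have sety: "set (i # (n + i) # ys) = set zs" using mi ni by (auto simp: ys_def)
    have ly: "length ys + 2 = d"
    proof -
      have "length (i # (n + i) # ys) = card (set zs)"
        unfolding sety[symmetric] using dy i by (intro distinct_card[symmetric]) auto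
      then show ?thesis using dz lz distinct_card by fastforce
    qed
    have ne: "c (i # (n + i) # ys) \<noteq> 0"
      using alternating_same_set[OF alt _ lz(1) _ dz sety] dy ly i zs(2) by auto
    \<comment> \<open>\<open>S\<close> collects the indices whose pair can be put in front of
      \<open>ys\<close> without repetition. Only these contribute to the primitivity sum, and all
      with the same coefficient.\<close>
    define S where "S = {j. j < n \<and> j \<notin> set ys \<and> n + j \<notin> set ys}"
    have rpl_ys: "rpl u v ys = ys" if "u \<notin> set ys" for u v using that by (auto intro!: map_idI)
    \<comment> \<open>At the mixed list \<open>u # (n + v) # ys\<close> the short root relation is
      the difference of the two pair coefficients.\<close>
    have ex: "c (v # (n + v) # ys) = c (u # (n + u) # ys)" if "u \<in> S" "v \<in> S" "u < v" for u v
    proof -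
      have d: "distinct (u # (n + v) # ys)" using that dy(1) by (auto simp: S_def)
      have "lie_op (2*n) (short_root n u v) c (u # (n + v) # ys) = 0"
        using that dy ly by (intro short) (auto simp: S_def Lst_def)
      then show ?thesis using that by (subst (asm) lie_op_short_root[OF d]) (auto simp: S_def rpl_ys)
    qed
    have iS: "i \<in> S" using i dy by (auto simp: S_def)
    have const: "c (j # (n + j) # ys) = c (i # (n + i) # ys)" if "j \<in> S" for j
      using ex[OF that iS] ex[OF iS that] by (metis linorder_neqE_nat)
    have zero: "c (j # (n + j) # ys) = 0" if "j < n" "j \<notin> S" for j
      using that ly by (intro alternating_not_distinct[OF alt]) (auto simp: S_def)
    have "0 = (\<Sum>k<n. c (k # (n + k) # ys))"
      using prim[of ys] ly dy by (auto simp: Lst_def)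
    also have "\<dots> = (\<Sum>k\<in>S. c (k # (n + k) # ys))"
      by (intro sum.mono_neutral_right) (auto simp: S_def intro!: zero)
    also have "\<dots> = of_nat (card S) * c (i # (n + i) # ys)" by (simp add: const)
    finally have "card S = 0" using ne by simp
    moreover have "finite S" by (simp add: S_def)
    ultimately show False using iS by auto
  qed
  have small: "set zs \<subseteq> {..<n}"
  proof
    fix x assume "x \<in> set zs"
    then have "x < 2*n" "x \<noteq> n + (x - n) \<or> \<not> x - n < n" using lz 2[of "x - n"] by auto
    then show "x \<in> {..<n}" by auto
  qed
  \<comment> \<open>With no \<open>f\<close> left, the short root relation at the list with
    \<open>j\<close> replaced by \<open>i\<close> reduces to \<open>c zs\<close>, so the entries are
    closed downwards.\<close>
  have "i \<in> set zs" if j: "j \<in> set zs" "i < j" for i j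
  proof (rule ccontr)
    assume ni: "i \<notin> set zs"
    have jn: "j < n" using j small by auto
    have "lie_op (2*n) (short_root n i j) c (rpl j i zs) = 0"
      using j jn by (intro short rpl_Lst) auto
    moreover have "i \<in> set (rpl j i zs)" using j by auto
    moreover have "n + j \<notin> set (rpl j i zs)" using 2[OF jn] j jn by auto
    moreover have "rpl i j (rpl j i zs) = zs" by (rule rpl_rpl[OF ni])
    ultimately show False
      using zs(2) jn j lie_op_short_root[OF rpl_distinct[OF ni dz], of i n j c j] by simp
  qed
  then have "set zs = {..<card (set zs)}" by (intro down_closed_card) auto
  then show ?thesis using lz dz distinct_card by metis
qed

text \<open>Orders the basis as \<open>e_0, ..., e_(n-1), f_(n-1), ..., f_0\<close>, by descending
  weight: greater height means lower weight, and positive root vectors strictly decrease the height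
  of a basis vector.\<close>

definition height :: "nat \<Rightarrow> nat list \<Rightarrow> nat" where
  "height n xs = (\<Sum>m<length xs. if xs ! m < n then xs ! m else 3 * n - 1 - xs ! m)"

text \<open>In a vector annihilated by the positive root vectors of a tensor product, the slice at a
  lowest weight of the first factor is annihilated in the second factor alone.\<close>
lemma tensor_highest_weight:
  assumes alt1: "\<And>ys. alternating p (\<lambda>xs. c xs ys)" and alt2: "\<And>xs. alternating d (c xs)"
    and short: "\<And>i j xs ys. i < j \<Longrightarrow> j < n \<Longrightarrow> xs \<in> Lst (2*n) p \<Longrightarrow> ys \<in> Lst (2*n) d \<Longrightarrow>
      lie_op (2*n) (short_root n i j) (\<lambda>xs. c xs ys) xs + lie_op (2*n) (short_root n i j) (c xs) ys = 0"
    and long: "\<And>i xs ys. i < n \<Longrightarrow> xs \<in> Lst (2*n) p \<Longrightarrow> ys \<in> Lst (2*n) d \<Longrightarrow>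
      lie_op (2*n) (long_root n i) (\<lambda>xs. c xs ys) xs + lie_op (2*n) (long_root n i) (c xs) ys = 0"
    and prim: "\<And>xs ys. 2 \<le> d \<Longrightarrow> xs \<in> Lst (2*n) p \<Longrightarrow> ys \<in> Lst (2*n) (d - 2) \<Longrightarrow>
      (\<Sum>k<n. c xs (k # (n + k) # ys)) = 0"
    and ne: "xs0 \<in> Lst (2*n) p" "ys0 \<in> Lst (2*n) d" "c xs0 ys0 \<noteq> 0"
  shows "\<exists>xs \<in> Lst (2*n) p. c xs [0..<d] \<noteq> 0"
proof -
  let ?P = "\<lambda>xs. xs \<in> Lst (2*n) p \<and> (\<exists>ys \<in> Lst (2*n) d. c xs ys \<noteq> 0)"
  \<comment> \<open>A first-factor list of greatest height among those with a nonzero slice; it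
    exists since \<open>Lst (2*n) p\<close> is finite.\<close>
  obtain xs where xs: "?P xs" "\<And>us. ?P us \<Longrightarrow> height n us \<le> height n xs"
  proof -
    have "finite (height n ` Lst (2*n) p)" by simp
    then have "\<forall>us. ?P us \<longrightarrow> height n us < Suc (Max (height n ` Lst (2*n) p))"
      by (simp add: le_imp_less_Suc)
    moreover have "?P xs0" using ne by blast
    ultimately have "\<exists>us. ?P us \<and> (\<forall>vs. ?P vs \<longrightarrow> height n vs \<le> height n us)"
      by (intro Lattices_Big.ex_has_greatest_nat)
    then show ?thesis using that by blast
  qed
  have higher: "c (xs[m := k]) ys = 0"
    if "m < p" "k < 2*n" "ys \<in> Lst (2*n) d"
      "(if xs ! m < n then xs ! m else 3 * n - 1 - xs ! m) < (if k < n then k else 3 * n - 1 - k)" for m k ys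
  proof (rule ccontr)
    assume "c (xs[m := k]) ys \<noteq> 0"
    then have "?P (xs[m := k])" using xs(1) that Lst_update by blast
    then have "height n (xs[m := k]) \<le> height n xs" by (rule xs(2))
    moreover have "height n xs < height n (xs[m := k])"
      unfolding height_def using that xs(1)
      by (simp, intro sum_strict_mono_ex1) (auto simp: nth_list_update Lst_def)
    ultimately show False by simp
  qed
  \<comment> \<open>Acting in the first factor, a positive root vector reads \<open>c\<close> only
    at lists of greater height than \<open>xs\<close>, where the slices vanish. The slice at
    \<open>xs\<close> is thus annihilated in the second factor alone.\<close>
  have low: "lie_op (2*n) A (\<lambda>xs. c xs ys) xs = 0"
    if "ys \<in> Lst (2*n) d" and A: "\<And>a b. a < 2*n \<Longrightarrow> b < 2*n \<Longrightarrow> A a b \<noteq> 0 \<Longrightarrow>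
      (if a < n then a else 3 * n - 1 - a) < (if b < n then b else 3 * n - 1 - b)" for A ys
    unfolding lie_op_def
  proof (intro sum.neutral ballI)
    fix m k assume mk: "m \<in> {..<length xs}" "k \<in> {..<2*n}"
    have x: "length xs = p" "xs ! m < 2*n" using xs(1) mk nth_Lst[of xs "2*n" p m] length_Lst[of xs] by auto
    show "A (xs ! m) k * c (xs[m := k]) ys = 0"
      using higher[of m k ys] A[of "xs ! m" k] mk x that(1) by auto
  qed
  obtain ys where ys: "ys \<in> Lst (2*n) d" "c xs ys \<noteq> 0" using xs(1) by blast
  have "set ys = {..<d}"
  proof (rule primitive_highest_weight[OF alt2 _ _ _ ys])
    fix i j us assume h: "i < j" "j < n" "us \<in> Lst (2*n) d"
    have "lie_op (2*n) (short_root n i j) (\<lambda>xs. c xs us) xs = 0"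
      by (rule low[OF h(3)]) (use h in \<open>auto simp: short_root_def unitm_def split: if_splits\<close>)
    then show "lie_op (2*n) (short_root n i j) (c xs) us = 0" using short[OF h(1,2) _ h(3)] xs(1) by force
  next
    fix i us assume h: "i < n" "us \<in> Lst (2*n) d"
    have "lie_op (2*n) (long_root n i) (\<lambda>xs. c xs us) xs = 0"
      by (rule low[OF h(2)]) (use h in \<open>auto simp: long_root_def unitm_def split: if_splits\<close>)
    then show "lie_op (2*n) (long_root n i) (c xs) us = 0" using long[OF h(1) _ h(2)] xs(1) by force
  qed (use prim xs(1) in auto)
  moreover have "distinct ys" using alternating_not_distinct[OF alt2] ys by (auto simp: Lst_def)
  ultimately have "c xs ys = c xs [0..<d] \<or> c xs ys = - c xs [0..<d]"
    using ys(1) by (intro alternating_same_set[OF alt2]) (simp_all add: length_Lst atLeast0LessThan)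
  then have "c xs [0..<d] \<noteq> 0" using ys(2) by force
  then show ?thesis using xs(1) by blast
qed

section \<open>Subspaces, orthogonal projections and the compact symplectic group\<close>

definition csub :: "cvec set \<Rightarrow> bool" where
  "csub W \<longleftrightarrow> (\<lambda>i. 0) \<in> W \<and> (\<forall>u\<in>W. \<forall>v\<in>W. \<forall>c. (\<lambda>i. u i + c * v i) \<in> W)"

lemma csub_0: "csub W \<Longrightarrow> (\<lambda>i. 0) \<in> W"
  and csub_add_scaled: "csub W \<Longrightarrow> u \<in> W \<Longrightarrow> v \<in> W \<Longrightarrow> (\<lambda>i. u i + c * v i) \<in> W"
  by (auto simp: csub_def)

lemma csub_scale: "csub W \<Longrightarrow> v \<in> W \<Longrightarrow> (\<lambda>i. c * v i) \<in> W"
  using csub_add_scaled[of W "\<lambda>i. 0" v c] csub_0[of W] by simp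

lemma csub_diff: "csub W \<Longrightarrow> u \<in> W \<Longrightarrow> v \<in> W \<Longrightarrow> (\<lambda>i. u i - v i) \<in> W"
  using csub_add_scaled[of W u v "-1"] by simp

lemma csub_sum:
  assumes "csub W" "\<And>a. a \<in> A \<Longrightarrow> f a \<in> W"
  shows "(\<lambda>i. \<Sum>a\<in>A. c a * f a i) \<in> W"
proof (cases "finite A")
  case True
  then show ?thesis using assms(2)
  proof (induction A)
    case (insert a A)
    then have "(\<lambda>i. (\<Sum>a\<in>A. c a * f a i) + c a * f a i) \<in> W"
      by (intro csub_add_scaled[OF assms(1)]) auto
    then show ?case using insert.hyps by (simp add: add.commute)
  qed (simp add: csub_0[OF assms(1)])
qed (simp add: csub_0[OF assms(1)])

lemma cspan_least: "csub W \<Longrightarrow> S \<subseteq> W \<Longrightarrow> cspan S \<subseteq> W"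
  unfolding cspan_def by (auto intro!: csub_sum)

lemma cspan_superset: "S \<subseteq> cspan S"
proof
  fix v assume "v \<in> S"
  then show "v \<in> cspan S" unfolding cspan_def
    by (intro CollectI exI[of _ "{v}"] exI[of _ "\<lambda>_. 1"]) auto
qed

lemma csub_cspan: "csub (cspan S)"
  unfolding csub_def
proof (intro conjI ballI allI)
  show "(\<lambda>i. 0) \<in> cspan S" unfolding cspan_def by (intro CollectI exI[of _ "{}"]) auto
  fix u v k assume "u \<in> cspan S" "v \<in> cspan S"
  then obtain A c B d where A: "finite A" "A \<subseteq> S" "u = (\<lambda>i. \<Sum>a\<in>A. c a * a i)"
    and B: "finite B" "B \<subseteq> S" "v = (\<lambda>i. \<Sum>a\<in>B. d a * a i)" unfolding cspan_def by blast
  let ?e = "\<lambda>a. (if a \<in> A then c a else 0) + k * (if a \<in> B then d a else 0)"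
  have "u i + k * v i = (\<Sum>a\<in>A \<union> B. ?e a * a i)" for i
  proof -
    have "u i = (\<Sum>a\<in>A \<union> B. (if a \<in> A then c a else 0) * a i)"
      unfolding A(3) using A B by (intro sum.mono_neutral_cong_left) auto
    moreover have "v i = (\<Sum>a\<in>A \<union> B. (if a \<in> B then d a else 0) * a i)"
      unfolding B(3) using A B by (intro sum.mono_neutral_cong_left) auto
    ultimately show ?thesis by (simp add: sum.distrib sum_distrib_left algebra_simps)
  qed
  then show "(\<lambda>i. u i + k * v i) \<in> cspan S" unfolding cspan_def
    using A B by (intro CollectI exI[of _ "A \<union> B"] exI[of _ ?e]) auto
qed

lemma csub_vecs: "csub (vecs N)"
  by (auto simp: csub_def vecs_def)

lemma csub_vimage:
  assumes "csub W" "\<And>u v c. f (\<lambda>i. u i + c * v i) = (\<lambda>i. f u i + c * f v i)" "f (\<lambda>i. 0) = (\<lambda>i. 0)"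
  shows "csub {v. f v \<in> W}"
  using assms by (auto simp: csub_def)

lemma csub_Int: "csub V \<Longrightarrow> csub W \<Longrightarrow> csub (V \<inter> W)"
  by (auto simp: csub_def)

lemma mv_add_scaled: "mv N A (\<lambda>i. u i + c * v i) = (\<lambda>i. mv N A u i + c * mv N A v i)"
  by (simp add: mv_def sum.distrib sum_distrib_left algebra_simps)

lemma mv_0: "mv N A (\<lambda>i. 0) = (\<lambda>i. 0)"
  by (simp add: mv_def)

lemma mv_diff: "mv N A (\<lambda>i. u i - v i) = (\<lambda>i. mv N A u i - mv N A v i)"
  by (simp add: mv_def sum_subtractf algebra_simps)

lemma mv_in_vecs: "mat_supp M N A \<Longrightarrow> mv N A v \<in> vecs M"
  by (auto simp: mv_def mat_supp_def vecs_def)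

section \<open>Hermitian product, orthogonal decomposition and projection\<close>

definition hip :: "nat \<Rightarrow> cvec \<Rightarrow> cvec \<Rightarrow> complex" where
  "hip N v w = (\<Sum>i<N. v i * cnj (w i))"

lemma hip_add_scaled_left: "hip N (\<lambda>i. u i + c * v i) w = hip N u w + c * hip N v w"
  by (simp add: hip_def sum.distrib sum_distrib_left algebra_simps)

lemma hip_add_scaled_right: "hip N w (\<lambda>i. u i + c * v i) = hip N w u + cnj c * hip N w v"
  by (simp add: hip_def sum.distrib sum_distrib_left algebra_simps)

lemma hip_diff_left: "hip N (\<lambda>i. u i - v i) w = hip N u w - hip N v w"
  by (simp add: hip_def sum_subtractf algebra_simps)

lemma hip_commute: "hip N v w = cnj (hip N w v)"
  by (simp add: hip_def mult.commute)

lemma hip_self_eq_0_iff: "hip N v v = 0 \<longleftrightarrow> (\<forall>i<N. v i = 0)"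
proof -
  have "hip N v v = of_real (\<Sum>i<N. (cmod (v i))\<^sup>2)"
    by (simp add: hip_def complex_norm_square flip: of_real_power)
  moreover have "(\<Sum>i<N. (cmod (v i))\<^sup>2) = 0 \<longleftrightarrow> (\<forall>i<N. v i = 0)"
    by (subst sum_nonneg_eq_0_iff) auto
  ultimately show ?thesis by (metis of_real_eq_0_iff)
qed

lemma hip_self_eq_0: "hip N v v = 0 \<Longrightarrow> v \<in> vecs N \<Longrightarrow> v = (\<lambda>i. 0)"
  unfolding hip_self_eq_0_iff vecs_def by (auto simp: fun_eq_iff) (metis linorder_not_less)

definition adj :: "cmat \<Rightarrow> cmat" where
  "adj g = (\<lambda>i j. cnj (g j i))"

lemma hip_mv: "hip M (mv N g u) w = hip N u (mv M (adj g) w)"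
  unfolding hip_def mv_def adj_def
  by (simp add: sum_distrib_left sum_distrib_right mult_ac) (rule sum.swap)

text \<open>Induction on the ambient dimension replaces orthonormal bases: the vectors of
  \<open>W\<close> with last coordinate zero form a subspace \<open>W'\<close> of smaller ambient
  dimension, and \<open>W\<close> exceeds \<open>W'\<close> by at most one vector \<open>u\<close>
  orthogonal to it.\<close>

lemma orth_decomposition:
  assumes "csub W" "W \<subseteq> vecs N" "v \<in> vecs N"
  shows "\<exists>w\<in>W. \<forall>x\<in>W. hip N (\<lambda>i. v i - w i) x = 0"
  using assms
proof (induction N arbitrary: W v)
  case 0
  then show ?case by (auto simp: hip_def intro: csub_0)
next
  case (Suc N)
  define W' where "W' = {w \<in> W. w N = 0}"
  have W': "csub W'" "W' \<subseteq> vecs N"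
  proof -
    show "csub W'" using Suc.prems(1) by (auto simp: csub_def W'_def)
    show "W' \<subseteq> vecs N" using Suc.prems(2) 
      unfolding W'_def vecs_def by (clarify, metis (mono_tags) Suc_leI le_neq_implies_less mem_Collect_eq subsetD)
  qed
  have dec: "\<exists>w\<in>W'. \<forall>x\<in>W'. hip (Suc N) (\<lambda>i. v i - w i) x = 0" for v
  proof -
    define v' where "v' = (\<lambda>i. if i < N then v i else 0)"
    have "v' \<in> vecs N" by (simp add: v'_def vecs_def)
    then obtain w where w: "w \<in> W'" "\<forall>x\<in>W'. hip N (\<lambda>i. v' i - w i) x = 0"
      using Suc.IH[OF W'] by blast
    have "hip (Suc N) (\<lambda>i. v i - w i) x = hip N (\<lambda>i. v' i - w i) x" if "x \<in> W'" for x
      using that by (simp add: hip_def v'_def W'_def)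
    with w show ?thesis by auto
  qed
  show ?case
  proof (cases "\<exists>w\<in>W. w N \<noteq> 0")
    case False
    then have "W' = W" by (auto simp: W'_def)
    with dec show ?thesis by auto
  next
    case True
    then obtain w0 where w0: "w0 \<in> W" "w0 N \<noteq> 0" by blast
    obtain z where z: "z \<in> W'" "\<And>x. x \<in> W' \<Longrightarrow> hip (Suc N) (\<lambda>i. w0 i - z i) x = 0"
      using dec[of w0] by blast
    define u where "u = (\<lambda>i. w0 i - z i)"
    have u: "u \<in> W" "u N \<noteq> 0" and u_orth: "\<And>x. x \<in> W' \<Longrightarrow> hip (Suc N) u x = 0"
      using csub_diff[OF Suc.prems(1) w0(1), of z] z w0 by (auto simp: u_def W'_def)
    have uu: "hip (Suc N) u u \<noteq> 0" using u(2) by (auto simp: hip_self_eq_0_iff)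
    obtain w1 where w1: "w1 \<in> W'" "\<And>x. x \<in> W' \<Longrightarrow> hip (Suc N) (\<lambda>i. v i - w1 i) x = 0"
      using dec[of v] by blast
    \<comment> \<open>Gram-Schmidt coefficient: correcting \<open>w1\<close> by \<open>k * u\<close>
      makes the error orthogonal to \<open>u\<close> and keeps it orthogonal to
      \<open>W'\<close>.\<close>
    define k where "k = hip (Suc N) v u / hip (Suc N) u u"
    define w where "w = (\<lambda>i. w1 i + k * u i)"
    have w: "w \<in> W" unfolding w_def using w1 u by (intro csub_add_scaled[OF Suc.prems(1)]) (auto simp: W'_def)
    have split: "hip (Suc N) (\<lambda>i. v i - w i) x = hip (Suc N) (\<lambda>i. v i - w1 i) x - k * hip (Suc N) u x" for x
      unfolding w_def hip_diff_left hip_add_scaled_left by simp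
    have "hip (Suc N) w1 u = 0" using u_orth[OF w1(1)] hip_commute[of "Suc N" w1 u] by simp
    then have ortho_u: "hip (Suc N) (\<lambda>i. v i - w i) u = 0"
      using uu unfolding split by (simp add: hip_diff_left k_def)
    have "hip (Suc N) (\<lambda>i. v i - w i) x = 0" if x: "x \<in> W" for x
    proof -
      \<comment> \<open>Subtracting \<open>t * u\<close> kills the last coordinate of
        \<open>x\<close>, which splits \<open>x\<close> into a vector of \<open>W'\<close> and a
        multiple of \<open>u\<close>.\<close>
      define t where "t = x N / u N"
      define y where "y = (\<lambda>i. x i + (- t) * u i)"
      have y: "y \<in> W'" unfolding W'_def
        using csub_add_scaled[OF Suc.prems(1) x u(1), of "- t"] u(2) by (auto simp: y_def t_def)
      have "hip (Suc N) (\<lambda>i. v i - w i) y = 0" using y unfolding split by (simp add: w1(2) u_orth)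
      moreover have "x = (\<lambda>i. y i + t * u i)" by (simp add: y_def)
      ultimately show ?thesis using ortho_u hip_add_scaled_right by (metis add_0 mult_zero_right)
    qed
    with w show ?thesis by blast
  qed
qed

definition orth_proj :: "nat \<Rightarrow> cvec set \<Rightarrow> cmat \<Rightarrow> bool" where
  "orth_proj N W P \<longleftrightarrow> mat_supp N N P \<and>
     (\<forall>v. mv N P v \<in> W \<and> (\<forall>x\<in>W. hip N (\<lambda>i. v i - mv N P v i) x = 0))"

lemma orth_proj_exists:
  assumes "csub W" "W \<subseteq> vecs N"
  shows "\<exists>P. orth_proj N W P"
proof -
  let ?e = "\<lambda>j i. if i = j then 1 else 0 :: complex"
  have "\<forall>j<N. \<exists>w\<in>W. \<forall>x\<in>W. hip N (\<lambda>i. ?e j i - w i) x = 0"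
    by (intro allI impI orth_decomposition[OF assms]) (auto simp: vecs_def)
  then obtain p where p: "\<And>j. j < N \<Longrightarrow> p j \<in> W"
    "\<And>j x. j < N \<Longrightarrow> x \<in> W \<Longrightarrow> hip N (\<lambda>i. ?e j i - p j i) x = 0" by metis
  define P where "P = (\<lambda>i j. if j < N then p j i else 0)"
  have supp: "mat_supp N N P" using p(1) assms(2) by (auto simp: mat_supp_def P_def vecs_def)
  have mvP: "mv N P v = (\<lambda>i. \<Sum>j<N. v j * p j i)" for v
    by (auto simp: mv_def P_def mult.commute intro!: sum.cong)
  have "mv N P v \<in> W" for v unfolding mvP using p(1) by (intro csub_sum[OF assms(1)]) auto
  moreover have "hip N (\<lambda>i. v i - mv N P v i) x = 0" if "x \<in> W" for v x
  proof -
    have "hip N (\<lambda>i. v i - mv N P v i) x = (\<Sum>i<N. \<Sum>j<N. v j * ((?e j i - p j i) * cnj (x i)))"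
      unfolding hip_def mvP
    proof (intro sum.cong refl)
      fix i assume "i \<in> {..<N}"
      then have "v i = (\<Sum>j<N. v j * ?e j i)" by (simp add: if_distrib cong: if_cong)
      then have "v i - (\<Sum>j<N. v j * p j i) = (\<Sum>j<N. v j * (?e j i - p j i))"
        by (simp add: sum_subtractf right_diff_distrib)
      then show "(v i - (\<Sum>j<N. v j * p j i)) * cnj (x i) = (\<Sum>j<N. v j * ((?e j i - p j i) * cnj (x i)))"
        by (simp add: sum_distrib_right mult.assoc)
    qed
    also have "\<dots> = (\<Sum>j<N. v j * hip N (\<lambda>i. ?e j i - p j i) x)"
      unfolding hip_def sum_distrib_left by (rule sum.swap)
    also have "\<dots> = 0" using p(2) that by (intro sum.neutral) auto
    finally show ?thesis .
  qed
  ultimately show ?thesis using supp unfolding orth_proj_def by blast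
qed

lemma orth_proj_unique:
  assumes "csub W" "W \<subseteq> vecs N" "orth_proj N W P" "w \<in> W" "\<And>x. x \<in> W \<Longrightarrow> hip N (\<lambda>i. v i - w i) x = 0"
  shows "mv N P v = w"
proof -
  let ?d = "\<lambda>i. mv N P v i - w i"
  have d: "?d \<in> W" using assms(3,4) by (intro csub_diff[OF assms(1)]) (auto simp: orth_proj_def)
  have "hip N ?d ?d = hip N (\<lambda>i. v i - w i) ?d - hip N (\<lambda>i. v i - mv N P v i) ?d"
    by (simp add: hip_diff_left)
  also have "\<dots> = 0" using assms(3,5) d by (simp add: orth_proj_def)
  finally have "?d = (\<lambda>i. 0)" using d assms(2) by (intro hip_self_eq_0) auto
  then show ?thesis by (auto simp: fun_eq_iff)
qed

lemma orth_proj_fixes: "csub W \<Longrightarrow> W \<subseteq> vecs N \<Longrightarrow> orth_proj N W P \<Longrightarrow> w \<in> W \<Longrightarrow> mv N P w = w"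
  by (rule orth_proj_unique) (auto simp: hip_def)

text \<open>Invariance of \<open>W\<close> under the adjoint means that \<open>g\<close> carries the
  orthogonal complement of \<open>W\<close> into itself; so \<open>g\<close> applied to both
  components of \<open>v\<close> is again an orthogonal decomposition.\<close>

lemma orth_proj_commute:
  assumes "csub W" "W \<subseteq> vecs N" "orth_proj N W P"
    and "\<And>w. w \<in> W \<Longrightarrow> mv N g w \<in> W" "\<And>w. w \<in> W \<Longrightarrow> mv N (adj g) w \<in> W"
  shows "mv N P (mv N g v) = mv N g (mv N P v)"
proof (rule orth_proj_unique[OF assms(1-3)])
  show "mv N g (mv N P v) \<in> W" using assms(3,4) by (simp add: orth_proj_def)
  fix x assume "x \<in> W"
  then have "hip N (\<lambda>i. v i - mv N P v i) (mv N (adj g) x) = 0"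
    using assms(3,5) by (simp add: orth_proj_def)
  then show "hip N (\<lambda>i. mv N g v i - mv N g (mv N P v) i) x = 0"
    by (simp add: mv_diff flip: hip_mv)
qed

section \<open>Matrix products and closure properties of the compact symplectic group\<close>

definition mm :: "nat \<Rightarrow> cmat \<Rightarrow> cmat \<Rightarrow> cmat" where
  "mm N A B = (\<lambda>i j. \<Sum>k<N. A i k * B k j)"

definition idn :: "nat \<Rightarrow> cmat" where
  "idn N = (\<lambda>i j. if i = j \<and> i < N then 1 else 0)"

definition tr :: "cmat \<Rightarrow> cmat" where
  "tr A = (\<lambda>i j. A j i)"

lemma mm_assoc: "mm N (mm M A B) C = mm M A (mm N B C)"
  by (intro ext) (auto simp: mm_def sum_distrib_left sum_distrib_right mult.assoc intro: sum.swap)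

lemma mv_mm: "mv N (mm M A B) v = mv M A (mv N B v)"
  by (intro ext) (auto simp: mm_def mv_def sum_distrib_left sum_distrib_right mult.assoc intro: sum.swap)

lemma tr_mm: "tr (mm N A B) = mm N (tr B) (tr A)"
  by (simp add: tr_def mm_def mult.commute)

lemma adj_mm: "adj (mm N A B) = mm N (adj B) (adj A)"
  by (simp add: adj_def mm_def mult.commute)

lemma adj_adj [simp]: "adj (adj A) = A" by (simp add: adj_def)

lemma mat_supp_mm: "mat_supp M N A \<Longrightarrow> mat_supp N K B \<Longrightarrow> mat_supp M K (mm N A B)"
  by (auto simp: mat_supp_def mm_def)

lemma mat_supp_tr: "mat_supp M N A \<Longrightarrow> mat_supp N M (tr A)"
  by (auto simp: mat_supp_def tr_def)

lemma mat_supp_adj: "mat_supp M N A \<Longrightarrow> mat_supp N M (adj A)"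
  by (auto simp: mat_supp_def adj_def)

lemma mm_idn_right: "mat_supp M N A \<Longrightarrow> mm N A (idn N) = A"
  by (intro ext) (auto simp: mm_def idn_def mat_supp_def if_distrib cong: if_cong)

lemma mm_idn_left:
  assumes "mat_supp N M A"
  shows "mm N (idn N) A = A"
proof (intro ext)
  fix i j
  show "mm N (idn N) A i j = A i j"
    using assms by (cases "i < N") (simp_all add: mm_def idn_def mat_supp_def if_distrib[of "\<lambda>x. x * _"] cong: if_cong)
qed

lemma mat_supp_sform: "mat_supp (2*m) (2*m) (sform m)"
  by (auto simp: mat_supp_def sform_def)

lemma mat_supp_ext: "mat_supp M N A \<Longrightarrow> mat_supp M N B \<Longrightarrow> (\<And>i j. i < M \<Longrightarrow> j < N \<Longrightarrow> A i j = B i j) \<Longrightarrow> A = B"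
  by (intro ext) (metis linorder_not_less mat_supp_def)

text \<open>The definition of \<open>in_Sp\<close> only provides \<open>adj g\<close> as a left
  inverse; closure under adjoints requires the other order, and this is where finite dimension
  enters.\<close>

lemma mm_left_right_inverse:
  assumes "mat_supp N N A" "mat_supp N N B" "mm N A B = idn N"
  shows "mm N B A = idn N"
proof -
  let ?M = "\<lambda>A. mat N N (\<lambda>(i, j). A i j) :: complex mat"
  have mult: "?M A * ?M B = ?M (mm N A B)" for A B
    by (rule eq_matI) (auto simp: scalar_prod_def mm_def atLeast0LessThan)
  have one: "?M (idn N) = 1\<^sub>m N" by (rule eq_matI) (auto simp: idn_def)
  have "?M B * ?M A = 1\<^sub>m N"
    by (rule mat_mult_left_right_inverse[of "?M A" N "?M B"]) (simp_all add: mult one assms(3))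
  then have "?M (mm N B A) $$ (i, j) = 1\<^sub>m N $$ (i, j)" for i j by (simp add: mult)
  then have "mm N B A i j = idn N i j" if "i < N" "j < N" for i j
    using that by (metis (no_types, lifting) case_prod_conv idn_def index_mat(1) index_one_mat(1))
  then show ?thesis
    by (intro mat_supp_ext[OF mat_supp_mm[OF assms(2,1)]]) (auto simp: idn_def mat_supp_def)
qed

lemma in_Sp_iff: "in_Sp m g \<longleftrightarrow> mat_supp (2*m) (2*m) g
    \<and> mm (2*m) (mm (2*m) (tr g) (sform m)) g = sform m \<and> mm (2*m) (adj g) g = idn (2*m)" (is "_ = (?s \<and> ?a \<and> ?b)")
proof -
  have a: "?a \<longleftrightarrow> (\<forall>i<2*m. \<forall>j<2*m. (\<Sum>k<2*m. \<Sum>l<2*m. g k i * sform m k l * g l j) = sform m i j)" if s: ?s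
  proof -
    have eq: "mm (2*m) (mm (2*m) (tr g) (sform m)) g i j = (\<Sum>k<2*m. \<Sum>l<2*m. g k i * sform m k l * g l j)" for i j
      unfolding mm_def tr_def sum_distrib_right by (rule sum.swap)
    have "?a \<longleftrightarrow> (\<forall>i<2*m. \<forall>j<2*m. mm (2*m) (mm (2*m) (tr g) (sform m)) g i j = sform m i j)"
      using mat_supp_ext[OF mat_supp_mm[OF mat_supp_mm[OF mat_supp_tr[OF s] mat_supp_sform] s] mat_supp_sform] by auto
    then show ?thesis by (simp add: eq)
  qed
  have b: "?b \<longleftrightarrow> (\<forall>i<2*m. \<forall>j<2*m. (\<Sum>k<2*m. cnj (g k i) * g k j) = (if i = j then 1 else 0))" if s: ?s
  proof -
    have "mat_supp (2*m) (2*m) (idn (2*m))" by (auto simp: mat_supp_def idn_def)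
    then have "?b \<longleftrightarrow> (\<forall>i<2*m. \<forall>j<2*m. mm (2*m) (adj g) g i j = idn (2*m) i j)"
      using mat_supp_ext[OF mat_supp_mm[OF mat_supp_adj[OF s] s]] by auto
    also have "\<dots> \<longleftrightarrow> (\<forall>i<2*m. \<forall>j<2*m. (\<Sum>k<2*m. cnj (g k i) * g k j) = (if i = j then 1 else 0))"
      by (simp add: mm_def adj_def idn_def)
    finally show ?thesis .
  qed
  show ?thesis unfolding in_Sp_def using a b by blast
qed

lemma in_Sp_supp: "in_Sp m g \<Longrightarrow> mat_supp (2*m) (2*m) g"
  by (simp add: in_Sp_def)

lemma in_Sp_mm:
  assumes "in_Sp m g" "in_Sp m h"
  shows "in_Sp m (mm (2*m) g h)"
proof -
  let ?N = "2*m"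
  have s: "mat_supp ?N ?N g" "mat_supp ?N ?N h" using assms by (simp_all add: in_Sp_supp)
  have "mm ?N (mm ?N (tr (mm ?N g h)) (sform m)) (mm ?N g h)
      = mm ?N (mm ?N (tr h) (mm ?N (mm ?N (tr g) (sform m)) g)) h"
    by (simp only: tr_mm mm_assoc)
  also have "\<dots> = sform m" using assms by (simp only: in_Sp_iff)
  finally have 1: "mm ?N (mm ?N (tr (mm ?N g h)) (sform m)) (mm ?N g h) = sform m" .
  have "mm ?N (adj (mm ?N g h)) (mm ?N g h) = mm ?N (adj h) (mm ?N (mm ?N (adj g) g) h)"
    by (simp only: adj_mm mm_assoc)
  also have "\<dots> = idn ?N" using assms by (simp only: in_Sp_iff mm_idn_left[OF s(2)])
  finally show ?thesis using 1 mat_supp_mm[OF s] unfolding in_Sp_iff by blast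
qed

text \<open>Closure under adjoints makes Hermitian adjoints of equivariant maps equivariant. As
  \<open>sform\<close> is real, the conjugated symplectic relation may be inserted between
  \<open>g\<close> and \<open>tr g\<close>, where unitarity cancels the outer pairs.\<close>

lemma in_Sp_adj:
  assumes "in_Sp m g"
  shows "in_Sp m (adj g)"
proof -
  let ?N = "2*m" and ?cg = "\<lambda>i j. cnj (g i j)"
  have s: "mat_supp ?N ?N g" using assms by (simp add: in_Sp_supp)
  have right: "mm ?N g (adj g) = idn ?N"
    by (rule mm_left_right_inverse[OF mat_supp_adj[OF s] s]) (use assms in \<open>simp only: in_Sp_iff\<close>)
  have sp: "mm ?N (mm ?N (tr g) (sform m)) g = sform m" using assms by (simp add: in_Sp_iff)
  have cnj_mm: "(\<lambda>i j. cnj (mm ?N A B i j)) = mm ?N (\<lambda>i j. cnj (A i j)) (\<lambda>i j. cnj (B i j))" for A B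
    by (simp add: mm_def)
  have cnj_sform: "(\<lambda>i j. cnj (sform m i j)) = sform m"
    by (intro ext) (simp add: sform_def)
  have cnj_tr: "(\<lambda>i j. cnj (tr g i j)) = adj g" "(\<lambda>i j. cnj (adj g i j)) = tr g"
    by (simp_all add: tr_def adj_def)
  have cs: "mm ?N (mm ?N (adj g) (sform m)) ?cg = sform m"
    using arg_cong[OF sp, of "\<lambda>A i j. cnj (A i j)"] unfolding cnj_mm cnj_sform cnj_tr .
  have cnj_idn: "(\<lambda>i j. cnj (idn ?N i j)) = idn ?N" by (intro ext) (simp add: idn_def)
  have ctr: "mm ?N ?cg (tr g) = idn ?N"
    using arg_cong[OF right, of "\<lambda>A i j. cnj (A i j)"] unfolding cnj_mm cnj_idn cnj_tr .
  have "mm ?N (mm ?N g (sform m)) (tr g) = mm ?N (mm ?N g (mm ?N (mm ?N (adj g) (sform m)) ?cg)) (tr g)"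
    by (simp only: cs)
  also have "\<dots> = mm ?N (mm ?N g (adj g)) (mm ?N (sform m) (mm ?N ?cg (tr g)))"
    by (simp only: mm_assoc)
  also have "\<dots> = sform m"
    by (simp only: right ctr mm_idn_left[OF mat_supp_sform] mm_idn_right[OF mat_supp_sform])
  finally have "mm ?N (mm ?N g (sform m)) (tr g) = sform m" .
  from arg_cong[OF this, of "\<lambda>A i j. cnj (A i j)"]
  have "mm ?N (mm ?N (tr (adj g)) (sform m)) (adj g) = sform m"
    unfolding cnj_mm cnj_sform by (simp add: tr_def adj_def)
  then show ?thesis unfolding in_Sp_iff using mat_supp_adj[OF s] right by simp
qed

section \<open>Exterior powers as alternating functions\<close>

abbreviation Ne :: "nat \<Rightarrow> nat \<Rightarrow> nat" where
  "Ne n d \<equiv> length (subsets d (2*n))"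

text \<open>The alternating tensor with coordinate vector \<open>v\<close>; on tensors the group acts entrywise, which
  avoids minors.\<close>
definition ev :: "nat \<Rightarrow> nat \<Rightarrow> cvec \<Rightarrow> nat list \<Rightarrow> complex" where
  "ev n d v xs = (\<Sum>J<Ne n d. v J * detsub d idm xs (subsets d (2*n) ! J))"

lemma alternating_ev: "alternating d (ev n d v)"
  unfolding ev_def by (intro alternating_sum alternating_mult_left alternating_detsub)

lemma ev_subsets: "I < Ne n d \<Longrightarrow> ev n d v (subsets d (2*n) ! I) = v I"
  by (simp add: ev_def detsub_idm_subsets if_distrib cong: if_cong)

lemma ev_add_scaled: "ev n d (\<lambda>i. u i + c * v i) xs = ev n d u xs + c * ev n d v xs"
  by (simp add: ev_def sum.distrib sum_distrib_left algebra_simps)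

lemma ev_0: "ev n d (\<lambda>i. 0) xs = 0"
  by (simp add: ev_def)

lemma subsets_in_Lst: "I < length (subsets d N) \<Longrightarrow> subsets d N ! I \<in> Lst N d"
  by (simp add: Lst_def nth_subsets)

lemma detsub_expand_Lst:
  assumes "set J \<subseteq> {..<N}" "length J = d"
  shows "detsub d g I J = (\<Sum>ks\<in>Lst N d. (\<Prod>i<d. g (I ! i) (ks ! i)) * detsub d idm ks J)"
proof -
  have "detsub d g I J = detsub d (\<lambda>i j. \<Sum>k<N. g i k * idm k j) I J"
    by (rule detsub_cong)
      (use assms nth_mem[of _ J] in \<open>force simp: idm_def if_distrib subset_iff cong: if_cong\<close>)
  then show ?thesis by (simp add: detsub_mult_aux)
qed

lemma mv_ext_act: "I < Ne n d \<Longrightarrow> mv (Ne n d) (ext_act n d g) v I =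
    (\<Sum>J<Ne n d. detsub d g (subsets d (2*n) ! I) (subsets d (2*n) ! J) * v J)"
  by (simp add: mv_def ext_act_def)

lemma ev_ext_act_det:
  assumes "xs \<in> Lst (2*n) d"
  shows "ev n d (mv (Ne n d) (ext_act n d g) v) xs = (\<Sum>J<Ne n d. detsub d g xs (subsets d (2*n) ! J) * v J)"
proof -
  have "alternating d (\<lambda>xs. \<Sum>J<Ne n d. detsub d g xs (subsets d (2*n) ! J) * v J)"
    by (intro alternating_sum alternating_mult_right alternating_detsub)
  note alternating_expand[OF this assms]
  moreover have "ev n d (mv (Ne n d) (ext_act n d g) v) xs = (\<Sum>I<Ne n d. detsub d idm xs (subsets d (2*n) ! I) *
      (\<Sum>J<Ne n d. detsub d g (subsets d (2*n) ! I) (subsets d (2*n) ! J) * v J))"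
    unfolding ev_def by (intro sum.cong refl, subst mult.commute) (simp add: mv_ext_act)
  ultimately show ?thesis by simp
qed

lemma ev_ext_act:
  assumes "xs \<in> Lst (2*n) d"
  shows "ev n d (mv (Ne n d) (ext_act n d g) v) xs = (\<Sum>ks\<in>Lst (2*n) d. (\<Prod>i<d. g (xs ! i) (ks ! i)) * ev n d v ks)"
proof -
  have "ev n d (mv (Ne n d) (ext_act n d g) v) xs = (\<Sum>J<Ne n d. \<Sum>ks\<in>Lst (2*n) d.
      (\<Prod>i<d. g (xs ! i) (ks ! i)) * (v J * detsub d idm ks (subsets d (2*n) ! J)))"
    unfolding ev_ext_act_det[OF assms]
    by (intro sum.cong refl, subst detsub_expand_Lst[of _ "2*n"])
      (auto simp: nth_subsets sum_distrib_right sum_distrib_left mult_ac)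
  also have "\<dots> = (\<Sum>ks\<in>Lst (2*n) d. (\<Prod>i<d. g (xs ! i) (ks ! i)) * ev n d v ks)"
    unfolding ev_def sum_distrib_left by (rule sum.swap)
  finally show ?thesis .
qed

lemma mat_supp_ext_act: "mat_supp (Ne n d) (Ne n d) (ext_act n d g)"
  by (auto simp: mat_supp_def ext_act_def)

lemma ext_act_mm: "ext_act n d (mm (2*n) g h) = mm (Ne n d) (ext_act n d g) (ext_act n d h)"
proof (rule mat_supp_ext[OF mat_supp_ext_act mat_supp_mm[OF mat_supp_ext_act mat_supp_ext_act]])
  fix i j assume "i < Ne n d" "j < Ne n d"
  then show "ext_act n d (mm (2*n) g h) i j = mm (Ne n d) (ext_act n d g) (ext_act n d h) i j"
    by (simp add: ext_act_def mm_def) (rule cauchy_binet; simp add: nth_subsets)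
qed

lemma detsub_tr: "detsub d (tr g) I J = detsub d g J I"
proof -
  have "detsub d (tr g) I J = (\<Sum>p | p permutes {..<d}. of_int (sign (inv_into UNIV p)) * (\<Prod>i<d. g (J ! i) (I ! inv_into UNIV p i)))"
    unfolding detsub_def
  proof (intro sum.cong refl arg_cong2[where f="(*)"])
    fix p assume "p \<in> {p. p permutes {..<d}}"
    then have p: "p permutes {..<d}" by simp
    then show "of_int (sign p) = (of_int (sign (inv_into UNIV p)) :: complex)"
      by (subst sign_inverse) (auto intro: permutation_permutes[THEN iffD2])
    show "(\<Prod>i<d. tr g (I ! i) (J ! p i)) = (\<Prod>i<d. g (J ! i) (I ! inv_into UNIV p i))"
      using prod.permute[OF permutes_inv[OF p], of "\<lambda>i. tr g (I ! i) (J ! p i)"]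
      by (simp add: o_def tr_def permutes_inverses[OF p])
  qed
  also have "\<dots> = detsub d g J I" unfolding detsub_def
    by (rule sum.reindex_bij_betw[of "inv_into UNIV" _ _ "\<lambda>p. of_int (sign p) * (\<Prod>i<d. g (J ! i) (I ! p i))"])
      (auto intro!: bij_betw_byWitness[where f'="inv_into UNIV"] simp: permutes_inv permutes_inv_inv)
  finally show ?thesis .
qed

lemma detsub_cnj: "detsub d (\<lambda>i j. cnj (g i j)) I J = cnj (detsub d g I J)"
  by (simp add: detsub_def)

lemma ext_act_adj: "ext_act n d (adj g) = adj (ext_act n d g)"
proof -
  have "detsub d (adj g) I J = cnj (detsub d g J I)" for I J
    using detsub_cnj[of d "tr g" I J] by (simp add: detsub_tr) (simp add: tr_def adj_def)
  then show ?thesis by (intro ext) (auto simp: ext_act_def adj_def)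
qed

section \<open>Contraction with the symplectic form on alternating tensors\<close>

lemma swp_Cons: "swp (Suc p) (Suc q) (x # xs) = x # swp p q xs"
  by (simp add: swp_def)

lemma alternating_Cons: "alternating (Suc d) c \<Longrightarrow> alternating d (\<lambda>xs. c (x # xs))"
  unfolding alternating_def
  by (metis Suc_less_eq Suc_inject length_Cons swp_Cons)

lemma remove2_eq_filter:
  assumes "distinct J" "p < length J" "q < length J"
  shows "remove2 J p q = filter (\<lambda>x. x \<noteq> J ! p \<and> x \<noteq> J ! q) J"
proof -
  have "filter P J = map (nth J) (filter (\<lambda>i. P (J ! i)) [0..<length J])" for P
    by (subst (1) map_nth[of J, symmetric], subst filter_map) (simp add: o_def)
  moreover have "filter (\<lambda>i. J ! i \<noteq> J ! p \<and> J ! i \<noteq> J ! q) [0..<length J] = filter (\<lambda>i. i \<noteq> p \<and> i \<noteq> q) [0..<length J]"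
    using assms by (intro filter_cong) (auto simp: nth_eq_iff_index_eq)
  ultimately show ?thesis by (simp add: remove2_def)
qed

text \<open>Moving \<open>J ! p\<close> to the front passes \<open>p\<close> entries; moving
  \<open>J ! q\<close> afterwards passes \<open>q\<close>, since \<open>J ! p\<close> now stands
  before it; exchanging the two front entries costs one more sign. This matches the exponent in
  \<open>ctr_coef\<close>.\<close>

lemma detsub_idm_front2:
  assumes J: "length J = d" "distinct J" and pq: "p < q" "q < d"
  shows "detsub d idm (J ! p # J ! q # remove2 J p q) J = (-1) ^ (p + q + 1)"
proof -
  define us vs ws where "us = take p J" and "vs = take (q - p - 1) (drop (Suc p) J)" and "ws = drop (Suc q) J"
  have J_eq: "J = us @ J ! p # vs @ J ! q # ws"
  proof -
    have "J = us @ J ! p # drop (Suc p) J" unfolding us_def using pq J by (simp add: id_take_nth_drop)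
    moreover have "drop (Suc p) J = vs @ J ! q # ws"
      using id_take_nth_drop[of "q - p - 1" "drop (Suc p) J"] pq J by (simp add: vs_def ws_def)
    ultimately show ?thesis by simp
  qed
  have len: "length us = p" "length vs = q - p - 1" "length ws = d - q - 1"
    using pq J by (auto simp: us_def vs_def ws_def)
  have "distinct (us @ J ! p # vs @ J ! q # ws)" using J(2) J_eq by metis
  moreover have "filter (\<lambda>x. x \<noteq> J ! p \<and> x \<noteq> J ! q) zs = zs" if "J ! p \<notin> set zs" "J ! q \<notin> set zs" for zs
    using that by (intro filter_True) auto
  ultimately have "filter (\<lambda>x. x \<noteq> J ! p \<and> x \<noteq> J ! q) (us @ J ! p # vs @ J ! q # ws) = us @ vs @ ws"
    by simp
  then have rem: "remove2 J p q = us @ vs @ ws"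
    using remove2_eq_filter[of J p q] J pq J_eq by auto
  let ?c = "\<lambda>xs. detsub d idm xs J"
  have "1 = ?c J" using J by (simp add: detsub_idm_self)
  also have "\<dots> = ?c (us @ J ! p # vs @ J ! q # ws)" using J_eq by metis
  also have "\<dots> = (-1) ^ p * ?c (J ! p # us @ vs @ J ! q # ws)"
    using alternating_move_front[OF alternating_detsub[of d idm J], of us "vs @ J ! q # ws" "J ! p"] len pq
    by simp
  also have "?c (J ! p # us @ vs @ J ! q # ws) = (-1) ^ q * ?c (J ! q # J ! p # us @ vs @ ws)"
    using alternating_move_front[OF alternating_detsub[of d idm J], of "J ! p # us @ vs" ws "J ! q"] len pq
    by simp
  also have "?c (J ! q # J ! p # us @ vs @ ws) = - ?c (J ! p # J ! q # us @ vs @ ws)"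
    using alternating_adjacent[OF alternating_detsub[of d idm J], of "[]" "us @ vs @ ws" "J ! q" "J ! p"] len pq
    by simp
  finally have "(1::complex) = (-1) ^ (p + q + 1) * ?c (J ! p # J ! q # us @ vs @ ws)"
    by (simp add: power_add mult.assoc)
  then have "(-1) ^ (p + q + 1) * (1::complex) = (-1) ^ (p + q + 1) * ((-1) ^ (p + q + 1) * ?c (J ! p # J ! q # us @ vs @ ws))"
    by simp
  also have "\<dots> = ?c (J ! p # J ! q # us @ vs @ ws)"
    by (simp add: mult.assoc[symmetric] flip: power_add)
  finally show ?thesis by (simp add: rem)
qed

lemma detsub_idm_not_distinct: "length I = d \<Longrightarrow> \<not> distinct I \<Longrightarrow> detsub d idm I J = 0"
  using alternating_not_distinct[OF alternating_detsub] by blast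

lemma detsub_idm_Cons2:
  assumes J: "length J = d" "sorted J" "distinct J" and I: "length I + 2 = d" "sorted I" "distinct I"
    and xy: "x < y"
  shows "detsub d idm (x # y # I) J = (\<Sum>p<d. \<Sum>q<d.
     if p < q \<and> J ! p = x \<and> J ! q = y \<and> remove2 J p q = I then (-1) ^ (p + q + 1) else 0)"
proof (cases "\<exists>p q. p < d \<and> q < d \<and> J ! p = x \<and> J ! q = y")
  case True
  then obtain p q where pq: "p < d" "q < d" "J ! p = x" "J ! q = y" by blast
  have "p < q"
    using J pq xy by (metis linorder_not_less sorted_nth_mono)
  have uniq: "(p' < q' \<and> J ! p' = x \<and> J ! q' = y \<and> remove2 J p' q' = I) \<longleftrightarrow> (p' = p \<and> q' = q \<and> remove2 J p q = I)"
    if "p' < d" "q' < d" for p' q'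
    using that pq J \<open>p < q\<close> by (auto simp: nth_eq_iff_index_eq)
  have "(\<Sum>p'<d. \<Sum>q'<d. if p' < q' \<and> J ! p' = x \<and> J ! q' = y \<and> remove2 J p' q' = I then (-1) ^ (p' + q' + 1) else 0)
      = (\<Sum>p'<d. \<Sum>q'<d. if p' = p \<and> q' = q \<and> remove2 J p q = I then (-1) ^ (p + q + 1) else (0::complex))"
    by (intro sum.cong refl) (simp only: uniq lessThan_iff, auto)
  also have "\<dots> = (\<Sum>p'<d. if p' = p then (if remove2 J p q = I then (-1) ^ (p + q + 1) else (0::complex)) else 0)"
    using pq by (intro sum.cong refl) (auto simp: sum.delta)
  also have "\<dots> = (if remove2 J p q = I then (-1) ^ (p + q + 1) else 0)" using pq by simp
  also have "\<dots> = detsub d idm (x # y # I) J"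
  proof (cases "remove2 J p q = I")
    case True
    then show ?thesis using detsub_idm_front2[OF J(1,3) \<open>p < q\<close> pq(2)] pq by simp
  next
    case False
    have "detsub d idm (x # y # I) J = 0"
    proof (cases "distinct (x # y # I)")
      case True
      have "set (x # y # I) \<noteq> set J"
      proof
        assume "set (x # y # I) = set J"
        then have "set I = set (remove2 J p q)"
          using True pq J by (auto simp: remove2_eq_filter)
        moreover have "sorted (remove2 J p q)" "distinct (remove2 J p q)"
          using pq J by (auto simp: remove2_eq_filter sorted_filter[of id, simplified] sorted_wrt_filter)
        ultimately show False using I False sorted_distinct_set_unique by metis
      qed
      then show ?thesis using I J True by (intro detsub_idm_eq_0) auto
    qed (use I in \<open>auto intro!: detsub_idm_not_distinct\<close>)
    then show ?thesis using False by simp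
  qed
  finally show ?thesis by simp
next
  case False
  then have ne: "set (x # y # I) \<noteq> set J" using J(1) by (auto simp: in_set_conv_nth set_eq_iff) metis
  have "detsub d idm (x # y # I) J = 0"
  proof (cases "distinct (x # y # I)")
    case True
    then show ?thesis using I J ne by (intro detsub_idm_eq_0) auto
  qed (use I in \<open>auto intro!: detsub_idm_not_distinct\<close>)
  moreover have "(\<Sum>p<d. \<Sum>q<d. if p < q \<and> J ! p = x \<and> J ! q = y \<and> remove2 J p q = I then (-1) ^ (p + q + 1) else (0::complex)) = 0"
    using False by (intro sum.neutral ballI) auto
  ultimately show ?thesis by simp
qed

text \<open>Turns deletion of two positions of \<open>J\<close> into insertion of a pair
  \<open>e_k, f_k\<close> in front of \<open>I\<close>, so that primitivity can be stated through
  alternating tensors.\<close>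

lemma ctr_coef_eq:
  assumes J: "length J = d" "sorted J" "distinct J" "set J \<subseteq> {..<2*n}" and I: "length I + 2 = d" "sorted I" "distinct I"
  shows "ctr_coef n J I = (\<Sum>k<n. detsub d idm (k # (n + k) # I) J)"
proof -
  have "(\<Sum>k<n. detsub d idm (k # (n + k) # I) J) = (\<Sum>k<n. \<Sum>p<d. \<Sum>q<d.
     if p < q \<and> J ! p = k \<and> J ! q = n + k \<and> remove2 J p q = I then (-1) ^ (p + q + 1) else 0)"
    by (intro sum.cong refl detsub_idm_Cons2[OF J(1-3) I]) auto
  also have "\<dots> = (\<Sum>p<d. \<Sum>q<d. \<Sum>k<n.
     if p < q \<and> J ! p = k \<and> J ! q = n + k \<and> remove2 J p q = I then (-1) ^ (p + q + 1) else 0)"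
    by (subst sum.swap) (intro sum.cong refl sum.swap)
  also have "\<dots> = (\<Sum>p<d. \<Sum>q<d.
     if p < q \<and> remove2 J p q = I then (-1) ^ (p + q + 1) * sform n (J ! p) (J ! q) else 0)"
  proof (intro sum.cong refl)
    fix p q assume pq: "p \<in> {..<d}" "q \<in> {..<d}"
    show "(\<Sum>k<n. if p < q \<and> J ! p = k \<and> J ! q = n + k \<and> remove2 J p q = I then (-1) ^ (p + q + 1) else 0) =
      (if p < q \<and> remove2 J p q = I then (-1) ^ (p + q + 1) * sform n (J ! p) (J ! q) else 0)"
    proof (cases "p < q \<and> remove2 J p q = I")
      case True
      \<comment> \<open>\<open>J\<close> is increasing, so among the two signs of
        \<open>sform\<close> only the positive one can occur.\<close>
      have lt: "J ! p < J ! q" using J pq True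
        by (metis sorted_nth_mono distinct_conv_nth le_neq_implies_less lessThan_iff less_imp_le_nat nat_neq_iff)
      have "(\<Sum>k<n. if p < q \<and> J ! p = k \<and> J ! q = n + k \<and> remove2 J p q = I then (-1) ^ (p + q + 1) else 0) =
        (\<Sum>k<n. if k = J ! p then (if J ! q = n + J ! p then (-1) ^ (p + q + 1) else 0) else (0::complex))"
        using True by (intro sum.cong) auto
      also have "\<dots> = (if J ! p < n \<and> J ! q = n + J ! p then (-1) ^ (p + q + 1) else 0)" by simp
      also have "\<dots> = (-1) ^ (p + q + 1) * sform n (J ! p) (J ! q)"
        using lt by (auto simp: sform_def)
      finally show ?thesis using True by simp
    qed (auto intro!: sum.neutral)
  qed
  finally show ?thesis by (simp add: ctr_coef_def J(1))
qed

lemma ctr_ev: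
  assumes "I \<in> set (subsets (d - 2) (2*n))" "2 \<le> d"
  shows "(\<Sum>j<Ne n d. v j * ctr_coef n (subsets d (2*n) ! j) I) = (\<Sum>k<n. ev n d v (k # (n + k) # I))"
proof -
  have "(\<Sum>j<Ne n d. v j * ctr_coef n (subsets d (2*n) ! j) I)
      = (\<Sum>j<Ne n d. \<Sum>k<n. v j * detsub d idm (k # (n + k) # I) (subsets d (2*n) ! j))"
    using assms by (intro sum.cong refl, subst ctr_coef_eq) (auto simp: nth_subsets mem_subsets sum_distrib_left)
  also have "\<dots> = (\<Sum>k<n. ev n d v (k # (n + k) # I))" unfolding ev_def by (rule sum.swap)
  finally show ?thesis .
qed

text \<open>For \<open>d < 2\<close> the truncated \<open>d - 2\<close> is \<open>0\<close>, so
  \<open>prim_ext\<close> formally still imposes a condition for \<open>[]\<close>; without a pair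
  of positions that condition is void.\<close>

lemma ctr_coef_short: "length J < 2 \<Longrightarrow> ctr_coef n J I = 0"
  unfolding ctr_coef_def by (intro sum.neutral ballI) auto

text \<open>The condition extends from increasing lists to all lists, since the contraction of an
  alternating tensor alternates in the remaining entries.\<close>

lemma prim_ext_iff: "v \<in> prim_ext n d \<longleftrightarrow> v \<in> vecs (Ne n d) \<and>
   (2 \<le> d \<longrightarrow> (\<forall>ys\<in>Lst (2*n) (d - 2). (\<Sum>k<n. ev n d v (k # (n + k) # ys)) = 0))"
proof (cases "2 \<le> d")
  case True
  then obtain e where e: "d = Suc (Suc e)" by (metis One_nat_def Suc_1 Suc_le_D Suc_le_mono)
  have alt: "alternating e (\<lambda>ys. \<Sum>k<n. ev n d v (k # (n + k) # ys))"
    using alternating_ev[of d n v] unfolding e by (intro alternating_sum alternating_Cons)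
  have "(\<forall>I\<in>set (subsets e (2*n)). (\<Sum>k<n. ev n d v (k # (n + k) # I)) = 0)
      \<longleftrightarrow> (\<forall>ys\<in>Lst (2*n) e. (\<Sum>k<n. ev n d v (k # (n + k) # ys)) = 0)"
  proof (intro iffI ballI)
    fix ys assume "\<forall>I\<in>set (subsets e (2*n)). (\<Sum>k<n. ev n d v (k # (n + k) # I)) = 0" "ys \<in> Lst (2*n) e"
    then show "(\<Sum>k<n. ev n d v (k # (n + k) # ys)) = 0"
      by (intro alternating_eq_0[OF alt]) auto
  qed (auto simp: mem_subsets Lst_def)
  then show ?thesis using True e ctr_ev[of _ d n v] by (auto simp: prim_ext_def)
next
  case False
  then show ?thesis by (auto simp: prim_ext_def nth_subsets ctr_coef_short)
qed

lemma csub_prim_ext: "csub (prim_ext n d)"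
  unfolding csub_def
  by (auto simp: prim_ext_iff vecs_def ev_0 ev_add_scaled sum.distrib simp flip: sum_distrib_left)

lemma prim_ext_vecs: "prim_ext n d \<subseteq> vecs (Ne n d)"
  by (auto simp: prim_ext_def)

lemma sum_Lst_Suc: "(\<Sum>ks\<in>Lst N (Suc d). F ks) = (\<Sum>k<N. \<Sum>ks\<in>Lst N d. (F (k # ks) :: complex))"
proof -
  have L: "Lst N (Suc d) = (\<lambda>(k, ks). k # ks) ` ({..<N} \<times> Lst N d)"
    by (auto simp: Lst_def image_iff length_Suc_conv)
  show ?thesis unfolding L
    by (subst sum.reindex) (auto simp: inj_on_def sum.cartesian_product case_prod_beta intro!: sum.cong)
qed

lemma sum_lessThan_add: "(\<Sum>k<m + n. G k) = (\<Sum>k<m. G k) + (\<Sum>k<n. G (m + k) :: complex)"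
  for m n :: nat
  by (induction n) (simp_all add: add.assoc)

lemma sum_sform:
  fixes F :: "nat \<Rightarrow> nat \<Rightarrow> complex"
  shows "(\<Sum>k<2*n. \<Sum>l<2*n. sform n k l * F k l) = (\<Sum>k<n. F k (n + k)) - (\<Sum>k<n. F (n + k) k)"
proof -
  have split: "(\<Sum>k<2*n. G k) = (\<Sum>k<n. G k) + (\<Sum>k<n. G (n + k))" for G :: "nat \<Rightarrow> complex"
    using sum_lessThan_add[of G n n] by (simp add: mult_2)
  have "(\<Sum>l<2*n. sform n k l * F k l) = F k (n + k)" if "k < n" for k
  proof -
    have "(\<Sum>l<2*n. sform n k l * F k l) = (\<Sum>l<2*n. if l = n + k then F k l else 0)"
      using that by (intro sum.cong) (auto simp: sform_def)
    then show ?thesis using that by simp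
  qed
  moreover have "(\<Sum>l<2*n. sform n (n + k) l * F (n + k) l) = - F (n + k) k" if "k < n" for k
  proof -
    have "(\<Sum>l<2*n. sform n (n + k) l * F (n + k) l) = (\<Sum>l<2*n. if l = k then - F (n + k) l else 0)"
      using that by (intro sum.cong) (auto simp: sform_def)
    then show ?thesis using that by simp
  qed
  ultimately show ?thesis by (subst split) (simp add: sum_negf)
qed

lemma in_Sp_sum_sform:
  assumes "in_Sp n g" "u < 2*n" "v < 2*n"
  shows "(\<Sum>k<2*n. \<Sum>l<2*n. sform n k l * (g k u * g l v)) = sform n u v"
  using assms unfolding in_Sp_def by (simp add: mult_ac)

text \<open>For alternating tensors the primitivity sum is half of the contraction of the first two
  slots with the full form \<open>sform\<close>. Since the group acts entrywise on tensors, the two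
  matrices applied to these slots are absorbed by \<open>sform\<close>.\<close>

lemma prim_ext_ext_act:
  assumes g: "in_Sp n g" and v: "v \<in> prim_ext n d"
  shows "mv (Ne n d) (ext_act n d g) v \<in> prim_ext n d"
  unfolding prim_ext_iff
proof (intro conjI impI ballI)
  show "mv (Ne n d) (ext_act n d g) v \<in> vecs (Ne n d)" by (rule mv_in_vecs[OF mat_supp_ext_act])
  fix ys assume "2 \<le> d" and "ys \<in> Lst (2*n) (d - 2)"
  then obtain e where d: "d = Suc (Suc e)" and ys: "ys \<in> Lst (2*n) e"
    by (metis One_nat_def Suc_1 Suc_le_D Suc_le_mono diff_Suc_Suc diff_zero)
  define c where "c = ev n d v"
  define c' where "c' = ev n d (mv (Ne n d) (ext_act n d g) v)"
  have skew_ev: "ev n d w (x # y # zs) = - ev n d w (y # x # zs)" if "zs \<in> Lst (2*n) e" for w x y zs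
    using alternating_adjacent[OF alternating_ev[of d n w], of "[]" zs x y] that d by (simp add: Lst_def)
  have two: "(\<Sum>k<2*n. \<Sum>l<2*n. sform n k l * ev n d w (k # l # zs)) = 2 * (\<Sum>k<n. ev n d w (k # (n + k) # zs))"
    if "zs \<in> Lst (2*n) e" for w zs
  proof -
    have "(\<Sum>k<n. ev n d w ((n + k) # k # zs)) = - (\<Sum>k<n. ev n d w (k # (n + k) # zs))"
      unfolding sum_negf[symmetric] by (intro sum.cong refl skew_ev that)
    then show ?thesis by (simp add: sum_sform)
  qed
  have expand: "c' (k # l # ys) = (\<Sum>u<2*n. \<Sum>w<2*n. \<Sum>ks\<in>Lst (2*n) e.
      (g k u * g l w) * ((\<Prod>i<e. g (ys ! i) (ks ! i)) * c (u # w # ks)))" if "k < 2*n" "l < 2*n" for k l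
  proof -
    have "k # l # ys \<in> Lst (2*n) d" using that ys d by (auto simp: Lst_def)
    then show ?thesis unfolding c'_def c_def
      by (subst ev_ext_act) (simp_all add: d sum_Lst_Suc prod.lessThan_Suc_shift mult_ac del: prod.lessThan_Suc)
  qed
  have "(\<Sum>k<2*n. \<Sum>l<2*n. sform n k l * c' (k # l # ys)) =
     (\<Sum>k<2*n. \<Sum>l<2*n. \<Sum>u<2*n. \<Sum>w<2*n. \<Sum>ks\<in>Lst (2*n) e. 
      sform n k l * (g k u * g l w) * ((\<Prod>i<e. g (ys ! i) (ks ! i)) * c (u # w # ks)))"
    by (intro sum.cong refl) (simp add: expand sum_distrib_left mult.assoc)
  \<comment> \<open>The next exchanges bring the sums over \<open>k\<close> and \<open>l\<close>
    inside, where the symplectic relation replaces them by \<open>sform n u w\<close>.\<close>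
  also have "\<dots> = (\<Sum>k<2*n. \<Sum>u<2*n. \<Sum>l<2*n. \<Sum>w<2*n. \<Sum>ks\<in>Lst (2*n) e. 
      sform n k l * (g k u * g l w) * ((\<Prod>i<e. g (ys ! i) (ks ! i)) * c (u # w # ks)))"
    by (intro sum.cong refl sum.swap)
  also have "\<dots> = (\<Sum>u<2*n. \<Sum>k<2*n. \<Sum>w<2*n. \<Sum>l<2*n. \<Sum>ks\<in>Lst (2*n) e. 
      sform n k l * (g k u * g l w) * ((\<Prod>i<e. g (ys ! i) (ks ! i)) * c (u # w # ks)))"
    by (subst sum.swap) (intro sum.cong refl sum.swap)
  also have "\<dots> = (\<Sum>u<2*n. \<Sum>w<2*n. \<Sum>k<2*n. \<Sum>l<2*n. \<Sum>ks\<in>Lst (2*n) e. 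
      sform n k l * (g k u * g l w) * ((\<Prod>i<e. g (ys ! i) (ks ! i)) * c (u # w # ks)))"
    by (intro sum.cong refl sum.swap)
  also have "\<dots> = (\<Sum>u<2*n. \<Sum>w<2*n. (\<Sum>k<2*n. \<Sum>l<2*n. sform n k l * (g k u * g l w)) *
      (\<Sum>ks\<in>Lst (2*n) e. (\<Prod>i<e. g (ys ! i) (ks ! i)) * c (u # w # ks)))"
    unfolding sum_distrib_right unfolding sum_distrib_left ..
  also have "\<dots> = (\<Sum>u<2*n. \<Sum>w<2*n. \<Sum>ks\<in>Lst (2*n) e. (\<Prod>i<e. g (ys ! i) (ks ! i)) * (sform n u w * c (u # w # ks)))"
    by (intro sum.cong refl, subst in_Sp_sum_sform[OF g])
      (simp_all add: sum_distrib_left mult.left_commute)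
  also have "\<dots> = (\<Sum>u<2*n. \<Sum>ks\<in>Lst (2*n) e. \<Sum>w<2*n. (\<Prod>i<e. g (ys ! i) (ks ! i)) * (sform n u w * c (u # w # ks)))"
    by (intro sum.cong refl sum.swap)
  also have "\<dots> = (\<Sum>ks\<in>Lst (2*n) e. (\<Prod>i<e. g (ys ! i) (ks ! i)) * (\<Sum>u<2*n. \<Sum>w<2*n. sform n u w * c (u # w # ks)))"
    by (subst sum.swap) (simp add: sum_distrib_left)
  also have "\<dots> = 0"
  proof (intro sum.neutral ballI)
    fix ks assume ks: "ks \<in> Lst (2*n) e"
    then have "(\<Sum>k<n. c (k # (n + k) # ks)) = 0" using v d unfolding c_def prim_ext_iff by simp
    then show "(\<Prod>i<e. g (ys ! i) (ks ! i)) * (\<Sum>u<2*n. \<Sum>w<2*n. sform n u w * c (u # w # ks)) = 0"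
      using two[OF ks, of v] unfolding c_def by simp
  qed
  finally show "(\<Sum>k<n. ev n d (mv (Ne n d) (ext_act n d g) v) (k # (n + k) # ys)) = 0"
    unfolding c'_def two[OF ys] by simp
qed

section \<open>One-parameter subgroups and infinitesimal equivariance\<close>

definition partner :: "nat \<Rightarrow> nat \<Rightarrow> nat" where
  "partner m j = (if j < m then j + m else j - m)"

definition psgn :: "nat \<Rightarrow> nat \<Rightarrow> complex" where
  "psgn m j = (if j < m then 1 else -1)"

text \<open>A unitary matrix is symplectic exactly when it commutes with the quaternionic structure,
  the conjugate-linear map pairing \<open>j\<close> with \<open>partner m j\<close> up to the sign
  \<open>psgn m j\<close>. Entrywise this is \<open>quat\<close>, which is easier to check on
  monomial curves than the bilinear relation.\<close>

lemma in_Sp_quaternionic: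
  assumes supp: "mat_supp (2*m) (2*m) g"
    and uni: "\<And>i j. i < 2*m \<Longrightarrow> j < 2*m \<Longrightarrow> (\<Sum>k<2*m. cnj (g k i) * g k j) = (if i = j then 1 else 0)"
    and quat: "\<And>k l. k < 2*m \<Longrightarrow> l < 2*m \<Longrightarrow> g (partner m k) (partner m l) * (psgn m k * psgn m l) = cnj (g k l)"
  shows "in_Sp m g"
  unfolding in_Sp_def
proof (intro conjI allI impI supp uni)
  fix i j assume ij: "i < 2*m" "j < 2*m"
  let ?j = "partner m j"
  have pj: "?j < 2*m" "partner m ?j = j" "psgn m ?j * psgn m ?j = 1" using ij by (auto simp: partner_def psgn_def)
  have inner: "(\<Sum>l<2*m. g k i * sform m k l * g l j) = cnj (cnj (g k i) * g k ?j) * psgn m ?j"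
    if k: "k < 2*m" for k
  proof -
    have pk: "partner m k < 2*m" "psgn m k * psgn m k = 1" using k by (auto simp: partner_def psgn_def)
    have "(\<Sum>l<2*m. g k i * sform m k l * g l j) = (\<Sum>l<2*m. if l = partner m k then g k i * psgn m k * g l j else 0)"
      using k by (intro sum.cong) (auto simp: sform_def partner_def psgn_def)
    also have "\<dots> = g k i * psgn m k * g (partner m k) j" using pk by simp
    also have "g (partner m k) j = cnj (g k ?j) * (psgn m k * psgn m ?j)"
      using quat[OF k pj(1)] pk pj by (simp add: mult_ac) (metis (no_types, opaque_lifting) mult.assoc mult.commute mult.right_neutral)
    finally show ?thesis using pk(2) by (simp add: mult_ac)
  qed
  have "(\<Sum>k<2*m. \<Sum>l<2*m. g k i * sform m k l * g l j) = (\<Sum>k<2*m. cnj (cnj (g k i) * g k ?j) * psgn m ?j)"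
    by (intro sum.cong refl inner) simp
  also have "\<dots> = cnj (\<Sum>k<2*m. cnj (g k i) * g k ?j) * psgn m ?j"
    by (simp add: sum_distrib_right)
  also have "\<dots> = (if i = ?j then 1 else 0) * psgn m ?j" using uni[OF ij(1) pj(1)] by simp
  also have "\<dots> = sform m i j" using ij by (auto simp: sform_def partner_def psgn_def)
  finally show "(\<Sum>k<2*m. \<Sum>l<2*m. g k i * sform m k l * g l j) = sform m i j" .
qed

text \<open>The one-parameter group generated by the monomial matrix \<open>e\<^sub>j \<mapsto> \<alpha>\<^sub>j e\<^bsub>\<tau>(j)\<^esub>\<close>, whose square is minus
  the projection onto the span of the \<open>e\<^sub>j\<close> with \<open>\<alpha>\<^sub>j \<noteq> 0\<close>.\<close>
definition mcurve :: "nat \<Rightarrow> (nat \<Rightarrow> nat) \<Rightarrow> cvec \<Rightarrow> complex \<Rightarrow> cmat" where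
  "mcurve m \<tau> \<alpha> t = (\<lambda>k j. if k < 2*m \<and> j < 2*m then
     (if k = j then if \<alpha> j = 0 then 1 else cos t else 0) + (if k = \<tau> j then sin t * \<alpha> j else 0) else 0)"

definition mgen :: "(nat \<Rightarrow> nat) \<Rightarrow> cvec \<Rightarrow> cmat" where
  "mgen \<tau> \<alpha> = (\<lambda>k j. if k = \<tau> j then \<alpha> j else 0)"

text \<open>In order: \<open>\<tau>\<close> is an involution, nonzero coefficients have modulus one,
  the generator is skew-Hermitian, and it commutes with the quaternionic structure. The first three
  make its square minus a coordinate projection, hence its exponential has the closed form
  \<open>mcurve\<close>.\<close>

definition good_gen :: "nat \<Rightarrow> (nat \<Rightarrow> nat) \<Rightarrow> cvec \<Rightarrow> bool" where
  "good_gen m \<tau> \<alpha> \<longleftrightarrow> (\<forall>j<2*m. \<tau> j < 2*m \<and> \<tau> (\<tau> j) = j \<and> (\<alpha> j \<noteq> 0 \<longrightarrow> cnj (\<alpha> j) * \<alpha> j = 1)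
     \<and> cnj (\<alpha> j) = - \<alpha> (\<tau> j) \<and> \<tau> (partner m j) = partner m (\<tau> j)
     \<and> \<alpha> (partner m j) * (psgn m (\<tau> j) * psgn m j) = cnj (\<alpha> j))"

lemma mcurve_in_Sp:
  assumes "good_gen m \<tau> \<alpha>"
  shows "in_Sp m (mcurve m \<tau> \<alpha> (of_real t))"
proof (rule in_Sp_quaternionic)
  let ?g = "mcurve m \<tau> \<alpha> (of_real t)"
  define d where "d j = (if \<alpha> j = 0 then 1 else complex_of_real (cos t))" for j
  define s where "s = complex_of_real (sin t)"
  have cs: "complex_of_real (cos t) * of_real (cos t) + s * s = 1"
    unfolding s_def by (metis of_real_1 of_real_add of_real_mult power2_eq_square sin_cos_squared_add2)
  have real: "cnj (d j) = d j" "cnj s = s" for j by (auto simp: d_def s_def)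
  have g: "?g k j = (if k = j then d j else 0) + (if k = \<tau> j then s * \<alpha> j else 0)" if "k < 2*m" "j < 2*m" for k j
    using that by (simp add: mcurve_def d_def s_def cos_of_real sin_of_real)
  show "mat_supp (2*m) (2*m) ?g" by (auto simp: mat_supp_def mcurve_def)
  fix i j assume ij: "i < 2*m" "j < 2*m"
  note G = assms[unfolded good_gen_def, rule_format]
  have ti: "\<tau> i < 2*m" "\<tau> j < 2*m" "\<tau> (\<tau> i) = i" "\<tau> (\<tau> j) = j" using G ij by auto
  have "(\<Sum>k<2*m. cnj (?g k i) * ?g k j) = (\<Sum>k<2*m. (if k = i then d i * (if i = j then d j else 0) else 0)
      + (if k = i then d i * (if i = \<tau> j then s * \<alpha> j else 0) else 0)
      + (if k = \<tau> i then s * cnj (\<alpha> i) * (if \<tau> i = j then d j else 0) else 0)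
      + (if k = \<tau> i then s * cnj (\<alpha> i) * (if \<tau> i = \<tau> j then s * \<alpha> j else 0) else 0))"
    using ij by (intro sum.cong refl) (auto simp: g real algebra_simps)
  also have "\<dots> = d i * (if i = j then d j else 0) + d i * (if i = \<tau> j then s * \<alpha> j else 0)
      + s * cnj (\<alpha> i) * (if \<tau> i = j then d j else 0) + s * cnj (\<alpha> i) * (if \<tau> i = \<tau> j then s * \<alpha> j else 0)"
    using ij ti by (simp add: sum.distrib)
  \<comment> \<open>The terms linear in \<open>s\<close> cancel because the generator is
    skew-Hermitian.\<close>
  also have "d i * (if i = \<tau> j then s * \<alpha> j else 0) + s * cnj (\<alpha> i) * (if \<tau> i = j then d j else 0) = 0"
  proof (cases "i = \<tau> j")
    case True
    then have "cnj (\<alpha> i) = - \<alpha> j" "cnj (\<alpha> j) = - \<alpha> i" using G ij ti by auto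
    then have "d i = d j" by (auto simp: d_def)
    then show ?thesis using True ti \<open>cnj (\<alpha> i) = - \<alpha> j\<close> by simp
  qed (use ti in auto)
  then have "d i * (if i = j then d j else 0) + d i * (if i = \<tau> j then s * \<alpha> j else 0)
      + s * cnj (\<alpha> i) * (if \<tau> i = j then d j else 0) + s * cnj (\<alpha> i) * (if \<tau> i = \<tau> j then s * \<alpha> j else 0)
      = d i * (if i = j then d j else 0) + s * cnj (\<alpha> i) * (if \<tau> i = \<tau> j then s * \<alpha> j else 0)"
    by (simp add: add.assoc)
  also have "\<dots> = (if i = j then 1 else 0)"
  proof (cases "i = j")
    case True
    have "d i * d i + s * cnj (\<alpha> i) * (s * \<alpha> i) = 1"
    proof (cases "\<alpha> i = 0")
      case False
      then have "cnj (\<alpha> i) * \<alpha> i = 1" using G ij by blast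
      then have eq: "s * cnj (\<alpha> i) * (s * \<alpha> i) = s * s"
        by (metis (no_types, lifting) mult.assoc mult.commute mult.right_neutral)
      have "d i = of_real (cos t)" using False by (simp add: d_def)
      then show ?thesis unfolding eq using cs by simp
    qed (simp add: d_def)
    then show ?thesis using True by simp
  next
    case False
    then have "\<tau> i \<noteq> \<tau> j" using ti by metis
    then show ?thesis using False by simp
  qed
  finally show "(\<Sum>k<2*m. cnj (?g k i) * ?g k j) = (if i = j then 1 else 0)" .
next
  let ?g = "mcurve m \<tau> \<alpha> (of_real t)"
  fix k l assume kl: "k < 2*m" "l < 2*m"
  note G = assms[unfolded good_gen_def, rule_format]
  have p: "partner m k < 2*m" "partner m l < 2*m" "partner m (\<tau> l) < 2*m" "\<tau> l < 2*m"
    using kl G[OF kl(2)] by (auto simp: partner_def)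
  have inj: "partner m x = partner m y \<longleftrightarrow> x = y" if "x < 2*m" "y < 2*m" for x y
    using that by (auto simp: partner_def split: if_splits)
  have Gl: "\<alpha> (partner m l) * (psgn m (\<tau> l) * psgn m l) = cnj (\<alpha> l)" "\<tau> (partner m l) = partner m (\<tau> l)"
    using G[OF kl(2)] by auto
  have z: "\<alpha> (partner m l) = 0 \<longleftrightarrow> \<alpha> l = 0"
    using Gl(1) by (auto simp: psgn_def split: if_splits)
  show "?g (partner m k) (partner m l) * (psgn m k * psgn m l) = cnj (?g k l)"
  proof -
    let ?a = "if k = l then if \<alpha> l = 0 then 1 else complex_of_real (cos t) else 0"
    let ?b = "if k = \<tau> l then complex_of_real (sin t) else 0"
    have "?g (partner m k) (partner m l) = ?a + ?b * \<alpha> (partner m l)"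
      using p by (simp add: mcurve_def cos_of_real sin_of_real z Gl(2) inj[OF kl] inj[OF kl(1) p(4)])
    moreover have "?a * (psgn m k * psgn m l) = ?a" by (simp add: psgn_def)
    moreover have "?b * \<alpha> (partner m l) * (psgn m k * psgn m l) = ?b * cnj (\<alpha> l)"
      unfolding Gl(1)[symmetric] by simp
    moreover have "cnj (?g k l) = ?a + ?b * cnj (\<alpha> l)"
      using kl by (simp add: mcurve_def cos_of_real sin_of_real)
    ultimately show ?thesis by (simp only: distrib_right)
  qed
qed

lemma mcurve_0: "i < 2*m \<Longrightarrow> j < 2*m \<Longrightarrow> mcurve m \<tau> \<alpha> 0 i j = (if i = j then 1 else 0)"
  by (simp add: mcurve_def)

lemma mcurve_deriv:
  assumes "i < 2*m" "j < 2*m"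
  shows "((\<lambda>t. mcurve m \<tau> \<alpha> t i j) has_field_derivative mgen \<tau> \<alpha> i j) (at 0)"
proof -
  have "((\<lambda>t. (if i = j then if \<alpha> j = 0 then 1 else cos t else 0) + (if i = \<tau> j then sin t * \<alpha> j else 0))
     has_field_derivative mgen \<tau> \<alpha> i j) (at 0)"
    by (cases "i = j"; cases "\<alpha> j = 0"; cases "i = \<tau> j")
      (auto simp: mgen_def intro!: derivative_eq_intros)
  then show ?thesis using assms by (simp add: mcurve_def)
qed

text \<open>\<open>mcurve\<close> is entire in \<open>t\<close>, but membership in the compact group
  is available for real \<open>t\<close>; vanishing along the reals \<open>1 / (k + 1)\<close>
  already determines the complex derivative.\<close>

lemma deriv_zero_on_reals:
  fixes F :: "complex \<Rightarrow> complex"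
  assumes "(F has_field_derivative D) (at 0)" "\<And>x :: real. F (of_real x) = 0"
  shows "D = 0"
proof -
  have "(\<lambda>h. (F (0 + h) - F 0) / h) \<midarrow>0\<rightarrow> D" using assms(1) by (simp add: DERIV_def)
  moreover have "(\<lambda>k. complex_of_real (1 / real (Suc k))) \<longlonglongrightarrow> of_real 0"
    by (intro tendsto_of_real LIMSEQ_Suc lim_1_over_n)
  ultimately have "(\<lambda>k. (F (0 + of_real (1 / real (Suc k))) - F 0) / of_real (1 / real (Suc k))) \<longlonglongrightarrow> D"
    by (intro LIMSEQ_SEQ_conv[THEN iffD2, rule_format, of "\<lambda>h. (F (0 + h) - F 0) / h" D 0])
      (simp_all del: of_real_divide of_nat_Suc)
  moreover have "F 0 = 0" using assms(2)[of 0] by simp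
  ultimately have "(\<lambda>k. 0 :: complex) \<longlonglongrightarrow> D"
    by (simp only: add_0 assms(2) diff_self div_0)
  then show ?thesis by (simp add: LIMSEQ_const_iff)
qed

text \<open>The value at \<open>0\<close> is recorded with the derivative since the product rule for
  Kronecker products needs both.\<close>

definition rep_deriv :: "rep \<Rightarrow> (complex \<Rightarrow> cmat) \<Rightarrow> (complex \<Rightarrow> cmat) \<Rightarrow> cmat \<Rightarrow> bool" where
  "rep_deriv R \<gamma>1 \<gamma>2 D \<longleftrightarrow> (\<forall>i<rdim R. \<forall>j<rdim R.
     ((\<lambda>t. ract R (\<gamma>1 t) (\<gamma>2 t) i j) has_field_derivative D i j) (at 0)
     \<and> ract R (\<gamma>1 0) (\<gamma>2 0) i j = (if i = j then 1 else 0))"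

definition ksum :: "nat \<Rightarrow> cmat \<Rightarrow> cmat \<Rightarrow> cmat" where
  "ksum N A B = (\<lambda>r c. A (r div N) (c div N) * (if r mod N = c mod N then 1 else 0)
     + (if r div N = c div N then 1 else 0) * B (r mod N) (c mod N))"

lemma rep_deriv_tensor:
  assumes "rep_deriv R1 \<gamma>1 \<gamma>2 A" "rep_deriv R2 \<gamma>1 \<gamma>2 B"
  shows "rep_deriv (tensor_rep R1 R2) \<gamma>1 \<gamma>2 (ksum (rdim R2) A B)"
  unfolding rep_deriv_def
proof (intro allI impI)
  fix i j assume ij: "i < rdim (tensor_rep R1 R2)" "j < rdim (tensor_rep R1 R2)"
  let ?N = "rdim R2"
  have N: "0 < ?N" using ij by (cases "?N = 0") (auto simp: tensor_rep_def)
  have b: "i div ?N < rdim R1" "j div ?N < rdim R1" "i mod ?N < ?N" "j mod ?N < ?N"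
    using ij N by (auto simp: tensor_rep_def less_mult_imp_div_less)
  have eq: "i = j \<longleftrightarrow> i div ?N = j div ?N \<and> i mod ?N = j mod ?N"
    by (metis div_mult_mod_eq)
  note 1 = assms(1)[unfolded rep_deriv_def, rule_format, OF b(1,2)]
  note 2 = assms(2)[unfolded rep_deriv_def, rule_format, OF b(3,4)]
  have "((\<lambda>t. ract R1 (\<gamma>1 t) (\<gamma>2 t) (i div ?N) (j div ?N) * ract R2 (\<gamma>1 t) (\<gamma>2 t) (i mod ?N) (j mod ?N))
     has_field_derivative ksum ?N A B i j) (at 0)"
    by (rule DERIV_cong[OF DERIV_mult'[OF conjunct1[OF 1] conjunct1[OF 2]]])
      (use 1 2 in \<open>simp add: ksum_def add.commute\<close>)
  then show "((\<lambda>t. ract (tensor_rep R1 R2) (\<gamma>1 t) (\<gamma>2 t) i j) has_field_derivative ksum ?N A B i j) (at 0)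
     \<and> ract (tensor_rep R1 R2) (\<gamma>1 0) (\<gamma>2 0) i j = (if i = j then 1 else 0)"
    using ij 1 2 eq by (simp add: tensor_rep_def kron_def)
qed

text \<open>The difference of the two sides is the derivative at \<open>0\<close> of one coordinate
  of the equivariance defect, which vanishes for all real parameters.\<close>

lemma homs_infinitesimal:
  assumes T: "T \<in> homs n P V" and curve: "\<And>t :: real. (\<gamma>1 (of_real t), \<gamma>2 (of_real t)) \<in> Grp n"
    and DP: "rep_deriv P \<gamma>1 \<gamma>2 DP" and DV: "rep_deriv V \<gamma>1 \<gamma>2 DV"
    and v: "v \<in> rsp P" and i: "i < rdim V"
  shows "mv (rdim P) T (mv (rdim P) DP v) i = mv (rdim V) DV (mv (rdim P) T v) i"
proof -
  define F where "F t = (\<Sum>k<rdim P. T i k * (\<Sum>j<rdim P. ract P (\<gamma>1 t) (\<gamma>2 t) k j * v j))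
     - (\<Sum>k<rdim V. ract V (\<gamma>1 t) (\<gamma>2 t) i k * mv (rdim P) T v k)" for t
  have "(F has_field_derivative ((\<Sum>k<rdim P. T i k * (\<Sum>j<rdim P. DP k j * v j))
     - (\<Sum>k<rdim V. DV i k * mv (rdim P) T v k))) (at 0)"
    unfolding F_def
    by (intro DERIV_diff DERIV_sum DERIV_cmult DERIV_cmult_right)
      (use DP DV i in \<open>auto simp: rep_deriv_def\<close>)
  moreover have "F (of_real t) = 0" for t
  proof -
    have "mv (rdim P) T (mv (rdim P) (ract P (\<gamma>1 (of_real t)) (\<gamma>2 (of_real t))) v)
       = mv (rdim V) (ract V (\<gamma>1 (of_real t)) (\<gamma>2 (of_real t))) (mv (rdim P) T v)"
      using T curve[of t] v unfolding homs_def by blast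
    then show ?thesis by (simp add: F_def mv_def fun_eq_iff)
  qed
  ultimately have "(\<Sum>k<rdim P. T i k * (\<Sum>j<rdim P. DP k j * v j)) - (\<Sum>k<rdim V. DV i k * mv (rdim P) T v k) = 0"
    by (rule deriv_zero_on_reals)
  then show ?thesis by (simp add: mv_def)
qed

text \<open>The derivation of the polynomial ring in \<open>x\<close>, \<open>y\<close> extending
  \<open>A\<close> on the linear forms; entry \<open>(j, i)\<close> is the coefficient of
  \<open>x^j y^(l-j)\<close> in the image of \<open>x^i y^(l-i)\<close>.\<close>

definition dsym :: "nat \<Rightarrow> cmat \<Rightarrow> cmat" where
  "dsym l A = (\<lambda>j i. (if j = i then of_nat i * A 0 0 + of_nat (l - i) * A 1 1 else 0)
     + (if i = Suc j then of_nat i * A 1 0 else 0) + (if j = Suc i then of_nat (l - i) * A 0 1 else 0))"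

text \<open>At the identity the off-diagonal functions \<open>v\<close> and \<open>w\<close> vanish,
  so only monomials with at most one off-diagonal factor have a nonzero derivative.\<close>

lemma monomial_deriv:
  fixes u v w z :: "complex \<Rightarrow> complex"
  assumes "(u has_field_derivative a) (at 0)" "(v has_field_derivative b) (at 0)"
    "(w has_field_derivative c) (at 0)" "(z has_field_derivative d) (at 0)"
    "u 0 = 1" "v 0 = 0" "w 0 = 0" "z 0 = 1"
  shows "((\<lambda>t. k1 * u t ^ p * v t ^ q * k2 * w t ^ r * z t ^ s) has_field_derivative
     k1 * k2 * ((if q = 0 \<and> r = 0 then of_nat p * a + of_nat s * d else 0)
       + (if q = 1 \<and> r = 0 then b else 0) + (if q = 0 \<and> r = 1 then c else 0))) (at 0)"
proof -
  have pow: "((\<lambda>t. f t ^ m) has_field_derivative of_nat m * f 0 ^ (m - 1) * e) (at 0)"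
    if "(f has_field_derivative e) (at 0)" for f :: "complex \<Rightarrow> complex" and m e
    using DERIV_power[OF that, of m] by (simp add: mult_ac)
  have q: "of_nat m * (0::complex) ^ (m - 1) = (if m = 1 then 1 else 0)" for m
    by (cases m) (auto simp: power_0_left)
  have "((\<lambda>t. k1 * u t ^ p * v t ^ q * k2 * w t ^ r * z t ^ s) has_field_derivative
    (k1 * u 0 ^ p * v 0 ^ q * k2 * w 0 ^ r) * (of_nat s * z 0 ^ (s - 1) * d)
    + ((k1 * u 0 ^ p * v 0 ^ q * k2) * (of_nat r * w 0 ^ (r - 1) * c)
      + ((k1 * u 0 ^ p) * (of_nat q * v 0 ^ (q - 1) * b) + k1 * (of_nat p * u 0 ^ (p - 1) * a) * v 0 ^ q) * k2 * w 0 ^ r) * z 0 ^ s) (at 0)"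
    by (intro DERIV_mult' DERIV_cmult DERIV_cmult_right pow assms)
  then show ?thesis
    by (rule DERIV_cong) (use assms(5-8) in \<open>auto simp: q power_0_left algebra_simps\<close>)
qed

lemma sym_act_id:
  assumes "g 0 0 = 1" "g 1 1 = 1" "g 0 1 = 0" "g 1 0 = 0" "i \<le> l" "j \<le> l"
  shows "sym_act l g j i = (if i = j then 1 else 0)"
proof -
  have "sym_act l g j i = (\<Sum>p\<le>j. if p = i \<and> i = j then 1 else 0)"
    unfolding sym_act_def using assms
    by (simp, intro sum.cong refl) (auto simp: power_0_left)
  then show ?thesis by (cases "i = j") auto
qed

lemma sym_act_deriv:
  assumes A: "\<And>i j. i < 2 \<Longrightarrow> j < 2 \<Longrightarrow> ((\<lambda>t. \<gamma> t i j) has_field_derivative A i j) (at 0)"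
    and id: "\<And>i j. i < 2 \<Longrightarrow> j < 2 \<Longrightarrow> \<gamma> 0 i j = (if i = j then 1 else 0)"
    and ij: "i \<le> l" "j \<le> l"
  shows "((\<lambda>t. sym_act l (\<gamma> t) j i) has_field_derivative dsym l A j i) (at 0)"
proof -
  let ?c = "\<lambda>p. p \<le> i \<and> j - p \<le> l - i"
  let ?D = "\<lambda>p. of_nat (i choose p) * of_nat ((l - i) choose (j - p)) *
      ((if i - p = 0 \<and> j - p = 0 then of_nat p * A 0 0 + of_nat (l - i - (j - p)) * A 1 1 else 0)
       + (if i - p = 1 \<and> j - p = 0 then A 1 0 else 0) + (if i - p = 0 \<and> j - p = 1 then A 0 1 else 0))"
  have "((\<lambda>t. \<Sum>p\<le>j. if ?c p then of_nat (i choose p) * \<gamma> t 0 0 ^ p * \<gamma> t 1 0 ^ (i - p)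
          * of_nat ((l - i) choose (j - p)) * \<gamma> t 0 1 ^ (j - p) * \<gamma> t 1 1 ^ (l - i - (j - p)) else 0)
      has_field_derivative (\<Sum>p\<le>j. if ?c p then ?D p else 0)) (at 0)"
  proof (intro DERIV_sum)
    fix p
    show "((\<lambda>t. if ?c p then of_nat (i choose p) * \<gamma> t 0 0 ^ p * \<gamma> t 1 0 ^ (i - p)
          * of_nat ((l - i) choose (j - p)) * \<gamma> t 0 1 ^ (j - p) * \<gamma> t 1 1 ^ (l - i - (j - p)) else 0)
      has_field_derivative (if ?c p then ?D p else 0)) (at 0)"
    proof (cases "?c p")
      case True
      show ?thesis unfolding if_P[OF True]
        by (rule monomial_deriv) (auto intro!: A simp: id)
    next
      case False
      show ?thesis unfolding if_not_P[OF False] by simp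
    qed
  qed
  moreover have "(\<Sum>p\<le>j. if ?c p then ?D p else 0) = dsym l A j i"
  proof -
    have "(\<Sum>p\<le>j. if ?c p then ?D p else 0) =
      (\<Sum>p\<le>j. (if p = j then (if i = j then of_nat i * A 0 0 + of_nat (l - i) * A 1 1 else 0) else 0)
        + (if p = j then (if i = Suc j then of_nat i * A 1 0 else 0) else 0)
        + (if p = i then (if j = Suc i then of_nat (l - i) * A 0 1 else 0) else 0))"
    proof (intro sum.cong refl)
      fix p assume p: "p \<in> {..j}"
      \<comment> \<open>Three shapes survive: no off-diagonal factor, or a single one turning
        \<open>x\<close> into \<open>y\<close> or \<open>y\<close> into \<open>x\<close>.\<close>
      consider "i = p \<and> j = p" | "i = Suc p \<and> j = p" | "i = p \<and> j = Suc p"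
        | "?c p \<longrightarrow> ?D p = 0" "\<not> (i = p \<and> j = p)" "\<not> (i = Suc p \<and> j = p)" "\<not> (i = p \<and> j = Suc p)"
        using p by (cases "i = p \<and> j = p"; cases "i = Suc p \<and> j = p"; cases "i = p \<and> j = Suc p") force+
      then show "(if ?c p then ?D p else 0) = (if p = j then (if i = j then of_nat i * A 0 0 + of_nat (l - i) * A 1 1 else 0) else 0)
        + (if p = j then (if i = Suc j then of_nat i * A 1 0 else 0) else 0)
        + (if p = i then (if j = Suc i then of_nat (l - i) * A 0 1 else 0) else 0)"
        using ij by cases auto
    qed
    also have "\<dots> = dsym l A j i" unfolding sum.distrib dsym_def using ij by auto
    finally show ?thesis .
  qed
  ultimately show ?thesis using ij unfolding sym_act_def by simp
qed

lemma rep_deriv_Symrep: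
  assumes "\<And>i j. i < 2 \<Longrightarrow> j < 2 \<Longrightarrow> ((\<lambda>t. \<gamma>1 t i j) has_field_derivative A i j) (at 0)"
    and "\<And>i j. i < 2 \<Longrightarrow> j < 2 \<Longrightarrow> \<gamma>1 0 i j = (if i = j then 1 else 0)"
  shows "rep_deriv (Symrep l) \<gamma>1 \<gamma>2 (dsym l A)"
  unfolding rep_deriv_def Symrep_def
  using sym_act_deriv[OF assms] sym_act_id[of "\<gamma>1 0"] assms(2) by auto

definition dext :: "nat \<Rightarrow> nat \<Rightarrow> cmat \<Rightarrow> cmat" where
  "dext n d A = (\<lambda>i j. lie_op (2*n) A (\<lambda>xs. detsub d idm xs (subsets d (2*n) ! j)) (subsets d (2*n) ! i))"

text \<open>Product rule on each Leibniz term. The differentiated slot \<open>m\<close> contributes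
  \<open>A (I ! m) (J ! p m)\<close>; this is also what the sum over \<open>k\<close> in
  \<open>lie_op\<close> leaves, as the identity factor in slot \<open>m\<close> selects
  \<open>k = J ! p m\<close>.\<close>

lemma detsub_deriv:
  assumes A: "\<And>i j. i < N \<Longrightarrow> j < N \<Longrightarrow> ((\<lambda>t. \<gamma> t i j) has_field_derivative A i j) (at 0)"
    and id: "\<And>i j. i < N \<Longrightarrow> j < N \<Longrightarrow> \<gamma> 0 i j = (if i = j then 1 else 0)"
    and I: "I \<in> Lst N d" and J: "J \<in> Lst N d"
  shows "((\<lambda>t. detsub d (\<gamma> t) I J) has_field_derivative lie_op N A (\<lambda>xs. detsub d idm xs J) I) (at 0)"
proof -
  have "((\<lambda>t. detsub d (\<gamma> t) I J) has_field_derivative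
     (\<Sum>p | p permutes {..<d}. of_int (sign p) *
       (\<Sum>m<d. A (I ! m) (J ! p m) * (\<Prod>i\<in>{..<d} - {m}. idm (I ! i) (J ! p i))))) (at 0)"
    unfolding detsub_def
  proof (intro DERIV_sum DERIV_cmult)
    fix p assume "p \<in> {p. p permutes {..<d}}"
    then have lt: "I ! m < N" "J ! p m < N" if "m < d" for m
      using that permutes_in_image[of p "{..<d}" m] I J by (auto intro!: nth_Lst)
    have "((\<lambda>t. \<Prod>i<d. \<gamma> t (I ! i) (J ! p i)) has_field_derivative
      (\<Sum>m<d. A (I ! m) (J ! p m) * (\<Prod>i\<in>{..<d} - {m}. \<gamma> 0 (I ! i) (J ! p i)))) (at 0)"
      by (rule has_field_derivative_prod) (use lt A in auto)
    moreover have "(\<Prod>i\<in>{..<d} - {m}. \<gamma> 0 (I ! i) (J ! p i)) = (\<Prod>i\<in>{..<d} - {m}. idm (I ! i) (J ! p i))" for m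
      by (intro prod.cong refl) (use lt id in \<open>auto simp: idm_def\<close>)
    ultimately show "((\<lambda>t. \<Prod>i<d. \<gamma> t (I ! i) (J ! p i)) has_field_derivative
      (\<Sum>m<d. A (I ! m) (J ! p m) * (\<Prod>i\<in>{..<d} - {m}. idm (I ! i) (J ! p i)))) (at 0)" by simp
  qed
  moreover have "(\<Sum>p | p permutes {..<d}. of_int (sign p) *
       (\<Sum>m<d. A (I ! m) (J ! p m) * (\<Prod>i\<in>{..<d} - {m}. idm (I ! i) (J ! p i))))
     = lie_op N A (\<lambda>xs. detsub d idm xs J) I"
  proof -
    have upd: "(\<Sum>k<N. A (I ! m) k * (\<Prod>i<d. idm (I[m := k] ! i) (J ! p i)))
        = A (I ! m) (J ! p m) * (\<Prod>i\<in>{..<d} - {m}. idm (I ! i) (J ! p i))"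
      if p: "p permutes {..<d}" and m: "m < d" for p m
    proof -
      have pm: "J ! p m < N" using permutes_in_image[OF p, of m] m J by (auto intro!: nth_Lst)
      have "(\<Prod>i<d. idm (I[m := k] ! i) (J ! p i)) = (if k = J ! p m then 1 else 0) * (\<Prod>i\<in>{..<d} - {m}. idm (I ! i) (J ! p i))" for k
        using m I by (subst prod.remove[of _ m]) (auto simp: Lst_def idm_def intro!: prod.cong)
      then have "(\<Sum>k<N. A (I ! m) k * (\<Prod>i<d. idm (I[m := k] ! i) (J ! p i)))
        = (\<Sum>k<N. if k = J ! p m then A (I ! m) k * (\<Prod>i\<in>{..<d} - {m}. idm (I ! i) (J ! p i)) else 0)"
        by (intro sum.cong refl) simp
      then show ?thesis using pm by simp
    qed
    have "lie_op N A (\<lambda>xs. detsub d idm xs J) I = (\<Sum>m<d. \<Sum>k<N. \<Sum>p | p permutes {..<d}.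
        of_int (sign p) * (A (I ! m) k * (\<Prod>i<d. idm (I[m := k] ! i) (J ! p i))))"
      unfolding lie_op_def detsub_def using I by (simp add: Lst_def sum_distrib_left mult_ac)
    also have "\<dots> = (\<Sum>m<d. \<Sum>p | p permutes {..<d}. \<Sum>k<N.
        of_int (sign p) * (A (I ! m) k * (\<Prod>i<d. idm (I[m := k] ! i) (J ! p i))))"
      by (intro sum.cong refl sum.swap)
    also have "\<dots> = (\<Sum>p | p permutes {..<d}. \<Sum>m<d. of_int (sign p) * (\<Sum>k<N.
        A (I ! m) k * (\<Prod>i<d. idm (I[m := k] ! i) (J ! p i))))"
      by (subst sum.swap) (simp add: sum_distrib_left)
    also have "\<dots> = (\<Sum>p | p permutes {..<d}. \<Sum>m<d. of_int (sign p) *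
        (A (I ! m) (J ! p m) * (\<Prod>i\<in>{..<d} - {m}. idm (I ! i) (J ! p i))))"
      by (intro sum.cong refl) (simp add: upd)
    finally show ?thesis by (simp add: sum_distrib_left)
  qed
  ultimately show ?thesis by simp
qed

lemma rep_deriv_Extrep:
  assumes A: "\<And>i j. i < 2*n \<Longrightarrow> j < 2*n \<Longrightarrow> ((\<lambda>t. \<gamma>2 t i j) has_field_derivative A i j) (at 0)"
    and id: "\<And>i j. i < 2*n \<Longrightarrow> j < 2*n \<Longrightarrow> \<gamma>2 0 i j = (if i = j then 1 else 0)"
  shows "rep_deriv (Extrep n d) \<gamma>1 \<gamma>2 (dext n d A)"
  unfolding rep_deriv_def
proof (intro allI impI conjI)
  fix i j assume "i < rdim (Extrep n d)" "j < rdim (Extrep n d)"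
  then have ij: "i < Ne n d" "j < Ne n d" by (auto simp: Extrep_def)
  show "((\<lambda>t. ract (Extrep n d) (\<gamma>1 t) (\<gamma>2 t) i j) has_field_derivative dext n d A i j) (at 0)"
    using detsub_deriv[OF A id subsets_in_Lst[OF ij(1)] subsets_in_Lst[OF ij(2)]] ij
    by (simp add: Extrep_def ext_act_def dext_def)
  have "detsub d (\<gamma>2 0) (subsets d (2*n) ! i) (subsets d (2*n) ! j) = detsub d idm (subsets d (2*n) ! i) (subsets d (2*n) ! j)"
    by (rule detsub_cong) (use ij in \<open>auto simp: idm_def id nth_subsets_less\<close>)
  then show "ract (Extrep n d) (\<gamma>1 0) (\<gamma>2 0) i j = (if i = j then 1 else 0)"
    using ij by (simp add: Extrep_def ext_act_def detsub_idm_subsets)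
qed

lemma mv_dext:
  assumes "I < Ne n d"
  shows "mv (Ne n d) (dext n d A) v I = lie_op (2*n) A (ev n d v) (subsets d (2*n) ! I)"
proof -
  let ?S = "\<lambda>J. subsets d (2*n) ! J"
  have "mv (Ne n d) (dext n d A) v I = (\<Sum>J<Ne n d. \<Sum>m<length (?S I). \<Sum>k<2*n. A (?S I ! m) k * (v J * detsub d idm ((?S I)[m := k]) (?S J)))"
    unfolding mv_def dext_def lie_op_def by (simp add: sum_distrib_right sum_distrib_left mult_ac)
  also have "\<dots> = (\<Sum>m<length (?S I). \<Sum>J<Ne n d. \<Sum>k<2*n. A (?S I ! m) k * (v J * detsub d idm ((?S I)[m := k]) (?S J)))"
    by (rule sum.swap)
  also have "\<dots> = (\<Sum>m<length (?S I). \<Sum>k<2*n. \<Sum>J<Ne n d. A (?S I ! m) k * (v J * detsub d idm ((?S I)[m := k]) (?S J)))"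
    by (intro sum.cong refl sum.swap)
  finally show ?thesis unfolding lie_op_def ev_def by (simp add: sum_distrib_left)
qed

section \<open>Highest weight vectors in tensor products\<close>

lemma sum_mult_split: "(\<Sum>k<M * N. f k) = (\<Sum>x<M. \<Sum>y<N. f (x * N + y) :: complex)" for M N :: nat
proof (induction M)
  case (Suc M)
  have "(\<Sum>k<Suc M * N. f k) = (\<Sum>k<M * N + N. f k)" by (simp add: add.commute)
  also have "\<dots> = (\<Sum>k<M * N. f k) + (\<Sum>y<N. f (M * N + y))" by (rule sum_lessThan_add)
  finally show ?case using Suc by simp
qed simp

lemma enc_less: "x < M \<Longrightarrow> y < N \<Longrightarrow> x * N + y < M * N" for x y M N :: nat
  using mult_le_mono1[of "Suc x" M N] by simp

lemma enc_div: "y < N \<Longrightarrow> (x * N + y) div N = x" and enc_mod: "y < N \<Longrightarrow> (x * N + y) mod N = y" for x y N :: nat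
  by auto

lemma mv_ksum:
  assumes "x < M" "y < N"
  shows "mv (M * N) (ksum N A B) w (x * N + y) =
    mv M A (\<lambda>x. w (x * N + y)) x + mv N B (\<lambda>y. w (x * N + y)) y"
proof -
  have "mv (M * N) (ksum N A B) w (x * N + y)
      = (\<Sum>x'<M. \<Sum>y'<N. (if y = y' then A x x' * w (x' * N + y') else 0)
          + (if x = x' then B y y' * w (x' * N + y') else 0))"
    unfolding mv_def sum_mult_split using assms
    by (intro sum.cong refl) (auto simp: ksum_def enc_div enc_mod algebra_simps)
  also have "\<dots> = (\<Sum>x'<M. A x x' * w (x' * N + y)) + (\<Sum>x'<M. if x = x' then \<Sum>y'<N. B y y' * w (x' * N + y') else 0)"
    unfolding sum.distrib using assms
    by (intro arg_cong2[where f="(+)"] sum.cong refl) (auto simp: sum.delta)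
  finally show ?thesis using assms by (simp add: mv_def)
qed

lemma mv_cong: "(\<And>j. j < N \<Longrightarrow> u j = v j) \<Longrightarrow> mv N A u = mv N A v"
  by (intro ext) (auto simp: mv_def intro!: sum.cong)

text \<open>Position of the basis tensor with labels \<open>i, I, j, J\<close> in \<open>(Sym^r
  \<otimes> \<Lambda>^p) \<otimes> (Sym^l \<otimes> \<Lambda>^d)\<close>, following the nesting of
  \<open>vrep\<close>.\<close>

definition enc4 :: "nat \<Rightarrow> nat \<Rightarrow> nat \<Rightarrow> nat \<Rightarrow> nat \<Rightarrow> nat \<Rightarrow> nat \<Rightarrow> nat" where
  "enc4 Np L Nd i I j J = (i * Np + I) * (L * Nd) + (j * Nd + J)"

lemma enc4_less: "i < R \<Longrightarrow> I < Np \<Longrightarrow> j < L \<Longrightarrow> J < Nd \<Longrightarrow> enc4 Np L Nd i I j J < (R * Np) * (L * Nd)"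
  unfolding enc4_def by (intro enc_less)

lemma enc4_cases:
  assumes "x < (R * Np) * (L * Nd)"
  obtains i I j J where "i < R" "I < Np" "j < L" "J < Nd" "x = enc4 Np L Nd i I j J"
proof -
  have pos: "0 < L * Nd" "0 < Np" "0 < Nd" using assms by (auto intro!: Nat.gr0I)
  let ?u = "x div (L * Nd)" and ?v = "x mod (L * Nd)"
  have u: "?u < R * Np" using assms by (simp add: less_mult_imp_div_less)
  have v: "?v < L * Nd" using pos by simp
  show ?thesis
  proof (rule that[of "?u div Np" "?u mod Np" "?v div Nd" "?v mod Nd"])
    show "?u div Np < R" "?v div Nd < L" using u v by (simp_all add: less_mult_imp_div_less)
    show "?u mod Np < Np" "?v mod Nd < Nd" using pos by simp_all
    show "x = enc4 Np L Nd (?u div Np) (?u mod Np) (?v div Nd) (?v mod Nd)"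
      unfolding enc4_def by (simp only: div_mult_mod_eq)
  qed
qed

lemma mv_ksum4:
  assumes "i < R" "I < Np" "j < L" "J < Nd"
  shows "mv ((R * Np) * (L * Nd)) (ksum (L * Nd) (ksum Np A B) (ksum Nd C D)) w (enc4 Np L Nd i I j J) =
    (mv R A (\<lambda>i. w (enc4 Np L Nd i I j J)) i + mv Np B (\<lambda>I. w (enc4 Np L Nd i I j J)) I)
    + (mv L C (\<lambda>j. w (enc4 Np L Nd i I j J)) j + mv Nd D (\<lambda>J. w (enc4 Np L Nd i I j J)) J)"
  unfolding enc4_def using assms by (simp add: mv_ksum enc_less)

lemma dsym_raise:
  assumes "i \<le> r"
  shows "mv (r + 1) (dsym r (unitm 0 1)) s i = (if i = 0 then 0 else of_nat (r - (i - 1)) * s (i - 1))"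
proof -
  have "mv (r + 1) (dsym r (unitm 0 1)) s i = (\<Sum>i'<r + 1. if i' = i - 1 \<and> i \<noteq> 0 then of_nat (r - i') * s i' else 0)"
    unfolding mv_def by (intro sum.cong refl) (auto simp: dsym_def unitm_def)
  then show ?thesis using assms by (cases "i = 0") (auto simp: sum.delta)
qed

lemma dsym_cartan:
  assumes "i \<le> r"
  shows "mv (r + 1) (dsym r (cartan 1 0)) s i = (2 * of_nat i - of_nat r) * s i"
proof -
  have "mv (r + 1) (dsym r (cartan 1 0)) s i = (\<Sum>i'<r + 1. if i' = i then (2 * of_nat i - of_nat r) * s i' else 0)"
    unfolding mv_def using assms by (intro sum.cong refl) (auto simp: dsym_def cartan_def unitm_def of_nat_diff)
  then show ?thesis using assms by simp
qed

definition delta :: "bool \<Rightarrow> int" where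
  "delta b = (if b then 1 else 0)"

definition ev2 :: "nat \<Rightarrow> nat \<Rightarrow> nat \<Rightarrow> (nat \<Rightarrow> nat \<Rightarrow> complex) \<Rightarrow> nat list \<Rightarrow> nat list \<Rightarrow> complex" where
  "ev2 n p d w xs ys = ev n p (\<lambda>I. ev n d (\<lambda>J. w I J) ys) xs"

lemma ev2_swap: "ev2 n p d w xs ys = ev n d (\<lambda>J. ev n p (\<lambda>I. w I J) xs) ys"
  unfolding ev2_def ev_def
  by (simp add: sum_distrib_left sum_distrib_right mult_ac) (rule sum.swap)

lemma alternating_ev2_1: "alternating p (\<lambda>xs. ev2 n p d w xs ys)"
  unfolding ev2_def by (rule alternating_ev)

lemma alternating_ev2_2: "alternating d (ev2 n p d w xs)"
  unfolding ev2_swap by (rule alternating_ev)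

lemma ev2_subsets: "I < Ne n p \<Longrightarrow> J < Ne n d \<Longrightarrow> ev2 n p d w (subsets p (2*n) ! I) (subsets d (2*n) ! J) = w I J"
  unfolding ev2_def by (simp add: ev_subsets)

lemma alternating2_eq_0:
  assumes "\<And>ys. alternating p (\<lambda>xs. c xs ys)" "\<And>xs. alternating d (c xs)"
    and "\<And>I J. I < Ne n p \<Longrightarrow> J < Ne n d \<Longrightarrow> c (subsets p (2*n) ! I) (subsets d (2*n) ! J) = 0"
    and "xs \<in> Lst (2*n) p" "ys \<in> Lst (2*n) d"
  shows "c xs ys = 0"
proof (rule alternating_eq_0[OF assms(1) _ assms(4)])
  fix I assume "I < Ne n p"
  then show "c (subsets p (2*n) ! I) ys = 0"
    by (intro alternating_eq_0[OF assms(2) _ assms(5)] assms(3))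
qed

lemma alternating_lie_op_param: "(\<And>ys. alternating p (\<lambda>xs. c xs ys)) \<Longrightarrow> alternating p (\<lambda>xs. lie_op N A (c xs) ys)"
  unfolding lie_op_def by (intro alternating_sum alternating_mult_left)

lemma alternating_add: "alternating d f \<Longrightarrow> alternating d g \<Longrightarrow> alternating d (\<lambda>x. f x + g x)"
  by (simp add: alternating_def)

text \<open>Both sides alternate in each list, so the coordinate relation, known at increasing
  lists, holds at all lists. This is the form that \<open>tensor_highest_weight\<close>
  consumes.\<close>

lemma lie_op_ev2:
  assumes "\<And>I J. I < Ne n p \<Longrightarrow> J < Ne n d \<Longrightarrow>
      mv (Ne n p) (dext n p A) (\<lambda>I. w I J) I + mv (Ne n d) (dext n d A) (\<lambda>J. w I J) J = \<mu> * w I J"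
    and "xs \<in> Lst (2*n) p" "ys \<in> Lst (2*n) d"
  shows "lie_op (2*n) A (\<lambda>xs. ev2 n p d w xs ys) xs + lie_op (2*n) A (ev2 n p d w xs) ys = \<mu> * ev2 n p d w xs ys"
proof -
  let ?c = "ev2 n p d w"
  have lie1: "alternating p (lie_op (2*n) A (\<lambda>xs. ?c xs ys))" for ys
    by (rule alternating_lie_op[OF alternating_ev2_1])
  have lie2: "alternating d (lie_op (2*n) A (?c xs))" for xs
    by (rule alternating_lie_op[OF alternating_ev2_2])
  have "lie_op (2*n) A (\<lambda>xs. ?c xs ys) xs + lie_op (2*n) A (?c xs) ys - \<mu> * ?c xs ys = 0"
  proof (rule alternating2_eq_0[of p _ d n, OF _ _ _ assms(2,3)])
    fix ys
    show "alternating p (\<lambda>xs. lie_op (2*n) A (\<lambda>xs. ?c xs ys) xs + lie_op (2*n) A (?c xs) ys - \<mu> * ?c xs ys)"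
      using alternating_diff[OF alternating_add[OF lie1[of ys] alternating_lie_op_param[of p ?c, OF alternating_ev2_1]]
          alternating_mult_left[OF alternating_ev2_1]] .
  next
    fix xs
    show "alternating d (\<lambda>ys. lie_op (2*n) A (\<lambda>xs. ?c xs ys) xs + lie_op (2*n) A (?c xs) ys - \<mu> * ?c xs ys)"
      using alternating_diff[OF alternating_add[OF alternating_lie_op_param[of d "\<lambda>ys xs. ?c xs ys", OF alternating_ev2_2] lie2[of xs]]
          alternating_mult_left[OF alternating_ev2_2]] .
  next
    fix I J assume IJ: "I < Ne n p" "J < Ne n d"
    have "lie_op (2*n) A (\<lambda>xs. ?c xs (subsets d (2*n) ! J)) (subsets p (2*n) ! I) = mv (Ne n p) (dext n p A) (\<lambda>I. w I J) I"
      unfolding ev2_def mv_dext[OF IJ(1), symmetric] ev_subsets[OF IJ(2)] ..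
    moreover have "lie_op (2*n) A (?c (subsets p (2*n) ! I)) (subsets d (2*n) ! J) = mv (Ne n d) (dext n d A) (\<lambda>J. w I J) J"
      unfolding ev2_swap mv_dext[OF IJ(2), symmetric] ev_subsets[OF IJ(1)] ..
    ultimately show "lie_op (2*n) A (\<lambda>xs. ?c xs (subsets d (2*n) ! J)) (subsets p (2*n) ! I)
      + lie_op (2*n) A (?c (subsets p (2*n) ! I)) (subsets d (2*n) ! J) - \<mu> * ?c (subsets p (2*n) ! I) (subsets d (2*n) ! J) = 0"
      using assms(1)[OF IJ] by (simp add: ev2_subsets[OF IJ])
  qed
  then show ?thesis by simp
qed

text \<open>The \<open>Sp(1)\<close> and \<open>Sp(n)\<close> factors are treated in turn. For the
  least exponent \<open>i\<close> the raising operator forces \<open>j = l\<close>, and the weight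
  then gives \<open>2 * i + l = k + r\<close>. The remaining array in \<open>I\<close>,
  \<open>J\<close> is a highest weight vector of a tensor product of exterior powers, so
  \<open>tensor_highest_weight\<close> supplies an \<open>I\<close> opposite \<open>[0..<d]\<close>;
  its weight is the last conclusion.\<close>

lemma highest_weight_component:
  assumes sym_raise: "\<And>i I j J. i \<le> r \<Longrightarrow> I < Ne n p \<Longrightarrow> j \<le> l \<Longrightarrow> J < Ne n d \<Longrightarrow>
      mv (r + 1) (dsym r (unitm 0 1)) (\<lambda>i. w i I j J) i + mv (l + 1) (dsym l (unitm 0 1)) (\<lambda>j. w i I j J) j = 0"
    and sym_wt: "\<And>i I j J. i \<le> r \<Longrightarrow> I < Ne n p \<Longrightarrow> j \<le> l \<Longrightarrow> J < Ne n d \<Longrightarrow>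
      mv (r + 1) (dsym r (cartan 1 0)) (\<lambda>i. w i I j J) i + mv (l + 1) (dsym l (cartan 1 0)) (\<lambda>j. w i I j J) j
        = of_nat k * w i I j J"
    and short: "\<And>u v i I j J. u < v \<Longrightarrow> v < n \<Longrightarrow> i \<le> r \<Longrightarrow> I < Ne n p \<Longrightarrow> j \<le> l \<Longrightarrow> J < Ne n d \<Longrightarrow>
      mv (Ne n p) (dext n p (short_root n u v)) (\<lambda>I. w i I j J) I
       + mv (Ne n d) (dext n d (short_root n u v)) (\<lambda>J. w i I j J) J = 0"
    and long: "\<And>u i I j J. u < n \<Longrightarrow> i \<le> r \<Longrightarrow> I < Ne n p \<Longrightarrow> j \<le> l \<Longrightarrow> J < Ne n d \<Longrightarrow>
      mv (Ne n p) (dext n p (long_root n u)) (\<lambda>I. w i I j J) I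
       + mv (Ne n d) (dext n d (long_root n u)) (\<lambda>J. w i I j J) J = 0"
    and wt: "\<And>u i I j J. u < n \<Longrightarrow> i \<le> r \<Longrightarrow> I < Ne n p \<Longrightarrow> j \<le> l \<Longrightarrow> J < Ne n d \<Longrightarrow>
      mv (Ne n p) (dext n p (cartan n u)) (\<lambda>I. w i I j J) I
       + mv (Ne n d) (dext n d (cartan n u)) (\<lambda>J. w i I j J) J = of_int (lam u) * w i I j J"
    and prim: "\<And>i I j. i \<le> r \<Longrightarrow> I < Ne n p \<Longrightarrow> j \<le> l \<Longrightarrow> (\<lambda>J. if J < Ne n d then w i I j J else 0) \<in> prim_ext n d"
    and nz: "i0 \<le> r" "I0 < Ne n p" "j0 \<le> l" "J0 < Ne n d" "w i0 I0 j0 J0 \<noteq> 0"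
    and d: "d \<le> n"
  obtains i I J where "i \<le> r" "2 * i + l = k + r" "I < Ne n p" "J < Ne n d" "subsets d (2*n) ! J = [0..<d]"
    "w i I l J \<noteq> 0"
    "\<And>u. u < n \<Longrightarrow> delta (u \<in> set (subsets p (2*n) ! I)) - delta (n + u \<in> set (subsets p (2*n) ! I)) + delta (u < d) = lam u"
proof -
  define i where "i = (LEAST i. i \<le> r \<and> (\<exists>I<Ne n p. \<exists>j\<le>l. \<exists>J<Ne n d. w i I j J \<noteq> 0))"
  have "i0 \<le> r \<and> (\<exists>I<Ne n p. \<exists>j\<le>l. \<exists>J<Ne n d. w i0 I j J \<noteq> 0)" using nz by blast
  then have "i \<le> r \<and> (\<exists>I<Ne n p. \<exists>j\<le>l. \<exists>J<Ne n d. w i I j J \<noteq> 0)"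
    unfolding i_def by (rule LeastI)
  then obtain I1 j1 J1 where i: "i \<le> r" and 1: "I1 < Ne n p" "j1 \<le> l" "J1 < Ne n d" "w i I1 j1 J1 \<noteq> 0" by blast
  have below: "w i' I j J = 0" if "i' < i" "I < Ne n p" "j \<le> l" "J < Ne n d" for i' I j J
    using not_less_Least[of i' "\<lambda>i. i \<le> r \<and> (\<exists>I<Ne n p. \<exists>j\<le>l. \<exists>J<Ne n d. w i I j J \<noteq> 0)"] that i
    unfolding i_def[symmetric] by (metis le_trans less_imp_le_nat)
  have "w i I j J = 0" if "j < l" "I < Ne n p" "J < Ne n d" for I j J
  proof -
    have j: "Suc j \<le> l" using that by simp
    \<comment> \<open>In the relation at \<open>(i, Suc j)\<close> the first-factor term sits at
      exponent \<open>i - 1\<close> and vanishes by minimality; the other has the nonzero factor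
      \<open>l - j\<close>.\<close>
    show ?thesis
      using sym_raise[OF i that(2) j that(3)] that below[of "i - 1" I "Suc j" J] j
      unfolding dsym_raise[OF i] dsym_raise[OF j] by (cases "i = 0") auto
  qed
  then have l1: "w i I1 l J1 \<noteq> 0" using 1 by (metis le_neq_implies_less)
  have "(2 * of_nat i - of_nat r) * w i I1 l J1 + (2 * of_nat l - of_nat l) * w i I1 l J1 = of_nat k * w i I1 l J1"
    using sym_wt[OF i 1(1) order_refl 1(3)] unfolding dsym_cartan[OF i] dsym_cartan[OF order_refl] .
  then have "(of_int (2 * int i - int r + int l) :: complex) * w i I1 l J1 = of_int (int k) * w i I1 l J1"
    by (simp add: algebra_simps)
  then have "2 * int i - int r + int l = int k" using l1 by (metis mult_right_cancel of_int_eq_iff)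
  then have il: "2 * i + l = k + r" by linarith
  let ?c = "ev2 n p d (\<lambda>I J. w i I l J)"
  have "\<exists>xs\<in>Lst (2*n) p. ?c xs [0..<d] \<noteq> 0"
  proof (rule tensor_highest_weight[of p ?c d n, OF alternating_ev2_1 alternating_ev2_2])
    show "lie_op (2*n) (short_root n u v) (\<lambda>xs. ?c xs ys) xs + lie_op (2*n) (short_root n u v) (?c xs) ys = 0"
      if "u < v" "v < n" "xs \<in> Lst (2*n) p" "ys \<in> Lst (2*n) d" for u v xs ys
      using lie_op_ev2[of p n d "short_root n u v" "\<lambda>I J. w i I l J" 0 xs ys] short[OF that(1,2) i] that by simp
    show "lie_op (2*n) (long_root n u) (\<lambda>xs. ?c xs ys) xs + lie_op (2*n) (long_root n u) (?c xs) ys = 0"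
      if "u < n" "xs \<in> Lst (2*n) p" "ys \<in> Lst (2*n) d" for u xs ys
      using lie_op_ev2[of p n d "long_root n u" "\<lambda>I J. w i I l J" 0 xs ys] long[OF that(1) i] that by simp
    show "subsets p (2*n) ! I1 \<in> Lst (2*n) p" "subsets d (2*n) ! J1 \<in> Lst (2*n) d"
      using 1 by (auto intro: subsets_in_Lst)
    show "?c (subsets p (2*n) ! I1) (subsets d (2*n) ! J1) \<noteq> 0" using 1 l1 by (simp add: ev2_subsets)
    fix xs ys assume h: "2 \<le> d" "xs \<in> Lst (2*n) p" "ys \<in> Lst (2*n) (d - 2)"
    have "(\<Sum>k<n. ?c xs (k # (n + k) # ys)) = ev n p (\<lambda>I. \<Sum>k<n. ev n d (\<lambda>J. w i I l J) (k # (n + k) # ys)) xs"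
      unfolding ev2_def ev_def[of n p] sum_distrib_right by (rule sum.swap)
    also have "\<dots> = (\<Sum>I<Ne n p. 0 * detsub p idm xs (subsets p (2*n) ! I))"
      unfolding ev_def[of n p]
    proof (intro sum.cong refl arg_cong2[where f="(*)"])
      fix I assume "I \<in> {..<Ne n p}"
      then have "(\<Sum>k<n. ev n d (\<lambda>J. if J < Ne n d then w i I l J else 0) (k # (n + k) # ys)) = 0"
        using prim[OF i, of I l] h unfolding prim_ext_iff by auto
      then show "(\<Sum>k<n. ev n d (\<lambda>J. w i I l J) (k # (n + k) # ys)) = 0" by (simp add: ev_def)
    qed
    finally show "(\<Sum>k<n. ?c xs (k # (n + k) # ys)) = 0" by simp
  qed
  then obtain xs where xs: "xs \<in> Lst (2*n) p" "?c xs [0..<d] \<noteq> 0" by blast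
  have dx: "distinct xs" using alternating_not_distinct[OF alternating_ev2_1 length_Lst[OF xs(1)]] xs(2) by blast
  obtain I where I: "I < Ne n p" "subsets p (2*n) ! I = sort xs"
    using subsets_index sort_mem_subsets[OF xs(1) dx] by metis
  obtain J where J: "J < Ne n d" "subsets d (2*n) ! J = [0..<d]"
  proof (rule subsets_index)
    show "[0..<d] \<in> set (subsets d (2*n))" using d by (auto simp: mem_subsets)
  qed
  have "?c (sort xs) [0..<d] \<noteq> 0"
    using alternating_sort[OF alternating_ev2_1[of p n d "\<lambda>I J. w i I l J" "[0..<d]"], of xs] xs
    by (auto simp: length_Lst)
  then have nzw: "w i I l J \<noteq> 0" using ev2_subsets[OF I(1) J(1), of "\<lambda>I J. w i I l J"] I J by simp
  have "delta (u \<in> set (subsets p (2*n) ! I)) - delta (n + u \<in> set (subsets p (2*n) ! I)) + delta (u < d) = lam u"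
    if u: "u < n" for u
  proof -
    let ?x = "subsets p (2*n) ! I"
    have L: "?x \<in> Lst (2*n) p" "[0..<d] \<in> Lst (2*n) d" using I J subsets_in_Lst by metis+
    have "lie_op (2*n) (cartan n u) (\<lambda>xs. ?c xs [0..<d]) ?x + lie_op (2*n) (cartan n u) (?c ?x) [0..<d]
        = of_int (lam u) * ?c ?x [0..<d]"
      by (rule lie_op_ev2[OF _ L]) (use wt[OF u i] in auto)
    moreover have "?c ?x [0..<d] = w i I l J" using ev2_subsets[OF I(1) J(1), of "\<lambda>I J. w i I l J"] J by simp
    moreover have "of_int (delta b) = (if b then 1 else 0 :: complex)" for b by (simp add: delta_def)
    moreover have "(if u \<in> set [0..<d] then 1 else 0) - (if n + u \<in> set [0..<d] then 1 else 0) = (if u < d then 1 else 0 :: complex)"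
      using d by auto
    ultimately have "(of_int (delta (u \<in> set ?x) - delta (n + u \<in> set ?x) + delta (u < d)) :: complex) * w i I l J
        = of_int (lam u) * w i I l J"
      unfolding lie_op_cartan[OF nth_subsets(3)[OF I(1)] u] lie_op_cartan[OF distinct_upt u]
      by (simp only: of_int_add of_int_diff distrib_right)
    then show ?thesis using nzw by (metis mult_right_cancel of_int_eq_iff)
  qed
  with that[OF i il I(1) J nzw] show ?thesis by blast
qed

section \<open>Root vectors acting on homomorphisms\<close>

text \<open>The summand \<open>S_r\<close> of the spinors has \<open>p = n - r\<close>; with
  \<open>p\<close> free, the constraints from the two groups can be stated separately.\<close>

definition vrep :: "nat \<Rightarrow> nat \<Rightarrow> nat \<Rightarrow> nat \<Rightarrow> nat \<Rightarrow> rep" where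
  "vrep n r p l d = tensor_rep (tensor_rep (Symrep r) (Extrep n p)) (tensor_rep (Symrep l) (Extrep n d))"

lemma rdim_simps [simp]:
  "rdim (Symrep l) = l + 1" "rdim (Extrep n d) = Ne n d" "rdim (tensor_rep R1 R2) = rdim R1 * rdim R2"
  "rdim (toprep n a b) = Ne n a * Ne n b" "rdim (pirep n k a b) = (k + 1) * (Ne n a * Ne n b)"
  "rdim (vrep n r p l d) = ((r + 1) * Ne n p) * ((l + 1) * Ne n d)"
  by (simp_all add: Symrep_def Extrep_def tensor_rep_def toprep_def pirep_def vrep_def Let_def)

lemma tens_enc: "x < M \<Longrightarrow> y < N \<Longrightarrow> tens M N u v (x * N + y) = u x * v y"
  by (simp add: tens_def enc_less)

lemma tens_in_vecs: "tens M N u v \<in> vecs (M * N)"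
  by (simp add: tens_def vecs_def)

lemma vecs_eqI_enc:
  assumes "u \<in> vecs (M * N)" "v \<in> vecs (M * N)" "\<And>x y. x < M \<Longrightarrow> y < N \<Longrightarrow> u (x * N + y) = v (x * N + y)"
  shows "u = v"
proof
  fix k show "u k = v k"
  proof (cases "k < M * N")
    case True
    then have "0 < N" by (auto intro!: Nat.gr0I)
    then show ?thesis using True assms(3)[of "k div N" "k mod N"] by (simp add: less_mult_imp_div_less)
  qed (use assms(1,2) in \<open>auto simp: vecs_def\<close>)
qed

lemma tens_add_scaled_right: "tens M N u (\<lambda>i. v i + c * w i) = (\<lambda>i. tens M N u v i + c * tens M N u w i)"
  by (auto simp: tens_def algebra_simps)

lemma tens_0_right: "tens M N u (\<lambda>i. 0) = (\<lambda>i. 0)"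
  by (auto simp: tens_def)

lemma mat_supp_kron: "mat_supp (M * N) (M * N) (kron M N A B)"
  by (auto simp: mat_supp_def kron_def)

lemma kron_enc: "x < M \<Longrightarrow> y < N \<Longrightarrow> x' < M \<Longrightarrow> y' < N \<Longrightarrow> kron M N A B (x * N + y) (x' * N + y') = A x x' * B y y'"
  by (simp add: kron_def enc_less)

lemma mv_kron_tens: "mv (M * N) (kron M N A B) (tens M N u v) = tens M N (mv M A u) (mv N B v)"
proof (rule vecs_eqI_enc[OF mv_in_vecs[OF mat_supp_kron] tens_in_vecs])
  fix x y assume xy: "x < M" "y < N"
  have "mv (M * N) (kron M N A B) (tens M N u v) (x * N + y) = (\<Sum>x'<M. \<Sum>y'<N. (A x x' * u x') * (B y y' * v y'))"
    unfolding mv_def sum_mult_split using xy by (intro sum.cong refl) (simp add: kron_enc tens_enc)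
  then show "mv (M * N) (kron M N A B) (tens M N u v) (x * N + y) = tens M N (mv M A u) (mv N B v) (x * N + y)"
    using xy by (simp add: tens_enc mv_def sum_product)
qed

lemma mv_ksum_tens:
  assumes "x < M" "y < N"
  shows "mv (M * N) (ksum N A B) (tens M N u v) (x * N + y) = mv M A u x * v y + u x * mv N B v y"
proof -
  have "mv M A (\<lambda>x. tens M N u v (x * N + y)) = mv M A (\<lambda>x. u x * v y)"
    using assms by (intro mv_cong) (simp add: tens_enc)
  moreover have "mv N B (\<lambda>y. tens M N u v (x * N + y)) = mv N B (\<lambda>y. u x * v y)"
    using assms by (intro mv_cong) (simp add: tens_enc)
  ultimately show ?thesis using assms
    by (simp add: mv_ksum) (simp add: mv_def sum_distrib_left sum_distrib_right mult_ac)
qed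

lemma dsym_add_scaled: "dsym l (\<lambda>i j. A i j + c * B i j) = (\<lambda>i j. dsym l A i j + c * dsym l B i j)"
  by (intro ext) (auto simp: dsym_def algebra_simps)

lemma dext_add_scaled: "dext n d (\<lambda>i j. A i j + c * B i j) = (\<lambda>i j. dext n d A i j + c * dext n d B i j)"
  by (intro ext) (simp add: dext_def lie_op_def sum.distrib sum_distrib_left algebra_simps)

lemma ksum_add_scaled: "ksum N (\<lambda>i j. A i j + c * B i j) (\<lambda>i j. C i j + c * D i j) = (\<lambda>i j. ksum N A C i j + c * ksum N B D i j)"
  by (intro ext) (simp add: ksum_def algebra_simps)

lemma mv_mat_add_scaled: "mv N (\<lambda>i j. A i j + c * B i j) v = (\<lambda>i. mv N A v i + c * mv N B v i)"
  by (intro ext) (simp add: mv_def sum.distrib sum_distrib_left algebra_simps)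

lemma dsym_0: "dsym l (\<lambda>_ _. 0) = (\<lambda>_ _. 0)"
  by (intro ext) (simp add: dsym_def)

lemma dext_0: "dext n d (\<lambda>_ _. 0) = (\<lambda>_ _. 0)"
  by (intro ext) (simp add: dext_def lie_op_def)

lemma mv_mat_0: "mv N (\<lambda>_ _. 0) v = (\<lambda>_. 0)"
  by (simp add: mv_def)

definition DP :: "nat \<Rightarrow> nat \<Rightarrow> nat \<Rightarrow> nat \<Rightarrow> cmat \<Rightarrow> cmat \<Rightarrow> cmat" where
  "DP n k a b A1 A2 = ksum (Ne n a * Ne n b) (dsym k A1) (ksum (Ne n b) (dext n a A2) (dext n b A2))"

definition DV :: "nat \<Rightarrow> nat \<Rightarrow> nat \<Rightarrow> nat \<Rightarrow> nat \<Rightarrow> cmat \<Rightarrow> cmat \<Rightarrow> cmat" where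
  "DV n r p l d A1 A2 = ksum ((l + 1) * Ne n d) (ksum (Ne n p) (dsym r A1) (dext n p A2)) (ksum (Ne n d) (dsym l A1) (dext n d A2))"

lemma DP_add_scaled: "DP n k a b (\<lambda>i j. A i j + c * B i j) (\<lambda>i j. C i j + c * D i j) = (\<lambda>i j. DP n k a b A C i j + c * DP n k a b B D i j)"
  unfolding DP_def dsym_add_scaled dext_add_scaled ksum_add_scaled ..

lemma DV_add_scaled: "DV n r p l d (\<lambda>i j. A i j + c * B i j) (\<lambda>i j. C i j + c * D i j) = (\<lambda>i j. DV n r p l d A C i j + c * DV n r p l d B D i j)"
  unfolding DV_def dsym_add_scaled dext_add_scaled ksum_add_scaled ..

definition lie_ok :: "nat \<Rightarrow> nat \<Rightarrow> nat \<Rightarrow> nat \<Rightarrow> nat \<Rightarrow> nat \<Rightarrow> nat \<Rightarrow> nat \<Rightarrow> cmat \<Rightarrow> cmat \<Rightarrow> cmat \<Rightarrow> bool" where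
  "lie_ok n k a b r p l d T A1 A2 \<longleftrightarrow> (\<forall>v\<in>rsp (pirep n k a b). \<forall>x<rdim (vrep n r p l d).
     mv (rdim (pirep n k a b)) T (mv (rdim (pirep n k a b)) (DP n k a b A1 A2) v) x
      = mv (rdim (vrep n r p l d)) (DV n r p l d A1 A2) (mv (rdim (pirep n k a b)) T v) x)"

text \<open>The passage to the complexified Lie algebra: the group yields the relation for
  skew-Hermitian generators, and it is complex-linear in the generator.\<close>

lemma lie_ok_add_scaled:
  assumes "lie_ok n k a b r p l d T A1 A2" "lie_ok n k a b r p l d T B1 B2"
  shows "lie_ok n k a b r p l d T (\<lambda>i j. A1 i j + c * B1 i j) (\<lambda>i j. A2 i j + c * B2 i j)"
  using assms unfolding lie_ok_def DP_add_scaled DV_add_scaled mv_mat_add_scaled mv_add_scaled by simp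

lemma lie_ok_base:
  assumes T: "T \<in> homs n (pirep n k a b) (vrep n r p l d)" and g1: "good_gen 1 \<tau>1 \<alpha>1" and g2: "good_gen n \<tau>2 \<alpha>2"
  shows "lie_ok n k a b r p l d T (mgen \<tau>1 \<alpha>1) (mgen \<tau>2 \<alpha>2)"
proof -
  let ?g1 = "mcurve 1 \<tau>1 \<alpha>1" and ?g2 = "mcurve n \<tau>2 \<alpha>2"
  have curve: "(?g1 (of_real t), ?g2 (of_real t)) \<in> Grp n" for t
    using mcurve_in_Sp[OF g1] mcurve_in_Sp[OF g2] by (simp add: Grp_def)
  have S: "rep_deriv (Symrep l) ?g1 ?g2 (dsym l (mgen \<tau>1 \<alpha>1))" for l
    by (rule rep_deriv_Symrep) (use mcurve_deriv[of _ 1] mcurve_0[of _ 1] in auto)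
  have E: "rep_deriv (Extrep n d) ?g1 ?g2 (dext n d (mgen \<tau>2 \<alpha>2))" for d
    by (rule rep_deriv_Extrep) (use mcurve_deriv mcurve_0 in auto)
  have top: "rep_deriv (toprep n a b) ?g1 ?g2 (ksum (Ne n b) (dext n a (mgen \<tau>2 \<alpha>2)) (dext n b (mgen \<tau>2 \<alpha>2)))"
    using rep_deriv_tensor[OF E E, of a b] by (simp add: rep_deriv_def toprep_def Let_def tensor_rep_def Extrep_def)
  have P: "rep_deriv (pirep n k a b) ?g1 ?g2 (DP n k a b (mgen \<tau>1 \<alpha>1) (mgen \<tau>2 \<alpha>2))"
    using rep_deriv_tensor[OF S[of k] top] by (simp add: pirep_def DP_def)
  have V: "rep_deriv (vrep n r p l d) ?g1 ?g2 (DV n r p l d (mgen \<tau>1 \<alpha>1) (mgen \<tau>2 \<alpha>2))"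
    using rep_deriv_tensor[OF rep_deriv_tensor[OF S[of r] E[of p]] rep_deriv_tensor[OF S[of l] E[of d]]]
    by (simp add: vrep_def DV_def)
  show ?thesis unfolding lie_ok_def using homs_infinitesimal[OF T curve P V] by blast
qed

lemma good_gen_0: "good_gen m id (\<lambda>_. 0)"
  by (auto simp: good_gen_def)

lemma mgen_0: "mgen id (\<lambda>_. 0) = (\<lambda>_ _. 0)"
  by (intro ext) (simp add: mgen_def)

section \<open>Root vectors as complex combinations of skew-Hermitian generators\<close>

definition short_perm :: "nat \<Rightarrow> nat \<Rightarrow> nat \<Rightarrow> nat \<Rightarrow> nat" where
  "short_perm n i j x = (if x = i then j else if x = j then i else if x = n + i then n + j else if x = n + j then n + i else x)"

definition long_perm :: "nat \<Rightarrow> nat \<Rightarrow> nat \<Rightarrow> nat" where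
  "long_perm n i x = (if x = i then n + i else if x = n + i then i else x)"

definition coef4 :: "nat \<Rightarrow> nat \<Rightarrow> nat \<Rightarrow> complex \<Rightarrow> complex \<Rightarrow> complex \<Rightarrow> complex \<Rightarrow> cvec" where
  "coef4 n i j p q r s x = (if x = i then p else if x = j then q else if x = n + i then r else if x = n + j then s else 0)"

definition coef2 :: "nat \<Rightarrow> nat \<Rightarrow> complex \<Rightarrow> complex \<Rightarrow> cvec" where
  "coef2 n i p q x = (if x = i then p else if x = n + i then q else 0)"

lemma good_gen_short_aux:
  assumes ij: "i < j" "j < n" and c: "cnj p * p = 1" "q = - cnj p" "r = cnj p" "s = cnj q"
  shows "good_gen n (short_perm n i j) (coef4 n i j p q r s)"
  unfolding good_gen_def
proof (intro allI impI)
  fix x assume x: "x < 2 * n"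
  have c': "p * cnj p = 1" using c(1) by (simp add: mult.commute)
  consider "x = i" | "x = j" | "x = n + i" | "x = n + j" | "x \<noteq> i" "x \<noteq> j" "x \<noteq> n + i" "x \<noteq> n + j" by blast
  then show "short_perm n i j x < 2 * n \<and> short_perm n i j (short_perm n i j x) = x \<and>
    (coef4 n i j p q r s x \<noteq> 0 \<longrightarrow> cnj (coef4 n i j p q r s x) * coef4 n i j p q r s x = 1) \<and>
    cnj (coef4 n i j p q r s x) = - coef4 n i j p q r s (short_perm n i j x) \<and>
    short_perm n i j (partner n x) = partner n (short_perm n i j x) \<and>
    coef4 n i j p q r s (partner n x) * (psgn n (short_perm n i j x) * psgn n x) = cnj (coef4 n i j p q r s x)"
  proof cases
    case 5
    then have "partner n x \<noteq> i" "partner n x \<noteq> j" "partner n x \<noteq> n + i" "partner n x \<noteq> n + j"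
      using x ij by (auto simp: partner_def)
    then show ?thesis using 5 x by (simp add: short_perm_def coef4_def)
  qed (use ij c c' in \<open>simp_all add: short_perm_def coef4_def partner_def psgn_def add.commute\<close>)
qed

text \<open>For a root vector \<open>E\<close> and its opposite \<open>F\<close> these are the
  skew-Hermitian elements \<open>E - F\<close> and \<open>\<i> (E + F)\<close>, from which
  \<open>E = ((E - F) - \<i> (\<i> (E + F))) / 2\<close> is recovered.\<close>

lemma good_gen_short:
  assumes "i < j" "j < n"
  shows "good_gen n (short_perm n i j) (coef4 n i j (-1) 1 (-1) 1)"
    "good_gen n (short_perm n i j) (coef4 n i j \<i> \<i> (-\<i>) (-\<i>))"
  by (rule good_gen_short_aux[OF assms]; simp)+

lemma good_gen_long_aux:
  assumes i: "i < n" and c: "cnj p * p = 1" "q = - cnj p"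
  shows "good_gen n (long_perm n i) (coef2 n i p q)"
  unfolding good_gen_def
proof (intro allI impI)
  fix x assume x: "x < 2 * n"
  have c': "p * cnj p = 1" using c(1) by (simp add: mult.commute)
  consider "x = i" | "x = n + i" | "x \<noteq> i" "x \<noteq> n + i" by blast
  then show "long_perm n i x < 2 * n \<and> long_perm n i (long_perm n i x) = x \<and>
    (coef2 n i p q x \<noteq> 0 \<longrightarrow> cnj (coef2 n i p q x) * coef2 n i p q x = 1) \<and>
    cnj (coef2 n i p q x) = - coef2 n i p q (long_perm n i x) \<and>
    long_perm n i (partner n x) = partner n (long_perm n i x) \<and>
    coef2 n i p q (partner n x) * (psgn n (long_perm n i x) * psgn n x) = cnj (coef2 n i p q x)"
  proof cases
    case 3
    then have "partner n x \<noteq> i" "partner n x \<noteq> n + i"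
      using x i by (auto simp: partner_def)
    then show ?thesis using 3 x by (simp add: long_perm_def coef2_def)
  qed (use i c c' in \<open>simp_all add: long_perm_def coef2_def partner_def psgn_def add.commute\<close>)
qed

lemma good_gen_cartan:
  assumes i: "i < n"
  shows "good_gen n id (coef2 n i \<i> (-\<i>))"
  unfolding good_gen_def
proof (intro allI impI)
  fix x assume x: "x < 2 * n"
  consider "x = i" | "x = n + i" | "x \<noteq> i" "x \<noteq> n + i" by blast
  then show "id x < 2 * n \<and> id (id x) = x \<and>
    (coef2 n i \<i> (-\<i>) x \<noteq> 0 \<longrightarrow> cnj (coef2 n i \<i> (-\<i>) x) * coef2 n i \<i> (-\<i>) x = 1) \<and>
    cnj (coef2 n i \<i> (-\<i>) x) = - coef2 n i \<i> (-\<i>) (id x) \<and> id (partner n x) = partner n (id x) \<and>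
    coef2 n i \<i> (-\<i>) (partner n x) * (psgn n (id x) * psgn n x) = cnj (coef2 n i \<i> (-\<i>) x)"
  proof cases
    case 3
    then have "partner n x \<noteq> i" "partner n x \<noteq> n + i"
      using x i by (auto simp: partner_def)
    then show ?thesis using 3 x by (simp add: coef2_def)
  qed (use i in \<open>simp_all add: coef2_def partner_def psgn_def add.commute\<close>)
qed

lemma good_gen_long:
  assumes "i < n"
  shows "good_gen n (long_perm n i) (coef2 n i (-1) 1)" "good_gen n (long_perm n i) (coef2 n i \<i> \<i>)"
  by (rule good_gen_long_aux[OF assms]; simp)+

text \<open>Written as \<open>0 + c * (u + c' * v)\<close> so that two applications of
  \<open>lie_ok_add_scaled\<close> match literally.\<close>

lemma short_root_mgen:
  assumes "i < j" "j < n"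
  shows "short_root n i j = (\<lambda>x y. 0 + (1/2) * (mgen (short_perm n i j) (coef4 n i j (-1) 1 (-1) 1) x y
     + (-\<i>) * mgen (short_perm n i j) (coef4 n i j \<i> \<i> (-\<i>) (-\<i>)) x y))"
proof (intro ext)
  fix x y
  consider "y = i" | "y = j" | "y = n + i" | "y = n + j" | "y \<noteq> i" "y \<noteq> j" "y \<noteq> n + i" "y \<noteq> n + j" by blast
  then show "short_root n i j x y = 0 + (1/2) * (mgen (short_perm n i j) (coef4 n i j (-1) 1 (-1) 1) x y
     + (-\<i>) * mgen (short_perm n i j) (coef4 n i j \<i> \<i> (-\<i>) (-\<i>)) x y)"
    by cases (use assms in \<open>simp_all add: short_root_def unitm_def mgen_def short_perm_def coef4_def\<close>)
qed

lemma long_root_mgen: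
  assumes "i < n"
  shows "long_root n i = (\<lambda>x y. 0 + (1/2) * (mgen (long_perm n i) (coef2 n i (-1) 1) x y
     + (-\<i>) * mgen (long_perm n i) (coef2 n i \<i> \<i>) x y))"
proof (intro ext)
  fix x y
  consider "y = i" | "y = n + i" | "y \<noteq> i" "y \<noteq> n + i" by blast
  then show "long_root n i x y = 0 + (1/2) * (mgen (long_perm n i) (coef2 n i (-1) 1) x y
     + (-\<i>) * mgen (long_perm n i) (coef2 n i \<i> \<i>) x y)"
    by cases (use assms in \<open>simp_all add: long_root_def unitm_def mgen_def long_perm_def coef2_def\<close>)
qed

text \<open>With the opposite sign of \<open>\<i>\<close> the same two generators yield the lowering
  operator.\<close>

lemma lower_mgen: "unitm 1 0 = (\<lambda>x y. 0 + (-1/2) * (mgen (long_perm 1 0) (coef2 1 0 (-1) 1) x y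
     + \<i> * mgen (long_perm 1 0) (coef2 1 0 \<i> \<i>) x y))"
proof (intro ext)
  fix x y :: nat
  consider "y = 0" | "y = 1" | "y \<noteq> 0" "y \<noteq> 1" by blast
  then show "unitm 1 0 x y = 0 + (-1/2) * (mgen (long_perm 1 0) (coef2 1 0 (-1) 1) x y
     + \<i> * mgen (long_perm 1 0) (coef2 1 0 \<i> \<i>) x y)"
    by cases (simp_all add: unitm_def mgen_def long_perm_def coef2_def)
qed

lemma cartan_mgen:
  assumes "i < n"
  shows "cartan n i = (\<lambda>x y. 0 + (-\<i>) * mgen id (coef2 n i \<i> (-\<i>)) x y)"
proof (intro ext)
  fix x y
  consider "y = i" | "y = n + i" | "y \<noteq> i" "y \<noteq> n + i" by blast
  then show "cartan n i x y = 0 + (-\<i>) * mgen id (coef2 n i \<i> (-\<i>)) x y"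
    by cases (use assms in \<open>simp_all add: cartan_def unitm_def mgen_def coef2_def\<close>)
qed

context
  fixes n k a b r p l d T
  assumes T: "T \<in> homs n (pirep n k a b) (vrep n r p l d)"
begin

lemma lie_ok_zero: "lie_ok n k a b r p l d T (\<lambda>_ _. 0) (\<lambda>_ _. 0)"
  using lie_ok_base[OF T good_gen_0 good_gen_0] by (simp add: mgen_0)

lemma lie_ok_sym_gen:
  assumes "good_gen 1 \<tau> \<alpha>" shows "lie_ok n k a b r p l d T (mgen \<tau> \<alpha>) (\<lambda>_ _. 0)"
  using lie_ok_base[OF T assms good_gen_0] by (simp add: mgen_0)

lemma lie_ok_ext_gen:
  assumes "good_gen n \<tau> \<alpha>" shows "lie_ok n k a b r p l d T (\<lambda>_ _. 0) (mgen \<tau> \<alpha>)"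
  using lie_ok_base[OF T good_gen_0 assms] by (simp add: mgen_0)

lemma lie_ok_short: "i < j \<Longrightarrow> j < n \<Longrightarrow> lie_ok n k a b r p l d T (\<lambda>_ _. 0) (short_root n i j)"
  using lie_ok_add_scaled[OF lie_ok_zero lie_ok_add_scaled[OF lie_ok_ext_gen lie_ok_ext_gen, OF good_gen_short, of i j i j "-\<i>"], of "1/2"]
  by (simp add: short_root_mgen)

lemma lie_ok_long: "i < n \<Longrightarrow> lie_ok n k a b r p l d T (\<lambda>_ _. 0) (long_root n i)"
  using lie_ok_add_scaled[OF lie_ok_zero lie_ok_add_scaled[OF lie_ok_ext_gen lie_ok_ext_gen, OF good_gen_long(1,2), of i i "-\<i>"], of "1/2"]
  by (simp add: long_root_mgen)

lemma lie_ok_cartan: "i < n \<Longrightarrow> lie_ok n k a b r p l d T (\<lambda>_ _. 0) (cartan n i)"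
  using lie_ok_add_scaled[OF lie_ok_zero lie_ok_ext_gen, OF good_gen_cartan, of i "-\<i>"]
  by (simp add: cartan_mgen)

lemma lie_ok_raise1: "lie_ok n k a b r p l d T (unitm 0 1) (\<lambda>_ _. 0)"
  using lie_ok_add_scaled[OF lie_ok_zero lie_ok_add_scaled[OF lie_ok_sym_gen lie_ok_sym_gen, OF good_gen_long(1,2), of 0 0 "-\<i>"], of "1/2"]
    long_root_mgen[of 0 1] by (simp add: long_root_def)

text \<open>Used in \<open>homs_eq_0\<close> to descend from \<open>x^k\<close> to all
  monomials.\<close>

lemma lie_ok_lower1: "lie_ok n k a b r p l d T (unitm 1 0) (\<lambda>_ _. 0)"
  using lie_ok_add_scaled[OF lie_ok_zero lie_ok_add_scaled[OF lie_ok_sym_gen lie_ok_sym_gen, OF good_gen_long(1,2), of 0 0 "\<i>"], of "-1/2"]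
  unfolding lower_mgen by simp

lemma lie_ok_cartan1: "lie_ok n k a b r p l d T (cartan 1 0) (\<lambda>_ _. 0)"
  using lie_ok_add_scaled[OF lie_ok_zero lie_ok_sym_gen, OF good_gen_cartan, of 0 "-\<i>"] cartan_mgen[of 0 1]
  by simp

end

section \<open>The highest weight vector of the source\<close>

lemma enc_cases:
  fixes x :: nat
  assumes "x < M * N"
  obtains i y where "i < M" "y < N" "x = i * N + y"
proof (rule that[of "x div N" "x mod N"])
  have "0 < N" using assms by (auto intro!: Nat.gr0I)
  then show "x div N < M" "x mod N < N" using assms by (simp_all add: less_mult_imp_div_less)
  show "x = x div N * N + x mod N" by (simp only: div_mult_mod_eq)
qed

definition hwv :: "nat \<Rightarrow> nat \<Rightarrow> nat \<Rightarrow> cvec" where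
  "hwv n a b = tens (Ne n a) (Ne n b) (ext_basis n a [0..<a]) (ext_basis n b [0..<b])"

definition unitv :: "nat \<Rightarrow> cvec" where
  "unitv i = (\<lambda>j. if j = i then 1 else 0)"

text \<open>\<open>unitv k\<close> is the monomial \<open>x^k\<close>, the highest weight vector of
  \<open>Sym^k\<close>, as exponents of \<open>x\<close> index the basis.\<close>

definition hwv0 :: "nat \<Rightarrow> nat \<Rightarrow> nat \<Rightarrow> nat \<Rightarrow> cvec" where
  "hwv0 n k a b = tens (k + 1) (Ne n a * Ne n b) (unitv k) (hwv n a b)"

lemma rsp_toprep: "rsp (toprep n a b) = cspan {mv (Ne n a * Ne n b)
    (kron (Ne n a) (Ne n b) (ext_act n a g2) (ext_act n b g2)) (hwv n a b) | g1 g2. (g1, g2) \<in> Grp n}"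
  by (simp add: toprep_def Let_def tensor_rep_def Extrep_def hwv_def)

lemma ract_toprep: "ract (toprep n a b) g1 g2 = kron (Ne n a) (Ne n b) (ext_act n a g2) (ext_act n b g2)"
  by (simp add: toprep_def Let_def tensor_rep_def Extrep_def)

lemma mv_idn: "v \<in> vecs N \<Longrightarrow> (\<And>i j. i < N \<Longrightarrow> j < N \<Longrightarrow> A i j = (if i = j then 1 else 0)) \<Longrightarrow> mat_supp N N A \<Longrightarrow> mv N A v = v"
proof (rule ext)
  fix i assume v: "v \<in> vecs N" and A: "\<And>i j. i < N \<Longrightarrow> j < N \<Longrightarrow> A i j = (if i = j then 1 else 0)" "mat_supp N N A"
  show "mv N A v i = v i"
  proof (cases "i < N")
    case True
    have "mv N A v i = (\<Sum>j<N. if i = j then v j else 0)"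
      unfolding mv_def using A(1)[OF True] by (intro sum.cong) auto
    then show ?thesis using True by simp
  qed (use v A in \<open>auto simp: mv_def vecs_def mat_supp_def\<close>)
qed

lemma in_Sp_idn: "in_Sp m (idn (2*m))"
proof -
  have "mcurve m id (\<lambda>_. 0) (of_real 0) = idn (2*m)" by (intro ext) (auto simp: mcurve_def idn_def)
  then show ?thesis using mcurve_in_Sp[OF good_gen_0[of m], of 0] by simp
qed

lemma ext_basis_vecs: "ext_basis n d I \<in> vecs (Ne n d)"
  by (auto simp: ext_basis_def vecs_def)

lemma ext_act_idn: "v \<in> vecs (Ne n d) \<Longrightarrow> mv (Ne n d) (ext_act n d (idn (2*n))) v = v"
proof (rule mv_idn[OF _ _ mat_supp_ext_act])
  fix i j assume ij: "i < Ne n d" "j < Ne n d"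
  have "detsub d (idn (2*n)) (subsets d (2*n) ! i) (subsets d (2*n) ! j) = detsub d idm (subsets d (2*n) ! i) (subsets d (2*n) ! j)"
    by (rule detsub_cong) (use ij in \<open>auto simp: idm_def idn_def nth_subsets_less\<close>)
  then show "ext_act n d (idn (2*n)) i j = (if i = j then 1 else 0)"
    using ij by (simp add: ext_act_def detsub_idm_subsets)
qed

lemma hwv_in_top: "hwv n a b \<in> rsp (toprep n a b)"
proof -
  have "(idn 2, idn (2*n)) \<in> Grp n" using in_Sp_idn[of 1] in_Sp_idn[of n] by (simp add: Grp_def)
  moreover have "mv (Ne n a * Ne n b) (kron (Ne n a) (Ne n b) (ext_act n a (idn (2*n))) (ext_act n b (idn (2*n)))) (hwv n a b) = hwv n a b"
    unfolding hwv_def mv_kron_tens by (simp add: ext_act_idn ext_basis_vecs)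
  ultimately show ?thesis unfolding rsp_toprep by (intro subsetD[OF cspan_superset]) force
qed

lemma tens_in_rsp: "u \<in> rsp R1 \<Longrightarrow> v \<in> rsp R2 \<Longrightarrow> tens (rdim R1) (rdim R2) u v \<in> rsp (tensor_rep R1 R2)"
  unfolding tensor_rep_def by (auto intro!: subsetD[OF cspan_superset])

lemma unitv_vecs: "i \<le> k \<Longrightarrow> unitv i \<in> rsp (Symrep k)"
  by (auto simp: unitv_def Symrep_def vecs_def)

lemma tens_unitv_in_pirep: "i \<le> k \<Longrightarrow> u \<in> rsp (toprep n a b) \<Longrightarrow> tens (k + 1) (Ne n a * Ne n b) (unitv i) u \<in> rsp (pirep n k a b)"
  using tens_in_rsp[of "unitv i" "Symrep k" u "toprep n a b"] by (simp add: unitv_vecs pirep_def)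

section \<open>Carriers of tensor products and their slices\<close>

definition wf_rep :: "rep \<Rightarrow> bool" where
  "wf_rep R \<longleftrightarrow> csub (rsp R) \<and> rsp R \<subseteq> vecs (rdim R)"

lemma wf_Extrep: "wf_rep (Extrep n d)"
  by (simp add: wf_rep_def Extrep_def csub_prim_ext prim_ext_vecs)

lemma wf_tensor_rep: "wf_rep (tensor_rep R1 R2)"
proof -
  have "cspan {tens (rdim R1) (rdim R2) v w |v w. v \<in> rsp R1 \<and> w \<in> rsp R2} \<subseteq> vecs (rdim R1 * rdim R2)"
    by (rule cspan_least[OF csub_vecs]) (auto simp: tens_in_vecs)
  then show ?thesis by (simp add: wf_rep_def tensor_rep_def csub_cspan)
qed

text \<open>Fixing the index of the first factor sends a pure tensor to a multiple of its second
  component, hence the whole span into the second carrier. Applied twice, this shows that coordinate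
  slices of a target vector are primitive.\<close>

lemma tensor_slice2:
  assumes "wf_rep R2" "w \<in> rsp (tensor_rep R1 R2)" "x < rdim R1"
  shows "(\<lambda>y. if y < rdim R2 then w (x * rdim R2 + y) else 0) \<in> rsp R2"
proof -
  let ?f = "\<lambda>w y. if y < rdim R2 then w (x * rdim R2 + y) else 0 :: complex"
  have "csub {w. ?f w \<in> rsp R2}"
    using assms(1) by (intro csub_vimage) (auto simp: wf_rep_def)
  moreover have "?f (tens (rdim R1) (rdim R2) u v) \<in> rsp R2" if "v \<in> rsp R2" for u v
  proof -
    have "?f (tens (rdim R1) (rdim R2) u v) = (\<lambda>y. u x * v y)"
      using that assms(1,3) by (auto simp: fun_eq_iff tens_enc wf_rep_def vecs_def)
    then show ?thesis using assms(1) that by (simp add: wf_rep_def csub_scale)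
  qed
  ultimately have "cspan {tens (rdim R1) (rdim R2) v w |v w. v \<in> rsp R1 \<and> w \<in> rsp R2} \<subseteq> {w. ?f w \<in> rsp R2}"
    by (intro cspan_least) auto
  then show ?thesis using assms(2) by (auto simp: tensor_rep_def)
qed

lemma tensor_slice1:
  assumes "wf_rep R1" "w \<in> rsp (tensor_rep R1 R2)" "y < rdim R2"
  shows "(\<lambda>x. if x < rdim R1 then w (x * rdim R2 + y) else 0) \<in> rsp R1"
proof -
  let ?f = "\<lambda>w x. if x < rdim R1 then w (x * rdim R2 + y) else 0 :: complex"
  have "csub {w. ?f w \<in> rsp R1}"
    using assms(1) by (intro csub_vimage) (auto simp: wf_rep_def)
  moreover have "?f (tens (rdim R1) (rdim R2) u v) \<in> rsp R1" if "u \<in> rsp R1" for u v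
  proof -
    have "?f (tens (rdim R1) (rdim R2) u v) = (\<lambda>x. v y * u x)"
      using that assms(1,3) by (auto simp: fun_eq_iff tens_enc wf_rep_def vecs_def)
    then show ?thesis using assms(1) that by (simp add: wf_rep_def csub_scale)
  qed
  ultimately have "cspan {tens (rdim R1) (rdim R2) v w |v w. v \<in> rsp R1 \<and> w \<in> rsp R2} \<subseteq> {w. ?f w \<in> rsp R1}"
    by (intro cspan_least) auto
  then show ?thesis using assms(2) by (auto simp: tensor_rep_def)
qed

lemma vrep_slice_J:
  assumes w: "w \<in> rsp (vrep n r p l d)" and i: "i \<le> r" "I < Ne n p" "j \<le> l"
  shows "(\<lambda>J. if J < Ne n d then w (enc4 (Ne n p) (l + 1) (Ne n d) i I j J) else 0) \<in> prim_ext n d"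
proof -
  let ?M = "(l + 1) * Ne n d"
  have x: "i * Ne n p + I < rdim (tensor_rep (Symrep r) (Extrep n p))" using i by (auto intro!: enc_less[of i "r + 1", simplified])
  have "(\<lambda>y. if y < ?M then w ((i * Ne n p + I) * ?M + y) else 0) \<in> rsp (tensor_rep (Symrep l) (Extrep n d))"
    using tensor_slice2[OF wf_tensor_rep w[unfolded vrep_def] x] by (simp only: rdim_simps)
  from tensor_slice2[OF wf_Extrep this, of j, unfolded rdim_simps] i
  have "(\<lambda>J. if J < Ne n d then (if j * Ne n d + J < ?M then w ((i * Ne n p + I) * ?M + (j * Ne n d + J)) else 0) else 0) \<in> prim_ext n d"
    by (simp only: Extrep_def rep.simps less_Suc_eq_le Suc_eq_plus1[symmetric])
  moreover have "j * Ne n d + J < ?M" if "J < Ne n d" for J using i that by (intro enc_less) auto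
  ultimately show ?thesis by (simp add: enc4_def cong: if_cong)
qed

lemma vrep_slice_I:
  assumes w: "w \<in> rsp (vrep n r p l d)" and i: "i \<le> r" "j \<le> l" "J < Ne n d"
  shows "(\<lambda>I. if I < Ne n p then w (enc4 (Ne n p) (l + 1) (Ne n d) i I j J) else 0) \<in> prim_ext n p"
proof -
  let ?M = "(l + 1) * Ne n d" and ?R = "(r + 1) * Ne n p"
  have y: "j * Ne n d + J < rdim (tensor_rep (Symrep l) (Extrep n d))" using i by (auto intro!: enc_less[of j "l + 1", simplified])
  have "(\<lambda>x. if x < ?R then w (x * ?M + (j * Ne n d + J)) else 0) \<in> rsp (tensor_rep (Symrep r) (Extrep n p))"
    using tensor_slice1[OF wf_tensor_rep w[unfolded vrep_def] y] by (simp only: rdim_simps)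
  from tensor_slice2[OF wf_Extrep this, of i, unfolded rdim_simps] i
  have "(\<lambda>I. if I < Ne n p then (if i * Ne n p + I < ?R then w ((i * Ne n p + I) * ?M + (j * Ne n d + J)) else 0) else 0) \<in> prim_ext n p"
    by (simp only: Extrep_def rep.simps less_Suc_eq_le Suc_eq_plus1[symmetric])
  moreover have "i * Ne n p + I < ?R" if "I < Ne n p" for I using i that by (intro enc_less) auto
  ultimately show ?thesis by (simp add: enc4_def cong: if_cong)
qed

lemma ev_ext_basis:
  assumes "I \<in> set (subsets d (2*n))"
  shows "ev n d (ext_basis n d I) xs = detsub d idm xs I"
proof -
  obtain i where i: "i < Ne n d" "subsets d (2*n) ! i = I" using subsets_index[OF assms] .
  have "ev n d (ext_basis n d I) xs = (\<Sum>J<Ne n d. if J = i then detsub d idm xs (subsets d (2*n) ! J) else 0)"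
    unfolding ev_def ext_basis_def using i nth_subsets_eq_iff[of _ d "2*n" i] by (intro sum.cong refl) auto
  then show ?thesis using i by simp
qed

lemma detsub_idm_upt_eq_0:
  assumes "length xs = a" "set xs \<noteq> {..<a}"
  shows "detsub a idm xs [0..<a] = 0"
proof (cases "distinct xs")
  case True
  then show ?thesis using assms by (intro detsub_idm_eq_0) (auto simp: atLeast0LessThan)
qed (use assms in \<open>auto intro: detsub_idm_not_distinct\<close>)

lemma upt_mem_subsets: "a \<le> n \<Longrightarrow> [0..<a] \<in> set (subsets a (2*n))"
  by (auto simp: mem_subsets)

lemma
  assumes a: "a \<le> n" and I: "I < Ne n a"
  shows dext_short_hw: "u < v \<Longrightarrow> v < n \<Longrightarrow> mv (Ne n a) (dext n a (short_root n u v)) (ext_basis n a [0..<a]) I = 0"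
    and dext_long_hw: "u < n \<Longrightarrow> mv (Ne n a) (dext n a (long_root n u)) (ext_basis n a [0..<a]) I = 0"
    and dext_cartan_hw: "u < n \<Longrightarrow> mv (Ne n a) (dext n a (cartan n u)) (ext_basis n a [0..<a]) I
       = of_int (delta (u < a)) * ext_basis n a [0..<a] I"
proof -
  let ?x = "subsets a (2*n) ! I"
  let ?c = "\<lambda>xs. detsub a idm xs [0..<a]"
  have ev: "ev n a (ext_basis n a [0..<a]) = ?c"
    by (intro ext ev_ext_basis upt_mem_subsets a)
  have x: "length ?x = a" "distinct ?x" using nth_subsets[OF I] by auto
  have big: "?c zs = 0" if "length zs = a" "n + u \<in> set zs" for zs u
  proof (rule detsub_idm_upt_eq_0[OF that(1)])
    have "n + u \<notin> {..<a}" using a by simp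
    then show "set zs \<noteq> {..<a}" using that(2) by metis
  qed
  show "mv (Ne n a) (dext n a (short_root n u v)) (ext_basis n a [0..<a]) I = 0" if uv: "u < v" "v < n"
  proof -
    \<comment> \<open>After the replacement the entries contain \<open>v\<close> but not the smaller
      \<open>u\<close>, so they are not an initial segment.\<close>
    have "?c (rpl u v ?x) = 0" if "u \<in> set ?x"
    proof (rule detsub_idm_upt_eq_0)
      have "v \<in> set (rpl u v ?x)" "u \<notin> set (rpl u v ?x)" using that uv by (auto split: if_splits)
      then show "set (rpl u v ?x) \<noteq> {..<a}" using uv by (metis lessThan_iff order_less_trans)
    qed (use x in simp)
    moreover have "?c (rpl (n + v) (n + u) ?x) = 0" if "n + v \<in> set ?x"
      using that x by (intro big[of _ u]) auto
    ultimately show ?thesis unfolding mv_dext[OF I] ev using uv x by (simp add: lie_op_short_root)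
  qed
  show "mv (Ne n a) (dext n a (long_root n u)) (ext_basis n a [0..<a]) I = 0" if u: "u < n"
  proof -
    have "?c (rpl u (n + u) ?x) = 0" if "u \<in> set ?x" using that x by (intro big[of _ u]) auto
    then show ?thesis unfolding mv_dext[OF I] ev using u x by (simp add: lie_op_long_root)
  qed
  show "mv (Ne n a) (dext n a (cartan n u)) (ext_basis n a [0..<a]) I = of_int (delta (u < a)) * ext_basis n a [0..<a] I" if u: "u < n"
  proof -
    have "?c ?x = ext_basis n a [0..<a] I" using ev_subsets[OF I, of "ext_basis n a [0..<a]"] ev by simp
    moreover have "((if u \<in> set ?x then 1 else 0) - (if n + u \<in> set ?x then 1 else 0)) * ?c ?x = of_int (delta (u < a)) * ?c ?x"
    proof (cases "set ?x = {..<a}")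
      case True then show ?thesis using a by (auto simp: delta_def)
    next
      case False
      then have "?c ?x = 0" by (rule detsub_idm_upt_eq_0[OF x(1)])
      then show ?thesis by simp
    qed
    ultimately show ?thesis unfolding mv_dext[OF I] ev lie_op_cartan[OF x(2) u] by simp
  qed
qed

lemma DP_hwv0_ext:
  assumes A: "\<And>I. I < Ne n a \<Longrightarrow> mv (Ne n a) (dext n a A) (ext_basis n a [0..<a]) I = \<mu> * ext_basis n a [0..<a] I"
    and B: "\<And>I. I < Ne n b \<Longrightarrow> mv (Ne n b) (dext n b A) (ext_basis n b [0..<b]) I = \<nu> * ext_basis n b [0..<b] I"
    and x: "x < (k + 1) * (Ne n a * Ne n b)"
  shows "mv ((k + 1) * (Ne n a * Ne n b)) (DP n k a b (\<lambda>_ _. 0) A) (hwv0 n k a b) x = (\<mu> + \<nu>) * hwv0 n k a b x"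
proof -
  let ?N = "Ne n a * Ne n b"
  obtain i y where iy: "i < k + 1" "y < ?N" "x = i * ?N + y" by (rule enc_cases[OF x])
  obtain I J where IJ: "I < Ne n a" "J < Ne n b" "y = I * Ne n b + J" by (rule enc_cases[OF iy(2)])
  have "mv ?N (ksum (Ne n b) (dext n a A) (dext n b A)) (hwv n a b) y = (\<mu> + \<nu>) * hwv n a b y"
    unfolding hwv_def IJ(3) 
    unfolding mv_ksum_tens[OF IJ(1,2)] tens_enc[OF IJ(1,2)] A[OF IJ(1)] B[OF IJ(2)] by (simp only: distrib_right mult_ac)
  then show ?thesis unfolding DP_def hwv0_def iy(3) using iy
    by (simp only: mv_ksum_tens tens_enc dsym_0 mv_mat_0) (simp add: algebra_simps)
qed

lemma DP_sym:
  assumes "\<And>i. i < k + 1 \<Longrightarrow> mv (k + 1) (dsym k A) s i = s' i" and x: "x < (k + 1) * (Ne n a * Ne n b)"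
  shows "mv ((k + 1) * (Ne n a * Ne n b)) (DP n k a b A (\<lambda>_ _. 0)) (tens (k + 1) (Ne n a * Ne n b) s u) x
     = tens (k + 1) (Ne n a * Ne n b) s' u x"
proof -
  let ?N = "Ne n a * Ne n b"
  obtain i y where iy: "i < k + 1" "y < ?N" "x = i * ?N + y" by (rule enc_cases[OF x])
  have "ksum (Ne n b) (\<lambda>_ _. 0) (\<lambda>_ _. 0) = (\<lambda>_ _. 0)" by (intro ext) (simp add: ksum_def)
  then show ?thesis unfolding DP_def iy(3) using iy assms(1)[OF iy(1)]
    by (simp only: mv_ksum_tens tens_enc dext_0 mv_mat_0 mult_zero_right add_0_right)
qed

section \<open>Homomorphisms are determined by the highest weight vector\<close>

lemma homs_rsp: "T \<in> homs n P V \<Longrightarrow> v \<in> rsp P \<Longrightarrow> mv (rdim P) T v \<in> rsp V"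
  by (auto simp: homs_def)

lemma homs_supp: "T \<in> homs n P V \<Longrightarrow> mat_supp (rdim V) (rdim P) T"
  by (auto simp: homs_def)

lemma homs_perp: "T \<in> homs n P V \<Longrightarrow> v \<in> vecs (rdim P) \<Longrightarrow> (\<And>w. w \<in> rsp P \<Longrightarrow> hip (rdim P) v w = 0) \<Longrightarrow>
    mv (rdim P) T v = (\<lambda>i. 0)"
  by (simp add: homs_def hip_def)

lemma homs_equivariant: "T \<in> homs n P V \<Longrightarrow> (g1, g2) \<in> Grp n \<Longrightarrow> v \<in> rsp P \<Longrightarrow>
    mv (rdim P) T (mv (rdim P) (ract P g1 g2) v) = mv (rdim V) (ract V g1 g2) (mv (rdim P) T v)"
  unfolding homs_def by blast

lemma vecs_nonzero_less: "v \<in> vecs N \<Longrightarrow> v x \<noteq> 0 \<Longrightarrow> x < N"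
  by (rule ccontr) (simp add: vecs_def)

lemma mv_scale: "mv N A (\<lambda>i. c * v i) = (\<lambda>i. c * mv N A v i)"
  by (intro ext) (simp add: mv_def sum_distrib_left mult_ac)

lemma tens_scale_left: "tens M N (\<lambda>i. c * u i) v x = c * tens M N u v x"
  by (simp add: tens_def)

lemma hwv0_in_pirep: "hwv0 n k a b \<in> rsp (pirep n k a b)"
  unfolding hwv0_def by (intro tens_unitv_in_pirep hwv_in_top) simp

text \<open>Eigenvalue \<open>0\<close> covers the raising operators, general eigenvalues the
  weights.\<close>

lemma lie_ok_eigen:
  assumes "lie_ok n k a b r p l d T A1 A2"
    and "\<And>x. x < (k + 1) * (Ne n a * Ne n b) \<Longrightarrow> mv ((k + 1) * (Ne n a * Ne n b)) (DP n k a b A1 A2) (hwv0 n k a b) x = \<mu> * hwv0 n k a b x"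
    and "x < ((r + 1) * Ne n p) * ((l + 1) * Ne n d)"
  shows "mv (((r + 1) * Ne n p) * ((l + 1) * Ne n d)) (DV n r p l d A1 A2) (mv ((k + 1) * (Ne n a * Ne n b)) T (hwv0 n k a b)) x
     = \<mu> * mv ((k + 1) * (Ne n a * Ne n b)) T (hwv0 n k a b) x"
proof -
  let ?N = "(k + 1) * (Ne n a * Ne n b)"
  have "mv (((r + 1) * Ne n p) * ((l + 1) * Ne n d)) (DV n r p l d A1 A2) (mv ?N T (hwv0 n k a b)) x
      = mv ?N T (mv ?N (DP n k a b A1 A2) (hwv0 n k a b)) x"
    using assms(1)[unfolded lie_ok_def, rule_format, OF hwv0_in_pirep, of x] assms(3) by (simp only: rdim_simps)
  also have "mv ?N T (mv ?N (DP n k a b A1 A2) (hwv0 n k a b)) = mv ?N T (\<lambda>x. \<mu> * hwv0 n k a b x)"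
    using assms(2) by (intro mv_cong) simp
  finally show ?thesis by (simp only: mv_scale)
qed

context
  fixes n k a b r p l d T
  assumes T: "T \<in> homs n (pirep n k a b) (vrep n r p l d)" and ab: "a \<le> n" "b \<le> n"
begin

abbreviation (input) hw_comp :: "nat \<Rightarrow> nat \<Rightarrow> nat \<Rightarrow> nat \<Rightarrow> complex" where
  "hw_comp i I j J \<equiv> mv ((k + 1) * (Ne n a * Ne n b)) T (hwv0 n k a b) (enc4 (Ne n p) (l + 1) (Ne n d) i I j J)"

lemma hw_image_ext:
  assumes lie: "lie_ok n k a b r p l d T (\<lambda>_ _. 0) A"
    and A: "\<And>I. I < Ne n a \<Longrightarrow> mv (Ne n a) (dext n a A) (ext_basis n a [0..<a]) I = \<mu> * ext_basis n a [0..<a] I"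
    and B: "\<And>I. I < Ne n b \<Longrightarrow> mv (Ne n b) (dext n b A) (ext_basis n b [0..<b]) I = \<nu> * ext_basis n b [0..<b] I"
    and i: "i \<le> r" "I < Ne n p" "j \<le> l" "J < Ne n d"
  shows "mv (Ne n p) (dext n p A) (\<lambda>I. hw_comp i I j J) I + mv (Ne n d) (dext n d A) (\<lambda>J. hw_comp i I j J) J = (\<mu> + \<nu>) * hw_comp i I j J"
proof -
  have i': "i < r + 1" "j < l + 1" using i by auto
  show ?thesis
    using lie_ok_eigen[OF lie DP_hwv0_ext[OF A B] enc4_less[OF i'(1) i(2) i'(2) i(4)]]
    unfolding DV_def mv_ksum4[OF i'(1) i(2) i'(2) i(4)] dsym_0 mv_mat_0 by simp
qed

lemma hw_image_sym:
  assumes lie: "lie_ok n k a b r p l d T A (\<lambda>_ _. 0)"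
    and A: "\<And>i. i < k + 1 \<Longrightarrow> mv (k + 1) (dsym k A) (unitv k) i = \<mu> * unitv k i"
    and i: "i \<le> r" "I < Ne n p" "j \<le> l" "J < Ne n d"
  shows "mv (r + 1) (dsym r A) (\<lambda>i. hw_comp i I j J) i + mv (l + 1) (dsym l A) (\<lambda>j. hw_comp i I j J) j = \<mu> * hw_comp i I j J"
proof -
  have i': "i < r + 1" "j < l + 1" using i by auto
  have D: "mv ((k + 1) * (Ne n a * Ne n b)) (DP n k a b A (\<lambda>_ _. 0)) (hwv0 n k a b) x = \<mu> * hwv0 n k a b x"
    if "x < (k + 1) * (Ne n a * Ne n b)" for x
    using DP_sym[OF A that, of "hwv n a b"] unfolding hwv0_def tens_scale_left .
  show ?thesis
    using lie_ok_eigen[OF lie D enc4_less[OF i'(1) i(2) i'(2) i(4)]]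
    unfolding DV_def mv_ksum4[OF i'(1) i(2) i'(2) i(4)] dext_0 mv_mat_0 by simp
qed

lemma dsym_raise_top: "i < k + 1 \<Longrightarrow> mv (k + 1) (dsym k (unitm 0 1)) (unitv k) i = 0 * unitv k i"
  using dsym_raise[of i k "unitv k"] by (auto simp: unitv_def split: if_splits)

lemma dsym_cartan_top:
  assumes "i < k + 1" shows "mv (k + 1) (dsym k (cartan 1 0)) (unitv k) i = of_nat k * unitv k i"
proof -
  have "i \<le> k" using assms by simp
  then show ?thesis unfolding dsym_cartan[OF \<open>i \<le> k\<close>] by (simp add: unitv_def)
qed

lemma hw_image_short:
  assumes "u < v" "v < n" "i \<le> r" "I < Ne n p" "j \<le> l" "J < Ne n d"
  shows "mv (Ne n p) (dext n p (short_root n u v)) (\<lambda>I. hw_comp i I j J) I + mv (Ne n d) (dext n d (short_root n u v)) (\<lambda>J. hw_comp i I j J) J = 0"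
  using hw_image_ext[OF lie_ok_short[OF T assms(1,2)] _ _ assms(3-6), of 0 0] dext_short_hw ab assms(1,2) by simp

lemma hw_image_long:
  assumes "u < n" "i \<le> r" "I < Ne n p" "j \<le> l" "J < Ne n d"
  shows "mv (Ne n p) (dext n p (long_root n u)) (\<lambda>I. hw_comp i I j J) I + mv (Ne n d) (dext n d (long_root n u)) (\<lambda>J. hw_comp i I j J) J = 0"
  using hw_image_ext[OF lie_ok_long[OF T assms(1)] _ _ assms(2-5), of 0 0] dext_long_hw ab assms(1) by simp

lemma hw_image_cartan:
  assumes "u < n" "i \<le> r" "I < Ne n p" "j \<le> l" "J < Ne n d"
  shows "mv (Ne n p) (dext n p (cartan n u)) (\<lambda>I. hw_comp i I j J) I + mv (Ne n d) (dext n d (cartan n u)) (\<lambda>J. hw_comp i I j J) J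
     = of_int (delta (u < a) + delta (u < b)) * hw_comp i I j J"
  using hw_image_ext[OF lie_ok_cartan[OF T assms(1)] dext_cartan_hw[OF ab(1) _ assms(1)] dext_cartan_hw[OF ab(2) _ assms(1)] assms(2-5)]
  by simp

lemma hw_image_nonzero:
  assumes "mv ((k + 1) * (Ne n a * Ne n b)) T (hwv0 n k a b) \<noteq> (\<lambda>_. 0)"
  obtains i I j J where "i \<le> r" "I < Ne n p" "j \<le> l" "J < Ne n d" "hw_comp i I j J \<noteq> 0"
proof -
  obtain x where x: "mv ((k + 1) * (Ne n a * Ne n b)) T (hwv0 n k a b) x \<noteq> 0" using assms by blast
  have "mv ((k + 1) * (Ne n a * Ne n b)) T (hwv0 n k a b) \<in> vecs (((r + 1) * Ne n p) * ((l + 1) * Ne n d))"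
    using homs_supp[OF T] by (intro mv_in_vecs) (simp only: rdim_simps)
  then have "x < ((r + 1) * Ne n p) * ((l + 1) * Ne n d)" using x by (rule vecs_nonzero_less)
  then obtain i I j J where i: "i < r + 1" "I < Ne n p" "j < l + 1" "J < Ne n d" "x = enc4 (Ne n p) (l + 1) (Ne n d) i I j J"
    by (rule enc4_cases)
  show ?thesis by (rule that[OF _ i(2) _ i(4) x[unfolded i(5)]]) (use i in simp_all)
qed

lemma homs_component:
  assumes nz: "mv ((k + 1) * (Ne n a * Ne n b)) T (hwv0 n k a b) \<noteq> (\<lambda>_. 0)" and d: "d \<le> n"
  obtains i I J where "i \<le> r" "2 * i + l = k + r" "I < Ne n p" "J < Ne n d" "subsets d (2*n) ! J = [0..<d]"
    "mv ((k + 1) * (Ne n a * Ne n b)) T (hwv0 n k a b) (enc4 (Ne n p) (l + 1) (Ne n d) i I l J) \<noteq> 0"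
    "\<And>u. u < n \<Longrightarrow> delta (u \<in> set (subsets p (2*n) ! I)) - delta (n + u \<in> set (subsets p (2*n) ! I)) + delta (u < d)
       = delta (u < a) + delta (u < b)"
proof -
  have rsp: "mv ((k + 1) * (Ne n a * Ne n b)) T (hwv0 n k a b) \<in> rsp (vrep n r p l d)"
    using homs_rsp[OF T hwv0_in_pirep] by (simp only: rdim_simps)
  obtain i0 I0 j0 J0 where nz0: "i0 \<le> r" "I0 < Ne n p" "j0 \<le> l" "J0 < Ne n d" "hw_comp i0 I0 j0 J0 \<noteq> 0"
    by (rule hw_image_nonzero[OF nz])
  show ?thesis
  proof (rule highest_weight_component[of r p n l d hw_comp k "\<lambda>u. delta (u < a) + delta (u < b)", OF _ _ hw_image_short hw_image_long hw_image_cartan _ nz0 d])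
    show "mv (r + 1) (dsym r (unitm 0 1)) (\<lambda>i. hw_comp i I j J) i + mv (l + 1) (dsym l (unitm 0 1)) (\<lambda>j. hw_comp i I j J) j = 0"
      if "i \<le> r" "I < Ne n p" "j \<le> l" "J < Ne n d" for i I j J
      using hw_image_sym[OF lie_ok_raise1[OF T] dsym_raise_top that] by simp
    show "mv (r + 1) (dsym r (cartan 1 0)) (\<lambda>i. hw_comp i I j J) i + mv (l + 1) (dsym l (cartan 1 0)) (\<lambda>j. hw_comp i I j J) j = of_nat k * hw_comp i I j J"
      if "i \<le> r" "I < Ne n p" "j \<le> l" "J < Ne n d" for i I j J
      using hw_image_sym[OF lie_ok_cartan1[OF T] dsym_cartan_top that] .
    show "(\<lambda>J. if J < Ne n d then hw_comp i I j J else 0) \<in> prim_ext n d" if "i \<le> r" "I < Ne n p" "j \<le> l" for i I j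
      by (rule vrep_slice_J[OF rsp that])
  qed (assumption | rule that)+
qed

text \<open>The argument of \<open>homs_component\<close> with the two tensor factors exchanged: it
  is not symmetric in them, and the second pass yields the mirrored inequalities.\<close>

lemma homs_component_swapped:
  assumes nz: "mv ((k + 1) * (Ne n a * Ne n b)) T (hwv0 n k a b) \<noteq> (\<lambda>_. 0)" and p: "p \<le> n"
  obtains j J where "j \<le> l" "2 * j + r = k + l" "J < Ne n d"
    "\<And>u. u < n \<Longrightarrow> delta (u \<in> set (subsets d (2*n) ! J)) - delta (n + u \<in> set (subsets d (2*n) ! J)) + delta (u < p)
       = delta (u < a) + delta (u < b)"
proof -
  have rsp: "mv ((k + 1) * (Ne n a * Ne n b)) T (hwv0 n k a b) \<in> rsp (vrep n r p l d)"
    using homs_rsp[OF T hwv0_in_pirep] by (simp only: rdim_simps)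
  obtain i0 I0 j0 J0 where nz0: "i0 \<le> r" "I0 < Ne n p" "j0 \<le> l" "J0 < Ne n d" "hw_comp i0 I0 j0 J0 \<noteq> 0"
    by (rule hw_image_nonzero[OF nz])
  show ?thesis
  proof (rule highest_weight_component[of l d n r p "\<lambda>j J i I. hw_comp i I j J" k "\<lambda>u. delta (u < a) + delta (u < b)",
        OF _ _ _ _ _ _ nz0(3,4,1,2,5) p])
    show "mv (l + 1) (dsym l (unitm 0 1)) (\<lambda>j. hw_comp i I j J) j + mv (r + 1) (dsym r (unitm 0 1)) (\<lambda>i. hw_comp i I j J) i = 0"
      if "j \<le> l" "J < Ne n d" "i \<le> r" "I < Ne n p" for i I j J
      using hw_image_sym[OF lie_ok_raise1[OF T] dsym_raise_top that(3,4,1,2)] by (simp add: add.commute)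
    show "mv (l + 1) (dsym l (cartan 1 0)) (\<lambda>j. hw_comp i I j J) j + mv (r + 1) (dsym r (cartan 1 0)) (\<lambda>i. hw_comp i I j J) i = of_nat k * hw_comp i I j J"
      if "j \<le> l" "J < Ne n d" "i \<le> r" "I < Ne n p" for i I j J
      using hw_image_sym[OF lie_ok_cartan1[OF T] dsym_cartan_top that(3,4,1,2)] by (subst add.commute)
    show "mv (Ne n d) (dext n d (short_root n u v)) (\<lambda>J. hw_comp i I j J) J + mv (Ne n p) (dext n p (short_root n u v)) (\<lambda>I. hw_comp i I j J) I = 0"
      if "u < v" "v < n" "j \<le> l" "J < Ne n d" "i \<le> r" "I < Ne n p" for u v i I j J
      using hw_image_short[OF that(1,2,5,6,3,4)] by (subst add.commute)
    show "mv (Ne n d) (dext n d (long_root n u)) (\<lambda>J. hw_comp i I j J) J + mv (Ne n p) (dext n p (long_root n u)) (\<lambda>I. hw_comp i I j J) I = 0"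
      if "u < n" "j \<le> l" "J < Ne n d" "i \<le> r" "I < Ne n p" for u i I j J
      using hw_image_long[OF that(1,4,5,2,3)] by (subst add.commute)
    show "mv (Ne n d) (dext n d (cartan n u)) (\<lambda>J. hw_comp i I j J) J + mv (Ne n p) (dext n p (cartan n u)) (\<lambda>I. hw_comp i I j J) I
        = of_int (delta (u < a) + delta (u < b)) * hw_comp i I j J"
      if "u < n" "j \<le> l" "J < Ne n d" "i \<le> r" "I < Ne n p" for u i I j J
      using hw_image_cartan[OF that(1,4,5,2,3)] by (subst add.commute)
    show "(\<lambda>I. if I < Ne n p then hw_comp i I j J else 0) \<in> prim_ext n p" if "j \<le> l" "J < Ne n d" "i \<le> r" for i j J
      by (rule vrep_slice_I[OF rsp that(3,1,2)])
  qed (assumption | rule that)+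
qed

lemma dsym_lower_unitv: "i < k + 1 \<Longrightarrow> mv (k + 1) (dsym k (unitm 1 0)) (unitv (Suc j)) i = of_nat (Suc j) * unitv j i"
  if "Suc j \<le> k" for i j
proof -
  assume "i < k + 1"
  have "mv (k + 1) (dsym k (unitm 1 0)) (unitv (Suc j)) i = (\<Sum>i'<k + 1. if i' = Suc j then of_nat (Suc j) * unitv j i else 0)"
    unfolding mv_def by (intro sum.cong refl) (auto simp: unitv_def dsym_def unitm_def)
  then show ?thesis using that by simp
qed

text \<open>The vectors \<open>x^k \<otimes> u\<close> with \<open>u\<close> in
  \<open>toprep\<close> come from \<open>hwv0\<close> by \<open>Sp(n)\<close>, the other monomials
  by the lowering operator of \<open>Sp(1)\<close>, and on the orthogonal complement of the carrier
  a homomorphism vanishes by the definition of \<open>homs\<close>.\<close>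

lemma homs_eq_0:
  assumes z: "mv ((k + 1) * (Ne n a * Ne n b)) T (hwv0 n k a b) = (\<lambda>_. 0)"
  shows "T = (\<lambda>_ _. 0)"
proof -
  let ?B = "Ne n a * Ne n b"
  let ?N = "(k + 1) * ?B"
  let ?M = "((r + 1) * Ne n p) * ((l + 1) * Ne n d)"
  have supp: "mat_supp ?M ?N T" using homs_supp[OF T] by (simp only: rdim_simps)
  have vanish: "csub {v. mv ?N T v \<in> {\<lambda>_. 0}}"
    by (rule csub_vimage) (auto simp: csub_def mv_add_scaled mv_0)
  have top: "mv ?N T (tens (k + 1) ?B (unitv k) u) = (\<lambda>_. 0)" if "u \<in> rsp (toprep n a b)" for u
  proof -
    have cs: "csub {u. mv ?N T (tens (k + 1) ?B (unitv k) u) \<in> {\<lambda>_. 0}}"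
      by (rule csub_vimage) (auto simp: csub_def tens_add_scaled_right tens_0_right mv_add_scaled mv_0)
    have "mv ?N T (tens (k + 1) ?B (unitv k) (mv ?B (kron (Ne n a) (Ne n b) (ext_act n a g2) (ext_act n b g2)) (hwv n a b))) = (\<lambda>_. 0)"
      if g: "(g1, g2) \<in> Grp n" for g1 g2
    proof -
      \<comment> \<open>Pairing \<open>g2\<close> with the identity of \<open>Sp(1)\<close> moves
        the exterior part alone and keeps \<open>x^k\<close> fixed.\<close>
      have g': "(idn 2, g2) \<in> Grp n" using g in_Sp_idn[of 1] by (simp add: Grp_def)
      have "mat_supp (k + 1) (k + 1) (sym_act k (idn 2))" by (auto simp: mat_supp_def sym_act_def)
      then have id: "mv (k + 1) (sym_act k (idn 2)) (unitv k) = unitv k"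
        by (intro mv_idn) (auto simp: unitv_def vecs_def sym_act_id idn_def)
      have act: "mv ?N (ract (pirep n k a b) (idn 2) g2) (hwv0 n k a b)
         = tens (k + 1) ?B (unitv k) (mv ?B (kron (Ne n a) (Ne n b) (ext_act n a g2) (ext_act n b g2)) (hwv n a b))"
        unfolding hwv0_def pirep_def tensor_rep_def rep.simps rdim_simps ract_toprep Symrep_def mv_kron_tens id ..
      have "mv (rdim (pirep n k a b)) T (mv (rdim (pirep n k a b)) (ract (pirep n k a b) (idn 2) g2) (hwv0 n k a b))
          = mv (rdim (vrep n r p l d)) (ract (vrep n r p l d) (idn 2) g2) (mv (rdim (pirep n k a b)) T (hwv0 n k a b))"
        by (rule homs_equivariant[OF T g' hwv0_in_pirep])
      then show ?thesis unfolding rdim_simps act z mv_0 .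
    qed
    then have "rsp (toprep n a b) \<subseteq> {u. mv ?N T (tens (k + 1) ?B (unitv k) u) \<in> {\<lambda>_. 0}}"
      unfolding rsp_toprep by (intro cspan_least[OF cs]) auto
    then show ?thesis using that by auto
  qed
  \<comment> \<open>Descent on the exponent of \<open>x\<close>; each lowering step produces a
    nonzero integer factor, which is cancelled.\<close>
  have all: "mv ?N T (tens (k + 1) ?B (unitv (k - m)) u) = (\<lambda>_. 0)" if u: "u \<in> rsp (toprep n a b)" and "m \<le> k" for u m
    using that(2)
  proof (induction m)
    case (Suc m)
    let ?j = "k - Suc m"
    have j: "k - m = Suc ?j" "Suc ?j \<le> k" using Suc.prems by auto
    have IH: "mv ?N T (tens (k + 1) ?B (unitv (Suc ?j)) u) = (\<lambda>_. 0)" using Suc.IH Suc.prems j(1) by simp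
    have mem: "tens (k + 1) ?B (unitv (Suc ?j)) u \<in> rsp (pirep n k a b)" by (rule tens_unitv_in_pirep[OF j(2) u])
    have "of_nat (Suc ?j) * mv ?N T (tens (k + 1) ?B (unitv ?j) u) x = 0" for x
    proof (cases "x < ?M")
      case True
      have "mv ?N T (mv ?N (DP n k a b (unitm 1 0) (\<lambda>_ _. 0)) (tens (k + 1) ?B (unitv (Suc ?j)) u)) x = 0"
        using lie_ok_lower1[OF T, unfolded lie_ok_def, rule_format, OF mem, of x] True
        unfolding rdim_simps IH mv_0 by simp
      moreover have "mv ?N T (mv ?N (DP n k a b (unitm 1 0) (\<lambda>_ _. 0)) (tens (k + 1) ?B (unitv (Suc ?j)) u))
         = mv ?N T (\<lambda>x. of_nat (Suc ?j) * tens (k + 1) ?B (unitv ?j) u x)"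
      proof (intro mv_cong)
        fix y assume "y < ?N"
        from DP_sym[OF dsym_lower_unitv[OF j(2)] this, of u]
        show "mv ?N (DP n k a b (unitm 1 0) (\<lambda>_ _. 0)) (tens (k + 1) ?B (unitv (Suc ?j)) u) y = of_nat (Suc ?j) * tens (k + 1) ?B (unitv ?j) u y"
          by (simp only: tens_scale_left)
      qed
      ultimately show ?thesis by (simp only: mv_scale)
    next
      case False
      then show ?thesis using supp by (simp add: mv_def mat_supp_def)
    qed
    then show ?case by (intro ext) (metis mult_eq_0_iff of_nat_eq_0_iff nat.distinct(2))
  qed (use top[OF u] in simp)
  have rsp0: "mv ?N T v = (\<lambda>_. 0)" if "v \<in> rsp (pirep n k a b)" for v
  proof -
    have "tens (k + 1) ?B s u \<in> {v. mv ?N T v \<in> {\<lambda>_. 0}}" if u: "u \<in> rsp (toprep n a b)" for s u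
    proof -
      have "tens (k + 1) ?B s u = (\<lambda>x. \<Sum>i<k + 1. s i * tens (k + 1) ?B (unitv i) u x)"
      proof
        fix x show "tens (k + 1) ?B s u x = (\<Sum>i<k + 1. s i * tens (k + 1) ?B (unitv i) u x)"
        proof (cases "x < (k + 1) * ?B")
          case True
          then have "x div ?B < k + 1" by (rule less_mult_imp_div_less)
          have "(\<Sum>i<k + 1. s i * tens (k + 1) ?B (unitv i) u x) = (\<Sum>i<k + 1. if i = x div ?B then s i * u (x mod ?B) else 0)"
            unfolding tens_def unitv_def using True by (intro sum.cong refl) auto
          then show ?thesis using True \<open>x div ?B < k + 1\<close> by (simp only: tens_def sum.delta finite_lessThan if_True lessThan_iff)
        qed (simp add: tens_def)
      qed
      moreover have "mv ?N T (tens (k + 1) ?B (unitv i) u) = (\<lambda>_. 0)" if "i < k + 1" for i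
        using all[OF u, of "k - i"] that by simp
      ultimately show ?thesis by (simp only:) (intro csub_sum[OF vanish], simp)
    qed
    then have "rsp (pirep n k a b) \<subseteq> {v. mv ?N T v \<in> {\<lambda>_. 0}}"
      unfolding pirep_def tensor_rep_def rep.simps rdim_simps by (intro cspan_least[OF vanish]) blast
    then show ?thesis using that by blast
  qed
  have wf: "csub (rsp (pirep n k a b))" "rsp (pirep n k a b) \<subseteq> vecs ?N"
    using wf_tensor_rep[of "Symrep k" "toprep n a b"] unfolding wf_rep_def pirep_def rdim_simps by auto
  have vecs0: "mv ?N T v = (\<lambda>_. 0)" if v: "v \<in> vecs ?N" for v
  proof -
    obtain x where x: "x \<in> rsp (pirep n k a b)" "\<forall>y\<in>rsp (pirep n k a b). hip ?N (\<lambda>i. v i - x i) y = 0"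
      using orth_decomposition[OF wf v] by blast
    have "(\<lambda>i. v i - x i) \<in> vecs ?N" using v x(1) wf(2) by (intro csub_diff[OF csub_vecs]) auto
    then have "mv ?N T (\<lambda>i. v i - x i) = (\<lambda>_. 0)"
      using homs_perp[OF T, unfolded rdim_simps] x(2) by blast
    then show ?thesis using rsp0[OF x(1)] by (simp add: mv_diff fun_eq_iff)
  qed
  show ?thesis
  proof (intro ext)
    fix x y
    show "T x y = 0"
    proof (cases "y < ?N")
      case True
      have "unitv y \<in> vecs ?N" using True by (auto simp: unitv_def vecs_def)
      then have "mv ?N T (unitv y) x = 0" using vecs0 by simp
      then show ?thesis using True by (simp add: mv_def unitv_def if_distrib cong: if_cong)
    qed (use supp in \<open>auto simp: mat_supp_def\<close>)
  qed
qed

end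

section \<open>Direct sums and dimensions of spaces of homomorphisms\<close>

definition zero_homs :: "nat \<Rightarrow> rep \<Rightarrow> rep \<Rightarrow> bool" where
  "zero_homs n P V \<longleftrightarrow> homs n P V \<subseteq> {\<lambda>_ _. 0}"

text \<open>All spaces of homomorphisms entering the computed indices turn out to be zero or a line,
  and these two predicates pass through direct sums without any dimension theory.\<close>

definition one_dim_homs :: "nat \<Rightarrow> rep \<Rightarrow> rep \<Rightarrow> bool" where
  "one_dim_homs n P V \<longleftrightarrow> (\<exists>T0\<in>homs n P V. T0 \<noteq> (\<lambda>_ _. 0) \<and> (\<forall>T\<in>homs n P V. \<exists>c. T = (\<lambda>i j. c * T0 i j)))"

lemma mat_lin_indep_nonzero:
  assumes "mat_lin_indep A" "finite A"
  shows "(\<lambda>_ _. 0) \<notin> A"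
proof
  assume z: "(\<lambda>_ _. 0) \<in> A"
  let ?c = "\<lambda>T :: cmat. if T = (\<lambda>_ _. 0) then 1 else 0 :: complex"
  have "(\<Sum>T\<in>A. ?c T * T i j) = 0" for i j by (intro sum.neutral) auto
  then have "\<forall>T\<in>A. ?c T = 0"
    using assms(1)[unfolded mat_lin_indep_def, THEN spec, of ?c] by simp
  from bspec[OF this z] have "?c (\<lambda>_ _. 0) = 0" .
  then show False by simp
qed

lemma hom_dim_0:
  assumes "zero_homs n P V"
  shows "hom_dim n P V = 0"
  unfolding hom_dim_def
proof (rule cSup_eq_maximum)
  show "0 \<in> {card A |A. finite A \<and> A \<subseteq> homs n P V \<and> mat_lin_indep A}"
    by (intro CollectI exI[of _ "{}"]) (simp add: mat_lin_indep_def)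
  fix x assume "x \<in> {card A |A. finite A \<and> A \<subseteq> homs n P V \<and> mat_lin_indep A}"
  then obtain A where A: "x = card A" "finite A" "A \<subseteq> {\<lambda>_ _. 0}" "mat_lin_indep A"
    using assms unfolding zero_homs_def by blast
  then have "A = {}" using mat_lin_indep_nonzero by blast
  then show "x \<le> 0" using A by simp
qed

lemma hom_dim_1:
  assumes "one_dim_homs n P V"
  shows "hom_dim n P V = 1"
  unfolding hom_dim_def
proof (rule cSup_eq_maximum)
  obtain T0 where T0: "T0 \<in> homs n P V" "T0 \<noteq> (\<lambda>_ _. 0)" "\<And>T. T \<in> homs n P V \<Longrightarrow> \<exists>c. T = (\<lambda>i j. c * T0 i j)"
    using assms unfolding one_dim_homs_def by blast
  obtain i0 j0 where nz: "T0 i0 j0 \<noteq> 0" using T0(2) by (metis ext)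
  have "mat_lin_indep {T0}" unfolding mat_lin_indep_def using nz by auto
  then show "1 \<in> {card A |A. finite A \<and> A \<subseteq> homs n P V \<and> mat_lin_indep A}"
    using T0(1) by (intro CollectI exI[of _ "{T0}"]) simp
  fix x assume "x \<in> {card A |A. finite A \<and> A \<subseteq> homs n P V \<and> mat_lin_indep A}"
  then obtain A where A: "x = card A" "finite A" "A \<subseteq> homs n P V" "mat_lin_indep A" by blast
  have "T1 = T2" if "T1 \<in> A" "T2 \<in> A" for T1 T2
  proof (rule ccontr)
    assume ne: "T1 \<noteq> T2"
    have "T1 \<in> homs n P V" "T2 \<in> homs n P V" using that A(3) by auto
    then obtain c1 c2 where c: "T1 = (\<lambda>i j. c1 * T0 i j)" "T2 = (\<lambda>i j. c2 * T0 i j)"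
      using T0(3)[of T1] T0(3)[of T2] by blast
    \<comment> \<open>Both matrices are multiples \<open>c1\<close>, \<open>c2\<close> of
      \<open>T0\<close>, so \<open>c2 * T1 - c1 * T2\<close> is a dependence.\<close>
    let ?c = "\<lambda>T. if T = T1 then c2 else if T = T2 then - c1 else 0"
    have "(\<Sum>T\<in>A. ?c T * T i j) = 0" for i j
    proof -
      have "(\<Sum>T\<in>A. ?c T * T i j) = (\<Sum>T\<in>{T1, T2}. ?c T * T i j)"
        using that A(2) by (intro sum.mono_neutral_right) auto
      also have "\<dots> = c2 * T1 i j + (- c1) * T2 i j" using ne by simp
      also have "\<dots> = 0" by (simp add: c)
      finally show ?thesis .
    qed
    then have "\<forall>T\<in>A. ?c T = 0"
      using A(4)[unfolded mat_lin_indep_def, THEN spec, of ?c] by blast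
    from bspec[OF this that(1)] have "c2 = 0" by simp
    then have "T2 = (\<lambda>_ _. 0)" by (simp add: c(2))
    then show False using mat_lin_indep_nonzero[OF A(4,2)] that(2) by simp
  qed
  then have "card A \<le> 1" using card_le_Suc0_iff_eq[OF A(2)] by (metis One_nat_def)
  then show "x \<le> 1" using A by simp
qed

section \<open>Homomorphisms into direct sums\<close>

definition wfr :: "rep \<Rightarrow> bool" where
  "wfr R \<longleftrightarrow> wf_rep R \<and> (\<forall>g1 g2. mat_supp (rdim R) (rdim R) (ract R g1 g2))"

lemma wfr_tensor: "wfr (tensor_rep R1 R2)"
  by (simp add: wfr_def wf_tensor_rep) (simp add: tensor_rep_def mat_supp_kron)

lemma rdim_dsum [simp]: "rdim (dsum A B) = rdim A + rdim B"
  by (simp add: dsum_def)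

lemma rsp_dsum: "v \<in> rsp (dsum A B) \<longleftrightarrow> (\<lambda>i. if i < rdim A then v i else 0) \<in> rsp A \<and> (\<lambda>i. v (i + rdim A)) \<in> rsp B"
  by (simp add: dsum_def)

lemma wfr_dsum:
  assumes "wfr A" "wfr B"
  shows "wfr (dsum A B)"
proof -
  have "csub (rsp (dsum A B))"
  proof -
    have "csub {v. (\<lambda>i. if i < rdim A then v i else 0) \<in> rsp A}" "csub {v. (\<lambda>i. v (i + rdim A)) \<in> rsp B}"
      using assms by (auto intro!: csub_vimage simp: wfr_def wf_rep_def)
    from csub_Int[OF this] show ?thesis by (simp add: dsum_def Collect_conj_eq)
  qed
  moreover have "rsp (dsum A B) \<subseteq> vecs (rdim A + rdim B)"
  proof
    fix v assume "v \<in> rsp (dsum A B)"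
    then have "(\<lambda>i. v (i + rdim A)) \<in> vecs (rdim B)" using assms by (auto simp: rsp_dsum wfr_def wf_rep_def)
    then show "v \<in> vecs (rdim A + rdim B)" unfolding vecs_def
      by (auto) (metis add.commute add_le_cancel_left le_add_diff_inverse2 le_add_same_cancel1 le_trans zero_le)
  qed
  moreover have "mat_supp (rdim A + rdim B) (rdim A + rdim B) (ract (dsum A B) g1 g2)" for g1 g2
    by (auto simp: dsum_def mat_supp_def)
  ultimately show ?thesis by (simp add: wfr_def wf_rep_def)
qed

lemma wfr_zero_rep: "wfr zero_rep"
  by (auto simp: wfr_def wf_rep_def zero_rep_def csub_def vecs_def mat_supp_def)

lemma mv_dsum:
  assumes "wfr A"
  shows "i < rdim A \<Longrightarrow> mv (rdim A + rdim B) (ract (dsum A B) g1 g2) x i = mv (rdim A) (ract A g1 g2) x i"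
    and "i < rdim B \<Longrightarrow> mv (rdim A + rdim B) (ract (dsum A B) g1 g2) x (i + rdim A) = mv (rdim B) (ract B g1 g2) (\<lambda>j. x (j + rdim A)) i"
  unfolding mv_def sum_lessThan_add by (simp_all add: dsum_def add.commute)

lemma vecs_eq_iff: "u \<in> vecs N \<Longrightarrow> v \<in> vecs N \<Longrightarrow> u = v \<longleftrightarrow> (\<forall>i<N. u i = v i)"
proof
  assume "u \<in> vecs N" "v \<in> vecs N" "\<forall>i<N. u i = v i"
  then have "u i = v i" for i by (cases "i < N") (simp_all add: vecs_def)
  then show "u = v" by (rule ext)
qed simp

lemma homs_dsum_iff:
  assumes A: "wfr A" and B: "wfr B" and supp: "mat_supp (rdim A + rdim B) (rdim P) T"
  shows "T \<in> homs n P (dsum A B) \<longleftrightarrow>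
    (\<lambda>i j. if i < rdim A then T i j else 0) \<in> homs n P A \<and> (\<lambda>i j. T (i + rdim A) j) \<in> homs n P B"
proof -
  let ?N = "rdim P" and ?a = "rdim A" and ?b = "rdim B"
  let ?TA = "\<lambda>i j. if i < ?a then T i j else 0" and ?TB = "\<lambda>i j. T (i + ?a) j"
  have mA: "mv ?N ?TA v = (\<lambda>i. if i < ?a then mv ?N T v i else 0)" and mB: "mv ?N ?TB v = (\<lambda>i. mv ?N T v (i + ?a))" for v
    by (auto simp: mv_def fun_eq_iff)
  have vec: "u = u' \<longleftrightarrow> (\<forall>i<?a. u i = u' i) \<and> (\<forall>i<?b. u (i + ?a) = u' (i + ?a))"
    if "u \<in> vecs (?a + ?b)" "u' \<in> vecs (?a + ?b)" for u u'
  proof (intro iffI ext)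
    fix i assume h: "(\<forall>i<?a. u i = u' i) \<and> (\<forall>i<?b. u (i + ?a) = u' (i + ?a))"
    consider "i < ?a" | "?a \<le> i" "i - ?a < ?b" | "?a + ?b \<le> i" by linarith
    then show "u i = u' i"
    proof cases
      case 2
      then show ?thesis using h[THEN conjunct2, rule_format, of "i - ?a"] by simp
    qed (use h that in \<open>auto simp: vecs_def\<close>)
  qed simp
  have T_vec: "mv ?N T v \<in> vecs (?a + ?b)" for v by (rule mv_in_vecs[OF supp])
  have sA: "mat_supp ?a ?N ?TA" and sB: "mat_supp ?b ?N ?TB" using supp by (auto simp: mat_supp_def)
  have tail: "mv ?N T v (i + ?a) = 0" if "?b \<le> i" for v i using T_vec[of v] that by (simp add: vecs_def)
  have rspc: "mv ?N T v \<in> rsp (dsum A B) \<longleftrightarrow> mv ?N ?TA v \<in> rsp A \<and> mv ?N ?TB v \<in> rsp B" for v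
    by (simp add: rsp_dsum mA mB)
  have perp: "mv ?N T v = (\<lambda>i. 0) \<longleftrightarrow> mv ?N ?TA v = (\<lambda>i. 0) \<and> mv ?N ?TB v = (\<lambda>i. 0)" for v
    using vec[OF T_vec, of "\<lambda>i. 0" v] tail[of _ v] by (auto simp: mA mB fun_eq_iff vecs_def)
  have equiv: "mv ?N T u = mv (?a + ?b) (ract (dsum A B) g1 g2) (mv ?N T v) \<longleftrightarrow>
     mv ?N ?TA u = mv ?a (ract A g1 g2) (mv ?N ?TA v) \<and> mv ?N ?TB u = mv ?b (ract B g1 g2) (mv ?N ?TB v)" for g1 g2 u v
  proof -
    have "mat_supp (?a + ?b) (?a + ?b) (ract (dsum A B) g1 g2)" using wfr_dsum[OF A B] by (simp add: wfr_def)
    note vec[OF T_vec mv_in_vecs[OF this], of u]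
    moreover have cA: "mv ?a (ract A g1 g2) (mv ?N ?TA v) = mv ?a (ract A g1 g2) (mv ?N T v)"
      by (rule mv_cong) (simp add: mA)
    moreover have "mv ?N ?TA u = mv ?a (ract A g1 g2) (mv ?N ?TA v) \<longleftrightarrow> (\<forall>i<?a. mv ?N T u i = mv ?a (ract A g1 g2) (mv ?N T v) i)"
    proof -
      have "mv ?a (ract A g1 g2) (mv ?N ?TA v) \<in> vecs ?a" using A by (intro mv_in_vecs) (simp add: wfr_def)
      from vecs_eq_iff[OF mv_in_vecs[OF sA] this, of u] show ?thesis unfolding cA by (simp add: mA)
    qed
    moreover have "mv ?N ?TB u = mv ?b (ract B g1 g2) (mv ?N ?TB v) \<longleftrightarrow> (\<forall>i<?b. mv ?N T u (i + ?a) = mv ?b (ract B g1 g2) (\<lambda>i. mv ?N T v (i + ?a)) i)"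
    proof -
      have "mv ?b (ract B g1 g2) (mv ?N ?TB v) \<in> vecs ?b" using B by (intro mv_in_vecs) (simp add: wfr_def)
      from vecs_eq_iff[OF mv_in_vecs[OF sB] this, of u] show ?thesis unfolding mB .
    qed
    ultimately show ?thesis by (simp add: mv_dsum[OF A])
  qed
  show ?thesis unfolding homs_def mem_Collect_eq rdim_dsum
    using supp sA sB rspc perp equiv by (simp only:) blast
qed

lemma zero_homs_dsum:
  assumes "wfr A" "wfr B" "zero_homs n P A" "zero_homs n P B"
  shows "zero_homs n P (dsum A B)"
  unfolding zero_homs_def
proof
  fix T assume T: "T \<in> homs n P (dsum A B)"
  have supp: "mat_supp (rdim A + rdim B) (rdim P) T" using homs_supp[OF T] by simp
  have "(\<lambda>i j. if i < rdim A then T i j else 0) \<in> homs n P A" "(\<lambda>i j. T (i + rdim A) j) \<in> homs n P B"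
    using homs_dsum_iff[OF assms(1,2) supp] T by auto
  then have z: "(\<lambda>i j. if i < rdim A then T i j else 0) = (\<lambda>_ _. 0)" "(\<lambda>i j. T (i + rdim A) j) = (\<lambda>_ _. 0)"
    using assms(3,4) by (auto simp: zero_homs_def)
  have "T i j = 0" for i j
    using fun_cong[OF fun_cong[OF z(1), of i], of j] fun_cong[OF fun_cong[OF z(2), of "i - rdim A"], of j]
    by (cases "i < rdim A") auto
  then show "T \<in> {\<lambda>_ _. 0}" by auto
qed

lemma homs_0: "wfr V \<Longrightarrow> (\<lambda>_ _. 0) \<in> homs n P V"
  by (auto simp: homs_def mat_supp_def mv_mat_0 mv_0 wfr_def wf_rep_def csub_0)

lemma one_dim_homs_dsum_left:
  assumes "wfr A" "wfr B" "one_dim_homs n P A" "zero_homs n P B"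
  shows "one_dim_homs n P (dsum A B)"
proof -
  obtain T0 where T0: "T0 \<in> homs n P A" "T0 \<noteq> (\<lambda>_ _. 0)" "\<And>T. T \<in> homs n P A \<Longrightarrow> \<exists>c. T = (\<lambda>i j. c * T0 i j)"
    using assms(3) unfolding one_dim_homs_def by blast
  have s0: "mat_supp (rdim A) (rdim P) T0" by (rule homs_supp[OF T0(1)])
  have "mat_supp (rdim A + rdim B) (rdim P) T0" using s0 by (auto simp: mat_supp_def)
  note iff = homs_dsum_iff[OF assms(1,2) this]
  have "(\<lambda>i j. if i < rdim A then T0 i j else 0) = T0" using s0 by (auto simp: mat_supp_def fun_eq_iff)
  moreover have "(\<lambda>i j. T0 (i + rdim A) j) = (\<lambda>_ _. 0)" using s0 by (auto simp: mat_supp_def fun_eq_iff)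
  ultimately have mem: "T0 \<in> homs n P (dsum A B)" using iff T0(1) homs_0[OF assms(2)] by simp
  have "\<exists>c. T = (\<lambda>i j. c * T0 i j)" if T: "T \<in> homs n P (dsum A B)" for T
  proof -
    have supp: "mat_supp (rdim A + rdim B) (rdim P) T" using homs_supp[OF T] by simp
    have TA: "(\<lambda>i j. if i < rdim A then T i j else 0) \<in> homs n P A" and "(\<lambda>i j. T (i + rdim A) j) \<in> homs n P B"
      using homs_dsum_iff[OF assms(1,2) supp] T by auto
    then have z: "(\<lambda>i j. T (i + rdim A) j) = (\<lambda>_ _. 0)" using assms(4) by (auto simp: zero_homs_def)
    obtain c where c: "(\<lambda>i j. if i < rdim A then T i j else 0) = (\<lambda>i j. c * T0 i j)" using T0(3)[OF TA] by blast
    have "T i j = c * T0 i j" for i j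
      using fun_cong[OF fun_cong[OF c, of i], of j] fun_cong[OF fun_cong[OF z, of "i - rdim A"], of j]
      by (cases "i < rdim A") auto
    then show ?thesis by (intro exI[of _ c] ext)
  qed
  then show ?thesis unfolding one_dim_homs_def using mem T0(2) by blast
qed

lemma one_dim_homs_dsum_right:
  assumes "wfr A" "wfr B" "zero_homs n P A" "one_dim_homs n P B"
  shows "one_dim_homs n P (dsum A B)"
proof -
  obtain T0 where T0: "T0 \<in> homs n P B" "T0 \<noteq> (\<lambda>_ _. 0)" "\<And>T. T \<in> homs n P B \<Longrightarrow> \<exists>c. T = (\<lambda>i j. c * T0 i j)"
    using assms(4) unfolding one_dim_homs_def by blast
  define S where "S = (\<lambda>i j. if i < rdim A then 0 else T0 (i - rdim A) j)"
  have s0: "mat_supp (rdim B) (rdim P) T0" by (rule homs_supp[OF T0(1)])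
  have "mat_supp (rdim A + rdim B) (rdim P) S" using s0 by (auto simp: mat_supp_def S_def)
  note iff = homs_dsum_iff[OF assms(1,2) this]
  have "(\<lambda>i j. if i < rdim A then S i j else 0) = (\<lambda>_ _. 0)" by (auto simp: S_def fun_eq_iff)
  moreover have S0: "(\<lambda>i j. S (i + rdim A) j) = T0" by (auto simp: S_def)
  ultimately have mem: "S \<in> homs n P (dsum A B)" using iff T0(1) homs_0[OF assms(1)] by simp
  have nz: "S \<noteq> (\<lambda>_ _. 0)" using T0(2) S0 by auto
  have "\<exists>c. T = (\<lambda>i j. c * S i j)" if T: "T \<in> homs n P (dsum A B)" for T
  proof -
    have supp: "mat_supp (rdim A + rdim B) (rdim P) T" using homs_supp[OF T] by simp
    have "(\<lambda>i j. if i < rdim A then T i j else 0) \<in> homs n P A" and TB: "(\<lambda>i j. T (i + rdim A) j) \<in> homs n P B"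
      using homs_dsum_iff[OF assms(1,2) supp] T by auto
    then have z: "(\<lambda>i j. if i < rdim A then T i j else 0) = (\<lambda>_ _. 0)" using assms(3) by (auto simp: zero_homs_def)
    obtain c where c: "(\<lambda>i j. T (i + rdim A) j) = (\<lambda>i j. c * T0 i j)" using T0(3)[OF TB] by blast
    have "T i j = c * S i j" for i j
      using fun_cong[OF fun_cong[OF z, of i], of j] fun_cong[OF fun_cong[OF c, of "i - rdim A"], of j]
      by (cases "i < rdim A") (auto simp: S_def)
    then show ?thesis by (intro exI[of _ c] ext)
  qed
  then show ?thesis unfolding one_dim_homs_def using mem nz by blast
qed

lemma wfr_dsum_list: "(\<And>R. R \<in> set Rs \<Longrightarrow> wfr R) \<Longrightarrow> wfr (dsum_list Rs)"
  by (induction Rs) (auto simp: dsum_list_def wfr_zero_rep intro!: wfr_dsum)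

lemma zero_homs_zero_rep: "zero_homs n P zero_rep"
  unfolding zero_homs_def
proof
  fix T assume "T \<in> homs n P zero_rep"
  then have "mat_supp 0 (rdim P) T" by (auto simp: homs_def zero_rep_def)
  then show "T \<in> {\<lambda>_ _. 0}" by (auto simp: mat_supp_def fun_eq_iff)
qed

lemma zero_homs_dsum_list:
  "(\<And>R. R \<in> set Rs \<Longrightarrow> wfr R) \<Longrightarrow> (\<And>R. R \<in> set Rs \<Longrightarrow> zero_homs n P R) \<Longrightarrow> zero_homs n P (dsum_list Rs)"
proof (induction Rs)
  case (Cons R Rs)
  have "wfr (dsum_list Rs)" by (rule wfr_dsum_list) (use Cons.prems in auto)
  moreover have "zero_homs n P (dsum_list Rs)" using Cons by auto
  ultimately show ?case using Cons.prems zero_homs_dsum[of R "dsum_list Rs"] by (simp add: dsum_list_def)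
qed (simp add: dsum_list_def zero_homs_zero_rep)

lemma one_dim_homs_dsum_list:
  assumes "distinct xs" "\<And>x. x \<in> set xs \<Longrightarrow> wfr (f x)" "x0 \<in> set xs" "one_dim_homs n P (f x0)"
    "\<And>x. x \<in> set xs \<Longrightarrow> x \<noteq> x0 \<Longrightarrow> zero_homs n P (f x)"
  shows "one_dim_homs n P (dsum_list (map f xs))"
  using assms(1-3,5)
proof (induction xs)
  case (Cons x xs)
  have wf: "wfr (f x)" "wfr (dsum_list (map f xs))" using Cons.prems(2) by (auto intro!: wfr_dsum_list)
  show ?case
  proof (cases "x = x0")
    case True
    have "zero_homs n P (dsum_list (map f xs))"
      using Cons.prems True by (intro zero_homs_dsum_list) auto
    then show ?thesis using one_dim_homs_dsum_left[OF wf] assms(4) True by (simp add: dsum_list_def)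
  next
    case False
    have "one_dim_homs n P (dsum_list (map f xs))" using Cons False by auto
    moreover have "zero_homs n P (f x)" using Cons.prems False by auto
    ultimately show ?thesis using one_dim_homs_dsum_right[OF wf] by (simp add: dsum_list_def)
  qed
qed simp

lemma tensor_zero_rep: "tensor_rep zero_rep C = zero_rep"
proof -
  have "cspan {tens 0 (rdim C) v w |v w. v \<in> {\<lambda>i. 0} \<and> w \<in> rsp C} = {\<lambda>i. 0}"
  proof (rule equalityI)
    show "cspan {tens 0 (rdim C) v w |v w. v \<in> {\<lambda>i. 0} \<and> w \<in> rsp C} \<subseteq> {\<lambda>i. 0}"
      by (rule cspan_least) (auto simp: csub_def tens_def)
    show "{\<lambda>i. 0} \<subseteq> cspan {tens 0 (rdim C) v w |v w. v \<in> {\<lambda>i. 0} \<and> w \<in> rsp C}"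
      using csub_0[OF csub_cspan] by blast
  qed
  then show ?thesis by (auto simp: tensor_rep_def zero_rep_def kron_def fun_eq_iff)
qed

text \<open>An equality of records and not just an isomorphism: the index of the first factor is the
  leading digit in a tensor product, so stacking in that factor commutes with
  \<open>tensor_rep\<close>.\<close>

lemma tensor_dsum:
  assumes "wfr A" "wfr B"
  shows "tensor_rep (dsum A B) C = dsum (tensor_rep A C) (tensor_rep B C)"
proof -
  let ?a = "rdim A" and ?b = "rdim B" and ?c = "rdim C"
  let ?S = "{tens (?a + ?b) ?c v w |v w. v \<in> rsp (dsum A B) \<and> w \<in> rsp C}"
  have A: "csub (rsp A)" "rsp A \<subseteq> vecs ?a" and B: "csub (rsp B)" "rsp B \<subseteq> vecs ?b"
    using assms by (auto simp: wfr_def wf_rep_def)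
  have act: "kron (?a + ?b) ?c (ract (dsum A B) g1 g2) (ract C g1 g2) i j = ract (dsum (tensor_rep A C) (tensor_rep B C)) g1 g2 i j" for g1 g2 i j
  proof (cases "i < (?a + ?b) * ?c \<and> j < (?a + ?b) * ?c")
    case True
    then have c: "0 < ?c" by (auto intro!: Nat.gr0I)
    have lt: "x div ?c < ?a \<longleftrightarrow> x < ?a * ?c" "\<not> x < ?a * ?c \<Longrightarrow> (x - ?a * ?c) div ?c = x div ?c - ?a"
      "\<not> x < ?a * ?c \<Longrightarrow> (x - ?a * ?c) mod ?c = x mod ?c" for x
    proof -
      show "x div ?c < ?a \<longleftrightarrow> x < ?a * ?c" using c by (simp add: div_less_iff_less_mult)
      assume "\<not> x < ?a * ?c"
      then obtain y where y: "x = y + ?a * ?c" by (metis le_add_diff_inverse2 linorder_not_less)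
      show "(x - ?a * ?c) div ?c = x div ?c - ?a" "(x - ?a * ?c) mod ?c = x mod ?c" using c by (simp_all add: y)
    qed
    have lt2: "x div ?c < ?a + ?b" if "x < (?a + ?b) * ?c" for x using that by (simp add: less_mult_imp_div_less)
    show ?thesis using True lt2[of i] lt2[of j]
      by (auto simp: dsum_def tensor_rep_def kron_def lt not_less[symmetric] distrib_right)
  next
    case False
    then show ?thesis by (auto simp: dsum_def tensor_rep_def kron_def distrib_right)
  qed
  have rsp: "cspan ?S = rsp (dsum (tensor_rep A C) (tensor_rep B C))"
  proof (rule equalityI)
    have "wfr (dsum (tensor_rep A C) (tensor_rep B C))" by (intro wfr_dsum wfr_tensor)
    then have cs: "csub (rsp (dsum (tensor_rep A C) (tensor_rep B C)))" by (simp add: wfr_def wf_rep_def)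
    show "cspan ?S \<subseteq> rsp (dsum (tensor_rep A C) (tensor_rep B C))"
    proof (rule cspan_least[OF cs], clarify)
      fix v w assume v: "v \<in> rsp (dsum A B)" and w: "w \<in> rsp C"
      have "(\<lambda>i. if i < ?a * ?c then tens (?a + ?b) ?c v w i else 0) = tens ?a ?c (\<lambda>i. if i < ?a then v i else 0) w"
        by (auto simp: tens_def fun_eq_iff less_mult_imp_div_less distrib_right)
      moreover have "(\<lambda>i. tens (?a + ?b) ?c v w (i + ?a * ?c)) = tens ?b ?c (\<lambda>i. v (i + ?a)) w"
      proof
        fix i
        show "tens (?a + ?b) ?c v w (i + ?a * ?c) = tens ?b ?c (\<lambda>i. v (i + ?a)) w i"
          by (cases "?c = 0") (simp_all add: tens_def distrib_right add.commute)
      qed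
      ultimately show "tens (?a + ?b) ?c v w \<in> rsp (dsum (tensor_rep A C) (tensor_rep B C))"
        using v w by (simp add: rsp_dsum tens_in_rsp)
    qed
    show "rsp (dsum (tensor_rep A C) (tensor_rep B C)) \<subseteq> cspan ?S"
    proof
      fix v assume v: "v \<in> rsp (dsum (tensor_rep A C) (tensor_rep B C))"
      let ?sh = "\<lambda>(u::cvec) i. if i < ?a * ?c then 0 else u (i - ?a * ?c)"
      have "rsp (tensor_rep A C) \<subseteq> cspan ?S"
        unfolding tensor_rep_def rep.simps
      proof (rule cspan_least[OF csub_cspan], clarify)
        fix u w assume u: "u \<in> rsp A" and w: "w \<in> rsp C"
        have z: "u i = 0" if "?a \<le> i" for i using u A(2) that by (auto simp: vecs_def)
        have "(\<lambda>i. if i < ?a then u i else 0) = u" using z by (auto simp: fun_eq_iff)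
        moreover have "(\<lambda>i. u (i + ?a)) = (\<lambda>i. 0)" using z by (auto simp: fun_eq_iff)
        ultimately have "u \<in> rsp (dsum A B)" using u csub_0[OF B(1)] by (simp add: rsp_dsum)
        moreover have "tens ?a ?c u w = tens (?a + ?b) ?c u w"
        proof
          fix i
          show "tens ?a ?c u w i = tens (?a + ?b) ?c u w i"
          proof (cases "i < ?a * ?c")
            case True then show ?thesis by (simp add: tens_def distrib_right)
          next
            case False
            then have "?a \<le> i div ?c \<or> ?c = 0" by (metis div_less_iff_less_mult linorder_not_less neq0_conv)
            then show ?thesis using False z by (auto simp: tens_def)
          qed
        qed
        ultimately show "tens ?a ?c u w \<in> cspan ?S" using w by (intro subsetD[OF cspan_superset]) auto
      qed
      moreover have "rsp (tensor_rep B C) \<subseteq> {u. ?sh u \<in> cspan ?S}"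
        unfolding tensor_rep_def rep.simps
      proof (rule cspan_least, rule csub_vimage[OF csub_cspan], force, force, clarify)
        fix u w assume u: "u \<in> rsp B" and w: "w \<in> rsp C"
        define u' where "u' = (\<lambda>i. if i < ?a then 0 else u (i - ?a))"
        have "(\<lambda>i. if i < ?a then u' i else 0) = (\<lambda>i. 0)" "(\<lambda>i. u' (i + ?a)) = u"
          by (auto simp: u'_def fun_eq_iff)
        then have "u' \<in> rsp (dsum A B)" using u csub_0[OF A(1)] by (simp add: rsp_dsum)
        moreover have "?sh (tens ?b ?c u w) = tens (?a + ?b) ?c u' w"
        proof
          fix i
          show "?sh (tens ?b ?c u w) i = tens (?a + ?b) ?c u' w i"
          proof (cases "i < ?a * ?c")
            case True then show ?thesis by (simp add: tens_def u'_def less_mult_imp_div_less)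
          next
            case False
            then obtain y where y: "i = y + ?a * ?c" by (metis le_add_diff_inverse2 linorder_not_less)
            then show ?thesis by (cases "?c = 0") (auto simp: tens_def u'_def distrib_right)
          qed
        qed
        ultimately show "?sh (tens ?b ?c u w) \<in> cspan ?S" using w by (simp only:) (intro subsetD[OF cspan_superset], auto)
      qed
      ultimately have "(\<lambda>i. (if i < ?a * ?c then v i else 0) + 1 * ?sh (\<lambda>i. v (i + ?a * ?c)) i) \<in> cspan ?S"
        using v by (intro csub_add_scaled[OF csub_cspan]) (auto simp: rsp_dsum)
      moreover have "(\<lambda>i. (if i < ?a * ?c then v i else 0) + 1 * ?sh (\<lambda>i. v (i + ?a * ?c)) i) = v" by (auto simp: fun_eq_iff)
      ultimately show "v \<in> cspan ?S" by simp
    qed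
  qed
  have "ract (tensor_rep (dsum A B) C) = ract (dsum (tensor_rep A C) (tensor_rep B C))"
    by (intro ext) (simp add: act[symmetric] tensor_rep_def[of "dsum A B"])
  moreover have "rsp (tensor_rep (dsum A B) C) = rsp (dsum (tensor_rep A C) (tensor_rep B C))"
    by (simp add: rsp[symmetric] tensor_rep_def[of "dsum A B"])
  ultimately show ?thesis by (intro rep.equality) (auto simp: distrib_right)
qed

lemma tensor_dsum_list:
  "(\<And>R. R \<in> set Rs \<Longrightarrow> wfr R) \<Longrightarrow> tensor_rep (dsum_list Rs) C = dsum_list (map (\<lambda>R. tensor_rep R C) Rs)"
proof (induction Rs)
  case (Cons R Rs)
  have "wfr (dsum_list Rs)" by (rule wfr_dsum_list) (use Cons.prems in auto)
  then have "tensor_rep (dsum R (dsum_list Rs)) C = dsum (tensor_rep R C) (tensor_rep (dsum_list Rs) C)"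
    using Cons.prems by (intro tensor_dsum) auto
  then show ?case using Cons by (simp add: dsum_list_def)
qed (simp add: dsum_list_def tensor_zero_rep)

section \<open>Embedding symmetric powers\<close>

text \<open>The binary form with coefficients \<open>v\<close>, so that the group acts on
  \<open>Sym^l\<close> by linear substitution.\<close>

definition pev :: "nat \<Rightarrow> cvec \<Rightarrow> complex \<Rightarrow> complex \<Rightarrow> complex" where
  "pev l v z0 z1 = (\<Sum>i\<le>l. v i * (z0 ^ i * z1 ^ (l - i)))"

text \<open>Multiplying the two binomial expansions and collecting the power
  \<open>j = p + q\<close> of \<open>z0\<close> gives the sum in \<open>sym_act\<close>.\<close>

lemma sym_act_poly:
  assumes "i \<le> l"
  shows "(\<Sum>j\<le>l. sym_act l g j i * (z0 ^ j * z1 ^ (l - j)))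
    = (g 0 0 * z0 + g 1 0 * z1) ^ i * (g 0 1 * z0 + g 1 1 * z1) ^ (l - i)"
proof -
  define F where "F p q = (of_nat (i choose p) * (g 0 0 * z0) ^ p * (g 1 0 * z1) ^ (i - p))
     * (of_nat ((l - i) choose q) * (g 0 1 * z0) ^ q * (g 1 1 * z1) ^ (l - i - q))" for p q
  \<comment> \<open>Extends \<open>F\<close> by zero, so that the rectangle of exponents can be
    replaced by the triangle \<open>p + q \<le> l\<close> and reindexed by
    \<open>p + q\<close>.\<close>
  define G where "G p q = (if p \<le> i \<and> q \<le> l - i then F p q else 0)" for p q
  have "(g 0 0 * z0 + g 1 0 * z1) ^ i * (g 0 1 * z0 + g 1 1 * z1) ^ (l - i) = (\<Sum>p\<le>i. \<Sum>q\<le>l - i. F p q)"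
    unfolding binomial_ring F_def sum_product ..
  also have "\<dots> = (\<Sum>(p, q)\<in>{..i} \<times> {..l - i}. G p q)"
    unfolding sum.cartesian_product[symmetric] by (intro sum.cong refl) (simp add: G_def)
  also have "\<dots> = (\<Sum>(p, q)\<in>{(p, q). p + q \<le> l}. G p q)"
  proof (rule sum.mono_neutral_left)
    have "{(p, q). p + q \<le> l} \<subseteq> {..l} \<times> {..l}" by auto
    then show "finite {(p, q). p + q \<le> l}" by (rule finite_subset) simp
  qed (use assms in \<open>auto simp: G_def split: if_splits\<close>)
  also have "\<dots> = (\<Sum>j\<le>l. \<Sum>p\<le>j. G p (j - p))" by (rule sum.triangle_reindex_eq)
  also have "\<dots> = (\<Sum>j\<le>l. sym_act l g j i * (z0 ^ j * z1 ^ (l - j)))"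
  proof (intro sum.cong refl)
    fix j assume "j \<in> {..l}"
    then have j: "j \<le> l" by simp
    have "G p (j - p) = (if p \<le> i \<and> j - p \<le> l - i then of_nat (i choose p) * g 0 0 ^ p * g 1 0 ^ (i - p)
          * of_nat ((l - i) choose (j - p)) * g 0 1 ^ (j - p) * g 1 1 ^ (l - i - (j - p)) else 0) * (z0 ^ j * z1 ^ (l - j))"
      if "p \<le> j" for p
    proof (cases "p \<le> i \<and> j - p \<le> l - i")
      case True
      have z0: "z0 ^ j = z0 ^ p * z0 ^ (j - p)" using that by (simp flip: power_add)
      have "l - j = (i - p) + (l - i - (j - p))" using True that assms by linarith
      then have z1: "z1 ^ (l - j) = z1 ^ (i - p) * z1 ^ (l - i - (j - p))" by (simp only: power_add)
      show ?thesis using True unfolding G_def F_def z0 z1 by (simp add: power_mult_distrib mult_ac)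
    next
      case False
      show ?thesis unfolding G_def if_not_P[OF False] by simp
    qed
    then show "(\<Sum>p\<le>j. G p (j - p)) = sym_act l g j i * (z0 ^ j * z1 ^ (l - j))"
      unfolding sym_act_def using assms j by (simp add: sum_distrib_right)
  qed
  finally show ?thesis by simp
qed

lemma pev_sym_act:
  "pev l (mv (l + 1) (sym_act l g) v) z0 z1 = pev l v (g 0 0 * z0 + g 1 0 * z1) (g 0 1 * z0 + g 1 1 * z1)"
proof -
  have "pev l (mv (l + 1) (sym_act l g) v) z0 z1 = (\<Sum>j\<le>l. \<Sum>i\<le>l. v i * (sym_act l g j i * (z0 ^ j * z1 ^ (l - j))))"
    unfolding pev_def mv_def Suc_eq_plus1[symmetric] lessThan_Suc_atMost sum_distrib_right
    by (intro sum.cong refl) (simp add: mult_ac)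
  also have "\<dots> = (\<Sum>i\<le>l. v i * (\<Sum>j\<le>l. sym_act l g j i * (z0 ^ j * z1 ^ (l - j))))"
    by (subst sum.swap) (simp add: sum_distrib_left)
  also have "\<dots> = pev l v (g 0 0 * z0 + g 1 0 * z1) (g 0 1 * z0 + g 1 1 * z1)"
    unfolding pev_def by (intro sum.cong refl) (simp add: sym_act_poly)
  finally show ?thesis .
qed

text \<open>Setting \<open>z1 = 1\<close> leaves a polynomial in one variable, whose coefficients
  are determined by its values.\<close>

lemma pev_eq:
  assumes "\<And>z0 z1. pev l u z0 z1 = pev l v z0 z1" "i \<le> l"
  shows "u i = v i"
proof -
  have "(\<Sum>i\<le>l. u i * z ^ i) = (\<Sum>i\<le>l. v i * z ^ i)" for z
    using assms(1)[of z 1] by (simp add: pev_def)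
  then show ?thesis using polyfun_eq_coeffs[of u l v] assms(2) by blast
qed

definition pev2 :: "nat \<Rightarrow> nat \<Rightarrow> cvec \<Rightarrow> complex \<Rightarrow> complex \<Rightarrow> complex \<Rightarrow> complex \<Rightarrow> complex" where
  "pev2 r l w z0 z1 y0 y1 = pev r (\<lambda>i. pev l (\<lambda>j. w (i * (l + 1) + j)) y0 y1) z0 z1"

lemma pev_cong: "(\<And>i. i \<le> l \<Longrightarrow> u i = v i) \<Longrightarrow> pev l u z0 z1 = pev l v z0 z1"
  unfolding pev_def by (intro sum.cong) auto

lemma pev2_eqI:
  assumes "u \<in> vecs ((r + 1) * (l + 1))" "v \<in> vecs ((r + 1) * (l + 1))"
    and "\<And>z0 z1 y0 y1. pev2 r l u z0 z1 y0 y1 = pev2 r l v z0 z1 y0 y1"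
  shows "u = v"
proof (rule vecs_eqI_enc[OF assms(1,2)])
  fix i j assume "i < r + 1" "j < l + 1"
  then have ij: "i \<le> r" "j \<le> l" by auto
  have "pev l (\<lambda>j. u (i * (l + 1) + j)) y0 y1 = pev l (\<lambda>j. v (i * (l + 1) + j)) y0 y1" for y0 y1
    by (rule pev_eq[of r, OF _ ij(1)]) (use assms(3) in \<open>simp add: pev2_def\<close>)
  then show "u (i * (l + 1) + j) = v (i * (l + 1) + j)" by (rule pev_eq[OF _ ij(2)])
qed

lemma mv_kron_enc:
  assumes "x < M" "y < N"
  shows "mv (M * N) (kron M N A B) w (x * N + y) = mv M A (\<lambda>x'. mv N B (\<lambda>y'. w (x' * N + y')) y) x"
  unfolding mv_def sum_mult_split using assms
  by (intro sum.cong refl) (simp add: kron_enc sum_distrib_left mult.assoc)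

lemma pev_mv: "pev l (\<lambda>j. mv M A (\<lambda>x. f x j) i) y0 y1 = mv M A (\<lambda>x. pev l (f x) y0 y1) i"
  unfolding pev_def mv_def by (simp add: sum_distrib_left sum_distrib_right mult_ac) (rule sum.swap)

lemma pev2_kron:
  "pev2 r l (mv ((r + 1) * (l + 1)) (kron (r + 1) (l + 1) (sym_act r g) (sym_act l g)) w) z0 z1 y0 y1 =
   pev2 r l w (g 0 0 * z0 + g 1 0 * z1) (g 0 1 * z0 + g 1 1 * z1) (g 0 0 * y0 + g 1 0 * y1) (g 0 1 * y0 + g 1 1 * y1)"
proof -
  let ?w = "\<lambda>i j. w (i * (l + 1) + j)"
  have "pev l (\<lambda>j. mv ((r + 1) * (l + 1)) (kron (r + 1) (l + 1) (sym_act r g) (sym_act l g)) w (i * (l + 1) + j)) y0 y1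
     = mv (r + 1) (sym_act r g) (\<lambda>i. pev l (?w i) (g 0 0 * y0 + g 1 0 * y1) (g 0 1 * y0 + g 1 1 * y1)) i" if "i \<le> r" for i
  proof -
    have "pev l (\<lambda>j. mv ((r + 1) * (l + 1)) (kron (r + 1) (l + 1) (sym_act r g) (sym_act l g)) w (i * (l + 1) + j)) y0 y1
       = pev l (\<lambda>j. mv (r + 1) (sym_act r g) (\<lambda>x. mv (l + 1) (sym_act l g) (?w x) j) i) y0 y1"
      by (rule pev_cong, rule mv_kron_enc) (use that in simp_all)
    also have "\<dots> = mv (r + 1) (sym_act r g) (\<lambda>x. pev l (mv (l + 1) (sym_act l g) (?w x)) y0 y1) i"
      by (rule pev_mv)
    finally show ?thesis unfolding pev_sym_act .
  qed
  then show ?thesis unfolding pev2_def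
    by (subst pev_cong[where v="mv (r + 1) (sym_act r g) (\<lambda>i. pev l (?w i) (g 0 0 * y0 + g 1 0 * y1) (g 0 1 * y0 + g 1 1 * y1))"])
      (simp_all only: pev_sym_act)
qed

text \<open>Multiplication by \<open>(x\<^sub>1 y\<^sub>2 - y\<^sub>1 x\<^sub>2)\<^sup>r\<close>, which embeds \<open>Sym\<^sup>k\<close> into \<open>Sym\<^sup>r \<otimes> Sym\<^sup>k\<^sup>+\<^sup>r\<close>.\<close>
definition sym_emb :: "nat \<Rightarrow> nat \<Rightarrow> cmat" where
  "sym_emb k r = (\<lambda>R m. if R < (r + 1) * (k + r + 1) \<and> m \<le> k \<and> R mod (k + r + 1) + R div (k + r + 1) = m + r
     then of_nat (r choose (R div (k + r + 1))) * (-1) ^ (r - R div (k + r + 1)) else 0)"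

lemma mat_supp_sym_emb: "mat_supp ((r + 1) * (k + r + 1)) (k + 1) (sym_emb k r)"
  by (auto simp: mat_supp_def sym_emb_def)

lemma sym_emb_enc: "i \<le> r \<Longrightarrow> j \<le> k + r \<Longrightarrow> sym_emb k r (i * (k + r + 1) + j) m =
    (if m \<le> k \<and> j + i = m + r then of_nat (r choose i) * (-1) ^ (r - i) else 0)"
  using enc_less[of i "r + 1" j "k + r + 1"] enc_div[of j "k + r + 1" i] enc_mod[of j "k + r + 1" i]
  unfolding sym_emb_def by (simp only: less_Suc_eq_le Suc_eq_plus1[symmetric] simp_thms)

text \<open>Expanding the power, the coefficient of \<open>z0^i z1^(r-i)\<close> is
  \<open>y1^i y0^(r-i)\<close> up to a signed binomial coefficient; multiplied with
  \<open>y0^m y1^(k-m)\<close> it has \<open>y0\<close>-exponent \<open>m + r - i\<close>, which is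
  the condition in \<open>sym_emb\<close>.\<close>

lemma pev2_sym_emb:
  "pev2 r (k + r) (mv (k + 1) (sym_emb k r) v) z0 z1 y0 y1 = (z0 * y1 - z1 * y0) ^ r * pev k v y0 y1"
proof -
  have inner: "(\<Sum>j\<le>k + r. (\<Sum>m<k + 1. sym_emb k r (i * (k + r + 1) + j) m * v m) * (y0 ^ j * y1 ^ (k + r - j)))
     = of_nat (r choose i) * (-1) ^ (r - i) * (y1 ^ i * y0 ^ (r - i)) * pev k v y0 y1" if i: "i \<le> r" for i
  proof -
    have summand: "sym_emb k r (i * (k + r + 1) + j) m * v m * (y0 ^ j * y1 ^ (k + r - j))
        = (if j = m + r - i then of_nat (r choose i) * (-1) ^ (r - i) * v m * (y0 ^ j * y1 ^ (k + r - j)) else 0)"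
      if "m \<le> k" "j \<le> k + r" for m j
    proof -
      have "j + i = m + r \<longleftrightarrow> j = m + r - i" using i by auto
      then show ?thesis unfolding sym_emb_enc[OF i that(2)] using that(1) by (cases "j = m + r - i") simp_all
    qed
    have "(\<Sum>j\<le>k + r. (\<Sum>m<k + 1. sym_emb k r (i * (k + r + 1) + j) m * v m) * (y0 ^ j * y1 ^ (k + r - j)))
       = (\<Sum>m<k + 1. \<Sum>j\<le>k + r. sym_emb k r (i * (k + r + 1) + j) m * v m * (y0 ^ j * y1 ^ (k + r - j)))"
      unfolding sum_distrib_right by (rule sum.swap)
    also have "\<dots> = (\<Sum>m\<le>k. \<Sum>j\<le>k + r. if j = m + r - i then of_nat (r choose i) * (-1) ^ (r - i) * v m * (y0 ^ j * y1 ^ (k + r - j)) else 0)"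
      by (intro sum.cong summand) auto
    also have "\<dots> = (\<Sum>m\<le>k. of_nat (r choose i) * (-1) ^ (r - i) * v m * (y0 ^ (m + r - i) * y1 ^ (k + r - (m + r - i))))"
      using i by (intro sum.cong refl) (simp add: sum.delta)
    also have "\<dots> = (\<Sum>m\<le>k. of_nat (r choose i) * (-1) ^ (r - i) * (y1 ^ i * y0 ^ (r - i)) * (v m * (y0 ^ m * y1 ^ (k - m))))"
    proof (intro sum.cong refl)
      fix m assume "m \<in> {..k}"
      then have e: "m + r - i = m + (r - i)" "k + r - (m + (r - i)) = (k - m) + i" using i by auto
      have e': "y0 ^ (m + r - i) = y0 ^ m * y0 ^ (r - i)" "y1 ^ (k + r - (m + r - i)) = y1 ^ (k - m) * y1 ^ i"
        by (simp_all only: e power_add)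
      show "of_nat (r choose i) * (-1) ^ (r - i) * v m * (y0 ^ (m + r - i) * y1 ^ (k + r - (m + r - i)))
        = of_nat (r choose i) * (-1) ^ (r - i) * (y1 ^ i * y0 ^ (r - i)) * (v m * (y0 ^ m * y1 ^ (k - m)))"
        unfolding e' by (simp only: mult_ac)
    qed
    finally show ?thesis by (simp add: pev_def sum_distrib_left)
  qed
  have "pev2 r (k + r) (mv (k + 1) (sym_emb k r) v) z0 z1 y0 y1
     = (\<Sum>i\<le>r. (of_nat (r choose i) * (-1) ^ (r - i) * (y1 ^ i * y0 ^ (r - i)) * pev k v y0 y1) * (z0 ^ i * z1 ^ (r - i)))"
    unfolding pev2_def pev_def[of r] pev_def[of "k + r"] mv_def by (intro sum.cong refl) (simp only: inner atMost_iff)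
  also have "\<dots> = (\<Sum>i\<le>r. of_nat (r choose i) * (z0 * y1) ^ i * (- (z1 * y0)) ^ (r - i)) * pev k v y0 y1"
    unfolding sum_distrib_right
  proof (intro sum.cong refl)
    fix i
    have "(- (z1 * y0)) ^ (r - i) = (-1) ^ (r - i) * (z1 ^ (r - i) * y0 ^ (r - i))"
      by (metis mult_minus1 power_mult_distrib)
    then show "(of_nat (r choose i) * (-1) ^ (r - i) * (y1 ^ i * y0 ^ (r - i)) * pev k v y0 y1) * (z0 ^ i * z1 ^ (r - i))
      = of_nat (r choose i) * (z0 * y1) ^ i * (- (z1 * y0)) ^ (r - i) * pev k v y0 y1"
      by (simp add: power_mult_distrib mult_ac)
  qed
  also have "\<dots> = (z0 * y1 + - (z1 * y0)) ^ r * pev k v y0 y1" unfolding binomial_ring[of "z0 * y1" "- (z1 * y0)" r] ..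
  finally show ?thesis by simp
qed

lemma in_Sp_1_det: "in_Sp 1 g \<Longrightarrow> g 0 0 * g 1 1 - g 1 0 * g 0 1 = 1"
  using sum_sform[of 1 "\<lambda>k l. g k 0 * g l 1"] in_Sp_sum_sform[of 1 g 0 1] by (simp add: sform_def)

text \<open>Under simultaneous substitution the form \<open>z0 * y1 - z1 * y0\<close> is multiplied
  by the determinant of \<open>g\<close>, which is \<open>1\<close> on \<open>Sp(1)\<close>.\<close>

lemma sym_emb_equivariant:
  assumes "in_Sp 1 g"
  shows "mv (k + 1) (sym_emb k r) (mv (k + 1) (sym_act k g) v)
    = mv ((r + 1) * (k + r + 1)) (kron (r + 1) (k + r + 1) (sym_act r g) (sym_act (k + r) g)) (mv (k + 1) (sym_emb k r) v)"
proof (rule pev2_eqI[OF mv_in_vecs[OF mat_supp_sym_emb] mv_in_vecs[OF mat_supp_kron]])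
  fix z0 z1 y0 y1
  have "(g 0 0 * z0 + g 1 0 * z1) * (g 0 1 * y0 + g 1 1 * y1) - (g 0 1 * z0 + g 1 1 * z1) * (g 0 0 * y0 + g 1 0 * y1)
     = (g 0 0 * g 1 1 - g 1 0 * g 0 1) * (z0 * y1 - z1 * y0)" by (simp add: algebra_simps)
  then have "(g 0 0 * z0 + g 1 0 * z1) * (g 0 1 * y0 + g 1 1 * y1) - (g 0 1 * z0 + g 1 1 * z1) * (g 0 0 * y0 + g 1 0 * y1) = z0 * y1 - z1 * y0"
    using in_Sp_1_det[OF assms] by simp
  then show "pev2 r (k + r) (mv (k + 1) (sym_emb k r) (mv (k + 1) (sym_act k g) v)) z0 z1 y0 y1
    = pev2 r (k + r) (mv ((r + 1) * (k + r + 1)) (kron (r + 1) (k + r + 1) (sym_act r g) (sym_act (k + r) g)) (mv (k + 1) (sym_emb k r) v)) z0 z1 y0 y1"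
    unfolding pev2_kron pev2_sym_emb pev_sym_act by simp
qed

section \<open>Contractions between exterior powers\<close>

definition E2 :: "nat \<Rightarrow> nat \<Rightarrow> nat \<Rightarrow> cvec \<Rightarrow> nat list \<Rightarrow> nat list \<Rightarrow> complex" where
  "E2 n p d v = ev2 n p d (\<lambda>I J. v (I * Ne n d + J))"

lemma E2_subsets: "I < Ne n p \<Longrightarrow> J < Ne n d \<Longrightarrow> E2 n p d v (subsets p (2*n) ! I) (subsets d (2*n) ! J) = v (I * Ne n d + J)"
  by (simp add: E2_def ev2_subsets)

lemma E2_eqI:
  assumes "u \<in> vecs (Ne n p * Ne n d)" "v \<in> vecs (Ne n p * Ne n d)"
    "\<And>xs ys. xs \<in> Lst (2*n) p \<Longrightarrow> ys \<in> Lst (2*n) d \<Longrightarrow> E2 n p d u xs ys = E2 n p d v xs ys"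
  shows "u = v"
proof (rule vecs_eqI_enc[OF assms(1,2)])
  fix I J assume IJ: "I < Ne n p" "J < Ne n d"
  show "u (I * Ne n d + J) = v (I * Ne n d + J)"
    using assms(3)[OF subsets_in_Lst[OF IJ(1)] subsets_in_Lst[OF IJ(2)]] by (simp add: E2_subsets IJ)
qed

lemma ev_cong: "(\<And>I. I < Ne n p \<Longrightarrow> u I = v I) \<Longrightarrow> ev n p u xs = ev n p v xs"
  unfolding ev_def by (intro sum.cong) auto

lemma ev_sum: "ev n d (\<lambda>J. \<Sum>x\<in>A. c x * f x J) ys = (\<Sum>x\<in>A. c x * ev n d (f x) ys)"
proof -
  have "ev n d (\<lambda>J. \<Sum>x\<in>A. c x * f x J) ys = (\<Sum>J<Ne n d. \<Sum>x\<in>A. c x * (f x J * detsub d idm ys (subsets d (2*n) ! J)))"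
    unfolding ev_def sum_distrib_right by (simp only: mult.assoc)
  also have "\<dots> = (\<Sum>x\<in>A. \<Sum>J<Ne n d. c x * (f x J * detsub d idm ys (subsets d (2*n) ! J)))" by (rule sum.swap)
  finally show ?thesis unfolding ev_def sum_distrib_left .
qed

lemma ev_mv: "ev n d (\<lambda>J. mv M A (\<lambda>x. f x J) i) ys = mv M A (\<lambda>x. ev n d (f x) ys) i"
  unfolding mv_def by (rule ev_sum)

lemma E2_kron:
  assumes xs: "xs \<in> Lst (2*n) p" and ys: "ys \<in> Lst (2*n) d"
  shows "E2 n p d (mv (Ne n p * Ne n d) (kron (Ne n p) (Ne n d) (ext_act n p g) (ext_act n d g)) v) xs ys
    = (\<Sum>us\<in>Lst (2*n) p. \<Sum>vs\<in>Lst (2*n) d. (\<Prod>i<p. g (xs ! i) (us ! i)) * ((\<Prod>i<d. g (ys ! i) (vs ! i)) * E2 n p d v us vs))"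
proof -
  let ?v = "\<lambda>I J. v (I * Ne n d + J)"
  have "E2 n p d (mv (Ne n p * Ne n d) (kron (Ne n p) (Ne n d) (ext_act n p g) (ext_act n d g)) v) xs ys
     = ev n p (\<lambda>I. ev n d (\<lambda>J. mv (Ne n p) (ext_act n p g) (\<lambda>I. mv (Ne n d) (ext_act n d g) (?v I) J) I) ys) xs"
    unfolding E2_def ev2_def by (intro ev_cong) (simp add: mv_kron_enc)
  also have "\<dots> = ev n p (mv (Ne n p) (ext_act n p g) (\<lambda>I. ev n d (mv (Ne n d) (ext_act n d g) (?v I)) ys)) xs"
    unfolding ev_mv ..
  also have "\<dots> = (\<Sum>us\<in>Lst (2*n) p. (\<Prod>i<p. g (xs ! i) (us ! i)) * ev n p (\<lambda>I. ev n d (mv (Ne n d) (ext_act n d g) (?v I)) ys) us)"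
    by (rule ev_ext_act[OF xs])
  also have "\<dots> = (\<Sum>us\<in>Lst (2*n) p. (\<Prod>i<p. g (xs ! i) (us ! i)) * (\<Sum>vs\<in>Lst (2*n) d. (\<Prod>i<d. g (ys ! i) (vs ! i)) * E2 n p d v us vs))"
    unfolding ev_ext_act[OF ys] ev_sum E2_def ev2_def ..
  finally show ?thesis by (simp add: sum_distrib_left)
qed

definition contr :: "nat \<Rightarrow> (nat list \<Rightarrow> nat list \<Rightarrow> complex) \<Rightarrow> nat list \<Rightarrow> nat list \<Rightarrow> complex" where
  "contr n c xs ys = (\<Sum>k<2*n. \<Sum>l<2*n. sform n k l * c (k # xs) (l # ys))"

text \<open>The matrix of \<open>contr\<close>: the column of a basis tensor is computed from its
  pair of minors of the identity.\<close>

definition contr_mat :: "nat \<Rightarrow> nat \<Rightarrow> nat \<Rightarrow> cmat" where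
  "contr_mat n p d = (\<lambda>R C. if R < Ne n p * Ne n d \<and> C < Ne n (Suc p) * Ne n (Suc d) then
     contr n (\<lambda>xs ys. detsub (Suc p) idm xs (subsets (Suc p) (2*n) ! (C div Ne n (Suc d)))
        * detsub (Suc d) idm ys (subsets (Suc d) (2*n) ! (C mod Ne n (Suc d))))
       (subsets p (2*n) ! (R div Ne n d)) (subsets d (2*n) ! (R mod Ne n d)) else 0)"

lemma mat_supp_contr: "mat_supp (Ne n p * Ne n d) (Ne n (Suc p) * Ne n (Suc d)) (contr_mat n p d)"
  by (auto simp: mat_supp_def contr_mat_def)

lemma E2_expand: "E2 n p d v xs ys = (\<Sum>I<Ne n p. \<Sum>J<Ne n d. v (I * Ne n d + J) *
    (detsub p idm xs (subsets p (2*n) ! I) * detsub d idm ys (subsets d (2*n) ! J)))"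
  unfolding E2_def ev2_def ev_def sum_distrib_right by (intro sum.cong refl) (simp add: mult_ac)

lemma mv_contr_mat:
  assumes "I < Ne n p" "J < Ne n d"
  shows "mv (Ne n (Suc p) * Ne n (Suc d)) (contr_mat n p d) v (I * Ne n d + J)
    = contr n (E2 n (Suc p) (Suc d) v) (subsets p (2*n) ! I) (subsets d (2*n) ! J)"
proof -
  let ?x = "subsets p (2*n) ! I" and ?y = "subsets d (2*n) ! J"
  let ?D = "\<lambda>I' J' xs ys. detsub (Suc p) idm xs (subsets (Suc p) (2*n) ! I') * detsub (Suc d) idm ys (subsets (Suc d) (2*n) ! J')"
  have "mv (Ne n (Suc p) * Ne n (Suc d)) (contr_mat n p d) v (I * Ne n d + J)
     = (\<Sum>I'<Ne n (Suc p). \<Sum>J'<Ne n (Suc d). contr n (?D I' J') ?x ?y * v (I' * Ne n (Suc d) + J'))"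
    unfolding mv_def sum_mult_split
    by (intro sum.cong refl) (use assms in \<open>simp add: contr_mat_def enc_less enc_div enc_mod\<close>)
  also have "\<dots> = (\<Sum>I'<Ne n (Suc p). \<Sum>J'<Ne n (Suc d). \<Sum>k<2*n. \<Sum>l<2*n. sform n k l * (v (I' * Ne n (Suc d) + J') * ?D I' J' (k # ?x) (l # ?y)))"
    unfolding contr_def sum_distrib_right by (intro sum.cong refl) (simp add: mult_ac)
  also have "\<dots> = (\<Sum>I'<Ne n (Suc p). \<Sum>k<2*n. \<Sum>l<2*n. \<Sum>J'<Ne n (Suc d). sform n k l * (v (I' * Ne n (Suc d) + J') * ?D I' J' (k # ?x) (l # ?y)))"
    by (rule sum.cong[OF refl], subst sum.swap, intro sum.cong refl sum.swap)
  also have "\<dots> = (\<Sum>k<2*n. \<Sum>l<2*n. \<Sum>I'<Ne n (Suc p). \<Sum>J'<Ne n (Suc d). sform n k l * (v (I' * Ne n (Suc d) + J') * ?D I' J' (k # ?x) (l # ?y)))"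
    by (subst sum.swap, intro sum.cong refl sum.swap)
  finally show ?thesis unfolding contr_def E2_expand sum_distrib_left .
qed

lemma E2_contr_mat:
  assumes xs: "xs \<in> Lst (2*n) p" and ys: "ys \<in> Lst (2*n) d"
  shows "E2 n p d (mv (Ne n (Suc p) * Ne n (Suc d)) (contr_mat n p d) v) xs ys = contr n (E2 n (Suc p) (Suc d) v) xs ys"
proof -
  let ?w = "mv (Ne n (Suc p) * Ne n (Suc d)) (contr_mat n p d) v"
  have alt1: "alternating p (\<lambda>xs. contr n (E2 n (Suc p) (Suc d) v) xs ys)" for ys
    unfolding contr_def E2_def
    by (intro alternating_sum alternating_mult_left alternating_Cons[of p "\<lambda>xs. ev2 n (Suc p) (Suc d) _ xs _"] alternating_ev2_1)
  have alt2: "alternating d (contr n (E2 n (Suc p) (Suc d) v) xs)" for xs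
    unfolding contr_def E2_def
    by (intro alternating_sum alternating_mult_left alternating_Cons alternating_ev2_2)
  have "E2 n p d ?w xs ys - contr n (E2 n (Suc p) (Suc d) v) xs ys = 0"
  proof (rule alternating2_eq_0[of p _ d n, OF _ _ _ xs ys])
    show "alternating p (\<lambda>xs. E2 n p d ?w xs ys - contr n (E2 n (Suc p) (Suc d) v) xs ys)" for ys
      unfolding E2_def[of n p d] by (intro alternating_diff alternating_ev2_1 alt1)
    show "alternating d (\<lambda>ys. E2 n p d ?w xs ys - contr n (E2 n (Suc p) (Suc d) v) xs ys)" for xs
      unfolding E2_def[of n p d] by (intro alternating_diff alternating_ev2_2 alt2)
    show "E2 n p d ?w (subsets p (2*n) ! I) (subsets d (2*n) ! J) - contr n (E2 n (Suc p) (Suc d) v) (subsets p (2*n) ! I) (subsets d (2*n) ! J) = 0"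
      if "I < Ne n p" "J < Ne n d" for I J
      unfolding E2_subsets[OF that] mv_contr_mat[OF that] by simp
  qed
  then show ?thesis by simp
qed

abbreviation kact :: "nat \<Rightarrow> nat \<Rightarrow> nat \<Rightarrow> cmat \<Rightarrow> cmat" where
  "kact n p d g \<equiv> kron (Ne n p) (Ne n d) (ext_act n p g) (ext_act n d g)"

text \<open>As for primitivity, the two contracted slots absorb \<open>g\<close> through the
  symplectic relation; the other slots carry the action on the smaller exterior powers.\<close>

lemma contr_mat_equivariant:
  assumes g: "in_Sp n g"
  shows "mv (Ne n (Suc p) * Ne n (Suc d)) (contr_mat n p d) (mv (Ne n (Suc p) * Ne n (Suc d)) (kact n (Suc p) (Suc d) g) v)
    = mv (Ne n p * Ne n d) (kact n p d g) (mv (Ne n (Suc p) * Ne n (Suc d)) (contr_mat n p d) v)"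
proof (rule E2_eqI[OF mv_in_vecs[OF mat_supp_contr] mv_in_vecs[OF mat_supp_kron]])
  fix xs ys assume xs: "xs \<in> Lst (2*n) p" and ys: "ys \<in> Lst (2*n) d"
  let ?c = "E2 n (Suc p) (Suc d) v"
  let ?G = "\<lambda>us vs. (\<Prod>i<p. g (xs ! i) (us ! i)) * (\<Prod>i<d. g (ys ! i) (vs ! i))"
  let ?L = "\<lambda>d. Lst (2*n) d"
  have cons: "E2 n (Suc p) (Suc d) (mv (Ne n (Suc p) * Ne n (Suc d)) (kact n (Suc p) (Suc d) g) v) (k # xs) (l # ys)
     = (\<Sum>u<2*n. \<Sum>w<2*n. \<Sum>us\<in>?L p. \<Sum>vs\<in>?L d. (g k u * g l w) * (?G us vs * ?c (u # us) (w # vs)))"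
    if "k < 2*n" "l < 2*n" for k l
  proof -
    have m: "k # xs \<in> ?L (Suc p)" "l # ys \<in> ?L (Suc d)" using that xs ys by (auto simp: Lst_def)
    have "E2 n (Suc p) (Suc d) (mv (Ne n (Suc p) * Ne n (Suc d)) (kact n (Suc p) (Suc d) g) v) (k # xs) (l # ys)
      = (\<Sum>u<2*n. \<Sum>us\<in>?L p. \<Sum>w<2*n. \<Sum>vs\<in>?L d. (g k u * g l w) * (?G us vs * ?c (u # us) (w # vs)))"
      unfolding E2_kron[OF m] sum_Lst_Suc
      by (intro sum.cong refl) (simp add: prod.lessThan_Suc_shift mult_ac del: prod.lessThan_Suc)
    also have "\<dots> = (\<Sum>u<2*n. \<Sum>w<2*n. \<Sum>us\<in>?L p. \<Sum>vs\<in>?L d. (g k u * g l w) * (?G us vs * ?c (u # us) (w # vs)))"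
      by (intro sum.cong refl sum.swap)
    finally show ?thesis .
  qed
  have "contr n (E2 n (Suc p) (Suc d) (mv (Ne n (Suc p) * Ne n (Suc d)) (kact n (Suc p) (Suc d) g) v)) xs ys
    = (\<Sum>k<2*n. \<Sum>l<2*n. \<Sum>u<2*n. \<Sum>w<2*n. sform n k l * (g k u * g l w) * (\<Sum>us\<in>?L p. \<Sum>vs\<in>?L d. ?G us vs * ?c (u # us) (w # vs)))"
    unfolding contr_def by (intro sum.cong refl) (simp only: cons lessThan_iff sum_distrib_left mult.assoc)
  also have "\<dots> = (\<Sum>k<2*n. \<Sum>u<2*n. \<Sum>l<2*n. \<Sum>w<2*n. sform n k l * (g k u * g l w) * (\<Sum>us\<in>?L p. \<Sum>vs\<in>?L d. ?G us vs * ?c (u # us) (w # vs)))"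
    by (intro sum.cong refl sum.swap)
  also have "\<dots> = (\<Sum>u<2*n. \<Sum>k<2*n. \<Sum>w<2*n. \<Sum>l<2*n. sform n k l * (g k u * g l w) * (\<Sum>us\<in>?L p. \<Sum>vs\<in>?L d. ?G us vs * ?c (u # us) (w # vs)))"
    by (subst sum.swap) (intro sum.cong refl sum.swap)
  also have "\<dots> = (\<Sum>u<2*n. \<Sum>w<2*n. \<Sum>k<2*n. \<Sum>l<2*n. sform n k l * (g k u * g l w) * (\<Sum>us\<in>?L p. \<Sum>vs\<in>?L d. ?G us vs * ?c (u # us) (w # vs)))"
    by (intro sum.cong refl sum.swap)
  also have "\<dots> = (\<Sum>u<2*n. \<Sum>w<2*n. (\<Sum>k<2*n. \<Sum>l<2*n. sform n k l * (g k u * g l w)) * (\<Sum>us\<in>?L p. \<Sum>vs\<in>?L d. ?G us vs * ?c (u # us) (w # vs)))"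
    by (simp only: sum_distrib_right)
  also have "\<dots> = (\<Sum>u<2*n. \<Sum>w<2*n. \<Sum>us\<in>?L p. \<Sum>vs\<in>?L d. ?G us vs * (sform n u w * ?c (u # us) (w # vs)))"
    by (intro sum.cong refl, subst in_Sp_sum_sform[OF g]) (simp_all add: sum_distrib_left mult_ac)
  also have "\<dots> = (\<Sum>u<2*n. \<Sum>us\<in>?L p. \<Sum>vs\<in>?L d. \<Sum>w<2*n. ?G us vs * (sform n u w * ?c (u # us) (w # vs)))"
    by (rule sum.cong[OF refl], subst sum.swap, intro sum.cong refl sum.swap)
  also have "\<dots> = (\<Sum>us\<in>?L p. \<Sum>vs\<in>?L d. \<Sum>u<2*n. \<Sum>w<2*n. ?G us vs * (sform n u w * ?c (u # us) (w # vs)))"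
    by (subst sum.swap, intro sum.cong refl sum.swap)
  also have "\<dots> = (\<Sum>us\<in>?L p. \<Sum>vs\<in>?L d. (\<Prod>i<p. g (xs ! i) (us ! i)) * ((\<Prod>i<d. g (ys ! i) (vs ! i)) * contr n ?c us vs))"
    unfolding contr_def sum_distrib_left by (simp only: mult.assoc)
  also have "\<dots> = (\<Sum>us\<in>?L p. \<Sum>vs\<in>?L d. (\<Prod>i<p. g (xs ! i) (us ! i)) * ((\<Prod>i<d. g (ys ! i) (vs ! i)) *
      E2 n p d (mv (Ne n (Suc p) * Ne n (Suc d)) (contr_mat n p d) v) us vs))"
    by (intro sum.cong refl) (simp add: E2_contr_mat)
  finally show "E2 n p d (mv (Ne n (Suc p) * Ne n (Suc d)) (contr_mat n p d) (mv (Ne n (Suc p) * Ne n (Suc d)) (kact n (Suc p) (Suc d) g) v)) xs ys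
    = E2 n p d (mv (Ne n p * Ne n d) (kact n p d g) (mv (Ne n (Suc p) * Ne n (Suc d)) (contr_mat n p d) v)) xs ys"
    unfolding E2_contr_mat[OF xs ys] E2_kron[OF xs ys] .
qed

fun contr_pow :: "nat \<Rightarrow> nat \<Rightarrow> nat \<Rightarrow> nat \<Rightarrow> cmat" where
  "contr_pow n p d 0 = idn (Ne n p * Ne n d)"
| "contr_pow n p d (Suc m) = mm (Ne n (p + m) * Ne n (d + m)) (contr_pow n p d m) (contr_mat n (p + m) (d + m))"

lemma mat_supp_contr_pow: "mat_supp (Ne n p * Ne n d) (Ne n (p + m) * Ne n (d + m)) (contr_pow n p d m)"
proof (induction m)
  case (Suc m)
  show ?case using mat_supp_mm[OF Suc mat_supp_contr[of "p + m" n "d + m"]] by simp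
qed (auto simp: mat_supp_def idn_def)

lemma mv_idn_id: "v \<in> vecs N \<Longrightarrow> mv N (idn N) v = v"
  by (rule mv_idn) (auto simp: idn_def mat_supp_def)

lemma contr_pow_equivariant:
  assumes g: "in_Sp n g" and v: "v \<in> vecs (Ne n (p + m) * Ne n (d + m))"
  shows "mv (Ne n (p + m) * Ne n (d + m)) (contr_pow n p d m) (mv (Ne n (p + m) * Ne n (d + m)) (kact n (p + m) (d + m) g) v)
    = mv (Ne n p * Ne n d) (kact n p d g) (mv (Ne n (p + m) * Ne n (d + m)) (contr_pow n p d m) v)"
  using v
proof (induction m arbitrary: v)
  case 0
  then show ?case using mv_in_vecs[OF mat_supp_kron] by (simp add: mv_idn_id)
next
  case (Suc m)
  note eq = contr_mat_equivariant[OF g, of "p + m" "d + m" v]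
  show ?case using Suc.IH[OF mv_in_vecs[OF mat_supp_contr]]
    by (simp add: mv_mm eq)
qed

fun contr_iter :: "nat \<Rightarrow> nat \<Rightarrow> (nat list \<Rightarrow> nat list \<Rightarrow> complex) \<Rightarrow> nat list \<Rightarrow> nat list \<Rightarrow> complex" where
  "contr_iter n 0 c = c"
| "contr_iter n (Suc m) c = contr_iter n m (contr n c)"

lemma contr_cong:
  assumes "\<And>us vs. us \<in> Lst (2*n) (Suc p) \<Longrightarrow> vs \<in> Lst (2*n) (Suc d) \<Longrightarrow> c us vs = c' us vs"
    and "xs \<in> Lst (2*n) p" "ys \<in> Lst (2*n) d"
  shows "contr n c xs ys = contr n c' xs ys"
  unfolding contr_def using assms by (intro sum.cong refl arg_cong2[where f="(*)"]) (auto simp: Lst_def)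

lemma contr_iter_cong:
  "(\<And>us vs. us \<in> Lst (2*n) (p + m) \<Longrightarrow> vs \<in> Lst (2*n) (d + m) \<Longrightarrow> c us vs = c' us vs) \<Longrightarrow>
    xs \<in> Lst (2*n) p \<Longrightarrow> ys \<in> Lst (2*n) d \<Longrightarrow> contr_iter n m c xs ys = contr_iter n m c' xs ys"
proof (induction m arbitrary: c c')
  case (Suc m)
  show ?case unfolding contr_iter.simps
    by (rule Suc.IH[OF contr_cong[of n "p + m" "d + m"]]) (use Suc.prems in auto)
qed simp

text \<open>Transfers the matrix power to coefficient functions, where individual coefficients can
  be computed.\<close>

lemma E2_contr_pow:
  assumes "xs \<in> Lst (2*n) p" "ys \<in> Lst (2*n) d" "v \<in> vecs (Ne n (p + m) * Ne n (d + m))"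
  shows "E2 n p d (mv (Ne n (p + m) * Ne n (d + m)) (contr_pow n p d m) v) xs ys = contr_iter n m (E2 n (p + m) (d + m) v) xs ys"
  using assms(3)
proof (induction m arbitrary: v)
  case 0
  then show ?case by (simp add: mv_idn_id)
next
  case (Suc m)
  let ?w = "mv (Ne n (p + Suc m) * Ne n (d + Suc m)) (contr_mat n (p + m) (d + m)) v"
  have "?w \<in> vecs (Ne n (p + m) * Ne n (d + m))" using mv_in_vecs[OF mat_supp_contr[of "p + m" n "d + m"], of v] by simp
  from Suc.IH[OF this]
  have "E2 n p d (mv (Ne n (p + Suc m) * Ne n (d + Suc m)) (contr_pow n p d (Suc m)) v) xs ys = contr_iter n m (E2 n (p + m) (d + m) ?w) xs ys"
    by (simp add: mv_mm)
  also have "\<dots> = contr_iter n m (contr n (E2 n (p + Suc m) (d + Suc m) v)) xs ys"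
    by (rule contr_iter_cong[OF _ assms(1,2)]) (use E2_contr_mat[of _ n "p + m" _ "d + m" v] in simp)
  finally show ?case by simp
qed

section \<open>Non-vanishing of iterated contractions\<close>

text \<open>Coordinates of the wedge product of the basis vectors listed in \<open>L\<close>, which
  need not be increasing.\<close>

definition extv :: "nat \<Rightarrow> nat \<Rightarrow> nat list \<Rightarrow> cvec" where
  "extv n d L = (\<lambda>I. if I < Ne n d then detsub d idm (subsets d (2*n) ! I) L else 0)"

lemma extv_vecs: "extv n d L \<in> vecs (Ne n d)"
  by (simp add: extv_def vecs_def)

lemma ev_extv: "xs \<in> Lst (2*n) d \<Longrightarrow> ev n d (extv n d L) xs = detsub d idm xs L"
  using alternating_expand[OF alternating_detsub[of d idm L], of xs "2*n"]
  by (simp add: ev_def extv_def mult.commute[of "detsub d idm xs _"])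

text \<open>The list is isotropic: it never contains both members of a pair \<open>e_k, f_k\<close>,
  so every term of the contraction vanishes separately.\<close>

lemma extv_prim:
  assumes L: "length L = d" "distinct L" "set L \<subseteq> {..<2*n}" and iso: "\<And>k. k < n \<Longrightarrow> k \<in> set L \<Longrightarrow> n + k \<notin> set L"
  shows "extv n d L \<in> prim_ext n d"
  unfolding prim_ext_iff
proof (intro conjI impI ballI extv_vecs)
  fix ys assume d: "2 \<le> d" and ys: "ys \<in> Lst (2*n) (d - 2)"
  show "(\<Sum>k<n. ev n d (extv n d L) (k # (n + k) # ys)) = 0"
  proof (rule sum.neutral, rule ballI)
    fix k assume "k \<in> {..<n}"
    then have k: "k < n" by simp
    have m: "k # (n + k) # ys \<in> Lst (2*n) d" using ys d k by (auto simp: Lst_def)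
    have "detsub d idm (k # (n + k) # ys) L = 0"
    proof (cases "distinct (k # (n + k) # ys)")
      case True
      have "set (k # (n + k) # ys) \<noteq> set L" using iso[OF k] by (metis list.set_intros(1,2))
      then show ?thesis using True L length_Lst[OF m] by (intro detsub_idm_eq_0)
    qed (use length_Lst[OF m] in \<open>rule detsub_idm_not_distinct\<close>)
    then show "ev n d (extv n d L) (k # (n + k) # ys) = 0" by (simp only: ev_extv[OF m])
  qed
qed

lemma E2_tens:
  "E2 n p d (tens (Ne n p) (Ne n d) u v) xs ys = ev n p u xs * ev n d v ys"
proof -
  have "E2 n p d (tens (Ne n p) (Ne n d) u v) xs ys
     = (\<Sum>I<Ne n p. \<Sum>J<Ne n d. (u I * detsub p idm xs (subsets p (2*n) ! I)) * (v J * detsub d idm ys (subsets d (2*n) ! J)))"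
    unfolding E2_expand by (intro sum.cong refl) (simp add: tens_enc mult_ac)
  then show ?thesis by (simp only: ev_def sum_product)
qed

lemma swp_append: "p < length zs \<Longrightarrow> q < length zs \<Longrightarrow> swp p q (zs @ B) = swp p q zs @ B"
  by (simp add: swp_def nth_append list_update_append)

lemma alternating_append: "alternating (M + length B) c \<Longrightarrow> alternating M (\<lambda>zs. c (zs @ B))"
  unfolding alternating_def by (metis length_append swp_append trans_less_add1)

lemma swp_map: "p < length zs \<Longrightarrow> q < length zs \<Longrightarrow> swp p q (map f zs) = map f (swp p q zs)"
  by (simp add: swp_def map_update)

lemma alternating_map: "alternating M c \<Longrightarrow> alternating M (\<lambda>zs. c (map f zs))"
  unfolding alternating_def by (metis length_map swp_map)

definition nonneg :: "complex \<Rightarrow> bool" where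
  "nonneg z \<longleftrightarrow> Im z = 0 \<and> 0 \<le> Re z"

lemma nonneg_sum: "(\<And>x. x \<in> A \<Longrightarrow> nonneg (f x)) \<Longrightarrow> nonneg (\<Sum>x\<in>A. f x)"
  by (auto simp: nonneg_def intro!: sum_nonneg)

lemma nonneg_sum_nonzero:
  assumes "finite A" "\<And>x. x \<in> A \<Longrightarrow> nonneg (f x)" "a \<in> A" "f a \<noteq> 0"
  shows "(\<Sum>x\<in>A. f x) \<noteq> 0"
proof
  assume "(\<Sum>x\<in>A. f x) = 0"
  then have "(\<Sum>x\<in>A. Re (f x)) = 0" by (metis Re_sum zero_complex.simps(1))
  then have "Re (f a) = 0" using assms sum_nonneg_eq_0_iff[of A "\<lambda>x. Re (f x)"] by (auto simp: nonneg_def)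
  moreover have "Im (f a) = 0" using assms by (simp add: nonneg_def)
  ultimately show False using assms(4) by (simp add: complex_eq_iff)
qed

text \<open>The invariant of the iterated contraction, \<open>Z\<close> being the indices still to
  be contracted. The support condition removes half of \<open>sform\<close>; positivity excludes
  cancellation in the other half; the last clause keeps one term alive.\<close>

definition contr_good :: "nat \<Rightarrow> nat list \<Rightarrow> nat list \<Rightarrow> nat list \<Rightarrow> (nat list \<Rightarrow> nat list \<Rightarrow> complex) \<Rightarrow> bool" where
  "contr_good n B A Z c \<longleftrightarrow> (\<forall>xs ys. \<not> set xs \<subseteq> {..<n} \<and> set xs \<subseteq> {..<2*n} \<and> set ys \<subseteq> {..<2*n}
        \<and> length xs = length Z + length B \<and> length ys = length Z + length A \<longrightarrow> c xs ys = 0)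
     \<and> (\<forall>zs\<in>Lst n (length Z). nonneg (c (zs @ B) (map ((+) n) zs @ A)))
     \<and> c (Z @ B) (map ((+) n) Z @ A) \<noteq> 0"

text \<open>Terms with an \<open>f\<close> in the first factor vanish by the support condition. What
  remains is a sum of nonnegative coefficients over \<open>k\<close>, with \<open>k = k0\<close>
  nonzero.\<close>

lemma contr_good_contr:
  assumes good: "contr_good n B A (k0 # Z) c" and k0: "k0 < n" "set Z \<subseteq> {..<n}" "set B \<subseteq> {..<2*n}" "set A \<subseteq> {..<2*n}"
  shows "contr_good n B A Z (contr n c)"
proof -
  have big: "c xs ys = 0" if "\<not> set xs \<subseteq> {..<n}" "set xs \<subseteq> {..<2*n}" "set ys \<subseteq> {..<2*n}"
    "length xs = Suc (length Z) + length B" "length ys = Suc (length Z) + length A" for xs ys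
    using good that by (simp add: contr_good_def)
  have nn: "nonneg (c (zs @ B) (map ((+) n) zs @ A))" if "zs \<in> Lst n (Suc (length Z))" for zs
    using good that by (simp add: contr_good_def)
  have nz: "c (k0 # Z @ B) ((n + k0) # map ((+) n) Z @ A) \<noteq> 0"
    using good by (simp add: contr_good_def)
  have contr: "contr n c (zs @ B) (map ((+) n) zs @ A) = (\<Sum>k<n. c ((k # zs) @ B) (map ((+) n) (k # zs) @ A))"
    if "zs \<in> Lst n (length Z)" for zs
  proof -
    have zs: "length zs = length Z" "set zs \<subseteq> {..<n}" using that by (auto simp: Lst_def)
    have "c ((n + k) # zs @ B) (k # map ((+) n) zs @ A) = 0" if "k < n" for k
      by (rule big) (use that zs k0 in auto)
    then have "(\<Sum>k<n. c ((n + k) # zs @ B) (k # map ((+) n) zs @ A)) = 0" by (intro sum.neutral) auto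
    then show ?thesis unfolding contr_def sum_sform by simp
  qed
  show ?thesis unfolding contr_good_def
  proof (intro conjI allI impI ballI)
    fix xs ys assume h: "\<not> set xs \<subseteq> {..<n} \<and> set xs \<subseteq> {..<2*n} \<and> set ys \<subseteq> {..<2*n}
        \<and> length xs = length Z + length B \<and> length ys = length Z + length A"
    have "c (k # xs) (l # ys) = 0" if "k < 2*n" "l < 2*n" for k l
      by (rule big) (use h that in auto)
    then show "contr n c xs ys = 0" unfolding contr_def by (intro sum.neutral ballI) auto
  next
    fix zs assume zs: "zs \<in> Lst n (length Z)"
    show "nonneg (contr n c (zs @ B) (map ((+) n) zs @ A))"
      unfolding contr[OF zs] by (intro nonneg_sum nn) (use zs in \<open>auto simp: Lst_def\<close>)
  next
    have Z: "Z \<in> Lst n (length Z)" using k0 by (simp add: Lst_def)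
    show "contr n c (Z @ B) (map ((+) n) Z @ A) \<noteq> 0" unfolding contr[OF Z]
    proof (rule nonneg_sum_nonzero[of _ _ k0])
      show "nonneg (c ((k # Z) @ B) (map ((+) n) (k # Z) @ A))" if "k \<in> {..<n}" for k
        by (rule nn) (use Z that in \<open>auto simp: Lst_def\<close>)
    qed (use nz k0 in simp_all)
  qed
qed

lemma contr_iter_nonzero:
  "contr_good n B A Z c \<Longrightarrow> set Z \<subseteq> {..<n} \<Longrightarrow> set B \<subseteq> {..<2*n} \<Longrightarrow> set A \<subseteq> {..<2*n} \<Longrightarrow> contr_iter n (length Z) c B A \<noteq> 0"
proof (induction Z arbitrary: c)
  case Nil
  then show ?case by (simp add: contr_good_def)
next
  case (Cons k0 Z)
  have "contr_good n B A Z (contr n c)" by (rule contr_good_contr[OF Cons.prems(1)]) (use Cons.prems in auto)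
  then show ?case using Cons by simp
qed

text \<open>At aligned lists \<open>c\<close> is a product of two minors of the identity that agree
  as functions of \<open>zs\<close> and are real, so it is the square of a modulus.\<close>

lemma contr_good_start:
  fixes a b M n :: nat
  defines "B \<equiv> [0..<b]" and "A \<equiv> [0..<a]" and "Z \<equiv> [a..<a + M]"
  assumes ab: "b \<le> a" "a + M \<le> n"
    and c: "\<And>xs ys. xs \<in> Lst (2*n) (b + M) \<Longrightarrow> ys \<in> Lst (2*n) (a + M) \<Longrightarrow>
      c xs ys = detsub (b + M) idm xs (Z @ B) * detsub (a + M) idm ys (map ((+) n) Z @ A)"
  shows "contr_good n B A Z c"
  unfolding contr_good_def
proof (intro conjI allI impI ballI)
  let ?Z' = "map ((+) n) Z"
  have len: "length Z = M" "length B = b" "length A = a" by (simp_all add: Z_def A_def B_def)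
  have sets: "set Z = {a..<a + M}" "set B = {..<b}" "set A = {..<a}" by (auto simp: Z_def A_def B_def)
  have dZ: "distinct (Z @ B)" "distinct (?Z' @ A)" using ab by (auto simp: Z_def A_def B_def distinct_map)
  {
    fix xs ys assume h: "\<not> set xs \<subseteq> {..<n} \<and> set xs \<subseteq> {..<2*n} \<and> set ys \<subseteq> {..<2*n}
        \<and> length xs = length Z + length B \<and> length ys = length Z + length A"
    have "detsub (b + M) idm xs (Z @ B) = 0"
    proof (cases "distinct xs")
      case True
      have "set (Z @ B) \<subseteq> {..<n}" using ab sets by auto
      then have "set xs \<noteq> set (Z @ B)" using h by metis
      then show ?thesis using True h dZ len by (intro detsub_idm_eq_0) auto
    qed (use h len in \<open>auto intro!: detsub_idm_not_distinct\<close>)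
    moreover have "xs \<in> Lst (2*n) (b + M)" "ys \<in> Lst (2*n) (a + M)" using h len by (auto simp: Lst_def)
    ultimately show "c xs ys = 0" by (simp add: c)
  }
  define G where "G zs = detsub (b + M) idm (zs @ B) (Z @ B)" for zs
  define H where "H zs = detsub (a + M) idm (map ((+) n) zs @ A) (?Z' @ A)" for zs
  have altG: "alternating M G" unfolding G_def
    by (rule alternating_append) (simp add: len add.commute alternating_detsub)
  have altH: "alternating M H" unfolding H_def
    using alternating_map[OF alternating_append[of M A "\<lambda>xs. detsub (a + M) idm xs (?Z' @ A)"], of "(+) n"]
      alternating_detsub[of "a + M" idm "?Z' @ A"] by (simp add: len add.commute)
  have GZ: "G Z = 1" "H Z = 1" unfolding G_def H_def using dZ len by (auto intro!: detsub_idm_self)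
  \<comment> \<open>Both functions alternate in \<open>zs\<close>, equal \<open>1\<close> at
    \<open>Z\<close> and vanish at every other increasing list.\<close>
  have GH: "H zs = G zs" if zs: "zs \<in> Lst n M" for zs
  proof -
    have "H zs - G zs = 0"
    proof (rule alternating_eq_0[OF alternating_diff[OF altH altG] _ zs])
      fix i assume i: "i < length (subsets M n)"
      let ?s = "subsets M n ! i"
      note s = nth_subsets[OF i]
      show "H ?s - G ?s = 0"
      proof (cases "?s = Z")
        case False
        have ne: "set ?s \<noteq> set Z"
        proof
          assume "set ?s = set Z"
          then have "?s = Z" using s by (intro sorted_distinct_set_unique) (auto simp: Z_def)
          with False show False by simp
        qed
        have "detsub (b + M) idm (?s @ B) (Z @ B) = 0"
        proof (cases "distinct (?s @ B)")
          case True
          have "set (?s @ B) \<noteq> set (Z @ B)" using ne True dZ(1) by auto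
          then show "detsub (b + M) idm (?s @ B) (Z @ B) = 0" using True dZ len s by (intro detsub_idm_eq_0) auto
        next
          case False
          show ?thesis by (rule detsub_idm_not_distinct[OF _ False]) (use s len in simp)
        qed
        moreover have "detsub (a + M) idm (map ((+) n) ?s @ A) (?Z' @ A) = 0"
        proof (cases "distinct (map ((+) n) ?s @ A)")
          case True
          have "set (map ((+) n) ?s @ A) \<noteq> set (?Z' @ A)"
          proof
            assume eq: "set (map ((+) n) ?s @ A) = set (?Z' @ A)"
            have "(+) n ` set ?s = (+) n ` set Z"
              using eq True dZ(2) by (simp only: set_append set_map distinct_append) blast
            then show False using ne by (simp add: inj_image_eq_iff)
          qed
          then show "detsub (a + M) idm (map ((+) n) ?s @ A) (?Z' @ A) = 0" using True dZ len s by (intro detsub_idm_eq_0) auto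
        next
          case False
          show ?thesis by (rule detsub_idm_not_distinct[OF _ False]) (use s len in simp)
        qed
        ultimately show ?thesis by (simp add: G_def H_def)
      qed (simp add: GZ)
    qed
    then show ?thesis by simp
  qed
  have cnjG: "cnj (G zs) = G zs" for zs
    unfolding G_def detsub_cnj[symmetric] by (simp add: idm_def if_distrib cong: if_cong)
  have val: "c (zs @ B) (map ((+) n) zs @ A) = G zs * cnj (G zs)" if zs: "zs \<in> Lst n M" for zs
  proof -
    have "zs @ B \<in> Lst (2*n) (b + M)" "map ((+) n) zs @ A \<in> Lst (2*n) (a + M)"
      using zs len ab sets by (auto simp: Lst_def)
    then show ?thesis using GH[OF zs] cnjG[of zs] by (simp add: c G_def H_def)
  qed
  show "nonneg (c (zs @ B) (map ((+) n) zs @ A))" if "zs \<in> Lst n (length Z)" for zs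
    using that unfolding len by (simp add: val complex_mult_cnj nonneg_def)
  have "Z \<in> Lst n M" using len sets ab by (auto simp: Lst_def)
  then show "c (Z @ B) (map ((+) n) Z @ A) \<noteq> 0" by (simp add: val GZ)
qed

section \<open>The intertwiner on exterior powers\<close>

lemma adj_kron: "adj (kron M N A B) = kron M N (adj A) (adj B)"
  by (intro ext) (auto simp: adj_def kron_def)

lemma hip_eqI:
  assumes "u \<in> vecs N" "v \<in> vecs N" "\<And>w. w \<in> vecs N \<Longrightarrow> hip N u w = hip N v w"
  shows "u = v"
proof -
  have d: "(\<lambda>i. u i - v i) \<in> vecs N" using assms(1,2) by (rule csub_diff[OF csub_vecs])
  have "hip N (\<lambda>i. u i - v i) (\<lambda>i. u i - v i) = 0" using assms(3)[OF d] by (simp add: hip_diff_left)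
  then have "(\<lambda>i. u i - v i) = (\<lambda>i. 0)" using d by (rule hip_self_eq_0)
  then show ?thesis by (simp add: fun_eq_iff)
qed

text \<open>Exchange of the two tensor factors: \<open>toprep n a b\<close> lies in
  \<open>\<Lambda>^a \<otimes> \<Lambda>^b\<close>, whereas in the target the exterior power grown
  from \<open>b\<close> comes first.\<close>

definition swapm :: "nat \<Rightarrow> nat \<Rightarrow> cmat" where
  "swapm M N = (\<lambda>R C. if R < N * M \<and> C < M * N \<and> R div M = C mod N \<and> R mod M = C div N then 1 else 0)"

lemma mat_supp_swapm: "mat_supp (N * M) (M * N) (swapm M N)"
  by (auto simp: mat_supp_def swapm_def)

lemma mv_swapm:
  assumes "x < M" "y < N"
  shows "mv (M * N) (swapm M N) v (y * M + x) = v (x * N + y)"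
proof -
  have "mv (M * N) (swapm M N) v (y * M + x) = (\<Sum>x'<M. \<Sum>y'<N. if y' = y then (if x' = x then v (x' * N + y') else 0) else 0)"
    unfolding mv_def sum_mult_split
    by (intro sum.cong refl) (use assms in \<open>auto simp: swapm_def enc_less enc_div enc_mod\<close>)
  then show ?thesis using assms by simp
qed

lemma mv_mv_swap: "mv M A (\<lambda>x. mv N B (\<lambda>y. f x y) j) i = mv N B (\<lambda>y. mv M A (\<lambda>x. f x y) i) j"
  unfolding mv_def sum_distrib_left by (subst sum.swap) (simp add: mult_ac)

lemma swapm_kron:
  "mv (M * N) (swapm M N) (mv (M * N) (kron M N A B) v) = mv (N * M) (kron N M B A) (mv (M * N) (swapm M N) v)"
proof (rule vecs_eqI_enc[OF mv_in_vecs[OF mat_supp_swapm] mv_in_vecs[OF mat_supp_kron]])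
  fix y x assume xy: "y < N" "x < M"
  have "mv N B (\<lambda>y. mv M A (\<lambda>x. mv (M * N) (swapm M N) v (y * M + x)) x) y = mv N B (\<lambda>y. mv M A (\<lambda>x. v (x * N + y)) x) y"
  proof (intro fun_cong[OF mv_cong] fun_cong[OF mv_cong, of M _ _ A x])
    fix y' x' assume "y' < N" "x' < M"
    then show "mv (M * N) (swapm M N) v (y' * M + x') = v (x' * N + y')" by (simp add: mv_swapm)
  qed
  then show "mv (M * N) (swapm M N) (mv (M * N) (kron M N A B) v) (y * M + x)
    = mv (N * M) (kron N M B A) (mv (M * N) (swapm M N) v) (y * M + x)"
    unfolding mv_swapm[OF xy(2,1)] mv_kron_enc[OF xy] mv_kron_enc[OF xy(2,1)] by (subst mv_mv_swap) simp
qed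

lemma swapm_tens: "mv (M * N) (swapm M N) (tens M N u v) = tens N M v u"
  by (rule vecs_eqI_enc[OF mv_in_vecs[OF mat_supp_swapm] tens_in_vecs])
    (simp add: mv_swapm tens_enc mult.commute)

abbreviation prim2 :: "nat \<Rightarrow> nat \<Rightarrow> nat \<Rightarrow> cvec set" where
  "prim2 n p d \<equiv> rsp (tensor_rep (Extrep n p) (Extrep n d))"

lemma prim2_sub: "csub (prim2 n p d)" "prim2 n p d \<subseteq> vecs (Ne n p * Ne n d)"
  using wf_tensor_rep[of "Extrep n p" "Extrep n d"] unfolding wf_rep_def rdim_simps by auto

lemma rsp_prim2: "prim2 n p d = cspan {tens (Ne n p) (Ne n d) u v |u v. u \<in> prim_ext n p \<and> v \<in> prim_ext n d}"
  by (simp add: tensor_rep_def Extrep_def)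

lemma prim2_invariant:
  assumes "in_Sp n g" "w \<in> prim2 n p d"
  shows "mv (Ne n p * Ne n d) (kact n p d g) w \<in> prim2 n p d"
proof -
  have "csub {w. mv (Ne n p * Ne n d) (kact n p d g) w \<in> prim2 n p d}"
    by (rule csub_vimage[OF prim2_sub(1)]) (simp_all add: mv_add_scaled mv_0)
  moreover have "mv (Ne n p * Ne n d) (kact n p d g) (tens (Ne n p) (Ne n d) u v) \<in> prim2 n p d"
    if "u \<in> prim_ext n p" "v \<in> prim_ext n d" for u v
    unfolding mv_kron_tens rsp_prim2
    using prim_ext_ext_act[OF assms(1) that(1)] prim_ext_ext_act[OF assms(1) that(2)]
    by (intro subsetD[OF cspan_superset]) blast
  ultimately have "prim2 n p d \<subseteq> {w. mv (Ne n p * Ne n d) (kact n p d g) w \<in> prim2 n p d}"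
    unfolding rsp_prim2[of n p d, THEN eq_reflection, symmetric] by (subst rsp_prim2) (rule cspan_least, auto)
  then show ?thesis using assms(2) by blast
qed

lemma kact_adj: "adj (kact n p d g) = kact n p d (adj g)"
  by (simp add: adj_kron ext_act_adj)

text \<open>Tested against an arbitrary \<open>w\<close>: both maps are moved across the Hermitian
  product, where \<open>contr_pow\<close> commutes with \<open>adj g\<close>, again an element of
  the group.\<close>

lemma adj_contr_pow_equivariant:
  assumes g: "in_Sp n g"
  shows "mv (Ne n b * Ne n a) (adj (contr_pow n b a M)) (mv (Ne n b * Ne n a) (kact n b a g) u)
    = mv (Ne n (b + M) * Ne n (a + M)) (kact n (b + M) (a + M) g) (mv (Ne n b * Ne n a) (adj (contr_pow n b a M)) u)"
proof (rule hip_eqI[OF mv_in_vecs[OF mat_supp_adj[OF mat_supp_contr_pow]] mv_in_vecs[OF mat_supp_kron]])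
  let ?P = "Ne n (b + M) * Ne n (a + M)" and ?Q = "Ne n b * Ne n a" and ?C = "contr_pow n b a M"
  fix w assume w: "w \<in> vecs ?P"
  have "hip ?P (mv ?Q (adj ?C) (mv ?Q (kact n b a g) u)) w = hip ?Q u (mv ?Q (kact n b a (adj g)) (mv ?P ?C w))"
    by (simp only: hip_mv adj_adj kact_adj)
  also have "\<dots> = hip ?Q u (mv ?P ?C (mv ?P (kact n (b + M) (a + M) (adj g)) w))"
    by (simp only: contr_pow_equivariant[OF in_Sp_adj[OF g] w])
  also have "\<dots> = hip ?P (mv ?P (kact n (b + M) (a + M) g) (mv ?Q (adj ?C) u)) w"
    by (simp only: hip_mv adj_adj kact_adj)
  finally show "hip ?P (mv ?Q (adj ?C) (mv ?Q (kact n b a g) u)) w = hip ?P (mv ?P (kact n (b + M) (a + M) g) (mv ?Q (adj ?C) u)) w" .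
qed

lemma hip_unitv: "x < N \<Longrightarrow> hip N (unitv x) w = cnj (w x)"
  by (simp add: hip_def unitv_def if_distrib[of "\<lambda>y. y * _"] cong: if_cong)

lemma ext_basis_unitv:
  assumes "i < Ne n d" "subsets d (2*n) ! i = I"
  shows "ext_basis n d I = unitv i"
proof
  fix j show "ext_basis n d I j = unitv i j"
    using assms nth_subsets_eq_iff[of j d "2*n" i] by (auto simp: ext_basis_def unitv_def)
qed

lemma tens_unitv:
  assumes "x < M" "y < N"
  shows "tens M N (unitv x) (unitv y) = unitv (x * N + y)"
proof (rule vecs_eqI_enc[OF tens_in_vecs])
  show "unitv (x * N + y) \<in> vecs (M * N)" using enc_less[OF assms] by (auto simp: unitv_def vecs_def)
  fix x' y' assume xy: "x' < M" "y' < N"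
  have "x' * N + y' = x * N + y \<longleftrightarrow> x' = x \<and> y' = y"
    using enc_div[OF xy(2), of x'] enc_div[OF assms(2), of x] enc_mod[OF xy(2), of x'] enc_mod[OF assms(2), of x] by metis
  then show "tens M N (unitv x) (unitv y) (x' * N + y') = unitv (x * N + y) (x' * N + y')"
    using xy by (simp add: tens_enc unitv_def)
qed

text \<open>The adjoint of the iterated contraction, followed by the projection onto the primitive part.\<close>
lemma ext_intertwiner:
  assumes ab: "b \<le> a" "a + M \<le> n"
  obtains Q where "mat_supp (Ne n (b + M) * Ne n (a + M)) (Ne n a * Ne n b) Q"
    "\<And>v. mv (Ne n a * Ne n b) Q v \<in> prim2 n (b + M) (a + M)"
    "\<And>g u. in_Sp n g \<Longrightarrow> mv (Ne n a * Ne n b) Q (mv (Ne n a * Ne n b) (kact n a b g) u)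
      = mv (Ne n (b + M) * Ne n (a + M)) (kact n (b + M) (a + M) g) (mv (Ne n a * Ne n b) Q u)"
    "mv (Ne n a * Ne n b) Q (hwv n a b) \<noteq> (\<lambda>_. 0)"
proof -
  let ?P = "Ne n (b + M) * Ne n (a + M)" and ?R = "Ne n b * Ne n a" and ?N = "Ne n a * Ne n b"
  let ?C = "contr_pow n b a M" and ?S = "swapm (Ne n a) (Ne n b)"
  let ?W = "prim2 n (b + M) (a + M)"
  obtain Pr where Pr: "orth_proj ?P ?W Pr" using orth_proj_exists[OF prim2_sub] by blast
  define Q where "Q = mm ?P Pr (mm ?R (adj ?C) ?S)"
  have Qv: "mv ?N Q v = mv ?P Pr (mv ?R (adj ?C) (mv ?N ?S v))" for v
    unfolding Q_def by (simp only: mv_mm)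
  have supp: "mat_supp ?P ?N Q" unfolding Q_def
    using Pr by (intro mat_supp_mm mat_supp_adj mat_supp_contr_pow mat_supp_swapm) (simp add: orth_proj_def)
  have rsp: "mv ?N Q v \<in> ?W" for v unfolding Qv using Pr by (simp add: orth_proj_def)
  have equiv: "mv ?N Q (mv ?N (kact n a b g) u) = mv ?P (kact n (b + M) (a + M) g) (mv ?N Q u)" if g: "in_Sp n g" for g u
  proof -
    \<comment> \<open>The primitive part is invariant under the group and its adjoints, so the
      projection commutes with the action.\<close>
    have "mv ?P Pr (mv ?P (kact n (b + M) (a + M) g) v) = mv ?P (kact n (b + M) (a + M) g) (mv ?P Pr v)" for v
      by (rule orth_proj_commute[OF prim2_sub Pr]) (auto simp only: kact_adj intro!: prim2_invariant g in_Sp_adj)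
    then show ?thesis unfolding Qv swapm_kron adj_contr_pow_equivariant[OF g] .
  qed
  let ?A = "[0..<a]" and ?B = "[0..<b]" and ?Z = "[a..<a + M]"
  let ?Z' = "map ((+) n) ?Z"
  \<comment> \<open>Test vector for non-vanishing: a pure tensor of two isotropic wedges, hence
    primitive, whose extra indices \<open>a, ..., a + M - 1\<close> appear as \<open>e\<close> in
    one factor and as \<open>f\<close> in the other, so that each can be contracted. The bound
    \<open>a + M \<le> n\<close> provides the room.\<close>
  define x where "x = tens (Ne n (b + M)) (Ne n (a + M)) (extv n (b + M) (?Z @ ?B)) (extv n (a + M) (?Z' @ ?A))"
  have p1: "extv n (b + M) (?Z @ ?B) \<in> prim_ext n (b + M)"
    by (rule extv_prim) (use ab in auto)
  have p2: "extv n (a + M) (?Z' @ ?A) \<in> prim_ext n (a + M)"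
    by (rule extv_prim) (use ab in \<open>auto simp: distinct_map\<close>)
  have xW: "x \<in> ?W" unfolding x_def rsp_prim2 using p1 p2 by (intro subsetD[OF cspan_superset]) blast
  then have xv: "x \<in> vecs ?P" using prim2_sub(2) by blast
  obtain I where I: "I < Ne n b" "subsets b (2*n) ! I = ?B"
    by (rule subsets_index[OF upt_mem_subsets[of b n]]) (use ab in auto)
  obtain J where J: "J < Ne n a" "subsets a (2*n) ! J = ?A"
    by (rule subsets_index[OF upt_mem_subsets[of a n]]) (use ab in auto)
  have hw: "mv ?N ?S (hwv n a b) = unitv (I * Ne n a + J)"
    unfolding hwv_def swapm_tens ext_basis_unitv[OF I] ext_basis_unitv[OF J] by (rule tens_unitv[OF I(1) J(1)])
  have B: "?B \<in> Lst (2*n) b" "?A \<in> Lst (2*n) a" using ab by (auto simp: Lst_def)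
  have "contr_iter n M (E2 n (b + M) (a + M) x) ?B ?A \<noteq> 0"
  proof -
    have "contr_good n ?B ?A ?Z (E2 n (b + M) (a + M) x)"
    proof (rule contr_good_start[OF ab])
      fix xs ys assume "xs \<in> Lst (2*n) (b + M)" "ys \<in> Lst (2*n) (a + M)"
      then show "E2 n (b + M) (a + M) x xs ys = detsub (b + M) idm xs (?Z @ ?B) * detsub (a + M) idm ys (?Z' @ ?A)"
        unfolding x_def E2_tens by (simp only: ev_extv)
    qed
    moreover have "set ?Z \<subseteq> {..<n}" "set ?B \<subseteq> {..<2*n}" "set ?A \<subseteq> {..<2*n}" using ab by auto
    ultimately have "contr_iter n (length ?Z) (E2 n (b + M) (a + M) x) ?B ?A \<noteq> 0" by (rule contr_iter_nonzero)
    then show ?thesis by simp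
  qed
  then have nz: "mv ?P ?C x (I * Ne n a + J) \<noteq> 0"
    using E2_contr_pow[OF B xv] E2_subsets[OF I(1) J(1), of "mv ?P ?C x"] unfolding I(2) J(2) by simp
  \<comment> \<open>\<open>x\<close> is primitive, so the projection disappears from the pairing;
    the adjoint then turns it into one coefficient of the contracted \<open>x\<close>.\<close>
  have "hip ?P (mv ?N Q (hwv n a b)) x = cnj (mv ?P ?C x (I * Ne n a + J))"
  proof -
    let ?y = "mv ?R (adj ?C) (mv ?N ?S (hwv n a b))"
    have "hip ?P (\<lambda>i. ?y i - mv ?P Pr ?y i) x = 0" using Pr xW by (simp add: orth_proj_def)
    then have "hip ?P (mv ?N Q (hwv n a b)) x = hip ?P ?y x" unfolding Qv by (simp add: hip_diff_left)
    also have "\<dots> = hip ?R (unitv (I * Ne n a + J)) (mv ?P ?C x)" unfolding hip_mv adj_adj hw ..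
    also have "\<dots> = cnj (mv ?P ?C x (I * Ne n a + J))" by (rule hip_unitv[OF enc_less[OF I(1) J(1)]])
    finally show ?thesis .
  qed
  then have "mv ?N Q (hwv n a b) \<noteq> (\<lambda>_. 0)" using nz by (auto simp: hip_def)
  with that[of Q] supp rsp equiv show ?thesis by blast
qed

section \<open>Existence of homomorphisms\<close>

lemma kron_mm: "mm (M * N) (kron M N A B) (kron M N C D) = kron M N (mm M A C) (mm N B D)"
proof (rule mat_supp_ext[OF mat_supp_mm[OF mat_supp_kron mat_supp_kron] mat_supp_kron])
  fix r c assume "r < M * N" "c < M * N"
  then obtain x y x' y' where xy: "x < M" "y < N" "r = x * N + y" "x' < M" "y' < N" "c = x' * N + y'"
    by (metis enc_cases)
  show "mm (M * N) (kron M N A B) (kron M N C D) r c = kron M N (mm M A C) (mm N B D) r c"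
    unfolding mm_def sum_mult_split xy(3,6) kron_enc[OF xy(1,2,4,5)] sum_product
    by (intro sum.cong refl) (simp only: kron_enc xy(1,2,4,5) lessThan_iff, simp only: mult_ac)
qed

lemma top_sub: "csub (rsp (toprep n a b))" "rsp (toprep n a b) \<subseteq> vecs (Ne n a * Ne n b)"
  unfolding rsp_toprep
  by (rule csub_cspan) (rule cspan_least[OF csub_vecs], auto intro: mv_in_vecs[OF mat_supp_kron])

lemma top_invariant:
  assumes g: "in_Sp n g" and u: "u \<in> rsp (toprep n a b)"
  shows "mv (Ne n a * Ne n b) (kact n a b g) u \<in> rsp (toprep n a b)"
proof -
  let ?N = "Ne n a * Ne n b"
  let ?S = "{mv ?N (kact n a b g2) (hwv n a b) | g1 g2. (g1, g2) \<in> Grp n}"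
  have cs: "csub {u. mv ?N (kact n a b g) u \<in> cspan ?S}"
    by (rule csub_vimage[OF csub_cspan]) (simp_all add: mv_add_scaled mv_0)
  have "mv ?N (kact n a b g) (mv ?N (kact n a b g2) (hwv n a b)) \<in> cspan ?S" if "(g1, g2) \<in> Grp n" for g1 g2
  proof -
    have "mv ?N (kact n a b g) (mv ?N (kact n a b g2) (hwv n a b)) = mv ?N (kact n a b (mm (2*n) g g2)) (hwv n a b)"
      by (simp only: mv_mm[symmetric] kron_mm ext_act_mm)
    moreover have "(g1, mm (2*n) g g2) \<in> Grp n" using that g by (simp add: Grp_def in_Sp_mm)
    ultimately show ?thesis by (intro subsetD[OF cspan_superset]) blast
  qed
  then have "cspan ?S \<subseteq> {u. mv ?N (kact n a b g) u \<in> cspan ?S}" by (intro cspan_least[OF cs]) blast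
  then show ?thesis using u unfolding rsp_toprep by blast
qed

text \<open>Reorders \<open>(Sym^r \<otimes> Sym^l) \<otimes> (\<Lambda>^p \<otimes>
  \<Lambda>^d)\<close>, in which the map is built, into the order of \<open>vrep\<close>.\<close>

definition rearr :: "nat \<Rightarrow> nat \<Rightarrow> nat \<Rightarrow> nat \<Rightarrow> cvec \<Rightarrow> cvec \<Rightarrow> cvec" where
  "rearr R Np L Nd x y = (\<lambda>c. if c < (R * Np) * (L * Nd) then
     x ((c div (L * Nd) div Np) * L + c mod (L * Nd) div Nd) * y ((c div (L * Nd) mod Np) * Nd + c mod (L * Nd) mod Nd) else 0)"

lemma rearr_vecs: "rearr R Np L Nd x y \<in> vecs ((R * Np) * (L * Nd))"
  by (simp add: rearr_def vecs_def)

lemma enc4_dec: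
  assumes "I < Np" "j < L" "J < Nd"
  shows "enc4 Np L Nd i I j J div (L * Nd) div Np = i" "enc4 Np L Nd i I j J mod (L * Nd) div Nd = j"
    "enc4 Np L Nd i I j J div (L * Nd) mod Np = I" "enc4 Np L Nd i I j J mod (L * Nd) mod Nd = J"
  unfolding enc4_def enc_div[OF enc_less[OF assms(2,3)]] enc_mod[OF enc_less[OF assms(2,3)]]
    enc_div[OF assms(1)] enc_div[OF assms(3)] enc_mod[OF assms(1)] enc_mod[OF assms(3)] by simp_all

lemma rearr_enc4:
  assumes "i < R" "I < Np" "j < L" "J < Nd"
  shows "rearr R Np L Nd x y (enc4 Np L Nd i I j J) = x (i * L + j) * y (I * Nd + J)"
  unfolding rearr_def enc4_dec[OF assms(2-4)] using enc4_less[OF assms] by simp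

lemma vecs_eqI_enc4:
  assumes "u \<in> vecs ((R * Np) * (L * Nd))" "v \<in> vecs ((R * Np) * (L * Nd))"
    "\<And>i I j J. i < R \<Longrightarrow> I < Np \<Longrightarrow> j < L \<Longrightarrow> J < Nd \<Longrightarrow> u (enc4 Np L Nd i I j J) = v (enc4 Np L Nd i I j J)"
  shows "u = v"
  unfolding vecs_eq_iff[OF assms(1,2)]
proof (intro allI impI)
  fix c assume "c < (R * Np) * (L * Nd)"
  then show "u c = v c" by (rule enc4_cases) (simp add: assms(3))
qed

lemma mv_kron4_rearr:
  "mv ((R * Np) * (L * Nd)) (kron (R * Np) (L * Nd) (kron R Np A B) (kron L Nd C D)) (rearr R Np L Nd x y)
   = rearr R Np L Nd (mv (R * L) (kron R L A C) x) (mv (Np * Nd) (kron Np Nd B D) y)"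
proof (rule vecs_eqI_enc4[OF mv_in_vecs[OF mat_supp_kron] rearr_vecs])
  fix i I j J assume h: "i < R" "I < Np" "j < L" "J < Nd"
  let ?x = "\<lambda>i j. x (i * L + j)" and ?y = "\<lambda>I J. y (I * Nd + J)"
  have val: "rearr R Np L Nd x y (i' * (L * Nd) + j') = ?x (i' div Np) (j' div Nd) * ?y (i' mod Np) (j' mod Nd)"
    if "i' < R * Np" "j' < L * Nd" for i' j'
    unfolding rearr_def enc_div[OF that(2)] enc_mod[OF that(2)] using enc_less[OF that] by simp
  have "mv ((R * Np) * (L * Nd)) (kron (R * Np) (L * Nd) (kron R Np A B) (kron L Nd C D)) (rearr R Np L Nd x y) (enc4 Np L Nd i I j J)
     = (\<Sum>i'<R. \<Sum>I'<Np. \<Sum>j'<L. \<Sum>J'<Nd. (A i i' * (C j j' * ?x i' j')) * (B I I' * (D J J' * ?y I' J')))"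
    unfolding enc4_def mv_kron_enc[OF enc_less[OF h(1,2)] enc_less[OF h(3,4)]] mv_def sum_mult_split sum_distrib_left
    by (intro sum.cong refl)
      (simp only: kron_enc val enc_less enc_div enc_mod h lessThan_iff, simp only: mult_ac)
  also have "\<dots> = (\<Sum>i'<R. \<Sum>j'<L. \<Sum>I'<Np. \<Sum>J'<Nd. (A i i' * (C j j' * ?x i' j')) * (B I I' * (D J J' * ?y I' J')))"
    by (intro sum.cong refl sum.swap)
  also have "\<dots> = (\<Sum>i'<R. \<Sum>j'<L. A i i' * (C j j' * ?x i' j')) * (\<Sum>I'<Np. \<Sum>J'<Nd. B I I' * (D J J' * ?y I' J'))"
    unfolding sum_distrib_right unfolding sum_distrib_left ..
  also have "\<dots> = mv (R * L) (kron R L A C) x (i * L + j) * mv (Np * Nd) (kron Np Nd B D) y (I * Nd + J)"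
  proof -
    have "mv (R * L) (kron R L A C) x (i * L + j) = (\<Sum>i'<R. \<Sum>j'<L. A i i' * (C j j' * ?x i' j'))"
      unfolding mv_kron_enc[OF h(1,3)] unfolding mv_def sum_distrib_left ..
    moreover have "mv (Np * Nd) (kron Np Nd B D) y (I * Nd + J) = (\<Sum>I'<Np. \<Sum>J'<Nd. B I I' * (D J J' * ?y I' J'))"
      unfolding mv_kron_enc[OF h(2,4)] unfolding mv_def sum_distrib_left ..
    ultimately show ?thesis by simp
  qed
  finally show "mv ((R * Np) * (L * Nd)) (kron (R * Np) (L * Nd) (kron R Np A B) (kron L Nd C D)) (rearr R Np L Nd x y) (enc4 Np L Nd i I j J)
    = rearr R Np L Nd (mv (R * L) (kron R L A C) x) (mv (Np * Nd) (kron Np Nd B D) y) (enc4 Np L Nd i I j J)"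
    by (simp only: rearr_enc4[OF h])
qed

lemma rearr_add_scaled_right: "rearr R Np L Nd x (\<lambda>i. u i + c * v i) = (\<lambda>i. rearr R Np L Nd x u i + c * rearr R Np L Nd x v i)"
  by (intro ext) (simp add: rearr_def algebra_simps)

lemma rearr_0_right: "rearr R Np L Nd x (\<lambda>i. 0) = (\<lambda>i. 0)"
  by (intro ext) (simp add: rearr_def)

lemma rearr_in_vrep:
  assumes y: "y \<in> prim2 n p d"
  shows "rearr (r + 1) (Ne n p) (l + 1) (Ne n d) x y \<in> rsp (vrep n r p l d)"
proof -
  let ?f = "rearr (r + 1) (Ne n p) (l + 1) (Ne n d) x"
  have cV: "csub (rsp (vrep n r p l d))" using wf_tensor_rep unfolding vrep_def wf_rep_def by blast
  have cs: "csub {y. ?f y \<in> rsp (vrep n r p l d)}"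
    by (rule csub_vimage[OF cV]) (simp_all add: rearr_add_scaled_right rearr_0_right)
  have "?f (tens (Ne n p) (Ne n d) u v) \<in> rsp (vrep n r p l d)" if uv: "u \<in> prim_ext n p" "v \<in> prim_ext n d" for u v
  proof -
    let ?t = "\<lambda>(i, j). tens ((r + 1) * Ne n p) ((l + 1) * Ne n d) (tens (r + 1) (Ne n p) (unitv i) u) (tens (l + 1) (Ne n d) (unitv j) v)"
    have mem: "?t ij \<in> rsp (vrep n r p l d)" if mem0: "ij \<in> {..<r + 1} \<times> {..<l + 1}" for ij
    proof -
      obtain i j where ij: "ij = (i, j)" "i \<le> r" "j \<le> l" using mem0 by (cases ij) auto
      have "tens (r + 1) (Ne n p) (unitv i) u \<in> rsp (tensor_rep (Symrep r) (Extrep n p))"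
        using tens_in_rsp[of "unitv i" "Symrep r" u "Extrep n p"] unitv_vecs[OF ij(2)] uv(1) by (simp add: Extrep_def)
      moreover have "tens (l + 1) (Ne n d) (unitv j) v \<in> rsp (tensor_rep (Symrep l) (Extrep n d))"
        using tens_in_rsp[of "unitv j" "Symrep l" v "Extrep n d"] unitv_vecs[OF ij(3)] uv(2) by (simp add: Extrep_def)
      ultimately show ?thesis unfolding ij(1) vrep_def case_prod_conv
        using tens_in_rsp[of _ "tensor_rep (Symrep r) (Extrep n p)" _ "tensor_rep (Symrep l) (Extrep n d)"]
        by (simp only: rdim_simps)
    qed
    \<comment> \<open>The carriers of the symmetric powers are full, so \<open>x\<close> is expanded
      in the monomial basis and each summand is a pure tensor in the target.\<close>
    have "?f (tens (Ne n p) (Ne n d) u v) = (\<lambda>c. \<Sum>ij\<in>{..<r + 1} \<times> {..<l + 1}. x (fst ij * (l + 1) + snd ij) * ?t ij c)"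
    proof (rule vecs_eqI_enc4[OF rearr_vecs])
      show "(\<lambda>c. \<Sum>ij\<in>{..<r + 1} \<times> {..<l + 1}. x (fst ij * (l + 1) + snd ij) * ?t ij c) \<in> vecs ((r + 1) * Ne n p * ((l + 1) * Ne n d))"
        by (rule csub_sum[OF csub_vecs]) (auto intro: tens_in_vecs)
      fix i I j J assume h: "i < r + 1" "I < Ne n p" "j < l + 1" "J < Ne n d"
      have t: "?t ij (enc4 (Ne n p) (l + 1) (Ne n d) i I j J) = (if ij = (i, j) then u I * v J else 0)" for ij
        unfolding enc4_def case_prod_beta tens_enc[OF enc_less[OF h(1,2)] enc_less[OF h(3,4)]] tens_enc[OF h(1,2)] tens_enc[OF h(3,4)]
        by (cases ij) (auto simp: unitv_def)
      have "(\<Sum>ij\<in>{..<r + 1} \<times> {..<l + 1}. x (fst ij * (l + 1) + snd ij) * ?t ij (enc4 (Ne n p) (l + 1) (Ne n d) i I j J))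
        = (\<Sum>ij\<in>{..<r + 1} \<times> {..<l + 1}. if ij = (i, j) then x (fst ij * (l + 1) + snd ij) * (u I * v J) else 0)"
        unfolding t by (intro sum.cong refl) simp
      also have "\<dots> = x (i * (l + 1) + j) * (u I * v J)" using h by (subst sum.delta) auto
      finally show "?f (tens (Ne n p) (Ne n d) u v) (enc4 (Ne n p) (l + 1) (Ne n d) i I j J)
        = (\<Sum>ij\<in>{..<r + 1} \<times> {..<l + 1}. x (fst ij * (l + 1) + snd ij) * ?t ij (enc4 (Ne n p) (l + 1) (Ne n d) i I j J))"
        unfolding rearr_enc4[OF h] tens_enc[OF h(2,4)] by simp
    qed
    then show ?thesis by (simp only: csub_sum[OF cV mem])
  qed
  then have "prim2 n p d \<subseteq> {y. ?f y \<in> rsp (vrep n r p l d)}"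
    unfolding rsp_prim2 by (intro cspan_least[OF cs]) auto
  then show ?thesis using y by blast
qed

lemma homs_nonzero:
  assumes ab: "b \<le> a" "a + M \<le> n"
  obtains T where "T \<in> homs n (pirep n k a b) (vrep n r (b + M) (k + r) (a + M))" "T \<noteq> (\<lambda>_ _. 0)"
proof -
  define p d l where "p = b + M" and "d = a + M" and "l = k + r"
  let ?B = "Ne n a * Ne n b"
  let ?N = "(k + 1) * ?B" and ?V = "((r + 1) * Ne n p) * ((l + 1) * Ne n d)"
  obtain Q where Qs: "mat_supp (Ne n p * Ne n d) ?B Q" and Qr: "\<And>v. mv ?B Q v \<in> prim2 n p d"
    and Qe: "\<And>g u. in_Sp n g \<Longrightarrow> mv ?B Q (mv ?B (kact n a b g) u) = mv (Ne n p * Ne n d) (kact n p d g) (mv ?B Q u)"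
    and Qn: "mv ?B Q (hwv n a b) \<noteq> (\<lambda>_. 0)"
    by (rule ext_intertwiner[OF ab]) (rule that[unfolded p_def d_def])
  obtain Pt where Pt: "orth_proj ?B (rsp (toprep n a b)) Pt" using orth_proj_exists[OF top_sub] by blast
  have fixP: "mv ?B Pt u = u" if "u \<in> rsp (toprep n a b)" for u by (rule orth_proj_fixes[OF top_sub Pt that])
  \<comment> \<open>\<open>homs\<close> demands vanishing on the complement of the carrier, so the
    carrier projection is applied first.\<close>
  define Q' where "Q' = mm ?B Q Pt"
  have Q'v: "mv ?B Q' v = mv ?B Q (mv ?B Pt v)" for v unfolding Q'_def by (rule mv_mm)
  define S where "S = sym_emb k r"
  define T where "T = (\<lambda>R c. if R < ?V \<and> c < ?N then
     rearr (r + 1) (Ne n p) (l + 1) (Ne n d) (\<lambda>x. S x (c div ?B)) (\<lambda>y. Q' y (c mod ?B)) R else 0)"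
  have supp: "mat_supp ?V ?N T" by (auto simp: mat_supp_def T_def)
  have Tv: "mv ?N T v (enc4 (Ne n p) (l + 1) (Ne n d) i I j J)
      = (\<Sum>m<k + 1. S (i * (l + 1) + j) m * mv ?B Q' (\<lambda>y. v (m * ?B + y)) (I * Ne n d + J))"
    if h: "i < r + 1" "I < Ne n p" "j < l + 1" "J < Ne n d" for v i I j J
  proof -
    have "T (enc4 (Ne n p) (l + 1) (Ne n d) i I j J) (m * ?B + y) = S (i * (l + 1) + j) m * Q' (I * Ne n d + J) y"
      if my: "m < k + 1" "y < ?B" for m y
      unfolding T_def rearr_enc4[OF h] enc_div[OF my(2)] enc_mod[OF my(2)]
      using enc_less[OF my] enc4_less[OF h] by simp
    then have "mv ?N T v (enc4 (Ne n p) (l + 1) (Ne n d) i I j J)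
      = (\<Sum>m<k + 1. \<Sum>y<?B. S (i * (l + 1) + j) m * (Q' (I * Ne n d + J) y * v (m * ?B + y)))"
      unfolding mv_def sum_mult_split[where M="k + 1" and N="?B"] by (intro sum.cong refl) (simp only: lessThan_iff mult.assoc)
    then show ?thesis by (simp only: mv_def sum_distrib_left)
  qed
  have Tt: "mv ?N T (tens (k + 1) ?B s u) = rearr (r + 1) (Ne n p) (l + 1) (Ne n d) (mv (k + 1) S s) (mv ?B Q' u)" for s u
  proof (rule vecs_eqI_enc4[OF mv_in_vecs[OF supp] rearr_vecs])
    fix i I j J assume h: "i < r + 1" "I < Ne n p" "j < l + 1" "J < Ne n d"
    have "mv ?B Q' (\<lambda>y. tens (k + 1) ?B s u (m * ?B + y)) = (\<lambda>x. s m * mv ?B Q' u x)" if "m < k + 1" for m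
    proof -
      have "mv ?B Q' (\<lambda>y. tens (k + 1) ?B s u (m * ?B + y)) = mv ?B Q' (\<lambda>y. s m * u y)"
        by (rule mv_cong) (simp only: tens_enc that)
      then show ?thesis by (simp only: mv_scale)
    qed
    then have "mv ?N T (tens (k + 1) ?B s u) (enc4 (Ne n p) (l + 1) (Ne n d) i I j J)
      = (\<Sum>m<k + 1. S (i * (l + 1) + j) m * (s m * mv ?B Q' u (I * Ne n d + J)))"
      unfolding Tv[OF h] by (intro sum.cong refl) simp
    also have "\<dots> = mv (k + 1) S s (i * (l + 1) + j) * mv ?B Q' u (I * Ne n d + J)"
      unfolding mv_def[of "k + 1"] sum_distrib_right by (simp only: mult.assoc)
    finally show "mv ?N T (tens (k + 1) ?B s u) (enc4 (Ne n p) (l + 1) (Ne n d) i I j J)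
      = rearr (r + 1) (Ne n p) (l + 1) (Ne n d) (mv (k + 1) S s) (mv ?B Q' u) (enc4 (Ne n p) (l + 1) (Ne n d) i I j J)"
      unfolding rearr_enc4[OF h] .
  qed
  have rspP: "rsp (pirep n k a b) = cspan {tens (k + 1) ?B s u |s u. s \<in> rsp (Symrep k) \<and> u \<in> rsp (toprep n a b)}"
    unfolding pirep_def tensor_rep_def rep.simps rdim_simps ..
  have cV: "csub (rsp (vrep n r p l d))" using wf_tensor_rep unfolding vrep_def wf_rep_def by blast
  have c1: "mv ?N T v \<in> rsp (vrep n r p l d)" if "v \<in> rsp (pirep n k a b)" for v
  proof -
    have "csub {v. mv ?N T v \<in> rsp (vrep n r p l d)}"
      by (rule csub_vimage[OF cV]) (simp_all add: mv_add_scaled mv_0)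
    then have "rsp (pirep n k a b) \<subseteq> {v. mv ?N T v \<in> rsp (vrep n r p l d)}"
      unfolding rspP by (rule cspan_least) (auto simp only: Tt Q'v intro!: rearr_in_vrep Qr)
    then show ?thesis using that by blast
  qed
  have actV: "ract (vrep n r p l d) g1 g2 = kron ((r + 1) * Ne n p) ((l + 1) * Ne n d)
      (kron (r + 1) (Ne n p) (sym_act r g1) (ext_act n p g2)) (kron (l + 1) (Ne n d) (sym_act l g1) (ext_act n d g2))" for g1 g2
    unfolding vrep_def tensor_rep_def rep.simps Symrep_def Extrep_def ..
  have actP: "ract (pirep n k a b) g1 g2 = kron (k + 1) ?B (sym_act k g1) (kact n a b g2)" for g1 g2
    unfolding pirep_def tensor_rep_def rep.simps rdim_simps ract_toprep Symrep_def ..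
  have c2: "mv ?N T (mv ?N (ract (pirep n k a b) g1 g2) v) = mv ?V (ract (vrep n r p l d) g1 g2) (mv ?N T v)"
    if g: "(g1, g2) \<in> Grp n" and v: "v \<in> rsp (pirep n k a b)" for g1 g2 v
  proof -
    have g12: "in_Sp 1 g1" "in_Sp n g2" using g by (auto simp: Grp_def)
    have cs: "csub {v. mv ?N T (mv ?N (ract (pirep n k a b) g1 g2) v) = mv ?V (ract (vrep n r p l d) g1 g2) (mv ?N T v)}"
      by (auto simp: csub_def mv_add_scaled mv_0)
    have "mv ?N T (mv ?N (ract (pirep n k a b) g1 g2) (tens (k + 1) ?B s u)) = mv ?V (ract (vrep n r p l d) g1 g2) (mv ?N T (tens (k + 1) ?B s u))"
      if u: "u \<in> rsp (toprep n a b)" for s u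
      unfolding actP actV mv_kron_tens Tt mv_kron4_rearr Q'v fixP[OF u] fixP[OF top_invariant[OF g12(2) u]] Qe[OF g12(2)]
      unfolding S_def l_def sym_emb_equivariant[OF g12(1)] ..
    then have "rsp (pirep n k a b) \<subseteq> {v. mv ?N T (mv ?N (ract (pirep n k a b) g1 g2) v) = mv ?V (ract (vrep n r p l d) g1 g2) (mv ?N T v)}"
      unfolding rspP by (intro cspan_least[OF cs]) blast
    then show ?thesis using v by blast
  qed
  have c3: "mv ?N T v = (\<lambda>i. 0)" if perp: "\<And>w. w \<in> rsp (pirep n k a b) \<Longrightarrow> hip ?N v w = 0" for v
  proof (rule vecs_eqI_enc4[OF mv_in_vecs[OF supp]])
    show "(\<lambda>i. 0) \<in> vecs ?V" by (simp add: vecs_def)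
    fix i I j J assume h: "i < r + 1" "I < Ne n p" "j < l + 1" "J < Ne n d"
    have "mv ?B Q' (\<lambda>y. v (m * ?B + y)) = (\<lambda>_. 0)" if m: "m < k + 1" for m
    proof -
      have "hip ?B (\<lambda>y. v (m * ?B + y)) u = 0" if u: "u \<in> rsp (toprep n a b)" for u
      proof -
        have mk: "m \<le> k" using m by simp
        have "hip ?N v (tens (k + 1) ?B (unitv m) u) = (\<Sum>x<k + 1. if x = m then hip ?B (\<lambda>y. v (x * ?B + y)) u else 0)"
          unfolding hip_def sum_mult_split[where M="k + 1" and N="?B"]
        proof (intro sum.cong refl)
          fix x assume "x \<in> {..<k + 1}"
          then have x: "x < k + 1" by simp
          have "(\<Sum>y<?B. v (x * ?B + y) * cnj (tens (k + 1) ?B (unitv m) u (x * ?B + y)))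
              = (\<Sum>y<?B. v (x * ?B + y) * cnj (unitv m x * u y))"
            by (intro sum.cong refl) (simp only: tens_enc[OF x] lessThan_iff)
          then show "(\<Sum>y<?B. v (x * ?B + y) * cnj (tens (k + 1) ?B (unitv m) u (x * ?B + y)))
              = (if x = m then \<Sum>y<?B. v (x * ?B + y) * cnj (u y) else 0)"
            by (simp add: unitv_def)
        qed
        also have "\<dots> = hip ?B (\<lambda>y. v (m * ?B + y)) u" using m by simp
        finally show ?thesis using perp[OF tens_unitv_in_pirep[OF mk u]] by simp
      qed
      then have "mv ?B Pt (\<lambda>y. v (m * ?B + y)) = (\<lambda>_. 0)"
        by (intro orth_proj_unique[OF top_sub Pt] csub_0[OF top_sub(1)]) simp
      then show ?thesis unfolding Q'v by (simp add: mv_0)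
    qed
    then show "mv ?N T v (enc4 (Ne n p) (l + 1) (Ne n d) i I j J) = 0"
      unfolding Tv[OF h] by (intro sum.neutral ballI) simp
  qed
  have mem: "T \<in> homs n (pirep n k a b) (vrep n r p l d)"
    unfolding homs_def mem_Collect_eq rdim_simps using supp c1 c2 c3[unfolded hip_def] by blast
  have "T \<noteq> (\<lambda>_ _. 0)"
  proof
    assume "T = (\<lambda>_ _. 0)"
    then have z: "mv ?N T (hwv0 n k a b) = (\<lambda>_. 0)" by (simp add: mv_mat_0)
    obtain y where y: "mv ?B Q (hwv n a b) y \<noteq> 0" using Qn by blast
    have "y < Ne n p * Ne n d" using vecs_nonzero_less[OF mv_in_vecs[OF Qs] y] .
    then obtain I J where IJ: "I < Ne n p" "J < Ne n d" "y = I * Ne n d + J" by (rule enc_cases)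
    \<comment> \<open>In the image of \<open>x^k\<close>, the term \<open>z0^r * y1^r * y0^k\<close>
      of \<open>(z0 * y1 - z1 * y0)^r * y0^k\<close> has coefficient \<open>1\<close>.\<close>
    have Sk: "mv (k + 1) S (unitv k) (r * (l + 1) + k) = 1"
    proof -
      have "mv (k + 1) S (unitv k) (r * (l + 1) + k) = (\<Sum>m<k + 1. if m = k then S (r * (l + 1) + k) m else 0)"
        unfolding mv_def by (intro sum.cong refl) (simp add: unitv_def)
      also have "\<dots> = S (r * (l + 1) + k) k" by simp
      also have "\<dots> = 1" unfolding S_def l_def using sym_emb_enc[of r r k k k] by simp
      finally show ?thesis .
    qed
    have r: "r < r + 1" "k < l + 1" by (simp_all add: l_def)
    have "mv ?N T (hwv0 n k a b) (enc4 (Ne n p) (l + 1) (Ne n d) r I k J) = mv ?B Q (hwv n a b) y"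
      unfolding hwv0_def Tt rearr_enc4[OF r(1) IJ(1) r(2) IJ(2)] Sk Q'v fixP[OF hwv_in_top] IJ(3) by simp
    then show False using y z by simp
  qed
  then show ?thesis using that mem unfolding p_def d_def l_def by blast
qed

section \<open>The twists\<close>

text \<open>Read the weight equation coordinate by coordinate: \<open>u < b\<close> forces
  \<open>e_u\<close> into \<open>L\<close>, \<open>a \<le> u < d\<close> forces \<open>f_u\<close>,
  and \<open>d \<le> u < a\<close> forces \<open>e_u\<close>. Counting gives the bounds, and in the
  case of equality no further entry fits.\<close>

lemma weight_bounds:
  assumes L: "length L = p" "distinct L" and ba: "b \<le> a" "a \<le> n" "d \<le> n"
    and wt: "\<And>u. u < n \<Longrightarrow> delta (u \<in> set L) - delta (n + u \<in> set L) + delta (u < d) = delta (u < a) + delta (u < b)"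
  shows "b \<le> d" "b + d \<le> p + a" "a + b \<le> p + d"
    "a \<le> d \<Longrightarrow> p + a = b + d \<Longrightarrow> set L = {..<b} \<union> {n + a..<n + d}"
proof -
  show bd: "b \<le> d"
  proof (rule ccontr)
    assume "\<not> b \<le> d"
    then show False using wt[of d] ba by (auto simp: delta_def split: if_splits)
  qed
  have card: "card (set L) = p" using L distinct_card by blast
  have sub1: "{..<b} \<subseteq> set L"
  proof
    fix u assume "u \<in> {..<b}"
    then show "u \<in> set L" using wt[of u] ba bd by (auto simp: delta_def split: if_splits)
  qed
  have sub2: "{..<b} \<union> {n + a..<n + d} \<subseteq> set L"
  proof -
    have "v \<in> set L" if "v \<in> {n + a..<n + d}" for v
    proof -
      define u where "u = v - n"
      have u: "v = n + u" "a \<le> u" "u < d" using that by (auto simp: u_def)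
      show ?thesis using wt[of u] u ba by (auto simp: delta_def split: if_splits)
    qed
    then show ?thesis using sub1 by auto
  qed
  have sub3: "{..<b} \<union> {d..<a} \<subseteq> set L"
  proof -
    have "u \<in> set L" if "u \<in> {d..<a}" for u
      using that wt[of u] ba bd by (auto simp: delta_def split: if_splits)
    then show ?thesis using sub1 by auto
  qed
  have c2: "card ({..<b} \<union> {n + a..<n + d}) = b + (d - a)"
    using ba by (subst card_Un_disjoint) auto
  have c3: "card ({..<b} \<union> {d..<a}) = b + (a - d)"
    using bd by (subst card_Un_disjoint) auto
  show "b + d \<le> p + a" using card_mono[OF _ sub2] c2 card by simp
  show "a + b \<le> p + d" using card_mono[OF _ sub3] c3 card by simp
  show "set L = {..<b} \<union> {n + a..<n + d}" if "a \<le> d" "p + a = b + d"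
    using card_subset_eq[OF _ sub2] c2 card that by simp
qed

lemma homs_necessary:
  assumes T: "T \<in> homs n (pirep n k a b) (vrep n r p l d)" "T \<noteq> (\<lambda>_ _. 0)"
    and ba: "b \<le> a" "a \<le> n" "d \<le> n" "p \<le> n"
  shows "l \<le> k + r" "r \<le> k + l" "b \<le> d" "b \<le> p" "b + d \<le> p + a" "b + p \<le> d + a" "a + b \<le> p + d"
proof -
  have b: "b \<le> n" using ba by simp
  have nz: "mv ((k + 1) * (Ne n a * Ne n b)) T (hwv0 n k a b) \<noteq> (\<lambda>_. 0)"
    using homs_eq_0[OF T(1) ba(2) b] T(2) by blast
  obtain i I where i: "i \<le> r" "2 * i + l = k + r" "I < Ne n p"
    "\<And>u. u < n \<Longrightarrow> delta (u \<in> set (subsets p (2*n) ! I)) - delta (n + u \<in> set (subsets p (2*n) ! I)) + delta (u < d)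
       = delta (u < a) + delta (u < b)"
    by (rule homs_component[OF T(1) ba(2) b nz ba(3)]) (rule that)
  obtain j J where j: "j \<le> l" "2 * j + r = k + l" "J < Ne n d"
    "\<And>u. u < n \<Longrightarrow> delta (u \<in> set (subsets d (2*n) ! J)) - delta (n + u \<in> set (subsets d (2*n) ! J)) + delta (u < p)
       = delta (u < a) + delta (u < b)"
    by (rule homs_component_swapped[OF T(1) ba(2) b nz ba(4)]) (rule that)
  show "l \<le> k + r" "r \<le> k + l" using i(2) j(2) by linarith+
  note w1 = weight_bounds[OF nth_subsets(1)[OF i(3)] nth_subsets(3)[OF i(3)] ba(1-3) i(4)]
  note w2 = weight_bounds[OF nth_subsets(1)[OF j(3)] nth_subsets(3)[OF j(3)] ba(1,2,4) j(4)]
  show "b \<le> d" "b + d \<le> p + a" "a + b \<le> p + d" using w1(1-3) by auto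
  show "b \<le> p" "b + p \<le> d + a" using w2(1,2) by auto
qed

lemma mv_lin2: "mv N (\<lambda>i j. c * A i j - e * B i j) v x = c * mv N A v x - e * mv N B v x"
  by (simp add: mv_def sum_distrib_left sum_subtractf left_diff_distrib mult.assoc)

lemma homs_lin2:
  assumes "wfr V" "S \<in> homs n P V" "T \<in> homs n P V"
  shows "(\<lambda>i j. c * S i j - e * T i j) \<in> homs n P V"
proof -
  let ?A = "\<lambda>i j. c * S i j - e * T i j"
  have eq: "mv (rdim P) ?A v = (\<lambda>x. c * mv (rdim P) S v x - e * mv (rdim P) T v x)" for v
    by (intro ext) (rule mv_lin2)
  have eq': "mv (rdim P) ?A v = (\<lambda>x. c * mv (rdim P) S v x + (- e) * mv (rdim P) T v x)" for v
    unfolding eq by simp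
  have cV: "csub (rsp V)" using assms(1) by (simp add: wfr_def wf_rep_def)
  have supp: "mat_supp (rdim V) (rdim P) ?A" using homs_supp[OF assms(2)] homs_supp[OF assms(3)] by (simp add: mat_supp_def)
  have rsp: "mv (rdim P) ?A v \<in> rsp V" if "v \<in> rsp P" for v unfolding eq'
    by (intro csub_add_scaled[OF cV] csub_scale[OF cV] homs_rsp[OF assms(2) that] homs_rsp[OF assms(3) that])
  have equiv: "mv (rdim P) ?A (mv (rdim P) (ract P g1 g2) v) = mv (rdim V) (ract V g1 g2) (mv (rdim P) ?A v)"
    if "(g1, g2) \<in> Grp n" "v \<in> rsp P" for g1 g2 v
    unfolding eq' homs_equivariant[OF assms(2) that] homs_equivariant[OF assms(3) that] mv_add_scaled mv_scale ..
  have perp: "mv (rdim P) ?A v = (\<lambda>i. 0)" if "v \<in> vecs (rdim P)" "\<forall>w\<in>rsp P. (\<Sum>i<rdim P. v i * cnj (w i)) = 0" for v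
  proof -
    have h: "\<And>w. w \<in> rsp P \<Longrightarrow> hip (rdim P) v w = 0" using that(2) by (simp add: hip_def)
    have z: "mv (rdim P) S v = (\<lambda>i. 0)" "mv (rdim P) T v = (\<lambda>i. 0)"
      using homs_perp[OF assms(2) that(1) h] homs_perp[OF assms(3) that(1) h] by blast+
    show ?thesis unfolding eq z by simp
  qed
  show ?thesis unfolding homs_def mem_Collect_eq using supp rsp equiv perp by blast
qed

lemma wfr_vrep: "wfr (vrep n r p l d)"
  unfolding vrep_def by (rule wfr_tensor)

text \<open>In the extremal case the labels \<open>i\<close>, \<open>I\<close> and \<open>J\<close>
  of a guaranteed nonzero coordinate are all determined. That coordinate is therefore an injective
  linear functional \<open>f\<close> on the homomorphisms, so \<open>f T0 * T - f T * T0\<close>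
  vanishes.\<close>

lemma homs_one_dim:
  assumes ab: "b \<le> a" "a + M \<le> n"
  shows "one_dim_homs n (pirep n k a b) (vrep n r (b + M) (k + r) (a + M))"
proof -
  let ?P = "pirep n k a b" and ?V = "vrep n r (b + M) (k + r) (a + M)" and ?N = "(k + 1) * (Ne n a * Ne n b)"
  have le: "a \<le> n" "b \<le> n" using ab by auto
  obtain T0 where T0: "T0 \<in> homs n ?P ?V" "T0 \<noteq> (\<lambda>_ _. 0)" by (rule homs_nonzero[OF ab])
  \<comment> \<open>The unique list of the extremal weight: \<open>e_0, ..., e_(b-1)\<close> and
    \<open>f_a, ..., f_(a+M-1)\<close>, already increasing.\<close>
  define L where "L = [0..<b] @ [n + a..<n + (a + M)]"
  have "L \<in> set (subsets (b + M) (2*n))" using ab by (auto simp: mem_subsets L_def sorted_append)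
  then obtain I0 where I0: "I0 < Ne n (b + M)" "subsets (b + M) (2*n) ! I0 = L" by (rule subsets_index)
  obtain J0 where J0: "J0 < Ne n (a + M)" "subsets (a + M) (2*n) ! J0 = [0..<a + M]"
    by (rule subsets_index[OF upt_mem_subsets[OF ab(2)]])
  define f where "f T = mv ?N T (hwv0 n k a b) (enc4 (Ne n (b + M)) (k + r + 1) (Ne n (a + M)) 0 I0 (k + r) J0)" for T
  have key: "T = (\<lambda>_ _. 0)" if T: "T \<in> homs n ?P ?V" and z: "f T = 0" for T
  proof (rule ccontr)
    assume "T \<noteq> (\<lambda>_ _. 0)"
    then have nz: "mv ?N T (hwv0 n k a b) \<noteq> (\<lambda>_. 0)" using homs_eq_0[OF T le] by blast
    show False
    proof (rule homs_component[OF T le nz ab(2)])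
      fix i I J
      assume i: "i \<le> r" "2 * i + (k + r) = k + r" "I < Ne n (b + M)" "J < Ne n (a + M)" "subsets (a + M) (2*n) ! J = [0..<a + M]"
        and ne: "mv ?N T (hwv0 n k a b) (enc4 (Ne n (b + M)) (k + r + 1) (Ne n (a + M)) i I (k + r) J) \<noteq> 0"
        and wt: "\<And>u. u < n \<Longrightarrow> delta (u \<in> set (subsets (b + M) (2*n) ! I)) - delta (n + u \<in> set (subsets (b + M) (2*n) ! I)) + delta (u < a + M)
           = delta (u < a) + delta (u < b)"
      have "set (subsets (b + M) (2*n) ! I) = {..<b} \<union> {n + a..<n + (a + M)}"
        by (rule weight_bounds(4)[OF nth_subsets(1)[OF i(3)] nth_subsets(3)[OF i(3)] ab(1) le(1) ab(2) wt]) auto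
      also have "\<dots> = set L" by (auto simp: L_def)
      finally have "set (subsets (b + M) (2*n) ! I) = set (subsets (b + M) (2*n) ! I0)" unfolding I0(2) .
      then have "subsets (b + M) (2*n) ! I = subsets (b + M) (2*n) ! I0"
        using nth_subsets(2,3)[OF i(3)] nth_subsets(2,3)[OF I0(1)] by (intro sorted_distinct_set_unique)
      then have "I = I0" using nth_subsets_eq_iff[OF i(3) I0(1)] by blast
      moreover have "J = J0" using nth_subsets_eq_iff[OF i(4) J0(1)] i(5) J0(2) by simp
      moreover have "i = 0" using i(2) by simp
      ultimately show False using ne z unfolding f_def by simp
    qed
  qed
  have "\<exists>c. T = (\<lambda>i j. c * T0 i j)" if T: "T \<in> homs n ?P ?V" for T
  proof -
    let ?D = "\<lambda>i j. f T0 * T i j - f T * T0 i j"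
    have "?D \<in> homs n ?P ?V" by (rule homs_lin2[OF wfr_vrep T T0(1)])
    moreover have "f ?D = 0" unfolding f_def mv_lin2 by simp
    ultimately have D: "?D = (\<lambda>_ _. 0)" by (rule key)
    have nz: "f T0 \<noteq> 0" using key[OF T0(1)] T0(2) by blast
    have "T i j = (f T / f T0) * T0 i j" for i j
      using fun_cong[OF fun_cong[OF D, of i], of j] nz by (simp add: field_simps)
    then show ?thesis by (intro exI[of _ "f T / f T0"] ext)
  qed
  then show ?thesis unfolding one_dim_homs_def using T0 by blast
qed

lemma Spiece_tensor: "tensor_rep (Spiece n r) (Rrep n l d) = vrep n r (n - r) l d"
  by (simp add: Spiece_def Rrep_def vrep_def)

lemma tensor_Spiece_list:
  "tensor_rep (dsum_list (map (Spiece n) rs)) (Rrep n l d) = dsum_list (map (\<lambda>r. vrep n r (n - r) l d) rs)"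
  by (subst tensor_dsum_list) (auto simp: Spiece_def wfr_tensor o_def Spiece_tensor[unfolded Spiece_def])

lemma hom_dim_list_1:
  assumes "distinct rs" "r0 \<in> set rs" "one_dim_homs n P (vrep n r0 (n - r0) l d)"
    and "\<And>r. r \<in> set rs \<Longrightarrow> r \<noteq> r0 \<Longrightarrow> zero_homs n P (vrep n r (n - r) l d)"
  shows "hom_dim n P (tensor_rep (dsum_list (map (Spiece n) rs)) (Rrep n l d)) = 1"
  unfolding tensor_Spiece_list
  by (rule hom_dim_1, rule one_dim_homs_dsum_list[where f="\<lambda>r. vrep n r (n - r) l d", OF assms(1) _ assms(2,3,4)]) (auto simp: wfr_vrep)

lemma hom_dim_list_0:
  assumes "\<And>r. r \<in> set rs \<Longrightarrow> zero_homs n P (vrep n r (n - r) l d)"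
  shows "hom_dim n P (tensor_rep (dsum_list (map (Spiece n) rs)) (Rrep n l d)) = 0"
  unfolding tensor_Spiece_list
  by (rule hom_dim_0, rule zero_homs_dsum_list) (use assms wfr_vrep in auto)

lemma admissible_imp:
  assumes "admissible n k a b l d" "b \<le> a" "a \<le> n"
  obtains r where "r \<le> n" "d \<le> n" "l \<le> k + r" "r \<le> k + l" "b \<le> d" "b \<le> n - r" "b + d \<le> n - r + a" "b + (n - r) \<le> d + a" "a + b \<le> n - r + d"
proof -
  have d: "d \<le> n" using assms(1) by (simp add: admissible_def)
  have "\<exists>r\<in>set [0..<n + 1]. \<not> zero_homs n (pirep n k a b) (vrep n r (n - r) l d)"
    using hom_dim_list_0[of "[0..<n + 1]" n "pirep n k a b" l d] assms(1) unfolding admissible_def Spin_def by blast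
  then obtain r where r0: "r \<in> set [0..<n + 1]" "\<not> zero_homs n (pirep n k a b) (vrep n r (n - r) l d)" by blast
  then obtain T where T: "T \<in> homs n (pirep n k a b) (vrep n r (n - r) l d)" "T \<noteq> (\<lambda>_ _. 0)"
    unfolding zero_homs_def by blast
  have r: "r \<le> n" using r0(1) by auto
  show ?thesis
    by (rule that[OF r d homs_necessary[OF T assms(2,3) d]]) simp_all
qed

text \<open>Exactly one spinor summand contributes. If \<open>d = a\<close>, the
  \<open>Sp(1)\<close> bound gives \<open>r0 \<le> r\<close> and the \<open>Sp(n)\<close> bound
  \<open>r \<le> r0\<close>; if \<open>k = 0\<close> and \<open>a = b\<close>, the two
  \<open>Sp(1)\<close> bounds already give \<open>r = l\<close>. The half-spin part is decided by
  the parity of \<open>n - r0\<close>.\<close>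

lemma key_twist:
  assumes ab: "b \<le> a" "a \<le> d" "d \<le> n" and M: "d = a \<or> (k = 0 \<and> a = b)"
    and r0: "r0 = n - (b + (d - a))" and l: "l = k + r0"
  shows "admissible n k a b l d" "index n k a b l d = (-1) ^ (n - r0)"
proof -
  let ?P = "pirep n k a b"
  let ?M = "d - a"
  have rn: "r0 \<le> n" "n - r0 = b + ?M" using r0 ab by auto
  have one: "one_dim_homs n ?P (vrep n r0 (n - r0) l d)"
    using homs_one_dim[OF ab(1), of ?M n k r0] ab unfolding rn(2) l by simp
  have zero: "zero_homs n ?P (vrep n r (n - r) l d)" if r: "r \<le> n" "r \<noteq> r0" for r
  proof (rule ccontr)
    assume "\<not> ?thesis"
    then obtain T where T: "T \<in> homs n ?P (vrep n r (n - r) l d)" "T \<noteq> (\<lambda>_ _. 0)"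
      unfolding zero_homs_def by auto
    have an: "a \<le> n" using ab by simp
    note N = homs_necessary[OF T ab(1) an ab(3), simplified]
    show False using N M r r0 l ab by auto
  qed
  have idx: "hom_dim n ?P (tensor_rep (dsum_list (map (Spiece n) rs)) (Rrep n l d)) = (if r0 \<in> set rs then 1 else 0)"
    if "distinct rs" "set rs \<subseteq> {..n}" for rs
  proof (cases "r0 \<in> set rs")
    case True
    then show ?thesis using hom_dim_list_1[OF that(1) True one] zero that(2) by auto
  next
    case False
    have "hom_dim n ?P (tensor_rep (dsum_list (map (Spiece n) rs)) (Rrep n l d)) = 0"
      by (rule hom_dim_list_0) (use zero that(2) False in auto)
    then show ?thesis using False by simp
  qed
  have "hom_dim n ?P (tensor_rep (Spin n) (Rrep n l d)) = (if r0 \<in> set [0..<n + 1] then 1 else 0)"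
    unfolding Spin_def by (rule idx) auto
  moreover have "r0 \<in> set [0..<n + 1]" using rn(1) by auto
  ultimately show "admissible n k a b l d" unfolding admissible_def using ab(3) by simp
  have "hom_dim n ?P (tensor_rep (Spin_plus n) (Rrep n l d)) = (if r0 \<in> set (filter (\<lambda>r. even (r + n)) [0..<n + 1]) then 1 else 0)"
    unfolding Spin_plus_def by (rule idx) auto
  moreover have "r0 \<in> set (filter (\<lambda>r. even (r + n)) [0..<n + 1]) \<longleftrightarrow> even (r0 + n)"
    using rn(1) unfolding set_filter set_upt by auto
  moreover have "hom_dim n ?P (tensor_rep (Spin_minus n) (Rrep n l d)) = (if r0 \<in> set (filter (\<lambda>r. odd (r + n)) [0..<n + 1]) then 1 else 0)"
    unfolding Spin_minus_def by (rule idx) auto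
  moreover have "r0 \<in> set (filter (\<lambda>r. odd (r + n)) [0..<n + 1]) \<longleftrightarrow> odd (r0 + n)"
    using rn(1) unfolding set_filter set_upt by auto
  moreover have "even (r0 + n) \<longleftrightarrow> even (n - r0)" using rn(1) by (simp add: even_diff_nat) presburger
  ultimately show "index n k a b l d = (-1) ^ (n - r0)"
    unfolding index_def by (cases "even (n - r0)") simp_all
qed

text \<open>As a difference of squares \<open>phi\<close> is visibly increasing in \<open>l\<close>
  and, for \<open>d \<le> n\<close>, in \<open>d\<close>, which the definition hides.\<close>

lemma phi_eq: "phi n l d = (int l + 1)\<^sup>2 - (int n - int d + 1)\<^sup>2"
  by (simp add: phi_def power2_eq_square algebra_simps)

theorem theorem3p4:
  fixes n k a b :: nat
  assumes "2 \<le> n" and "b \<le> a" and "a \<le> n"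
  shows "((0 < k \<or> b < a) \<longrightarrow>
            {(l, d). maximal_twist n k a b l d} = {(k + n - b, a)}
          \<and> index n k a b (k + n - b) a = (-1) ^ b)
       \<and> ((k = 0 \<and> a = b) \<longrightarrow>
            {(l, d). admissible n 0 a a l d} = {(n - d, d) | d. a \<le> d \<and> d \<le> n}
          \<and> (\<forall>d. a \<le> d \<and> d \<le> n \<longrightarrow>
                 phi n (n - d) d = 0
               \<and> maximal_twist n 0 a a (n - d) d
               \<and> minimal_twist n 0 a a (n - d) d
               \<and> index n 0 a a (n - d) d = (-1) ^ d))"
proof (intro conjI impI)
  assume pos: "0 < k \<or> b < a"
  have key: "admissible n k a b (k + n - b) a" "index n k a b (k + n - b) a = (-1) ^ (n - (n - b))"
    by (rule key_twist[OF assms(2) order_refl assms(3), of k "n - b"]; use assms in simp)+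
  then show "index n k a b (k + n - b) a = (-1) ^ b" using assms by simp
  have less: "phi n l d < phi n (k + n - b) a" if adm: "admissible n k a b l d" and ne: "(l, d) \<noteq> (k + n - b, a)" for l d
  proof -
    obtain r where r: "r \<le> n" "d \<le> n" "l \<le> k + r" "b \<le> d" "b + d \<le> n - r + a" "a + b \<le> n - r + d"
      by (rule admissible_imp[OF adm assms(2,3)]) (rule that)
    \<comment> \<open>\<open>X\<close> and \<open>Y\<close> are the values of \<open>l + 1\<close>
      and \<open>n - d + 1\<close> at the claimed twist, \<open>t\<close> is the distance of
      \<open>d\<close> from \<open>a\<close>.\<close>
    define X Y t where "X = int k + int n - int b + 1" and "Y = int n - int a + 1" and "t = \<bar>int d - int a\<bar>"
    \<comment> \<open>\<open>X - Y = k + a - b\<close>, so this is the point where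
      \<open>0 < k \<or> b < a\<close> is used.\<close>
    have XY: "1 \<le> X - Y" "1 \<le> Y" using pos assms unfolding X_def Y_def by auto
    \<comment> \<open>The two \<open>Sp(n)\<close> bounds on \<open>r\<close> together say
      \<open>r \<le> n - b - t\<close>.\<close>
    have l: "int l + 1 \<le> X - t" using r unfolding X_def t_def by linarith
    have max: "phi n (k + n - b) a = X\<^sup>2 - Y\<^sup>2"
      unfolding phi_eq X_def Y_def using assms by (simp add: of_nat_diff algebra_simps)
    show ?thesis
    proof (cases "t = 0")
      case True
      then have da: "d = a" unfolding t_def by simp
      with ne have "l \<noteq> k + n - b" by simp
      then have "int l + 1 < X" using l True assms unfolding X_def by (simp add: of_nat_diff)
      then have "(int l + 1)\<^sup>2 < X\<^sup>2" by (intro power_strict_mono) auto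
      then show ?thesis unfolding max unfolding phi_eq da Y_def by simp
    next
      case False
      then have t: "1 \<le> t" unfolding t_def by simp
      have "(int l + 1)\<^sup>2 \<le> (X - t)\<^sup>2" using l by (intro power_mono) auto
      moreover have "(Y - t)\<^sup>2 \<le> (int n - int d + 1)\<^sup>2"
      proof (cases "a \<le> d")
        case True
        then have "int n - int d + 1 = Y - t" unfolding Y_def t_def by simp
        then show ?thesis by simp
      next
        case False
        then have e: "int n - int d + 1 = Y + t" unfolding Y_def t_def by simp
        have "0 \<le> 4 * (Y * t)" using XY t by simp
        then show ?thesis unfolding e by (simp add: power2_eq_square algebra_simps)
      qed
      \<comment> \<open>Lowering both \<open>X\<close> and \<open>Y\<close> by \<open>t\<close>
        costs \<open>2 * t * (X - Y)\<close>, which is positive: this gives strictness when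
        \<open>d\<close> differs from \<open>a\<close>.\<close>
      moreover have "(X - t)\<^sup>2 - (Y - t)\<^sup>2 = X\<^sup>2 - Y\<^sup>2 - 2 * (t * (X - Y))"
        by (simp add: power2_eq_square algebra_simps)
      moreover have "0 < t * (X - Y)" using XY t by simp
      ultimately show ?thesis unfolding max unfolding phi_eq by linarith
    qed
  qed
  show "{(l, d). maximal_twist n k a b l d} = {(k + n - b, a)}"
  proof (rule equalityI; clarify)
    fix l d assume "maximal_twist n k a b l d"
    then have "admissible n k a b l d" "phi n (k + n - b) a \<le> phi n l d"
      using key(1) by (auto simp: maximal_twist_def)
    then show "l = k + n - b \<and> d = a" using less[of l d] by force
  next
    have "phi n l d \<le> phi n (k + n - b) a" if "admissible n k a b l d" for l d
      using less[OF that] by (cases "(l, d) = (k + n - b, a)") auto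
    then show "maximal_twist n k a b (k + n - b) a" using key(1) by (simp add: maximal_twist_def)
  qed
next
  assume ka: "k = 0 \<and> a = b"
  \<comment> \<open>Here \<open>r0 = n - d\<close>, since \<open>b + (d - a) = d\<close> for
    \<open>a = b\<close>.\<close>
  have key: "admissible n 0 a a (n - d) d" "index n 0 a a (n - d) d = (-1) ^ d" if d: "a \<le> d" "d \<le> n" for d
    using key_twist[OF order_refl d, of 0 "n - d" "n - d"] d by simp_all
  \<comment> \<open>With \<open>k = 0\<close> the \<open>Sp(1)\<close> bounds give
    \<open>l = r\<close>, and with \<open>a = b\<close> the \<open>Sp(n)\<close> bounds give
    \<open>n - r = d\<close>.\<close>
  have only: "l = n - d \<and> a \<le> d \<and> d \<le> n" if adm: "admissible n 0 a a l d" for l d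
  proof -
    obtain r where "r \<le> n" "d \<le> n" "l \<le> 0 + r" "r \<le> 0 + l" "a \<le> d" "a + d \<le> n - r + a" "a + (n - r) \<le> d + a"
      by (rule admissible_imp[OF adm order_refl assms(3)]) (rule that)
    then show ?thesis by linarith
  qed
  have phi0: "phi n (n - d) d = 0" if "d \<le> n" for d
    using that by (simp add: phi_def of_nat_diff)
  show "{(l, d). admissible n 0 a a l d} = {(n - d, d) | d. a \<le> d \<and> d \<le> n}"
    using only key(1) by blast
  have phi_adm: "phi n l d = 0" if "admissible n 0 a a l d" for l d
    using only[OF that] phi0[of d] by simp
  have "maximal_twist n 0 a a (n - d) d" "minimal_twist n 0 a a (n - d) d" if d: "a \<le> d" "d \<le> n" for d
    unfolding maximal_twist_def minimal_twist_def by (simp_all add: key(1)[OF d] phi_adm)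
  then show "\<forall>d. a \<le> d \<and> d \<le> n \<longrightarrow> phi n (n - d) d = 0 \<and> maximal_twist n 0 a a (n - d) d
      \<and> minimal_twist n 0 a a (n - d) d \<and> index n 0 a a (n - d) d = (-1) ^ d"
    using phi0 key(2) by blast
qed

end
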